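(* Let $\mathcal{H}(3)^{\mathbb{Z}_3}$ be the fixed-point vertex operator subalgebra of the rank three Heisenberg vertex operator algebra $\mathcal{H}(3)=\mathcal{H}^{\otimes 3}$ under the cyclic group $\mathbb{Z}_3\cong\langle(1\,2\,3)\rangle\subset S_3$ permuting the tensor factors. Then: (i) $\mathcal{H}(3)^{\mathbb{Z}_3}$ is a simple vertex operator algebra of type $(1,2,3^3,4,5^3)$, i.e. it is strongly generated by nine vectors whose conformal weights are $1,2,3,3,3,4,5,5,5$. This generating set is minimal. (ii) $\mathcal{H}(3)^{\mathbb{Z}_3}$ is isomorphic to $\mathcal{H}(1)\otimes W$, where $\mathcal{H}(1)$ is a rank one Heisenberg vertex algebra and $W$ is a vertex operator algebra of type $(2,3^3,4,5^3)$, i.e. strongly generated by eight vectors of conformal weights $2,3,3,3,4,5,5,5$. (iii) $\mathcal{H}(3)^{\mathbb{Z}_3}$ is not freely generated by any set of generators.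
   Context: $\mathcal{H}=\mathcal{H}(1)$ is the rank one Heisenberg vertex operator algebra over $\mathbb{C}$, generated by $\alpha(-1)\mathbf{1}$ with $[\alpha(m),\alpha(n)]=m\delta_{m+n,0}$, $\alpha(n)\mathbf{1}=0$ for $n\ge 0$, with conformal vector $\frac12\alpha(-1)^2\mathbf{1}$ (central charge $1$). $\mathcal{H}(3)=\mathcal{H}^{\otimes 3}$ has generators $\alpha_i(-1)\mathbf{1}$, $i=1,2,3$ (one for each tensor factor) and conformal vector $\frac12\sum_i\alpha_i(-1)^2\mathbf 1$. The group $S_3$ acts by automorphisms via $\sigma\cdot\alpha_{i_1}(m_1)\cdots\alpha_{i_k}(m_k)\mathbf{1}=\alpha_{\sigma(i_1)}(m_1)\cdots\alpha_{\sigma(i_k)}(m_k)\mathbf{1}$. Conformal weight means $L(0)$-eigenvalue. For a vertex operator algebra $V$ with $Y(a,z)=\sum_n a_n z^{-n-1}$, a set of homogeneous vectors $\{a^i\}_{i\in I}$ strongly generates $V$ if $V$ is spanned by the monomials $a^{i_1}_{-n_1}\cdots a^{i_k}_{-n_k}\mathbf{1}$ with $k\ge0$, $n_j\ge 1$. It is minimal if no proper subset strongly generates $V$. It freely generates $V$ if, in addition to strongly generating, the monomials $a^{i_1}_{-n_1}\cdots a^{i_k}_{-n_k}\mathbf{1}$ with the pairs $(i_j,n_j)$ ordered with respect to a fixed total order (repetitions allowed) form a basis of $V$. Type $(d_1^{m_1},d_2^{m_2},\dots)$ means strongly generated by a set with $m_j$ vectors of conformal weight $d_j$. *)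

theory Defs
  imports
    Complex_Main
    "HOL-Library.Multiset"
    "HOL-Library.Poly_Mapping"
    "HOL-Library.Function_Algebras"
    "HOL-Combinatorics.Cycles"
begin

section \<open>Vertex operator algebras\<close>

text \<open>
  The state space is the set \<open>states V\<close>, a complex subspace of the ambient type with respect to
  the scalar multiplication \<open>vscale V\<close>.  \<open>nprod V a n b\<close> is $a_n b$, where
  $Y(a,z) = \sum_n a_n z^{-n-1}$.
\<close>

record 'a voa =
  states :: "'a set"
  vscale :: "complex \<Rightarrow> 'a \<Rightarrow> 'a"
  nprod :: "'a \<Rightarrow> int \<Rightarrow> 'a \<Rightarrow> 'a"
  vac :: 'a
  conf :: 'a

definition linear_on_states ::
    "('a::ab_group_add, 'x) voa_scheme \<Rightarrow> ('b::ab_group_add, 'y) voa_scheme \<Rightarrow> ('a \<Rightarrow> 'b) \<Rightarrow> bool" where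
  "linear_on_states V W f \<longleftrightarrow>
     (\<forall>a \<in> states V. \<forall>b \<in> states V. f (a + b) = f a + f b) \<and>
     (\<forall>c. \<forall>a \<in> states V. f (vscale V c a) = vscale W c (f a))"

text \<open>
  The last clause is the component form of the Jacobi (Borcherds) identity.  By truncation each
  \<open>Sum_any\<close> below has only finitely many nonzero terms.
\<close>

definition vertex_algebra :: "'a::ab_group_add voa \<Rightarrow> bool" where
  "vertex_algebra V \<longleftrightarrow>
     vector_space (vscale V) \<and> module.subspace (vscale V) (states V) \<and>
     vac V \<in> states V \<and>
     (\<forall>a \<in> states V. \<forall>n. \<forall>b \<in> states V. nprod V a n b \<in> states V) \<and>
     (\<forall>a \<in> states V. \<forall>n. linear_on_states V V (nprod V a n)) \<and>
     (\<forall>b \<in> states V. \<forall>n. linear_on_states V V (\<lambda>a. nprod V a n b)) \<and>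
     (\<forall>a \<in> states V. \<forall>b \<in> states V. \<exists>N. \<forall>n \<ge> N. nprod V a n b = 0) \<and>
     (\<forall>b \<in> states V. \<forall>n. nprod V (vac V) n b = (if n = -1 then b else 0)) \<and>
     (\<forall>a \<in> states V. (\<forall>n \<ge> 0. nprod V a n (vac V) = 0) \<and> nprod V a (-1) (vac V) = a) \<and>
     (\<forall>a \<in> states V. \<forall>b \<in> states V. \<forall>c \<in> states V. \<forall>l m n.
        Sum_any (\<lambda>i. vscale V (of_int m gchoose i) (nprod V (nprod V a (l + int i) b) (m + n - int i) c)) =
        Sum_any (\<lambda>i. vscale V ((-1) ^ i * (of_int l gchoose i))
          (nprod V a (l + m - int i) (nprod V b (n + int i) c)
            - vscale V ((-1) powi l) (nprod V b (l + n - int i) (nprod V a (m + int i) c)))))"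

definition Lop :: "('a, 'x) voa_scheme \<Rightarrow> int \<Rightarrow> 'a \<Rightarrow> 'a" where
  "Lop V n = nprod V (conf V) (n + 1)"

definition weight_space :: "('a, 'x) voa_scheme \<Rightarrow> int \<Rightarrow> 'a set" where
  "weight_space V d = {a \<in> states V. Lop V 0 a = vscale V (of_int d) a}"

definition vertex_operator_algebra :: "'a::ab_group_add voa \<Rightarrow> bool" where
  "vertex_operator_algebra V \<longleftrightarrow>
     vertex_algebra V \<and> conf V \<in> states V \<and>
     (\<exists>c. \<forall>m n. \<forall>v \<in> states V.
        Lop V m (Lop V n v) - Lop V n (Lop V m v) =
        vscale V (of_int (m - n)) (Lop V (m + n) v) +
        vscale V (if m + n = 0 then (of_int m ^ 3 - of_int m) / 12 * c else 0) v) \<and>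
     (\<forall>a \<in> states V. \<forall>n. \<forall>b \<in> states V.
        nprod V (Lop V (-1) a) n b = vscale V (- of_int n) (nprod V a (n - 1) b)) \<and>
     states V = module.span (vscale V) (\<Union>d. weight_space V d) \<and>
     (\<forall>d. \<exists>B. finite B \<and> weight_space V d = module.span (vscale V) B) \<and>
     (\<exists>N. \<forall>d < N. weight_space V d = {0})"

definition va_ideal :: "'a::ab_group_add voa \<Rightarrow> 'a set \<Rightarrow> bool" where
  "va_ideal V I \<longleftrightarrow>
     I \<subseteq> states V \<and> module.subspace (vscale V) I \<and>
     (\<forall>a \<in> states V. \<forall>n. \<forall>v \<in> I. nprod V a n v \<in> I \<and> nprod V v n a \<in> I)"

definition simple_voa :: "'a::ab_group_add voa \<Rightarrow> bool" where
  "simple_voa V \<longleftrightarrow>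
     vertex_operator_algebra V \<and> states V \<noteq> {0} \<and>
     (\<forall>I. va_ideal V I \<longrightarrow> I = {0} \<or> I = states V)"

definition voa_iso :: "'a::ab_group_add voa \<Rightarrow> 'b::ab_group_add voa \<Rightarrow> ('a \<Rightarrow> 'b) \<Rightarrow> bool" where
  "voa_iso V W f \<longleftrightarrow>
     bij_betw f (states V) (states W) \<and> linear_on_states V W f \<and>
     (\<forall>a \<in> states V. \<forall>n. \<forall>b \<in> states V. f (nprod V a n b) = nprod W (f a) n (f b)) \<and>
     f (vac V) = vac W \<and> f (conf V) = conf W"

definition voa_isomorphic :: "'a::ab_group_add voa \<Rightarrow> 'b::ab_group_add voa \<Rightarrow> bool" where
  "voa_isomorphic V W \<longleftrightarrow> (\<exists>f. voa_iso V W f)"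


section \<open>Strong and free generation\<close>

text \<open>The list $[(a^1,n_1),\dots,(a^k,n_k)]$ stands for $a^1_{-n_1}\cdots a^k_{-n_k}\mathbf{1}$.\<close>

definition monomial :: "('a, 'x) voa_scheme \<Rightarrow> ('a \<times> nat) list \<Rightarrow> 'a" where
  "monomial V xs = foldr (\<lambda>(a, n) v. nprod V a (- int n) v) xs (vac V)"

definition strongly_generates :: "'a::ab_group_add voa \<Rightarrow> 'a set \<Rightarrow> bool" where
  "strongly_generates V S \<longleftrightarrow>
     S \<subseteq> (\<Union>d. weight_space V d) \<and>
     states V = module.span (vscale V) (monomial V ` lists (S \<times> {1..}))"

definition minimally_strongly_generates :: "'a::ab_group_add voa \<Rightarrow> 'a set \<Rightarrow> bool" where
  "minimally_strongly_generates V S \<longleftrightarrow>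
     strongly_generates V S \<and> (\<forall>T. T \<subset> S \<longrightarrow> \<not> strongly_generates V T)"

text \<open>
  "Basis" is meant for the family indexed by the ordered lists, so distinct lists must give
  distinct vectors.
\<close>

definition freely_generates :: "'a::ab_group_add voa \<Rightarrow> 'a set \<Rightarrow> bool" where
  "freely_generates V S \<longleftrightarrow>
     strongly_generates V S \<and>
     (\<exists>R. linear_order_on (S \<times> {1..}) R \<and>
        (let M = {xs \<in> lists (S \<times> {1..}). sorted_wrt (\<lambda>p q. (p, q) \<in> R) xs} in
           inj_on (monomial V) M \<and>
           \<not> module.dependent (vscale V) (monomial V ` M) \<and>
           module.span (vscale V) (monomial V ` M) = states V))"

text \<open>The multiset \<open>D\<close> lists the conformal weights of the elements of \<open>S\<close>.\<close>

definition has_weights :: "'a::ab_group_add voa \<Rightarrow> 'a set \<Rightarrow> int multiset \<Rightarrow> bool" where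
  "has_weights V S D \<longleftrightarrow>
     finite S \<and>
     (\<exists>wt. (\<forall>a \<in> S. a \<in> weight_space V (wt a) - {0}) \<and> image_mset wt (mset_set S) = D)"

definition of_type :: "'a::ab_group_add voa \<Rightarrow> int multiset \<Rightarrow> bool" where
  "of_type V D \<longleftrightarrow> (\<exists>S. strongly_generates V S \<and> has_weights V S D)"


section \<open>Fixed points and tensor products\<close>

definition fixed_points :: "'a voa \<Rightarrow> ('a \<Rightarrow> 'a) set \<Rightarrow> 'a voa" where
  "fixed_points V G = V\<lparr>states := {v \<in> states V. \<forall>g \<in> G. g v = v}\<rparr>"

text \<open>
  The tensor product of the state spaces is realised inside the dual of the space of bilinear
  forms: $u \otimes w$ is evaluation at $(u,w)$.  In particular, for
  $x = \sum_i u_i \otimes w_i$ and $y = \sum_j u'_j \otimes w'_j$ the definition of \<open>tensor_nprod\<close>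
  unfolds to
  $x_n y = \sum_{i,j} \sum_{p+q=n-1} (u_i)_p u'_j \otimes (w_i)_q w'_j$,
  that is, $Y(u \otimes w, z) = Y(u,z) \otimes Y(w,z)$.
\<close>

type_synonym ('a, 'b) tensor = "('a \<Rightarrow> 'b \<Rightarrow> complex) \<Rightarrow> complex"

definition bilinear_form ::
    "'a::ab_group_add voa \<Rightarrow> 'b::ab_group_add voa \<Rightarrow> ('a \<Rightarrow> 'b \<Rightarrow> complex) \<Rightarrow> bool" where
  "bilinear_form U W B \<longleftrightarrow>
     (\<forall>u \<in> states U. \<forall>u' \<in> states U. \<forall>w \<in> states W. B (u + u') w = B u w + B u' w) \<and>
     (\<forall>u \<in> states U. \<forall>w \<in> states W. \<forall>w' \<in> states W. B u (w + w') = B u w + B u w') \<and>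
     (\<forall>c. \<forall>u \<in> states U. \<forall>w \<in> states W.
        B (vscale U c u) w = c * B u w \<and> B u (vscale W c w) = c * B u w)"

definition pure_tensor ::
    "'a::ab_group_add voa \<Rightarrow> 'b::ab_group_add voa \<Rightarrow> 'a \<Rightarrow> 'b \<Rightarrow> ('a, 'b) tensor" where
  "pure_tensor U W u w = (\<lambda>B. if bilinear_form U W B then B u w else 0)"

definition tensor_scale :: "complex \<Rightarrow> ('a, 'b) tensor \<Rightarrow> ('a, 'b) tensor" where
  "tensor_scale c x = (\<lambda>B. c * x B)"

definition tensor_nprod ::
    "'a::ab_group_add voa \<Rightarrow> 'b::ab_group_add voa \<Rightarrow>
     ('a, 'b) tensor \<Rightarrow> int \<Rightarrow> ('a, 'b) tensor \<Rightarrow> ('a, 'b) tensor" where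
  "tensor_nprod U W x n y =
     (\<lambda>B. if bilinear_form U W B
          then x (\<lambda>u w. y (\<lambda>u' w'. Sum_any (\<lambda>p. B (nprod U u p u') (nprod W w (n - 1 - p) w'))))
          else 0)"

definition tensor_voa ::
    "'a::ab_group_add voa \<Rightarrow> 'b::ab_group_add voa \<Rightarrow> ('a, 'b) tensor voa" where
  "tensor_voa U W =
     \<lparr> states = module.span tensor_scale {pure_tensor U W u w | u w. u \<in> states U \<and> w \<in> states W},
       vscale = tensor_scale,
       nprod = tensor_nprod U W,
       vac = pure_tensor U W (vac U) (vac W),
       conf = pure_tensor U W (conf U) (vac W) + pure_tensor U W (vac U) (conf W) \<rparr>"


section \<open>The Heisenberg vertex operator algebra of rank r\<close>

text \<open>
  A multiset $\{(i_1,n_1),\dots,(i_k,n_k)\}$ with all $n_j \ge 1$ stands for the Fock space monomial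
  $\alpha_{i_1}(-n_1)\cdots\alpha_{i_k}(-n_k)\mathbf{1}$, so the Fock space is a polynomial
  ring, with the vacuum as its unit.  This is the usual identification of the $r$-fold tensor power
  of the rank one Fock space with the polynomial ring in the variables of all factors;
  \<open>i\<close> numbers the factor.
\<close>

type_synonym fock = "(nat \<times> nat) multiset \<Rightarrow>\<^sub>0 complex"

definition fock_scale :: "complex \<Rightarrow> fock \<Rightarrow> fock" where
  "fock_scale c p = Poly_Mapping.single {#} c * p"

text \<open>
  $\alpha_i(-n)$ for $n \ge 1$ multiplies by the variable $(i,n)$, and $\alpha_i(n)$ for $n \ge 0$ acts
  as $n$ times the partial derivative with respect to the variable $(i,n)$.
\<close>

definition alpha :: "nat \<Rightarrow> int \<Rightarrow> fock \<Rightarrow> fock" where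
  "alpha i n p =
     (if n < 0 then Poly_Mapping.single {#(i, nat (- n))#} 1 * p
      else \<Sum>M \<in> Poly_Mapping.keys p.
        Poly_Mapping.single (M - {#(i, nat n)#})
          (of_int n * of_nat (count M (i, nat n)) * Poly_Mapping.lookup p M))"

text \<open>
  The $n$-th mode of $Y(\alpha_{i_1}(-m_1)\cdots\alpha_{i_k}(-m_k)\mathbf{1}, z)$, which is the normally
  ordered product of the fields $\frac{1}{(m_j-1)!}\partial^{m_j-1}\alpha_{i_j}(z)$: if $b$ is the state
  given by the tail of the list, then
  $(\alpha_i(-m)b)_n = \sum_{j \ge 0} \binom{m+j-1}{j}
    (\alpha_i(-m-j)\, b_{n+j} - (-1)^m\, b_{n-m-j}\, \alpha_i(j))$.
  Only finitely many terms are nonzero on a given vector.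
\<close>

fun list_mode :: "(nat \<times> nat) list \<Rightarrow> int \<Rightarrow> fock \<Rightarrow> fock" where
  "list_mode [] n v = (if n = -1 then v else 0)"
| "list_mode ((i, m) # xs) n v =
     Sum_any (\<lambda>j. fock_scale (of_nat ((m + j - 1) choose j))
       (alpha i (- int m - int j) (list_mode xs (n + int j) v)
         - fock_scale ((-1) ^ m) (list_mode xs (n - int m - int j) (alpha i (int j) v))))"

text \<open>
  The fields being free bosons, \<open>list_mode xs\<close> does not depend on the order of \<open>xs\<close> (on indices
  with all $m_j \ge 1$), so any enumeration of the multiset can be chosen.
\<close>

definition fock_nprod :: "fock \<Rightarrow> int \<Rightarrow> fock \<Rightarrow> fock" where
  "fock_nprod a n v =
     (\<Sum>M \<in> Poly_Mapping.keys a.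
        fock_scale (Poly_Mapping.lookup a M) (list_mode (SOME xs. mset xs = M) n v))"

definition heisenberg :: "nat \<Rightarrow> fock voa" where
  "heisenberg r =
     \<lparr> states = {p. \<forall>M \<in> Poly_Mapping.keys p. set_mset M \<subseteq> {1..r} \<times> {1..}},
       vscale = fock_scale,
       nprod = fock_nprod,
       vac = 1,
       conf = fock_scale (1 / 2) (\<Sum>i \<in> {1..r}. alpha i (-1) (alpha i (-1) 1)) \<rparr>"

definition perm_act :: "(nat \<Rightarrow> nat) \<Rightarrow> fock \<Rightarrow> fock" where
  "perm_act \<sigma> p =
     (\<Sum>M \<in> Poly_Mapping.keys p.
        Poly_Mapping.single (image_mset (\<lambda>(i, n). (\<sigma> i, n)) M) (Poly_Mapping.lookup p M))"

definition Z3 :: "(nat \<Rightarrow> nat) set" where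
  "Z3 = {cycle_of_list [1, 2, 3] ^^ k | k. True}"

definition heisenberg3_Z3 :: "fock voa" where
  "heisenberg3_Z3 = fixed_points (heisenberg 3) (perm_act ` Z3)"

end

theory Submission
  imports Defs "HOL-Computational_Algebra.Formal_Power_Series"
begin

text \<open>
  Diagonalising the cyclic permutation turns the three bosons into an invariant one, spanning a
  Heisenberg algebra, and two bosons of charges 1 and 2 modulo 3; the invariants of charge 0 in the
  latter form \<open>WW\<close>, the second tensor factor.  Modulo decomposable vectors \<open>WW\<close> is spanned by the
  quadratics of charges 1 and 2 and by the cubics of equal charge.  The translation operator and
  the quantum corrections to the classical relations leave only one quadratic in each of the
  weights 2 to 5 and one cubic of either charge in each of the weights 3 and 5.
  Comparing graded dimensions with the number of Poincare-Birkhoff-Witt monomials shows that no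
  generator can be omitted; a free generating set would need nine letters of weight 5 but only
  eight of weight 6, which the translation operator forbids.
\<close>

section \<open>Finitely supported coefficient functions and linear extension from monomials\<close>

section \<open>Linear algebra of the Fock space\<close>

text \<open>The modes are given only by a recursion on lists, so the vertex algebra axioms have to
  be earned. The uniform device is Schur's lemma for the Fock module: once an identity is known for
  fewer letters, its deviation commutes with all Heisenberg operators, hence is a scalar, and
  weights, the vacuum and translation force this scalar to vanish. This yields independence of the
  order of letters, the behaviour of products under translation, and the Borcherds identity. The
  bound 5 has two sources. For quadratics, elimination ends in the coefficient e (e+1) (e+2) / 6 - e
  with e = weight - 4, zero at weight 5 and nonzero beyond; for cubics the relations run short in
  weight 5 and suffice from weight 6 on. Up to weight 5 the nine generators have as many ordered
  monomials as there are dimensions, but 76 against 75 in weight 6. Tensors are functionals on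
  bilinear forms, so the splitting isomorphism evaluates a form on the two factors of each
  eigenmonomial.\<close>

lemma lookup_fock_scale [simp]:
  "Poly_Mapping.lookup (fock_scale c p) M = c * Poly_Mapping.lookup p M"
proof -
  have "fock_scale c p = Poly_Mapping.map ((*) c) p"
    by (simp add: fock_scale_def mult_map_scale_conv_mult zero_multiset_def)
  then show ?thesis
    by (simp add: Poly_Mapping.map.rep_eq when_def)
qed

interpretation fs: vector_space fock_scale
proof
  show "fock_scale a (x + y) = fock_scale a x + fock_scale a y" for a x y
    by (simp add: fock_scale_def algebra_simps)
  show "fock_scale (a + b) x = fock_scale a x + fock_scale b x" for a b x
    by (rule poly_mapping_eqI) (simp add: lookup_add algebra_simps)
  show "fock_scale a (fock_scale b x) = fock_scale (a * b) x" for a b x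
    by (rule poly_mapping_eqI) (simp add: algebra_simps)
  show "fock_scale 1 x = x" for x
    by (rule poly_mapping_eqI) simp
qed

abbreviation flin :: "(fock \<Rightarrow> fock) \<Rightarrow> bool" where
  "flin f \<equiv> module_hom fock_scale fock_scale f"

lemma flinI:
  assumes "\<And>p q. f (p + q) = f p + f q" "\<And>c p. f (fock_scale c p) = fock_scale c (f p)"
  shows "flin f"
  by (intro module_hom.intro fs.module_axioms module_hom_axioms.intro) (use assms in auto)

lemmas flin_add = module_hom.add [of fock_scale fock_scale]
lemmas flin_scale = module_hom.scale [of fock_scale fock_scale]
lemmas flin_zero = module_hom.zero [of fock_scale fock_scale]
lemmas flin_diff = module_hom.diff [of fock_scale fock_scale]
lemmas flin_neg = module_hom.neg [of fock_scale fock_scale]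
lemmas flin_sum = module_hom.sum [of fock_scale fock_scale]

interpretation fp: module_pair fock_scale fock_scale ..

lemma flin_comp: "flin f \<Longrightarrow> flin g \<Longrightarrow> flin (\<lambda>x. f (g x))"
  by (rule flinI) (simp_all add: flin_add flin_scale)

lemma flin_ident: "flin (\<lambda>x. x)"
  by (rule flinI) simp_all

lemma flin_const_scale: "flin (fock_scale c)"
  by (rule flinI) (simp_all add: algebra_simps fs.scale_left_commute)

lemma fock_scale_mult_left [simp]: "fock_scale c p * q = fock_scale c (p * q)"
  by (simp add: fock_scale_def algebra_simps)

lemma fock_scale_mult_right [simp]: "p * fock_scale c q = fock_scale c (p * q)"
  by (simp add: fock_scale_def algebra_simps)

lemma flin_mult: "flin ((*) p)"
  by (rule flinI) (simp_all add: algebra_simps)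

abbreviation mon :: "(nat \<times> nat) multiset \<Rightarrow> fock" where
  "mon M \<equiv> Poly_Mapping.single M 1"

lemma fock_scale_mon: "fock_scale c (mon M) = Poly_Mapping.single M c"
  by (rule poly_mapping_eqI) (simp add: lookup_single when_def)

lemma fock_scale_single: "fock_scale c (Poly_Mapping.single M d) = Poly_Mapping.single M (c * d)"
  by (rule poly_mapping_eqI) (simp add: lookup_single when_def)

lemma mon_mult: "mon M * mon N = mon (M + N)"
  by (simp add: mult_single)

lemma mon_empty [simp]: "mon {#} = 1"
  by (simp flip: zero_multiset_def)

lemma fock_expand: "p = (\<Sum>M \<in> Poly_Mapping.keys p. fock_scale (Poly_Mapping.lookup p M) (mon M))"
proof (rule poly_mapping_eqI)
  fix K
  have "(\<Sum>M \<in> Poly_Mapping.keys p. Poly_Mapping.lookup p M * (if M = K then 1 else 0)) =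
      (\<Sum>M \<in> Poly_Mapping.keys p. if M = K then Poly_Mapping.lookup p M else 0)"
    by (intro sum.cong) auto
  then show "Poly_Mapping.lookup p K = Poly_Mapping.lookup
      (\<Sum>M \<in> Poly_Mapping.keys p. fock_scale (Poly_Mapping.lookup p M) (mon M)) K"
    by (simp add: lookup_sum lookup_single when_def in_keys_iff)
qed

lemma fock_eq_on_keysI:
  assumes "flin f" "flin g" "\<And>M. M \<in> Poly_Mapping.keys p \<Longrightarrow> f (mon M) = g (mon M)"
  shows "f p = g p"
proof -
  have "f p = (\<Sum>M \<in> Poly_Mapping.keys p. fock_scale (Poly_Mapping.lookup p M) (f (mon M)))"
    by (subst fock_expand) (simp only: flin_sum[OF assms(1)] flin_scale[OF assms(1)])
  also have "\<dots> = (\<Sum>M \<in> Poly_Mapping.keys p. fock_scale (Poly_Mapping.lookup p M) (g (mon M)))"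
    using assms(3) by simp
  also have "\<dots> = g p"
    by (subst (3) fock_expand) (simp only: flin_sum[OF assms(2)] flin_scale[OF assms(2)])
  finally show ?thesis .
qed

text \<open>Sums over the keys of a vector, such as annihilation operators, substitutions and modes
  as functions of their left argument, are instances of this linear extension, so their linearity is
  proved once.\<close>

definition lin :: "((nat \<times> nat) multiset \<Rightarrow> fock) \<Rightarrow> fock \<Rightarrow> fock" where
  "lin F p = (\<Sum>M \<in> Poly_Mapping.keys p. fock_scale (Poly_Mapping.lookup p M) (F M))"

lemma lin_superset:
  assumes "finite A" "Poly_Mapping.keys p \<subseteq> A"
  shows "lin F p = (\<Sum>M \<in> A. fock_scale (Poly_Mapping.lookup p M) (F M))"
  unfolding lin_def using assms by (intro sum.mono_neutral_left) (auto simp: in_keys_iff)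

lemma flin_lin: "flin (lin F)"
proof (rule flinI)
  fix p q :: fock
  let ?A = "Poly_Mapping.keys p \<union> Poly_Mapping.keys q"
  have "Poly_Mapping.keys (p + q) \<subseteq> ?A" by (rule keys_add)
  then show "lin F (p + q) = lin F p + lin F q"
    by (simp add: lin_superset[of ?A] lookup_add fs.scale_left_distrib sum.distrib)
next
  fix c and p :: fock
  have "Poly_Mapping.keys (fock_scale c p) \<subseteq> Poly_Mapping.keys p" by (auto simp: in_keys_iff)
  then show "lin F (fock_scale c p) = fock_scale c (lin F p)"
    by (simp add: lin_superset[of "Poly_Mapping.keys p"] fs.scale_sum_right)
qed

lemma lin_mon [simp]: "lin F (mon M) = F M"
  by (simp add: lin_def)

lemma lin_one [simp]: "lin F 1 = F {#}"
  using lin_mon[of F "{#}"] by simp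

text \<open>One notion for subspaces spanned by monomials: with suitable sets it describes states,
  conformal weights and polynomial degrees, and claims about linear maps on them reduce to single
  monomials.\<close>

definition supp_in :: "(nat \<times> nat) multiset set \<Rightarrow> fock set" where
  "supp_in A = {p. Poly_Mapping.keys p \<subseteq> A}"

lemma subspace_supp_in: "fs.subspace (supp_in A)"
proof (rule fs.subspaceI)
  fix p q assume "p \<in> supp_in A" "q \<in> supp_in A"
  then show "p + q \<in> supp_in A" unfolding supp_in_def using keys_add[of p q] by blast
qed (auto simp: supp_in_def in_keys_iff)

lemma mon_supp_in [simp]: "mon M \<in> supp_in A \<longleftrightarrow> M \<in> A"
  by (simp add: supp_in_def)

lemma one_supp_in [simp]: "1 \<in> supp_in A \<longleftrightarrow> {#} \<in> A"
  using mon_supp_in[of "{#}"] by (simp del: mon_supp_in)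

lemma supp_in_span: "supp_in A = fs.span (mon ` A)"
proof
  show "fs.span (mon ` A) \<subseteq> supp_in A"
    by (rule fs.span_minimal) (auto simp: subspace_supp_in)
  show "supp_in A \<subseteq> fs.span (mon ` A)"
  proof
    fix p assume "p \<in> supp_in A"
    then show "p \<in> fs.span (mon ` A)"
      by (subst fock_expand)
        (intro fs.span_sum fs.span_scale fs.span_base imageI, auto simp: supp_in_def)
  qed
qed

lemma flin_supp_inI:
  assumes "flin f" "p \<in> supp_in A" "fs.subspace S" "\<And>M. M \<in> A \<Longrightarrow> f (mon M) \<in> S"
  shows "f p \<in> S"
proof -
  have "f p = (\<Sum>M \<in> Poly_Mapping.keys p. fock_scale (Poly_Mapping.lookup p M) (f (mon M)))"
    by (subst fock_expand) (simp only: flin_sum[OF assms(1)] flin_scale[OF assms(1)])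
  also have "\<dots> \<in> S"
    using assms(2-4) by (auto simp: supp_in_def intro!: fs.subspace_sum fs.subspace_scale)
  finally show ?thesis .
qed

lemma supp_in_eqI:
  assumes "flin f" "flin g" "p \<in> supp_in A" "\<And>M. M \<in> A \<Longrightarrow> f (mon M) = g (mon M)"
  shows "f p = g p"
  by (rule fock_eq_on_keysI[OF assms(1,2)]) (use assms(3,4) in \<open>auto simp: supp_in_def\<close>)

lemma supp_in_mono: "A \<subseteq> B \<Longrightarrow> supp_in A \<subseteq> supp_in B"
  by (auto simp: supp_in_def)

lemma supp_in_empty [simp]: "supp_in {} = {0}"
  by (auto simp: supp_in_def poly_mapping_eq_iff in_keys_iff fun_eq_iff)

section \<open>Creation and annihilation operators and their commutation relations\<close>

section \<open>The Heisenberg operators\<close>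

abbreviation var :: "nat \<Rightarrow> nat \<Rightarrow> fock" where
  "var i n \<equiv> mon {#(i, n)#}"

lemma alpha_neg: "n < 0 \<Longrightarrow> alpha i n p = var i (nat (- n)) * p"
  by (simp add: alpha_def)

lemma alpha_nonneg:
  "n \<ge> 0 \<Longrightarrow> alpha i n p =
     lin (\<lambda>M. Poly_Mapping.single (M - {#(i, nat n)#}) (of_int n * of_nat (count M (i, nat n)))) p"
  by (simp add: alpha_def lin_def fock_scale_single mult.commute)

lemma flin_alpha: "flin (alpha i n)"
proof (cases "n < 0")
  case True
  then have "alpha i n = (*) (var i (nat (- n)))" by (auto simp: alpha_neg)
  then show ?thesis by (simp add: flin_mult)
next
  case False
  then have "alpha i n = lin (\<lambda>M. Poly_Mapping.single (M - {#(i, nat n)#}) (of_int n * of_nat (count M (i, nat n))))"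
    by (auto simp: alpha_nonneg)
  then show ?thesis by (simp add: flin_lin)
qed

lemma alpha_mon:
  "n \<ge> 0 \<Longrightarrow> alpha i n (mon M) = Poly_Mapping.single (M - {#(i, nat n)#}) (of_int n * of_nat (count M (i, nat n)))"
  by (simp add: alpha_nonneg)

lemma alpha_mon':
  "n \<ge> 0 \<Longrightarrow> alpha i n (mon M) = fock_scale (of_int n * of_nat (count M (i, nat n))) (mon (M - {#(i, nat n)#}))"
  by (simp add: alpha_mon fock_scale_mon)

lemma alpha_mon_neg: "n < 0 \<Longrightarrow> alpha i n (mon M) = mon (add_mset (i, nat (- n)) M)"
  by (simp add: alpha_neg mon_mult)

lemma alpha_0 [simp]: "alpha i 0 p = 0"
  by (simp add: alpha_nonneg lin_def)

lemma alpha_one: "n \<ge> 0 \<Longrightarrow> alpha i n 1 = 0"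
  using alpha_mon[of n i "{#}"] by simp

text \<open>Up to the factor \<open>n\<close> this is a partial derivative, hence Leibniz. Truncated
  multiset difference is harmless: when the letter is absent its count, and with it the coefficient,
  is 0.\<close>

lemma alpha_derivation:
  assumes "n \<ge> 0"
  shows "alpha i n (p * q) = alpha i n p * q + p * alpha i n q"
proof -
  define x where "x = (i, nat n)"
  have mm: "alpha i n (mon M * mon N) = alpha i n (mon M) * mon N + mon M * alpha i n (mon N)" for M N
  proof -
    have eq: "alpha i n (mon K) = Poly_Mapping.single (K - {#x#}) (of_int n * of_nat (count K x))" for K
      using assms by (simp add: alpha_mon x_def)
    have 1: "alpha i n (mon M) * mon N = Poly_Mapping.single (M + N - {#x#}) (of_int n * of_nat (count M x))"
    proof (cases "x \<in># M")
      case True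
      then have "M - {#x#} + N = M + N - {#x#}" by simp
      then show ?thesis by (simp add: eq mult_single)
    next
      case False
      then have "count M x = 0" by (simp add: not_in_iff)
      then show ?thesis by (simp add: eq)
    qed
    have 2: "mon M * alpha i n (mon N) = Poly_Mapping.single (M + N - {#x#}) (of_int n * of_nat (count N x))"
    proof (cases "x \<in># N")
      case True
      then have "M + (N - {#x#}) = M + N - {#x#}" by simp
      then show ?thesis by (simp add: eq mult_single)
    next
      case False
      then have "count N x = 0" by (simp add: not_in_iff)
      then show ?thesis by (simp add: eq)
    qed
    show ?thesis
      unfolding 1 2 by (simp add: mon_mult eq single_add[symmetric] algebra_simps)
  qed
  have m: "alpha i n (mon M * q) = alpha i n (mon M) * q + mon M * alpha i n q" for M q
  proof (rule fock_eq_on_keysI[where p = q])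
    show "flin (\<lambda>q. alpha i n (mon M * q))" by (intro flin_comp[OF flin_alpha] flin_mult)
    show "flin (\<lambda>q. alpha i n (mon M) * q + mon M * alpha i n q)"
      by (intro fp.module_hom_add flin_mult flin_comp[OF flin_mult] flin_alpha)
  qed (use mm in auto)
  \<comment> \<open>Multiplication commutes, so \<open>m\<close> also settles a monomial right
    factor, and linearity in \<open>p\<close> does the rest.\<close>
  have "alpha i n (q * p) = q * alpha i n p + p * alpha i n q"
  proof (rule fock_eq_on_keysI[where p = p])
    show "flin (\<lambda>p. alpha i n (q * p))" by (intro flin_comp[OF flin_alpha] flin_mult)
    have "flin (\<lambda>p. q * alpha i n p)" by (intro flin_comp[OF flin_mult] flin_alpha)
    moreover have "flin (\<lambda>p. p * alpha i n q)" by (rule flinI) (simp_all add: algebra_simps)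
    ultimately show "flin (\<lambda>p. q * alpha i n p + p * alpha i n q)" by (rule fp.module_hom_add)
  qed (use m in \<open>auto simp: mult.commute add.commute\<close>)
  then show ?thesis by (simp add: mult.commute add.commute)
qed

lemma alpha_var:
  "n \<ge> 0 \<Longrightarrow> alpha i n (var k m) = (if i = k \<and> n = int m then fock_scale (of_int n) 1 else 0)"
  using fock_scale_mon[of "of_int n" "{#}"] by (auto simp: alpha_mon)

lemma alpha_commute_nonneg:
  assumes "m \<ge> 0" "n \<ge> 0"
  shows "alpha i m (alpha k n p) = alpha k n (alpha i m p)"
proof (rule fock_eq_on_keysI[where p = p])
  fix M
  have *: "count (M - {#(k, nat n)#}) (i, nat m) * count M (k, nat n) = count (M - {#(i, nat m)#}) (k, nat n) * count M (i, nat m)"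
    by (cases "(i, nat m) = (k, nat n)") auto
  have **: "M - {#(k, nat n)#} - {#(i, nat m)#} = M - {#(i, nat m)#} - {#(k, nat n)#}"
    by (simp add: multiset_eq_iff)
  show "alpha i m (alpha k n (mon M)) = alpha k n (alpha i m (mon M))"
    using * by (simp add: alpha_mon' assms add_mset_commute flin_scale[OF flin_alpha] ** mult_ac flip: of_nat_mult)
qed (intro flin_comp[OF flin_alpha] flin_alpha)+

text \<open>Creation is multiplication by a variable and annihilation a derivation, so the
  commutator is multiplication by the derivative of that variable.\<close>

lemma alpha_commutator:
  "alpha i m (alpha k n p) = alpha k n (alpha i m p) +
     (if i = k \<and> m + n = 0 then fock_scale (of_int m) p else 0)"
proof -
  have pos: "alpha i m (alpha k n p) = alpha k n (alpha i m p) +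
     (if i = k \<and> m + n = 0 then fock_scale (of_int m) p else 0)" if "m \<ge> 0" "n < 0" for i k m n
    using that by (auto simp: alpha_neg alpha_derivation alpha_var)
  consider "m \<ge> 0" "n \<ge> 0" | "m \<ge> 0" "n < 0" | "m < 0" "n \<ge> 0" | "m < 0" "n < 0" by linarith
  then show ?thesis
  proof cases
    case 1
    then show ?thesis using alpha_commute_nonneg[OF 1, of i k p] 
      by (cases "m = 0") auto
  next
    case 2 then show ?thesis by (rule pos)
  next
    case 3
    \<comment> \<open>The mirrored case is the previous one with the operators exchanged; the sign
      is absorbed by \<open>n = - m\<close>.\<close>
    have "fock_scale (of_int m) p + fock_scale (of_int n) p = 0" if "m + n = 0"
      using that by (simp flip: fs.scale_left_distrib of_int_add)
    then show ?thesis using pos[OF 3(2,1), of k i] by (auto simp: algebra_simps)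
  next
    case 4 then show ?thesis by (auto simp: alpha_neg algebra_simps)
  qed
qed

section \<open>Conformal weight of monomials\<close>

section \<open>Weight grading\<close>

definition wt :: "(nat \<times> nat) multiset \<Rightarrow> nat" where
  "wt M = (\<Sum>x \<in># M. snd x)"

lemma wt_simps [simp]: "wt {#} = 0" "wt (add_mset x M) = snd x + wt M" "wt (M + N) = wt M + wt N"
  by (simp_all add: wt_def)

lemma wt_diff: "x \<in># M \<Longrightarrow> wt (M - {#x#}) = wt M - snd x \<and> snd x \<le> wt M"
  by (metis add_diff_cancel_left' insert_DiffM le_add1 wt_simps(2))

text \<open>A set of weights instead of a single one: singletons express homogeneity, rays
  \<open>{..D}\<close> bound the weights of arbitrary vectors. Integers admit negative weights,
  where only 0 lives.\<close>

abbreviation graded :: "int set \<Rightarrow> fock set" where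
  "graded A \<equiv> supp_in {M. int (wt M) \<in> A}"

lemma alpha_graded:
  assumes "p \<in> graded A" "\<And>d. d \<in> A \<Longrightarrow> d - n \<in> B"
  shows "alpha i n p \<in> graded B"
proof (rule flin_supp_inI[OF flin_alpha assms(1) subspace_supp_in])
  fix M assume M: "M \<in> {M. int (wt M) \<in> A}"
  show "alpha i n (mon M) \<in> graded B"
  proof (cases "n < 0")
    case True
    then have "int (wt (add_mset (i, nat (- n)) M)) = int (wt M) - n" by simp
    then show ?thesis using True M assms(2) by (simp add: alpha_mon_neg)
  next
    case False
    show ?thesis
    proof (cases "(i, nat n) \<in># M")
      case True
      then have "int (wt (M - {#(i, nat n)#})) = int (wt M) - n" using False wt_diff[OF True] by (auto simp: of_nat_diff)
      then have "mon (M - {#(i, nat n)#}) \<in> graded B" using M assms(2) by simp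
      then show ?thesis using False
        using fs.subspace_scale[OF subspace_supp_in, of "mon (M - {#(i, nat n)#})"]
        by (simp add: alpha_mon fock_scale_mon)
    next
      case False': False
      then show ?thesis using False 
        by (simp add: alpha_mon not_in_iff fs.subspace_0[OF subspace_supp_in])
    qed
  qed
qed

text \<open>Monomials have weight at least 0. The truncation properties, and many vanishing products
  later, are applications of this remark.\<close>

lemma graded_neg:
  assumes "\<And>d. d \<in> A \<Longrightarrow> d < 0" "p \<in> graded A"
  shows "p = 0"
proof -
  have "M \<notin> Poly_Mapping.keys p" for M
    using assms(1)[of "int (wt M)"] assms(2) by (auto simp: supp_in_def)
  then show ?thesis by (intro poly_mapping_eqI) (simp add: in_keys_iff)
qed

lemma graded_bound: "\<exists>D. p \<in> graded {..D}"
proof -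
  define D where "D = Max (insert 0 (wt ` Poly_Mapping.keys p))"
  have "wt M \<le> D" if "M \<in> Poly_Mapping.keys p" for M
    unfolding D_def using that by (intro Max_ge) auto
  then have "Poly_Mapping.keys p \<subseteq> {M. int (wt M) \<in> {..int D}}"
    by auto
  then show ?thesis unfolding supp_in_def by blast
qed

section \<open>Sums over the naturals with a certificate of finiteness\<close>

section \<open>Finitely supported sums\<close>

text \<open>\<open>Sum_any\<close> is 0 by default on families of infinite support, so splitting or
  reordering such sums is only sound with finiteness; this is the certificate that is carried
  along.\<close>

definition ev0 :: "(nat \<Rightarrow> 'b::zero) \<Rightarrow> bool" where
  "ev0 f \<longleftrightarrow> (\<exists>N. \<forall>j\<ge>N. f j = 0)"

lemma ev0_cong0: "ev0 f \<Longrightarrow> (\<And>j. f j = 0 \<Longrightarrow> g j = 0) \<Longrightarrow> ev0 g"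
  unfolding ev0_def by blast

lemma ev0_add: "ev0 f \<Longrightarrow> ev0 g \<Longrightarrow> ev0 (\<lambda>j. f j + (g j :: 'b::monoid_add))"
  unfolding ev0_def by (metis add_0 max.bounded_iff)

lemma ev0_diff: "ev0 f \<Longrightarrow> ev0 g \<Longrightarrow> ev0 (\<lambda>j. f j - (g j :: 'b::group_add))"
  unfolding ev0_def by (metis diff_0_right max.bounded_iff)

lemma ev0_zero: "ev0 (\<lambda>j. 0)"
  by (simp add: ev0_def)

lemma ev0_scale: "ev0 f \<Longrightarrow> ev0 (\<lambda>j. fock_scale (c j) (f j))"
  by (erule ev0_cong0) simp

lemma ev0_shift: "ev0 f \<Longrightarrow> ev0 (\<lambda>j. f (j + k))"
  unfolding ev0_def by (meson le_add1 order_trans)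

lemma ev0_finite: "ev0 f \<Longrightarrow> finite {j. f j \<noteq> 0}"
  unfolding ev0_def using finite_subset[of _ "{..<N}" for N]
  by (metis (mono_tags, lifting) finite_nat_set_iff_bounded leI mem_Collect_eq)

lemma Sum_any_upto:
  assumes "\<And>j. j \<ge> N \<Longrightarrow> f j = 0"
  shows "Sum_any f = sum f {..<(N::nat)}"
proof (rule Sum_any.expand_superset)
  show "{j. f j \<noteq> 0} \<subseteq> {..<N}" using assms leI by blast
qed simp

lemma Sum_any_add: "ev0 f \<Longrightarrow> ev0 g \<Longrightarrow> Sum_any (\<lambda>j. f j + g j) = Sum_any f + Sum_any (g :: nat \<Rightarrow> fock)"
  by (intro Sum_any.distrib ev0_finite)

lemma Sum_any_flin:
  assumes "flin X" "ev0 f"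
  shows "X (Sum_any f) = Sum_any (\<lambda>j. X (f j))"
proof -
  obtain N where N: "\<And>j. j \<ge> N \<Longrightarrow> f j = 0" using assms(2) unfolding ev0_def by blast
  then show ?thesis
    by (simp add: Sum_any_upto[of N] flin_sum[OF assms(1)] flin_zero[OF assms(1)])
qed

lemma Sum_any_scale: "ev0 f \<Longrightarrow> Sum_any (\<lambda>j. fock_scale c (f j)) = fock_scale c (Sum_any f)"
  by (simp add: Sum_any_flin[OF flin_const_scale])

lemma Sum_any_diff: "ev0 f \<Longrightarrow> ev0 g \<Longrightarrow> Sum_any (\<lambda>j. f j - g j) = Sum_any f - Sum_any (g :: nat \<Rightarrow> fock)"
  using Sum_any_add[of f "\<lambda>j. fock_scale (-1) (g j)"] Sum_any_scale[of g "-1"] ev0_scale[of g "\<lambda>_. -1"] by simp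

lemma Sum_any_mem:
  assumes "fs.subspace S" "\<And>j. f j \<in> S"
  shows "Sum_any f \<in> S"
  unfolding Sum_any.expand_set using assms by (intro fs.subspace_sum) auto

lemma Sum_any_delta_int:
  "Sum_any (\<lambda>j. if int j = q then g j else 0) = (if q \<ge> 0 then g (nat q) else (0 :: fock))"
proof (cases "q \<ge> 0")
  case True
  then have "(\<lambda>j. if int j = q then g j else 0) = (\<lambda>j. if j = nat q then g j else 0)" by (intro ext) auto
  then have "Sum_any (\<lambda>j. if int j = q then g j else 0) = Sum_any (\<lambda>j. if j = nat q then g j else 0)"
    by (simp only:)
  then show ?thesis using True by (simp only: Sum_any.delta if_True)
next
  case False
  then have "(\<lambda>j. if int j = q then g j else 0) = (\<lambda>j. 0)" by auto
  then show ?thesis using False by simp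
qed

lemma Sum_any_Suc:
  assumes "ev0 f"
  shows "Sum_any f = f 0 + Sum_any (\<lambda>j. f (Suc j) :: fock)"
proof -
  obtain N where N: "\<And>j. j \<ge> N \<Longrightarrow> f j = 0" using assms unfolding ev0_def by blast
  have "Sum_any f = sum f {..<Suc N}" by (rule Sum_any_upto) (simp add: N)
  also have "\<dots> = f 0 + (\<Sum>j<N. f (Suc j))" by (rule sum.lessThan_Suc_shift)
  also have "(\<Sum>j<N. f (Suc j)) = Sum_any (\<lambda>j. f (Suc j))"
    by (rule Sum_any_upto[symmetric]) (simp add: N)
  finally show ?thesis .
qed

section \<open>Normally ordered words: truncation, vacuum and commutator with a boson\<close>

section \<open>Modes of a list\<close>

text \<open>Variables with mode index 0 exist in the ambient type and are excluded here. The general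
  theory runs on all boson indices at once (\<open>St\<close>); the rank enters only through
  \<open>I\<close>.\<close>

definition states_on :: "nat set \<Rightarrow> fock set" where
  "states_on I = supp_in {M. set_mset M \<subseteq> I \<times> {1..}}"

abbreviation St :: "fock set" where "St \<equiv> states_on UNIV"

lemma subspace_states_on: "fs.subspace (states_on I)"
  by (simp add: states_on_def subspace_supp_in)

lemma states_on_mono: "I \<subseteq> J \<Longrightarrow> states_on I \<subseteq> states_on J"
  unfolding states_on_def by (intro supp_in_mono) auto

lemma states_on_St: "p \<in> states_on I \<Longrightarrow> p \<in> St"
  using states_on_mono[of I UNIV] by auto

lemma one_states_on [simp]: "1 \<in> states_on I"
  by (simp add: states_on_def)

lemma alpha_states_on:
  assumes "p \<in> states_on I" "i \<in> I \<or> n \<ge> 0"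
  shows "alpha i n p \<in> states_on I"
  unfolding states_on_def
proof (rule flin_supp_inI[OF flin_alpha assms(1)[unfolded states_on_def] subspace_supp_in])
  fix M :: "(nat \<times> nat) multiset" assume M: "M \<in> {M. set_mset M \<subseteq> I \<times> {1..}}"
  show "alpha i n (mon M) \<in> supp_in {M. set_mset M \<subseteq> I \<times> {1..}}"
  proof (cases "n < 0")
    case True
    then show ?thesis using M assms(2) by (auto simp: alpha_mon_neg)
  next
    case False
    have "set_mset (M - {#(i, nat n)#}) \<subseteq> I \<times> {1..}"
      using M by (auto dest: in_diffD)
    then show ?thesis using False
      by (simp add: alpha_mon' fs.subspace_scale[OF subspace_supp_in])
  qed
qed

lemma list_mode_graded:
  assumes "v \<in> graded A" "\<And>d. d \<in> A \<Longrightarrow> d + int (wt (mset xs)) - n - 1 \<in> B"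
  shows "list_mode xs n v \<in> graded B"
  using assms
proof (induction xs n v arbitrary: A B rule: list_mode.induct)
  case (1 n v)
  show ?case
  proof (cases "n = -1")
    case True
    then have "A \<subseteq> B" using 1 by force
    then have "graded A \<subseteq> graded B" by (intro supp_in_mono) auto
    then show ?thesis using 1 True by auto
  next
    case False
    then show ?thesis by (simp add: fs.subspace_0[OF subspace_supp_in])
  qed
next
  case (2 i m xs n v)
  let ?W = "int (wt (mset xs))"
  have 1: "alpha i (- int m - int j) (list_mode xs (n + int j) v) \<in> graded B" for j
  proof (rule alpha_graded)
    show "list_mode xs (n + int j) v \<in> graded ((\<lambda>d. d + ?W - (n + int j) - 1) ` A)"
      by (rule 2(1)[OF 2(3)]) simp
  qed (use 2(4) in \<open>auto simp: algebra_simps\<close>)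
  have 2: "list_mode xs (n - int m - int j) (alpha i (int j) v) \<in> graded B" for j
  proof (rule 2(2))
    show "alpha i (int j) v \<in> graded ((\<lambda>d. d - int j) ` A)"
      by (rule alpha_graded[OF 2(3)]) simp
  qed (use 2(4) in \<open>auto simp: algebra_simps\<close>)
  show ?case
    unfolding list_mode.simps using 1 2
    by (intro Sum_any_mem subspace_supp_in fs.subspace_scale[OF subspace_supp_in] fs.subspace_diff[OF subspace_supp_in])
qed

lemma list_mode_zero [simp]: "list_mode xs n 0 = 0"
  using list_mode_graded[of 0 "{}" xs n "{}"] by simp

lemma list_mode_trunc: "\<exists>N. \<forall>n\<ge>N. list_mode xs n v = 0"
proof -
  obtain D where D: "v \<in> graded {..D}" using graded_bound by blast
  have "list_mode xs n v = 0" if "n \<ge> D + int (wt (mset xs))" for n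
    by (rule graded_neg[OF _ list_mode_graded[OF D, where B = "{..<0}"]]) (use that in auto)
  then show ?thesis by blast
qed

lemma alpha_trunc: "\<exists>N. \<forall>n\<ge>N. alpha i n v = 0"
proof -
  obtain D where D: "v \<in> graded {..D}" using graded_bound by blast
  have "alpha i n v = 0" if "n \<ge> D + 1" for n
    by (rule graded_neg[OF _ alpha_graded[OF D, where B = "{..<0}"]]) (use that in auto)
  then show ?thesis by blast
qed

lemma trunc_ev0:
  assumes "\<exists>N::int. \<forall>n\<ge>N. f n = 0"
  shows "ev0 (\<lambda>j. f (n + int j))"
proof -
  obtain N where "\<forall>n\<ge>N. f n = 0" using assms by blast
  then have "\<forall>j\<ge>nat (N - n). f (n + int j) = 0" by auto
  then show ?thesis unfolding ev0_def by blast
qed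

lemma ev0_list_mode: "ev0 (\<lambda>j. list_mode xs (n + int j) v)"
  by (rule trunc_ev0[OF list_mode_trunc])

lemma ev0_alpha: "ev0 (\<lambda>j. alpha i (int j) v)"
  using trunc_ev0[OF alpha_trunc[of i v], of 0] by simp

lemma ev0_list_mode_Cons:
  "ev0 (\<lambda>j. fock_scale (c j) (alpha i (- int m - int j) (list_mode xs (n + int j) v)
         - fock_scale s (list_mode xs (n - int m - int j) (alpha i (int j) v))))"
  by (intro ev0_scale ev0_diff) 
    (rule ev0_cong0[OF ev0_list_mode[of xs n v]] ev0_cong0[OF ev0_alpha[of i v]],
     simp add: flin_zero[OF flin_alpha])+

lemma flin_list_mode: "flin (list_mode xs n)"
proof (induction xs arbitrary: n)
  case Nil
  show ?case by (rule flinI) auto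
next
  case (Cons x xs)
  obtain i m where x: "x = (i, m)" by force
  define t where "t j v = fock_scale (of_nat ((m + j - 1) choose j)) (alpha i (- int m - int j) (list_mode xs (n + int j) v)
         - fock_scale ((-1) ^ m) (list_mode xs (n - int m - int j) (alpha i (int j) v)))" for j v
  have t: "flin (t j)" for j
    unfolding t_def
    by (intro flin_comp[OF flin_const_scale] fp.module_hom_sub flin_comp[OF flin_alpha] flin_comp[OF Cons.IH] Cons.IH flin_alpha)
  have e: "ev0 (\<lambda>j. t j v)" for v
    unfolding t_def by (rule ev0_list_mode_Cons)
  have eq: "list_mode (x # xs) n = (\<lambda>v. Sum_any (\<lambda>j. t j v))"
    by (simp add: x t_def fun_eq_iff)
  show ?case unfolding eq
    by (rule flinI) (simp_all add: flin_add[OF t] flin_scale[OF t] Sum_any_add Sum_any_scale e)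
qed

lemma list_mode_states_on:
  assumes "set xs \<subseteq> I \<times> {1..}" "v \<in> states_on I"
  shows "list_mode xs n v \<in> states_on I"
  using assms
proof (induction xs n v rule: list_mode.induct)
  case (1 n v)
  then show ?case by (auto simp: fs.subspace_0[OF subspace_states_on])
next
  case (2 i m xs n v)
  then have "list_mode xs (n - int m - int j) (alpha i (int j) v) \<in> states_on I" for j
    by (simp add: alpha_states_on)
  then show ?case using 2
    unfolding list_mode.simps
    by (intro Sum_any_mem subspace_states_on fs.subspace_scale[OF subspace_states_on]
        fs.subspace_diff[OF subspace_states_on] alpha_states_on) auto
qed

lemma list_mode_vac:
  "n \<ge> 0 \<Longrightarrow> list_mode xs n 1 = 0"
  "set xs \<subseteq> UNIV \<times> {1..} \<Longrightarrow> list_mode xs (-1) 1 = mon (mset xs)"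
proof -
  show 0: "list_mode xs n 1 = 0" if "n \<ge> 0" for n xs
    using that
  proof (induction xs arbitrary: n)
    case (Cons x xs)
    then show ?case
      by (cases x) (simp add: alpha_one flin_zero[OF flin_alpha])
  qed simp
  show "set xs \<subseteq> UNIV \<times> {1..} \<Longrightarrow> list_mode xs (-1) 1 = mon (mset xs)"
  proof (induction xs)
    case (Cons x xs)
    obtain i m where x: "x = (i, m)" by force
    have m: "m \<ge> 1" using Cons.prems x by auto
    \<comment> \<open>Inner modes with \<open>j > 0\<close> are nonnegative and kill the vacuum, and
      so does each annihilation operator; only the creation term at \<open>j = 0\<close>
      remains.\<close>
    have "list_mode (x # xs) (-1) 1 = Sum_any (\<lambda>j. if int j = 0 then alpha i (- int m) (list_mode xs (-1) 1) else 0)"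
      unfolding x list_mode.simps by (intro Sum_any.cong) (auto simp: alpha_one 0 flin_zero[OF flin_alpha])
    also have "\<dots> = alpha i (- int m) (list_mode xs (-1) 1)"
      by (subst Sum_any_delta_int) simp
    finally show ?case using Cons m by (simp add: x alpha_mon_neg)
  qed simp
qed

text \<open>The ways of contracting boson \<open>k\<close> with one letter of a list. The order of
  the remaining letters is kept, since modes are not yet known to be independent of it.\<close>

fun deletions :: "nat \<Rightarrow> (nat \<times> nat) list \<Rightarrow> (nat \<times> (nat \<times> nat) list) list" where
  "deletions k [] = []"
| "deletions k ((i, m) # xs) = (if i = k then [(m, xs)] else []) @ map (\<lambda>(m', ys). (m', (i, m) # ys)) (deletions k xs)"

lemma deletions_props:
  "(m, ys) \<in> set (deletions k xs) \<Longrightarrow> length ys < length xs \<and> set ys \<subseteq> set xs"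
  by (induction k xs arbitrary: m ys rule: deletions.induct) (auto split: if_splits, force+)

text \<open>Leibniz rule: \<open>alpha k (int j)\<close> removes one letter \<open>(k, j)\<close>
  with factor \<open>j\<close>, so the sum over \<open>j\<close> turns into a sum over contractions,
  each read at its own mode index.\<close>

lemma Sum_any_alpha_deletions:
  assumes "\<And>j. flin (F j)" "set xs \<subseteq> UNIV \<times> {1..}"
  shows "Sum_any (\<lambda>j. F j (alpha k (int j) (mon (mset xs)))) =
    (\<Sum>(m, ys) \<leftarrow> deletions k xs. F m (fock_scale (of_nat m) (mon (mset ys))))"
  using assms
proof (induction xs arbitrary: F)
  case Nil
  then show ?case by (simp add: alpha_one flin_zero)
next
  case (Cons x xs)
  obtain i m where x: "x = (i, m)" by force
  let ?q = "mon (mset xs)"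
  have F': "flin (\<lambda>q. F j (var i m * q))" for j by (intro flin_comp[OF Cons.prems(1)] flin_mult)
  have "mon (mset (x # xs)) = var i m * ?q" by (simp add: x mon_mult)
  then have "F j (alpha k (int j) (mon (mset (x # xs)))) =
      (if int j = int m then if i = k then F j (fock_scale (of_nat m) ?q) else 0 else 0) + F j (var i m * alpha k (int j) ?q)" for j
    by (auto simp: alpha_derivation alpha_var flin_add[OF Cons.prems(1)] flin_zero[OF Cons.prems(1)])
  moreover have "ev0 (\<lambda>j. F j (var i m * alpha k (int j) ?q))"
    by (rule ev0_cong0[OF ev0_alpha[of k ?q]]) (simp add: flin_zero[OF Cons.prems(1)])
  moreover have "ev0 (\<lambda>j. if int j = int m then if i = k then F j (fock_scale (of_nat m) ?q) else 0 else 0)"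
    unfolding ev0_def by (rule exI[of _ "Suc m"]) auto
  ultimately have "Sum_any (\<lambda>j. F j (alpha k (int j) (mon (mset (x # xs))))) =
     (if i = k then F m (fock_scale (of_nat m) ?q) else 0) + Sum_any (\<lambda>j. F j (var i m * alpha k (int j) ?q))"
    by (simp add: Sum_any_add Sum_any_delta_int)
  also have "Sum_any (\<lambda>j. F j (var i m * alpha k (int j) ?q)) =
     (\<Sum>(m', ys) \<leftarrow> deletions k xs. F m' (var i m * fock_scale (of_nat m') (mon (mset ys))))"
    using Cons.IH[OF F'] Cons.prems(2) by simp
  finally show ?case
    by (simp add: x o_def case_prod_unfold mon_mult)
qed

text \<open>The left side is the coefficient demanded by the commutator formula, the right side the
  one produced by the recursion of \<open>list_mode\<close>: contraction with the creation part
  happens at \<open>j = p - m\<close>, with the annihilation part at \<open>j = - p\<close>.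
  Strictly between 0 and \<open>m\<close> there is neither, and the binomial vanishes.\<close>

lemma gchoose_absorb_int:
  assumes "m \<ge> 1"
  shows "(of_int p gchoose m) * (of_nat m :: complex) =
    (if int m \<le> p then of_nat ((m + nat (p - int m) - 1) choose nat (p - int m)) * of_int p
     else if p \<le> 0 then - ((-1) ^ m) * of_nat ((m + nat (- p) - 1) choose nat (- p)) * of_int p else 0)"
proof -
  obtain k where k: "m = Suc k" using assms by (cases m) auto
  have absorb: "(of_int p gchoose Suc k) * of_nat (Suc k) = of_int p * ((of_int p - 1) gchoose k :: complex)"
    using gbinomial_absorption[of k "of_int p :: complex"] by (simp add: mult.commute)
  consider "int m \<le> p" | "0 < p" "p < int m" | "p \<le> 0" by linarith
  then show ?thesis
  proof cases
    case 1
    then have "(of_int p - 1 :: complex) = of_nat (nat p - 1)" by (simp add: k of_nat_diff)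
    then have "((of_int p - 1) gchoose k :: complex) = of_nat ((nat p - 1) choose k)"
      by (simp add: binomial_gbinomial)
    also have "(nat p - 1) choose k = (nat p - 1) choose (nat p - 1 - k)"
      using 1 k by (intro binomial_symmetric) auto
    finally have "((of_int p - 1) gchoose k :: complex) = of_nat ((nat p - 1) choose (nat p - 1 - k))" .
    moreover have "nat p - 1 - k = nat (p - int m)" "nat p - 1 = m + nat (p - int m) - 1" using 1 k by auto
    ultimately show ?thesis using 1 absorb by (simp add: k mult.commute)
  next
    case 2
    then have "(of_int p :: complex) = of_nat (nat p)" by simp
    then have "(of_int p gchoose m :: complex) = of_nat (nat p choose m)" by (simp only: binomial_gbinomial)
    also have "nat p choose m = 0" using 2 by (intro binomial_eq_0) auto
    finally show ?thesis using 2 by simp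
  next
    case 3
    have "((of_int p - 1) gchoose k :: complex) = (-1) ^ k * ((of_nat k - (of_int p - 1) - 1) gchoose k)"
      by (rule gbinomial_negated_upper)
    also have "(of_nat k - (of_int p - 1) - 1 :: complex) = of_nat (k + nat (- p))" using 3 by simp
    also have "(of_nat (k + nat (- p)) gchoose k :: complex) = of_nat ((k + nat (- p)) choose nat (- p))"
      by (metis add_diff_cancel_left' binomial_gbinomial binomial_symmetric le_add1)
    finally show ?thesis using 3 absorb by (simp add: k)
  qed
qed

text \<open>The correction in [a(p), b_n] = sum_j binom(p, j) (a(j) b)_(p+n-j), where a is boson
  \<open>k\<close> and b the state of the list; the factor \<open>of_nat m\<close> comes from the
  contraction.\<close>

definition list_comm :: "nat \<Rightarrow> int \<Rightarrow> (nat \<times> nat) list \<Rightarrow> int \<Rightarrow> fock \<Rightarrow> fock" where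
  "list_comm k p xs n v =
     (\<Sum>(m, ys) \<leftarrow> deletions k xs. fock_scale ((of_int p gchoose m) * of_nat m) (list_mode ys (p + n - int m) v))"

lemma flin_sum_list: "flin X \<Longrightarrow> X (\<Sum>y \<leftarrow> ys. f y) = (\<Sum>y \<leftarrow> ys. X (f y))"
  by (induction ys) (simp_all add: flin_zero flin_add)

lemma Sum_any_sum_list:
  "(\<And>y. y \<in> set ys \<Longrightarrow> ev0 (f y)) \<Longrightarrow>
    Sum_any (\<lambda>j. \<Sum>y \<leftarrow> ys. f y j :: fock) = (\<Sum>y \<leftarrow> ys. Sum_any (f y)) \<and> ev0 (\<lambda>j. \<Sum>y \<leftarrow> ys. f y j)"
  by (induction ys) (auto simp: Sum_any_add ev0_add ev0_zero)

text \<open>Moving the operator through the normally ordered product of the first letter with the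
  rest yields contractions with the rest, known by induction, and with the first letter, collected
  in \<open>d\<close>.\<close>

lemma alpha_list_mode:
  assumes "set xs \<subseteq> UNIV \<times> {1..}"
  shows "alpha k p (list_mode xs n v) = list_mode xs n (alpha k p v) + list_comm k p xs n v"
  using assms
proof (induction xs arbitrary: n v)
  case Nil
  then show ?case by (simp add: list_comm_def flin_zero[OF flin_alpha])
next
  case (Cons x xs)
  obtain i m where x: "x = (i, m)" by force
  have m: "m \<ge> 1" and xs: "set xs \<subseteq> UNIV \<times> {1..}" using Cons.prems x by auto
  note IH = Cons.IH[OF xs]
  define c where "c j = (of_nat ((m + j - 1) choose j) :: complex)" for j
  define s where "s = ((-1) ^ m :: complex)"
  define t where "t ys n v j = fock_scale (c j) (alpha i (- int m - int j) (list_mode ys (n + int j) v)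
         - fock_scale s (list_mode ys (n - int m - int j) (alpha i (int j) v)))" for ys n v j
  have lm: "list_mode ((i, m) # ys) n v = Sum_any (t ys n v)" for ys n v
    by (simp add: t_def c_def s_def)
  have et: "ev0 (t ys n v)" for ys n v
    unfolding t_def by (rule ev0_list_mode_Cons)
  define g :: "nat \<times> (nat \<times> nat) list \<Rightarrow> complex" where "g = (\<lambda>(m', ys). (of_int p gchoose m') * of_nat m')"
  \<comment> \<open>Contraction with the first letter: the creation mode \<open>- m - j\<close>
    meets \<open>p\<close> for \<open>j = p - m\<close>, the annihilation mode \<open>j\<close> for
    \<open>j = - p\<close>; each occurs for at most one \<open>j\<close>.\<close>
  define d where "d j = (if int j = p - int m then if i = k then fock_scale (c j * of_int p) (list_mode xs (n + int j) v) else 0 else 0)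
     - (if int j = - p then if i = k then fock_scale (c j * s * of_int p) (list_mode xs (n - int m - int j) v) else 0 else 0)" for j
  have cmt: "list_comm k p xs n' w = (\<Sum>y \<leftarrow> deletions k xs. fock_scale (g y) (list_mode (snd y) (p + n' - int (fst y)) w))" for n' w
    by (simp add: list_comm_def g_def case_prod_unfold)
  have step: "alpha k p (t xs n v j) = t xs n (alpha k p v) j
      + (\<Sum>y \<leftarrow> deletions k xs. fock_scale (g y) (t (snd y) (p + n - int (fst y)) v j)) + d j" for j
  proof -
    have a: "alpha k p (alpha i (- int m - int j) (list_mode xs (n + int j) v)) =
      alpha i (- int m - int j) (list_mode xs (n + int j) (alpha k p v)) +
      (\<Sum>y \<leftarrow> deletions k xs. fock_scale (g y) (alpha i (- int m - int j) (list_mode (snd y) (p + n - int (fst y) + int j) v))) +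
      (if int j = p - int m then if i = k then fock_scale (of_int p) (list_mode xs (n + int j) v) else 0 else 0)"
      by (auto simp: alpha_commutator[of k p i] IH flin_add[OF flin_alpha] cmt flin_sum_list[OF flin_alpha]
          flin_scale[OF flin_alpha] algebra_simps)
    have b: "alpha k p (list_mode xs (n - int m - int j) (alpha i (int j) v)) =
      list_mode xs (n - int m - int j) (alpha i (int j) (alpha k p v)) +
      (\<Sum>y \<leftarrow> deletions k xs. fock_scale (g y) (list_mode (snd y) (p + n - int (fst y) - int m - int j) (alpha i (int j) v))) +
      (if int j = - p then if i = k then fock_scale (of_int p) (list_mode xs (n - int m - int j) v) else 0 else 0)"
      by (auto simp: alpha_commutator[of k p i] IH flin_add[OF flin_list_mode] cmt
          flin_scale[OF flin_list_mode] algebra_simps)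
    have "alpha k p (t xs n v j) = fock_scale (c j) (alpha k p (alpha i (- int m - int j) (list_mode xs (n + int j) v))
       - fock_scale s (alpha k p (list_mode xs (n - int m - int j) (alpha i (int j) v))))"
      by (simp add: t_def flin_scale[OF flin_alpha] flin_diff[OF flin_alpha])
    also have "\<dots> = t xs n (alpha k p v) j
      + (fock_scale (c j) ((\<Sum>y \<leftarrow> deletions k xs. fock_scale (g y) (alpha i (- int m - int j) (list_mode (snd y) (p + n - int (fst y) + int j) v)))
        - fock_scale s (\<Sum>y \<leftarrow> deletions k xs. fock_scale (g y) (list_mode (snd y) (p + n - int (fst y) - int m - int j) (alpha i (int j) v))))) + d j"
      unfolding a b t_def d_def by (auto simp: fs.scale_right_distrib fs.scale_right_diff_distrib algebra_simps)
    also have "fock_scale (c j) ((\<Sum>y \<leftarrow> deletions k xs. fock_scale (g y) (alpha i (- int m - int j) (list_mode (snd y) (p + n - int (fst y) + int j) v)))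
        - fock_scale s (\<Sum>y \<leftarrow> deletions k xs. fock_scale (g y) (list_mode (snd y) (p + n - int (fst y) - int m - int j) (alpha i (int j) v))))
      = (\<Sum>y \<leftarrow> deletions k xs. fock_scale (g y) (t (snd y) (p + n - int (fst y)) v j))"
      unfolding t_def
      by (simp add: flin_sum_list[OF flin_const_scale] fs.scale_right_diff_distrib sum_list_subtractf mult_ac)
    finally show ?thesis .
  qed
  have "alpha k p (list_mode (x # xs) n v) = Sum_any (\<lambda>j. alpha k p (t xs n v j))"
    by (simp only: x lm Sum_any_flin[OF flin_alpha et])
  also have "\<dots> = Sum_any (\<lambda>j. t xs n (alpha k p v) j
      + (\<Sum>y \<leftarrow> deletions k xs. fock_scale (g y) (t (snd y) (p + n - int (fst y)) v j)) + d j)"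
    by (simp only: step)
  also have "\<dots> = Sum_any (t xs n (alpha k p v)) +
     (\<Sum>y \<leftarrow> deletions k xs. fock_scale (g y) (Sum_any (t (snd y) (p + n - int (fst y)) v))) + Sum_any d"
  proof -
    note S = Sum_any_sum_list[of "deletions k xs" "\<lambda>y j. fock_scale (g y) (t (snd y) (p + n - int (fst y)) v j)", OF ev0_scale[OF et]]
    have "ev0 d" unfolding ev0_def d_def
      by (rule exI[of _ "nat \<bar>p\<bar> + m + 1"]) auto
    then show ?thesis
      using S by (simp add: Sum_any_add ev0_add et Sum_any_scale)
  qed
  also have "Sum_any d = (if i = k then fock_scale ((of_int p gchoose m) * of_nat m) (list_mode xs (p + n - int m) v) else 0)"
  proof -
    have "Sum_any d = (if p - int m \<ge> 0 then if i = k then fock_scale (c (nat (p - int m)) * of_int p) (list_mode xs (n + int (nat (p - int m))) v) else 0 else 0)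
      - (if - p \<ge> 0 then if i = k then fock_scale (c (nat (- p)) * s * of_int p) (list_mode xs (n - int m - int (nat (- p))) v) else 0 else 0)"
      unfolding d_def
      by (subst Sum_any_diff) (auto simp: Sum_any_delta_int ev0_def intro: exI[of _ "nat \<bar>p\<bar> + m + 1"])
    also have "\<dots> = (if i = k then fock_scale ((of_int p gchoose m) * of_nat m) (list_mode xs (p + n - int m) v) else 0)"
    proof -
      consider "int m \<le> p" | "0 < p" "p < int m" | "p \<le> 0" by linarith
      then show ?thesis
      proof cases
        case 1
        then have "n + int (nat (p - int m)) = p + n - int m" by simp
        then show ?thesis unfolding gchoose_absorb_int[OF m] using 1 m by (simp add: c_def algebra_simps)
      next
        case 2
        then show ?thesis unfolding gchoose_absorb_int[OF m] by simp
      next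
        case 3
        then have "n - int m - int (nat (- p)) = p + n - int m" by simp
        then show ?thesis unfolding gchoose_absorb_int[OF m] using 3 m by (simp add: c_def s_def algebra_simps)
      qed
    qed
    finally show ?thesis .
  qed
  finally show ?case
    by (simp add: x list_comm_def g_def case_prod_unfold o_def lm algebra_simps del: list_mode.simps)
qed

section \<open>Schur's lemma for the Fock module\<close>

section \<open>Operators commuting with the Heisenberg operators\<close>

lemma lookup_alpha:
  assumes "n \<ge> 1"
  shows "Poly_Mapping.lookup (alpha i (int n) q) N =
    of_nat n * of_nat (count N (i, n) + 1) * Poly_Mapping.lookup q (add_mset (i, n) N)"
proof -
  let ?x = "(i, n)"
  have "Poly_Mapping.lookup (alpha i (int n) q) N = (\<Sum>M \<in> Poly_Mapping.keys q.
     Poly_Mapping.lookup q M * (if M - {#?x#} = N then of_nat n * of_nat (count M ?x) else 0))"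
    by (simp add: alpha_nonneg lin_def lookup_sum lookup_single when_def)
  also have "\<dots> = (\<Sum>M \<in> Poly_Mapping.keys q. if M = add_mset ?x N
     then of_nat n * of_nat (count N ?x + 1) * Poly_Mapping.lookup q (add_mset ?x N) else 0)"
  proof (intro sum.cong refl)
    fix M
    show "Poly_Mapping.lookup q M * (if M - {#?x#} = N then of_nat n * of_nat (count M ?x) else 0) =
      (if M = add_mset ?x N then of_nat n * of_nat (count N ?x + 1) * Poly_Mapping.lookup q (add_mset ?x N) else 0)"
    proof (cases "?x \<in># M")
      case True
      then have "M - {#?x#} = N \<longleftrightarrow> M = add_mset ?x N" by (metis add_mset_remove_trivial insert_DiffM)
      then show ?thesis by auto
    next
      case False
      then have "count M ?x = 0" "M \<noteq> add_mset ?x N" by (auto simp: not_in_iff)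
      then show ?thesis by simp
    qed
  qed
  also have "\<dots> = of_nat n * of_nat (count N ?x + 1) * Poly_Mapping.lookup q (add_mset ?x N)"
    by (auto simp: in_keys_iff)
  finally show ?thesis .
qed

text \<open>A monomial other than 1 contains a letter, and differentiating by this letter recovers
  its coefficient up to a nonzero factor.\<close>

lemma vacuum_line:
  assumes "q \<in> St" "\<And>k p. p \<ge> 1 \<Longrightarrow> alpha k (int p) q = 0"
  shows "q = fock_scale (Poly_Mapping.lookup q {#}) 1"
proof (rule poly_mapping_eqI)
  fix M
  show "Poly_Mapping.lookup q M = Poly_Mapping.lookup (fock_scale (Poly_Mapping.lookup q {#}) 1) M"
  proof (cases "M = {#}")
    case True
    then show ?thesis by (simp add: lookup_one zero_multiset_def)
  next
    case False
    then obtain x N where M: "M = add_mset x N" by (meson multiset_cases)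
    obtain k m where x: "x = (k, m)" by force
    have "Poly_Mapping.lookup q M = 0"
    proof (rule ccontr)
      assume nz: "Poly_Mapping.lookup q M \<noteq> 0"
      then have "m \<ge> 1" using assms(1) by (auto simp: states_on_def supp_in_def in_keys_iff M x)
      then have "of_nat m * of_nat (count N (k, m) + 1) * Poly_Mapping.lookup q M = 0"
        using lookup_alpha[of m k q N] assms(2) by (simp add: M x)
      then show False using nz \<open>m \<ge> 1\<close> by (simp del: of_nat_Suc of_nat_add add: add.commute)
    qed
    then show ?thesis using False by (simp add: lookup_one zero_multiset_def)
  qed
qed

lemma fock_op_eq_0:
  assumes "flin X" "X 1 = 0"
    and comm: "\<And>k n p. p \<in> St \<Longrightarrow> n \<ge> 1 \<Longrightarrow> X (alpha k (- int n) p) = alpha k (- int n) (X p)"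
    and "v \<in> St"
  shows "X v = 0"
proof (rule supp_in_eqI[OF assms(1) fp.module_hom_zero assms(4)[unfolded states_on_def]])
  fix M :: "(nat \<times> nat) multiset" assume "M \<in> {M. set_mset M \<subseteq> UNIV \<times> {1..}}"
  then show "X (mon M) = 0"
  proof (induction M)
    case empty
    then show ?case using assms(2) by simp
  next
    case (add x M)
    obtain k n where x: "x = (k, n)" by force
    have n: "n \<ge> 1" and M: "M \<in> {M. set_mset M \<subseteq> UNIV \<times> {1..}}" using add.prems x by auto
    have "mon (add_mset x M) = alpha k (- int n) (mon M)" using n by (simp add: alpha_mon_neg x)
    moreover have "mon M \<in> St" using M by (simp add: states_on_def)
    ultimately show ?case using comm[OF _ n, of "mon M" k] add.IH[OF M] by (simp add: flin_zero[OF flin_alpha])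
  qed
qed

text \<open>The image of the vacuum is again killed by all annihilation operators, hence a multiple
  of the vacuum, and the creation operators carry this multiple to all states.\<close>

lemma fock_op_scalar:
  assumes X: "flin X" and St: "\<And>v. v \<in> St \<Longrightarrow> X v \<in> St"
    and comm: "\<And>k p v. v \<in> St \<Longrightarrow> X (alpha k p v) = alpha k p (X v)"
    and "v \<in> St"
  shows "X v = fock_scale (Poly_Mapping.lookup (X 1) {#}) v"
proof -
  let ?c = "Poly_Mapping.lookup (X 1) {#}"
  have "alpha k (int p) (X 1) = 0" if "p \<ge> 1" for k p
    using that comm[of 1 k "int p"] by (simp add: alpha_one flin_zero[OF X])
  then have 1: "X 1 = fock_scale ?c 1"
    using St by (intro vacuum_line) auto
  have "X v - fock_scale ?c v = 0"
  proof (rule fock_op_eq_0[OF _ _ _ assms(4)])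
    show "flin (\<lambda>v. X v - fock_scale ?c v)" by (intro fp.module_hom_sub X flin_const_scale)
  qed (use 1 comm in \<open>auto simp: flin_diff[OF flin_alpha] flin_scale[OF flin_alpha]\<close>)
  then show ?thesis by simp
qed

text \<open>A scalar cannot change weights. This is how the scalar of a deviation is usually seen to
  vanish.\<close>

lemma fock_op_weight_eq_0:
  assumes "flin X" "\<And>v. v \<in> St \<Longrightarrow> X v \<in> St"
    and "\<And>k p v. v \<in> St \<Longrightarrow> X (alpha k p v) = alpha k p (X v)"
    and "X 1 \<in> graded {d}" "d \<noteq> 0" "v \<in> St"
  shows "X v = 0"
proof -
  have "Poly_Mapping.lookup (X 1) {#} = 0"
    using assms(4,5) by (auto simp: supp_in_def in_keys_iff)
  then show ?thesis using fock_op_scalar[OF assms(1-3) assms(6)] by simp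
qed

section \<open>Independence of the order of letters; commutator and iterate formulas\<close>

section \<open>The products of the Fock space\<close>

abbreviation Y :: "fock \<Rightarrow> int \<Rightarrow> fock \<Rightarrow> fock" where "Y \<equiv> fock_nprod"

lemma mset_SOME: "mset (SOME xs. mset xs = M) = M"
  by (rule someI_ex) (rule ex_mset)

lemma Y_lin: "Y a n v = lin (\<lambda>M. list_mode (SOME xs. mset xs = M) n v) a"
  by (simp add: fock_nprod_def lin_def)

lemma Y_mon: "Y (mon M) n v = list_mode (SOME xs. mset xs = M) n v"
  by (simp add: Y_lin)

lemma flin_Y_left: "flin (\<lambda>a. Y a n v)"
  unfolding Y_lin by (rule flin_lin)

lemma flin_Y: "flin (Y a n)"
  unfolding fock_nprod_def
  by (rule flinI) (simp_all add: flin_add[OF flin_list_mode] flin_scale[OF flin_list_mode]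
      fs.scale_right_distrib sum.distrib fs.scale_sum_right mult.commute)

lemmas Y_add_left = flin_add[OF flin_Y_left]
lemmas Y_diff_left = flin_diff[OF flin_Y_left]
lemmas Y_scale_left = flin_scale[OF flin_Y_left]
lemmas Y_zero_left [simp] = flin_zero[OF flin_Y_left]
lemmas Y_add = flin_add[OF flin_Y]
lemmas Y_diff = flin_diff[OF flin_Y]
lemmas Y_scale = flin_scale[OF flin_Y]
lemmas Y_zero [simp] = flin_zero[OF flin_Y]

lemma Y_graded:
  assumes "a \<in> graded A" "v \<in> graded B" "\<And>d e. d \<in> A \<Longrightarrow> e \<in> B \<Longrightarrow> d + e - n - 1 \<in> C"
  shows "Y a n v \<in> graded C"
proof (rule flin_supp_inI[OF flin_Y_left assms(1) subspace_supp_in])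
  fix M assume "M \<in> {M. int (wt M) \<in> A}"
  then have "d + int (wt (mset (SOME xs. mset xs = M))) - n - 1 \<in> C" if "d \<in> B" for d
    using assms(3)[of "int (wt M)" d] that by (simp add: mset_SOME add.commute)
  then show "Y (mon M) n v \<in> graded C"
    unfolding Y_mon by (rule list_mode_graded[OF assms(2)])
qed

lemma Y_graded1: "a \<in> graded {d} \<Longrightarrow> v \<in> graded {e} \<Longrightarrow> Y a n v \<in> graded {d + e - n - 1}"
  by (erule (1) Y_graded) auto

lemma Y_states_on:
  assumes "a \<in> states_on I" "v \<in> states_on I"
  shows "Y a n v \<in> states_on I"
proof (rule flin_supp_inI[OF flin_Y_left assms(1)[unfolded states_on_def] subspace_states_on])
  fix M :: "(nat \<times> nat) multiset" assume "M \<in> {M. set_mset M \<subseteq> I \<times> {1..}}"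
  then have "set (SOME xs. mset xs = M) \<subseteq> I \<times> {1..}" by (simp flip: set_mset_mset add: mset_SOME)
  then show "Y (mon M) n v \<in> states_on I"
    unfolding Y_mon by (intro list_mode_states_on assms(2))
qed

lemma Y_trunc: "\<exists>N. \<forall>n\<ge>N. Y a n v = 0"
proof -
  obtain D where D: "a \<in> graded {..D}" using graded_bound by blast
  obtain D' where D': "v \<in> graded {..D'}" using graded_bound by blast
  have "Y a n v = 0" if "n \<ge> D + D'" for n
    by (rule graded_neg[OF _ Y_graded[OF D D', where C = "{..<0}"]]) (use that in auto)
  then show ?thesis by blast
qed

lemma ev0_Y: "ev0 (\<lambda>j. Y a (n + int j) v)"
  by (rule trunc_ev0[OF Y_trunc])

lemma ev0_Y_alpha: "ev0 (\<lambda>j. Y a (n j) (alpha i (int j) v))"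
  by (rule ev0_cong0[OF ev0_alpha[of i v]]) simp

lemma ev0_Y_alpha_left: "ev0 (\<lambda>j. Y (alpha i (int j) a) (n j) v)"
  by (rule ev0_cong0[OF ev0_alpha[of i a]]) simp

lemma flin_Sum_any:
  assumes "\<And>j. flin (t j)" "\<And>v. ev0 (\<lambda>j. t j v)"
  shows "flin (\<lambda>v. Sum_any (\<lambda>j. t j v))"
  by (rule flinI) (simp_all add: flin_add[OF assms(1)] flin_scale[OF assms(1)] Sum_any_add Sum_any_scale assms(2))

text \<open>The modes of two enumerations differ by an operator whose commutators with the bosons
  involve shorter lists only, where the modes agree by induction; so it commutes with all bosons and
  is a scalar. For \<open>n >= 0\<close> it kills the vacuum; for \<open>n < 0\<close> it raises the
  weight by the weight of the list minus \<open>n + 1\<close>, a positive number.\<close>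

lemma list_mode_eq_Y:
  assumes "set xs \<subseteq> UNIV \<times> {1..}" "v \<in> St"
  shows "list_mode xs n v = Y (mon (mset xs)) n v"
  using assms
proof (induction xs arbitrary: n v rule: length_induct)
  case (1 xs)
  define zs where "zs = (SOME zs. mset zs = mset xs)"
  have mset_zs: "mset zs = mset xs" by (simp add: zs_def mset_SOME)
  have zs: "set zs \<subseteq> UNIV \<times> {1..}" "length zs = length xs"
    using mset_zs 1(2) by (metis set_mset_mset, metis size_mset)
  define X where "X v = list_mode xs n v - list_mode zs n v" for v
  have comm: "list_comm k p ys n w = Sum_any (\<lambda>j. fock_scale (of_int p gchoose j)
      (Y (alpha k (int j) (mon (mset ys))) (p + n - int j) w))"
    if ys: "set ys \<subseteq> UNIV \<times> {1..}" "length ys = length xs" "w \<in> St" for k p ys w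
  proof -
    have F: "flin (\<lambda>q. fock_scale (of_int p gchoose j) (Y q (p + n - int j) w))" for j
      by (intro flin_comp[OF flin_const_scale] flin_Y_left)
    have "list_comm k p ys n w = (\<Sum>(m, us) \<leftarrow> deletions k ys. fock_scale (of_int p gchoose m)
        (Y (fock_scale (of_nat m) (mon (mset us))) (p + n - int m) w))"
      unfolding list_comm_def
    proof (intro arg_cong[of _ _ sum_list] map_cong refl, clarify)
      fix m us assume "(m, us) \<in> set (deletions k ys)"
      from deletions_props[OF this] have "list_mode us (p + n - int m) w = Y (mon (mset us)) (p + n - int m) w"
        using 1(1) that by auto
      then show "fock_scale ((of_int p gchoose m) * of_nat m) (list_mode us (p + n - int m) w) =
        fock_scale (of_int p gchoose m) (Y (fock_scale (of_nat m) (mon (mset us))) (p + n - int m) w)"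
        by (simp add: Y_scale_left)
    qed
    then show ?thesis using Sum_any_alpha_deletions[OF F ys(1)] by simp
  qed
  have X: "flin X" unfolding X_def by (intro fp.module_hom_sub flin_list_mode)
  have XSt: "X w \<in> St" if "w \<in> St" for w
    unfolding X_def using that 1(2) zs by (intro fs.subspace_diff[OF subspace_states_on] list_mode_states_on)
  have Xc: "X (alpha k p w) = alpha k p (X w)" if "w \<in> St" for k p w
    unfolding X_def using that 1(2) zs
    by (simp add: flin_diff[OF flin_alpha] alpha_list_mode comm mset_zs)
  have "X v = 0"
  \<comment> \<open>For the empty list the weight argument fails at \<open>n = -1\<close>, but there
    is only one enumeration.\<close>
  proof (cases "xs = []")
    case True
    then show ?thesis using zs by (simp add: X_def)
  next
    case xs: False
    then have W: "wt (mset xs) > 0" using 1(2) by (cases xs) auto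
    show ?thesis
    proof (cases "n \<ge> 0")
      case True
      show ?thesis
        by (rule fock_op_eq_0[OF X _ Xc 1(3)]) (simp_all add: X_def list_mode_vac True)
    next
      case False
      have o: "1 \<in> graded {0}" by simp
      have X1: "X 1 \<in> graded {int (wt (mset xs)) - n - 1}"
        unfolding X_def
        by (intro fs.subspace_diff[OF subspace_supp_in] list_mode_graded[OF o]) (auto simp: mset_zs)
      show ?thesis
        by (rule fock_op_weight_eq_0[OF X XSt Xc X1]) (use 1(3) W False in auto)
    qed
  qed
  then show ?case by (simp add: X_def zs_def Y_mon)
qed

lemma Y_vac: "n \<ge> 0 \<Longrightarrow> Y a n 1 = 0" "a \<in> St \<Longrightarrow> Y a (-1) 1 = a"
proof -
  show "Y a n 1 = 0" if "n \<ge> 0"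
    using that by (simp add: fock_nprod_def list_mode_vac)
  assume a: "a \<in> St"
  show "Y a (-1) 1 = a"
  proof (rule supp_in_eqI[OF flin_Y_left flin_ident a[unfolded states_on_def]])
    fix M :: "(nat \<times> nat) multiset" assume "M \<in> {M. set_mset M \<subseteq> UNIV \<times> {1..}}"
    then have "set (SOME xs. mset xs = M) \<subseteq> UNIV \<times> {1..}" by (simp flip: set_mset_mset add: mset_SOME)
    then show "Y (mon M) (-1) 1 = mon M" by (simp add: Y_mon list_mode_vac mset_SOME)
  qed
qed

lemma Y_one: "Y 1 n v = (if n = -1 then v else 0)"
  by (simp add: fock_nprod_def)

text \<open>Since the order of letters is irrelevant by now, the contractions of
  \<open>alpha_list_mode\<close> can be written as modes of \<open>alpha k (int j) a\<close>,
  without reference to lists.\<close>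

lemma Y_comm:
  assumes "a \<in> St" "v \<in> St"
  shows "alpha k p (Y a n v) = Y a n (alpha k p v) +
     Sum_any (\<lambda>j. fock_scale (of_int p gchoose j) (Y (alpha k (int j) a) (p + n - int j) v))"
proof -
  have F: "flin (\<lambda>q. fock_scale (of_int p gchoose j) (Y q (p + n - int j) v))" for j
    by (intro flin_comp[OF flin_const_scale] flin_Y_left)
  have F': "flin (\<lambda>a. Sum_any (\<lambda>j. fock_scale (of_int p gchoose j) (Y (alpha k (int j) a) (p + n - int j) v)))"
    by (intro flin_Sum_any flin_comp[OF flin_const_scale] flin_comp[OF flin_Y_left] flin_alpha ev0_scale ev0_Y_alpha_left)
  show ?thesis
  proof (rule supp_in_eqI[OF _ _ assms(1)[unfolded states_on_def]])
    show "flin (\<lambda>a. alpha k p (Y a n v))" by (intro flin_comp[OF flin_alpha] flin_Y_left)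
    show "flin (\<lambda>a. Y a n (alpha k p v) + Sum_any (\<lambda>j. fock_scale (of_int p gchoose j) (Y (alpha k (int j) a) (p + n - int j) v)))"
      by (intro fp.module_hom_add flin_Y_left F')
    fix M :: "(nat \<times> nat) multiset" assume "M \<in> {M. set_mset M \<subseteq> UNIV \<times> {1..}}"
    moreover obtain xs where M: "M = mset xs" by (metis ex_mset)
    ultimately have xs: "set xs \<subseteq> UNIV \<times> {1..}" by auto
    have "alpha k p (Y (mon M) n v) = list_mode xs n (alpha k p v) + list_comm k p xs n v"
      using xs assms(2) by (simp add: M alpha_list_mode flip: list_mode_eq_Y)
    also have "list_comm k p xs n v = (\<Sum>(m, us) \<leftarrow> deletions k xs. fock_scale (of_int p gchoose m)
        (Y (fock_scale (of_nat m) (mon (mset us))) (p + n - int m) v))"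
      unfolding list_comm_def
    proof (intro arg_cong[of _ _ sum_list] map_cong refl, clarify)
      fix m us assume "(m, us) \<in> set (deletions k xs)"
      from deletions_props[OF this] have "list_mode us (p + n - int m) v = Y (mon (mset us)) (p + n - int m) v"
        using xs assms(2) by (intro list_mode_eq_Y) auto
      then show "fock_scale ((of_int p gchoose m) * of_nat m) (list_mode us (p + n - int m) v) =
        fock_scale (of_int p gchoose m) (Y (fock_scale (of_nat m) (mon (mset us))) (p + n - int m) v)"
        by (simp add: Y_scale_left)
    qed
    also have "\<dots> = Sum_any (\<lambda>j. fock_scale (of_int p gchoose j) (Y (alpha k (int j) (mon M)) (p + n - int j) v))"
      unfolding M by (rule Sum_any_alpha_deletions[OF F xs, symmetric])
    also have "list_mode xs n (alpha k p v) = Y (mon M) n (alpha k p v)" if "alpha k p v \<in> St"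
      using xs that by (simp add: M list_mode_eq_Y)
    finally show "alpha k p (Y (mon M) n v) = Y (mon M) n (alpha k p v) +
      Sum_any (\<lambda>j. fock_scale (of_int p gchoose j) (Y (alpha k (int j) (mon M)) (p + n - int j) v))"
      using assms(2) alpha_states_on by auto
  qed
qed

lemma ev0_Y_iterate:
  "ev0 (\<lambda>j. fock_scale (c j) (alpha i (- int m - int j) (Y a (n + int j) v)
        - fock_scale s (Y a (n - int m - int j) (alpha i (int j) v))))"
  by (intro ev0_scale ev0_diff ev0_Y_alpha) (rule ev0_cong0[OF ev0_Y[of a n v]], simp add: flin_zero[OF flin_alpha])

text \<open>The defining recursion with an arbitrary state as tail. As \<open>Y\<close> uses an
  unspecified enumeration, a first letter can only be split off through
  \<open>list_mode_eq_Y\<close>.\<close>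

lemma Y_iterate:
  assumes "a \<in> St" "v \<in> St" "m \<ge> 1"
  shows "Y (alpha i (- int m) a) n v = Sum_any (\<lambda>j. fock_scale (of_nat ((m + j - 1) choose j))
      (alpha i (- int m - int j) (Y a (n + int j) v)
        - fock_scale ((-1) ^ m) (Y a (n - int m - int j) (alpha i (int j) v))))"
proof (rule supp_in_eqI[OF _ _ assms(1)[unfolded states_on_def]])
  show "flin (\<lambda>a. Y (alpha i (- int m) a) n v)" by (intro flin_comp[OF flin_Y_left] flin_alpha)
  show "flin (\<lambda>a. Sum_any (\<lambda>j. fock_scale (of_nat ((m + j - 1) choose j)) (alpha i (- int m - int j) (Y a (n + int j) v)
        - fock_scale ((-1) ^ m) (Y a (n - int m - int j) (alpha i (int j) v)))))"
    by (intro flin_Sum_any flin_comp[OF flin_const_scale] fp.module_hom_sub flin_comp[OF flin_alpha] flin_Y_left ev0_Y_iterate)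
  fix M :: "(nat \<times> nat) multiset" assume "M \<in> {M. set_mset M \<subseteq> UNIV \<times> {1..}}"
  moreover obtain xs where M: "M = mset xs" by (metis ex_mset)
  ultimately have xs: "set xs \<subseteq> UNIV \<times> {1..}" "set ((i, m) # xs) \<subseteq> UNIV \<times> {1..}" using assms(3) by auto
  have "Y (alpha i (- int m) (mon M)) n v = list_mode ((i, m) # xs) n v"
    using assms by (subst list_mode_eq_Y[OF xs(2) assms(2)]) (simp add: alpha_mon_neg M)
  then show "Y (alpha i (- int m) (mon M)) n v = Sum_any (\<lambda>j. fock_scale (of_nat ((m + j - 1) choose j))
      (alpha i (- int m - int j) (Y (mon M) (n + int j) v)
        - fock_scale ((-1) ^ m) (Y (mon M) (n - int m - int j) (alpha i (int j) v))))"
    using xs(1) assms(2) by (simp add: M list_mode_eq_Y alpha_states_on)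
qed

section \<open>Translation covariance, and skew-symmetry of vacuum components\<close>

section \<open>The translation operator and skew-symmetry\<close>

text \<open>The translation operator, written as a product so that it is available before any
  conformal vector; \<open>omega3_0\<close> identifies it with L(-1).\<close>

definition T :: "fock \<Rightarrow> fock" where "T a = Y a (-2) 1"

lemma flin_T: "flin T"
  unfolding T_def by (rule flin_Y_left)

lemma T_states_on: "a \<in> states_on I \<Longrightarrow> T a \<in> states_on I"
  by (simp add: T_def Y_states_on)

lemma T_one [simp]: "T 1 = 0"
  by (simp add: T_def Y_one)

lemma T_graded: "a \<in> graded {d} \<Longrightarrow> T a \<in> graded {d + 1}"
  using Y_graded1[of a d 1 0 "-2"] by (simp add: T_def add.commute)

lemma alpha_T:
  assumes "a \<in> St"
  shows "alpha k p (T a) = T (alpha k p a) + fock_scale (of_int p) (alpha k (p - 1) a)"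
proof (cases "p < 0")
  case True
  define m where "m = nat (- p)"
  have m: "p = - int m" "m \<ge> 1" using True by (auto simp: m_def)
  \<comment> \<open>The mode is nonnegative for \<open>j >= 2\<close> and kills the vacuum: only two
    terms of the iterate formula survive.\<close>
  have z: "Y a (int j - 2) 1 = (if j = 0 then T a else if j = 1 then a else 0)" for j
    using Y_vac[where a = a] assms by (auto simp: T_def)
  have "T (alpha k p a) = Sum_any (\<lambda>j. fock_scale (of_nat ((m + j - 1) choose j)) (alpha k (- int m - int j) (Y a (-2 + int j) 1)))"
    unfolding T_def m(1) using m(2) assms by (subst Y_iterate) (simp_all add: alpha_one)
  also have "\<dots> = Sum_any (\<lambda>j. (if int j = 0 then alpha k p (T a) else 0) + (if int j = 1 then fock_scale (of_nat m) (alpha k (p - 1) a) else 0))"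
    using m by (intro Sum_any.cong) (auto simp: z flin_zero[OF flin_alpha])
  also have "\<dots> = alpha k p (T a) + fock_scale (of_nat m) (alpha k (p - 1) a)"
    by (subst Sum_any_add) (auto simp: Sum_any_delta_int ev0_def intro: exI[of _ 2] simp del: of_nat_eq_0_iff of_nat_eq_1_iff)
  finally show ?thesis by (simp add: m(1))
next
  case False
  have "alpha k p (T a) = Sum_any (\<lambda>j. fock_scale (of_int p gchoose j) (Y (alpha k (int j) a) (p - 2 - int j) 1))"
    unfolding T_def using False assms by (subst Y_comm) (simp_all add: alpha_one)
  also have "\<dots> = Sum_any (\<lambda>j. (if int j = p then T (alpha k p a) else 0) + (if int j = p - 1 then fock_scale (of_int p) (alpha k (p - 1) a) else 0))"
  proof (intro Sum_any.cong)
    fix j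
    \<comment> \<open>For \<open>j > p\<close> the binomial vanishes; for \<open>j < p - 1\<close>
      the mode \<open>p - 2 - j\<close> is nonnegative and kills the vacuum.\<close>
    consider "int j = p" | "int j = p - 1" | "int j > p" | "int j < p - 1" by linarith
    then show "fock_scale (of_int p gchoose j) (Y (alpha k (int j) a) (p - 2 - int j) 1) =
      (if int j = p then T (alpha k p a) else 0) + (if int j = p - 1 then fock_scale (of_int p) (alpha k (p - 1) a) else 0)"
    proof cases
      case 1
      then have "(of_int p gchoose j :: complex) = 1"
        by (metis binomial_gbinomial binomial_n_n of_int_of_nat_eq of_nat_1)
      then show ?thesis using 1 by (simp add: T_def)
    next
      case 2
      then have "p = int (Suc j)" by simp
      then have "(of_int p gchoose j :: complex) = of_nat (Suc j choose j)"
        by (simp only: binomial_gbinomial of_int_of_nat_eq)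
      also have "\<dots> = of_int p" using \<open>p = int (Suc j)\<close> by simp
      finally show ?thesis using 2 assms by (auto simp: Y_vac alpha_states_on)
    next
      case 3
      then obtain q where "p = int q" "q < j" using False by (metis int_nat_eq nat_less_iff not_less of_nat_less_iff)
      then have "(of_int p gchoose j :: complex) = 0"
        by (metis binomial_eq_0 binomial_gbinomial of_int_of_nat_eq of_nat_0)
      then show ?thesis using 3 by simp
    next
      case 4
      then show ?thesis by (simp add: Y_vac)
    qed
  qed
  also have "\<dots> = T (alpha k p a) + fock_scale (of_int p) (alpha k (p - 1) a)"
  proof (subst Sum_any_add)
    show "ev0 (\<lambda>j. if int j = p then T (alpha k p a) else 0)" unfolding ev0_def by (rule exI[of _ "nat p + 1"]) auto
    show "ev0 (\<lambda>j. if int j = p - 1 then fock_scale (of_int p) (alpha k (p - 1) a) else 0)"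
      unfolding ev0_def by (rule exI[of _ "nat p + 1"]) auto
  qed (use False in \<open>auto simp: Sum_any_delta_int\<close>)
  finally show ?thesis .
qed

lemma St_mon_induct [consumes 1, case_names linear mon]:
  assumes "a \<in> states_on I"
    and "\<And>p q c. P p \<Longrightarrow> P q \<Longrightarrow> P (fock_scale c p + q)"
    and "\<And>M. set_mset M \<subseteq> I \<times> {1..} \<Longrightarrow> P (mon M)"
    and "P 0"
  shows "P a"
proof -
  have "a \<in> fs.span (mon ` {M. set_mset M \<subseteq> I \<times> {1..}})"
    using assms(1) by (simp add: states_on_def supp_in_span)
  then show ?thesis
    by (induction rule: fs.span_induct_alt) (use assms in auto)
qed

lemma mon_states_on [simp]: "mon M \<in> states_on I \<longleftrightarrow> set_mset M \<subseteq> I \<times> {1..}"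
  by (simp add: states_on_def)

lemma mon_graded: "mon M \<in> graded {int (wt M)}"
  by simp

text \<open>By induction on the number of letters the deviation \<open>X\<close> commutes with the
  bosons, hence is a scalar. On the vacuum it is 0 for \<open>n >= -1\<close>; otherwise it raises
  weights by \<open>wt M - n\<close>, which is positive.\<close>

lemma T_Y_mon:
  assumes "set_mset M \<subseteq> UNIV \<times> {1..}" "v \<in> St"
  shows "T (Y (mon M) n v) = Y (mon M) n (T v) - fock_scale (of_int n) (Y (mon M) (n - 1) v)"
  using assms
proof (induction "size M" arbitrary: M n v rule: less_induct)
  case less
  let ?a = "mon M"
  define X where "X v = T (Y ?a n v) - Y ?a n (T v) + fock_scale (of_int n) (Y ?a (n - 1) v)" for v
  have a: "?a \<in> St" using less.prems by simp
  have IH: "T (Y (alpha k (int j) ?a) r w) = Y (alpha k (int j) ?a) r (T w) - fock_scale (of_int r) (Y (alpha k (int j) ?a) (r - 1) w)"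
    if "w \<in> St" for k j r w
  proof (cases "(k, j) \<in># M")
    case True
    then have "size (M - {#(k, j)#}) < size M" by (meson size_Diff1_less)
    moreover have "set_mset (M - {#(k, j)#}) \<subseteq> UNIV \<times> {1..}" using less.prems(1) by (auto dest: in_diffD)
    ultimately show ?thesis using less.hyps[of "M - {#(k, j)#}" w r] that
      by (simp add: alpha_mon' Y_scale_left flin_scale[OF flin_T] fs.scale_right_diff_distrib mult.commute)
  next
    case False
    then show ?thesis by (simp add: alpha_mon' not_in_iff flin_zero[OF flin_T])
  qed
  have X: "flin X" unfolding X_def
    by (intro fp.module_hom_sub fp.module_hom_add flin_comp[OF flin_T] flin_comp[OF flin_Y] flin_Y flin_T flin_comp[OF flin_const_scale])
  have XSt: "X w \<in> St" if "w \<in> St" for w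
    unfolding X_def using that a
    by (intro fs.subspace_diff[OF subspace_states_on] fs.subspace_add[OF subspace_states_on]
        fs.subspace_scale[OF subspace_states_on] Y_states_on T_states_on)
  have Xc: "X (alpha k p w) = alpha k p (X w)" if w: "w \<in> St" for k p w
  proof -
    define S where "S q r u = Sum_any (\<lambda>j. fock_scale (of_int q gchoose j) (Y (alpha k (int j) ?a) (q + r - int j) u))" for q r u
    have Yc: "alpha k q (Y ?a r u) = Y ?a r (alpha k q u) + S q r u" if "u \<in> St" for q r u
      unfolding S_def by (rule Y_comm[OF a that])
    have St: "alpha k q u \<in> St" if "u \<in> St" for q u using that by (simp add: alpha_states_on)
    note e = ev0_scale[OF ev0_Y_alpha_left]
    have TS: "T (S p n w) = S p n (T w) - Sum_any (\<lambda>j. fock_scale ((of_int p gchoose j) * of_int (p + n - int j)) (Y (alpha k (int j) ?a) (p + n - int j - 1) w))"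
      unfolding S_def
      by (simp add: Sum_any_flin[OF flin_T e] flin_scale[OF flin_T] IH[OF w] fs.scale_right_diff_distrib Sum_any_diff e)
    \<comment> \<open>The factor \<open>p + n - j\<close> splits into two commutator sums: one with
      \<open>p - 1\<close>, as produced by moving \<open>T\<close> past the boson, and one with mode
      \<open>n - 1\<close>, as required by the last summand of \<open>X\<close>.\<close>
    have id: "(of_int p gchoose j) * of_int (p + n - int j) = of_int p * (of_int (p - 1) gchoose j) + of_int n * (of_int p gchoose j :: complex)" for j
      using gbinomial_absorb_comp[of "of_int p :: complex" j] by (simp add: algebra_simps)
    have "Sum_any (\<lambda>j. fock_scale ((of_int p gchoose j) * of_int (p + n - int j)) (Y (alpha k (int j) ?a) (p + n - int j - 1) w))
      = fock_scale (of_int p) (S (p - 1) n w) + fock_scale (of_int n) (S p (n - 1) w)"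
      unfolding S_def id by (simp add: fs.scale_left_distrib Sum_any_add e Sum_any_scale[symmetric] algebra_simps)
    then have TS: "T (S p n w) = S p n (T w) - fock_scale (of_int p) (S (p - 1) n w) - fock_scale (of_int n) (S p (n - 1) w)"
      using TS by (simp add: algebra_simps)
    have "alpha k p (T (Y ?a n w)) = T (Y ?a n (alpha k p w)) + T (S p n w) + fock_scale (of_int p) (Y ?a n (alpha k (p - 1) w)) + fock_scale (of_int p) (S (p - 1) n w)"
      using w a by (simp add: alpha_T Y_states_on Yc flin_add[OF flin_T] algebra_simps)
    moreover have "alpha k p (Y ?a n (T w)) = Y ?a n (T (alpha k p w)) + fock_scale (of_int p) (Y ?a n (alpha k (p - 1) w)) + S p n (T w)"
      using w by (simp add: alpha_T T_states_on Yc Y_add Y_scale)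
    moreover have "alpha k p (Y ?a (n - 1) w) = Y ?a (n - 1) (alpha k p w) + S p (n - 1) w"
      using w by (rule Yc)
    ultimately show ?thesis
      unfolding X_def by (simp add: flin_add[OF flin_alpha] flin_diff[OF flin_alpha] flin_scale[OF flin_alpha] TS algebra_simps)
  qed
  have "X v = 0"
  proof (cases "n \<ge> -1")
    case True
    have "X 1 = 0"
    proof (cases "n = -1")
      case True
      then show ?thesis using a by (simp add: X_def Y_vac) (simp add: T_def)
    next
      case False
      then show ?thesis using True a by (cases "n = 0") (simp_all add: X_def Y_vac flin_zero[OF flin_T])
    qed
    then show ?thesis using fock_op_eq_0[OF X _ Xc less.prems(2)] by simp
  next
    case False
    have o: "1 \<in> graded {0}" by simp
    have X1: "X 1 \<in> graded {int (wt M) - n}"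
      unfolding X_def
      using T_graded[OF Y_graded1[OF mon_graded o], of M n] Y_graded1[OF mon_graded o, of M "n - 1"]
      by (intro fs.subspace_diff[OF subspace_supp_in] fs.subspace_add[OF subspace_supp_in]
        fs.subspace_scale[OF subspace_supp_in]) (simp_all add: fs.subspace_0[OF subspace_supp_in])
    show ?thesis
      by (rule fock_op_weight_eq_0[OF X XSt Xc X1]) (use less.prems False in auto)
  qed
  then show ?case by (simp add: X_def algebra_simps)
qed

abbreviation vcoeff :: "fock \<Rightarrow> complex" where "vcoeff p \<equiv> Poly_Mapping.lookup p {#}"

lemma lookup_Sum_any:
  assumes "ev0 f"
  shows "Poly_Mapping.lookup (Sum_any f) M = Sum_any (\<lambda>j. Poly_Mapping.lookup (f j :: fock) M)"
proof -
  obtain N where N: "\<And>j. j \<ge> N \<Longrightarrow> f j = 0" using assms unfolding ev0_def by blast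
  then show ?thesis by (simp add: Sum_any_upto[of N] lookup_sum)
qed

lemma vcoeff_alpha_neg: "n < 0 \<Longrightarrow> vcoeff (alpha i n p) = 0"
proof -
  assume n: "n < 0"
  have "alpha i n p \<in> supp_in {M. M \<noteq> {#}}"
  proof (rule flin_supp_inI[OF flin_alpha _ subspace_supp_in])
    show "p \<in> supp_in UNIV" by (simp add: supp_in_def)
  qed (simp add: alpha_mon_neg n)
  then show ?thesis by (auto simp: supp_in_def in_keys_iff)
qed

lemma gchoose_neg_nat: "s \<ge> 1 \<Longrightarrow> (of_int (- int s) gchoose j :: complex) = (-1) ^ j * of_nat ((s + j - 1) choose j)"
proof -
  assume "s \<ge> 1"
  then have "(of_nat j - of_int (- int s) - 1 :: complex) = of_nat (s + j - 1)" by (simp add: of_nat_diff)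
  then show ?thesis
    by (subst gbinomial_negated_upper) (simp add: binomial_gbinomial)
qed

text \<open>The vacuum component, in the mode landing in weight 0, is the form in which
  skew-symmetry enters the Borcherds identity. One letter of \<open>N\<close> at a time crosses
  over: the commutator formula on one side and the iterate formula on the other give the same sum,
  because results of creation operators have no vacuum component.\<close>

lemma vcoeff_skew:
  assumes "set_mset M \<subseteq> UNIV \<times> {1..}" "set_mset N \<subseteq> UNIV \<times> {1..}"
  shows "vcoeff (Y (mon M) (int (wt M + wt N) - 1) (mon N)) =
    (-1) ^ (wt M + wt N) * vcoeff (Y (mon N) (int (wt M + wt N) - 1) (mon M))"
  using assms
proof (induction N arbitrary: M)
  case empty
  show ?case
  proof (cases "M = {#}")
    case False
    then have "wt M \<ge> 1" using empty(1) by (cases M) auto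
    then show ?thesis by (simp add: Y_vac Y_one)
  qed simp
next
  case (add x N)
  obtain i s where x: "x = (i, s)" by force
  have s: "s \<ge> 1" and N: "set_mset N \<subseteq> UNIV \<times> {1..}" using add.prems x by auto
  define K where "K = wt M + wt (add_mset x N)"
  have K: "K = wt M + s + wt N" by (simp add: K_def x)
  let ?a = "mon M" and ?b = "mon N"
  have a: "?a \<in> St" and b: "?b \<in> St" using add.prems N by auto
  have xN: "mon (add_mset x N) = alpha i (- int s) ?b" using s by (simp add: alpha_mon_neg x)
  \<comment> \<open>Removing \<open>(i, s)\<close> on one side and contracting \<open>(i, j)\<close>
    on the other lowers the total weight by \<open>s + j\<close>; the sign is therefore (-1)^(K - s
    - j), written with plus signs.\<close>
  have IH: "vcoeff (Y (alpha i (int j) ?a) (int K - 1 - int s - int j) ?b) =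
      (-1) ^ (K + s + j) * vcoeff (Y ?b (int K - 1 - int s - int j) (alpha i (int j) ?a))" for j
  proof (cases "(i, j) \<in># M")
    case True
    let ?M = "M - {#(i, j)#}"
    have "wt M = wt ?M + j" using wt_diff[OF True] by simp
    then have e: "int K - 1 - int s - int j = int (wt ?M + wt N) - 1" "K = (wt ?M + wt N) + s + j" using K by auto
    have "set_mset ?M \<subseteq> UNIV \<times> {1..}" using add.prems(1) by (auto dest: in_diffD)
    note add.IH[OF this N]
    moreover have "((-1) ^ (K + s + j) :: complex) = (-1) ^ (wt ?M + wt N)"
    proof -
      have "K + s + j = (wt ?M + wt N) + 2 * (s + j)" using e(2) by simp
      then show ?thesis by (simp only: power_add) simp
    qed
    ultimately show ?thesis unfolding e(1) by (simp add: alpha_mon' Y_scale Y_scale_left)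
  next
    case False
    then show ?thesis by (simp add: alpha_mon' not_in_iff)
  qed
  have "vcoeff (Y ?a (int K - 1) (alpha i (- int s) ?b)) =
     - Sum_any (\<lambda>j. (of_int (- int s) gchoose j) * vcoeff (Y (alpha i (int j) ?a) (int K - 1 - int s - int j) ?b))"
  proof -
    have r: "- int s + (int K - 1) - int j = int K - 1 - int s - int j" for j by simp
    have "Y ?a (int K - 1) (alpha i (- int s) ?b) = alpha i (- int s) (Y ?a (int K - 1) ?b) -
      Sum_any (\<lambda>j. fock_scale (of_int (- int s) gchoose j) (Y (alpha i (int j) ?a) (int K - 1 - int s - int j) ?b))"
      unfolding Y_comm[OF a b] r by simp
    then show ?thesis using s
      by (simp only: lookup_minus lookup_Sum_any[OF ev0_scale[OF ev0_Y_alpha_left]])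
        (simp add: vcoeff_alpha_neg)
  qed
  also have "\<dots> = - Sum_any (\<lambda>j. of_nat ((s + j - 1) choose j) * ((-1) ^ (K + s) * vcoeff (Y ?b (int K - 1 - int s - int j) (alpha i (int j) ?a))))"
    unfolding IH gchoose_neg_nat[OF s]
    by (intro arg_cong[of _ _ uminus] Sum_any.cong) (simp add: power_add power_mult_distrib[symmetric] mult_ac)
  also have "\<dots> = (-1) ^ K * vcoeff (Y (alpha i (- int s) ?b) (int K - 1) ?a)"
  proof -
    have e: "ev0 (\<lambda>j. of_nat ((s + j - 1) choose j) * ((-1) ^ (K + s) * vcoeff (Y ?b (int K - 1 - int s - int j) (alpha i (int j) ?a))))"
      by (rule ev0_cong0[OF ev0_Y_alpha[of ?b "\<lambda>j. int K - 1 - int s - int j" i ?a]]) simp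
    have "vcoeff (Y (alpha i (- int s) ?b) (int K - 1) ?a) =
      Sum_any (\<lambda>j. - (of_nat ((s + j - 1) choose j) * ((-1) ^ s * vcoeff (Y ?b (int K - 1 - int s - int j) (alpha i (int j) ?a)))))"
      using s by (simp add: Y_iterate[OF b a s] lookup_Sum_any[OF ev0_Y_iterate] lookup_minus vcoeff_alpha_neg)
    also have "(-1) ^ K * \<dots> = Sum_any (\<lambda>j. - (of_nat ((s + j - 1) choose j) * ((-1) ^ (K + s) * vcoeff (Y ?b (int K - 1 - int s - int j) (alpha i (int j) ?a)))))"
    proof (subst Sum_any_right_distrib)
      show "finite {j. - (of_nat ((s + j - 1) choose j) * ((-1) ^ s * vcoeff (Y ?b (int K - 1 - int s - int j) (alpha i (int j) ?a)))) \<noteq> 0}"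
        by (rule ev0_finite, rule ev0_cong0[OF e]) auto
    qed (simp add: power_add mult_ac)
    also have "\<dots> = - Sum_any (\<lambda>j. of_nat ((s + j - 1) choose j) * ((-1) ^ (K + s) * vcoeff (Y ?b (int K - 1 - int s - int j) (alpha i (int j) ?a))))"
      using Sum_any_right_distrib[OF ev0_finite[OF e], of "-1"] by simp
    finally show ?thesis by simp
  qed
  finally show ?case unfolding K_def[symmetric] xN .
qed

section \<open>The deviation from the Borcherds identity is a scalar, and the scalar is 0\<close>

section \<open>The Borcherds identity\<close>

lemma T_Y:
  assumes "a \<in> St" "v \<in> St"
  shows "T (Y a n v) = Y a n (T v) - fock_scale (of_int n) (Y a (n - 1) v)"
proof (rule supp_in_eqI[OF _ _ assms(1)[unfolded states_on_def]])
  show "flin (\<lambda>a. T (Y a n v))" by (intro flin_comp[OF flin_T] flin_Y_left)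
  show "flin (\<lambda>a. Y a n (T v) - fock_scale (of_int n) (Y a (n - 1) v))"
    by (intro fp.module_hom_sub flin_Y_left flin_comp[OF flin_const_scale])
qed (simp add: T_Y_mon assms(2))

text \<open>Truncation provides exactly these hypotheses: contractions with a fixed vector end at a
  bound independent of \<open>i\<close>, while in \<open>i\<close> the bound may vary with
  \<open>s\<close>.\<close>

lemma Sum_any_swap:
  fixes f :: "nat \<Rightarrow> nat \<Rightarrow> fock"
  assumes "\<exists>S. \<forall>s\<ge>S. \<forall>i. f i s = 0" "\<And>s. ev0 (\<lambda>i. f i s)"
  shows "Sum_any (\<lambda>i. Sum_any (\<lambda>s. f i s)) = Sum_any (\<lambda>s. Sum_any (\<lambda>i. f i s :: fock))"
    and "ev0 (\<lambda>i. Sum_any (\<lambda>s. f i s))"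
proof -
  obtain S where S: "\<And>s i. s \<ge> S \<Longrightarrow> f i s = 0" using assms(1) by blast
  have "\<exists>N. \<forall>i\<ge>N. \<forall>s<S'. f i s = 0" for S'
  proof (induction S')
    case (Suc S')
    then obtain N where N: "\<And>i s. i \<ge> N \<Longrightarrow> s < S' \<Longrightarrow> f i s = 0" by blast
    obtain N' where N': "\<And>i. i \<ge> N' \<Longrightarrow> f i S' = 0" using assms(2)[of S'] unfolding ev0_def by blast
    have "\<forall>i\<ge>max N N'. \<forall>s<Suc S'. f i s = 0" using N N' by (auto simp: less_Suc_eq)
    then show ?case by blast
  qed simp
  then obtain N where "\<And>i s. i \<ge> N \<Longrightarrow> s < S \<Longrightarrow> f i s = 0" by blast
  then have N: "f i s = 0" if "i \<ge> N" for i s using S that by (cases "s < S") auto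
  have "Sum_any (\<lambda>i. Sum_any (\<lambda>s. f i s)) = (\<Sum>i<N. \<Sum>s<S. f i s)"
    by (subst Sum_any_upto[of N]) (auto simp: N intro!: sum.cong Sum_any_upto S)
  also have "\<dots> = (\<Sum>s<S. \<Sum>i<N. f i s)" by (rule sum.swap)
  also have "\<dots> = Sum_any (\<lambda>s. Sum_any (\<lambda>i. f i s))"
    by (subst Sum_any_upto[of S "\<lambda>s. Sum_any (\<lambda>i. f i s)"]) (auto simp: S intro!: sum.cong Sum_any_upto[symmetric] N)
  finally show "Sum_any (\<lambda>i. Sum_any (\<lambda>s. f i s)) = Sum_any (\<lambda>s. Sum_any (\<lambda>i. f i s))" .
  show "ev0 (\<lambda>i. Sum_any (\<lambda>s. f i s))"
    unfolding ev0_def by (intro exI[of _ N]) (simp add: N)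
qed

text \<open>Merges the binomials of two successive expansions into one with the sum of the upper
  indices.\<close>

lemma Sum_any_Vandermonde:
  assumes "ev0 G"
  shows "Sum_any (\<lambda>i. Sum_any (\<lambda>s. fock_scale ((x gchoose i) * (y gchoose s)) (G (i + s)))) =
    Sum_any (\<lambda>r. fock_scale ((x + y) gchoose r) (G r))"
proof -
  obtain N where N: "\<And>r. r \<ge> N \<Longrightarrow> G r = 0" using assms unfolding ev0_def by blast
  let ?f = "\<lambda>i s. fock_scale ((x gchoose i) * (y gchoose s)) (G (i + s))"
  have "Sum_any (\<lambda>i. Sum_any (?f i)) = (\<Sum>i<N. \<Sum>s<N. ?f i s)"
    by (subst Sum_any_upto[of N]) (auto simp: N intro!: sum.cong Sum_any_upto)
  also have "\<dots> = (\<Sum>(i, s) \<in> {..<N} \<times> {..<N}. ?f i s)" by (rule sum.cartesian_product)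
  also have "\<dots> = (\<Sum>(i, s) \<in> {(i, s). i + s < N}. ?f i s)"
    by (intro sum.mono_neutral_right) (auto, meson N leI)
  also have "\<dots> = (\<Sum>r<N. \<Sum>i\<le>r. ?f i (r - i))" by (rule sum.triangle_reindex)
  also have "\<dots> = (\<Sum>r<N. fock_scale ((x + y) gchoose r) (G r))"
    by (intro sum.cong refl) (simp flip: fs.scale_sum_left gbinomial_Vandermonde add: atMost_atLeast0)
  also have "\<dots> = Sum_any (\<lambda>r. fock_scale ((x + y) gchoose r) (G r))"
    by (rule Sum_any_upto[symmetric]) (simp add: N)
  finally show ?thesis .
qed

lemma Sum_any_shift:
  assumes "ev0 f" "\<And>s. s < t \<Longrightarrow> f s = 0"
  shows "Sum_any f = Sum_any (\<lambda>s. f (s + t) :: fock)"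
  using assms
proof (induction t arbitrary: f)
  case (Suc t)
  have "Sum_any f = Sum_any (\<lambda>s. f (Suc s))" using Suc.prems by (simp add: Sum_any_Suc)
  also have "\<dots> = Sum_any (\<lambda>s. f (Suc (s + t)))"
    using Suc.prems ev0_shift[OF Suc.prems(1), of 1] by (intro Suc.IH) auto
  finally show ?case by simp
qed simp

lemma Sum_any_lincomb:
  assumes "ev0 (\<lambda>s. fock_scale (C s) (u s))" "ev0 (\<lambda>s. fock_scale (C s) (w s))"
  shows "Sum_any (\<lambda>s. fock_scale (C s) (fock_scale c (u s - fock_scale e (w s)))) =
    fock_scale c (Sum_any (\<lambda>s. fock_scale (C s) (u s)) - fock_scale e (Sum_any (\<lambda>s. fock_scale (C s) (w s))))"
proof -
  have "Sum_any (\<lambda>s. fock_scale (C s) (fock_scale c (u s - fock_scale e (w s)))) =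
    Sum_any (\<lambda>s. fock_scale c (fock_scale (C s) (u s)) - fock_scale (c * e) (fock_scale (C s) (w s)))"
    by (intro Sum_any.cong) (simp add: fs.scale_right_diff_distrib mult_ac)
  also have "\<dots> = fock_scale c (Sum_any (\<lambda>s. fock_scale (C s) (u s))) - fock_scale (c * e) (Sum_any (\<lambda>s. fock_scale (C s) (w s)))"
    by (simp only: Sum_any_diff ev0_scale assms Sum_any_scale)
  finally show ?thesis by (simp add: fs.scale_right_diff_distrib)
qed

definition B_lhs :: "int \<Rightarrow> int \<Rightarrow> int \<Rightarrow> fock \<Rightarrow> fock \<Rightarrow> fock \<Rightarrow> fock" where
  "B_lhs l m n a b v = Sum_any (\<lambda>i. fock_scale (of_int m gchoose i) (Y (Y a (l + int i) b) (m + n - int i) v))"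

definition B_rhs :: "int \<Rightarrow> int \<Rightarrow> int \<Rightarrow> fock \<Rightarrow> fock \<Rightarrow> fock \<Rightarrow> fock" where
  "B_rhs l m n a b v = Sum_any (\<lambda>i. fock_scale ((-1) ^ i * (of_int l gchoose i))
     (Y a (l + m - int i) (Y b (n + int i) v) - fock_scale ((-1) powi l) (Y b (l + n - int i) (Y a (m + int i) v))))"

definition B_err :: "int \<Rightarrow> int \<Rightarrow> int \<Rightarrow> fock \<Rightarrow> fock \<Rightarrow> fock \<Rightarrow> fock" where
  "B_err l m n a b v = B_lhs l m n a b v - B_rhs l m n a b v"

lemma ev0_YY: "ev0 (\<lambda>i. Y a (r i) (Y b (n + int i) v))"
  by (rule ev0_cong0[OF ev0_Y[of b n v]]) simp

lemma ev0_YY_left: "ev0 (\<lambda>i. Y (Y a (n + int i) b) (r i) v)"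
  by (rule ev0_cong0[OF ev0_Y[of a n b]]) simp

lemma flin_B_err: "flin (B_err l m n a b)"
proof -
  have "flin (\<lambda>v. B_err l m n a b v)"
    unfolding B_err_def B_lhs_def B_rhs_def
    by (intro fp.module_hom_sub flin_Sum_any flin_comp[OF flin_const_scale] flin_comp[OF flin_Y] flin_Y
      ev0_scale ev0_diff ev0_YY ev0_YY_left)
  then show ?thesis .
qed

lemma flin_B_err_a: "flin (\<lambda>a. B_err l m n a b v)"
  unfolding B_err_def B_lhs_def B_rhs_def
  by (intro fp.module_hom_sub flin_Sum_any flin_comp[OF flin_const_scale] flin_comp[OF flin_Y] 
    flin_comp[OF flin_Y_left] flin_Y_left ev0_scale ev0_diff ev0_YY ev0_YY_left)

lemma flin_B_err_b: "flin (\<lambda>b. B_err l m n a b v)"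
  unfolding B_err_def B_lhs_def B_rhs_def
  by (intro fp.module_hom_sub flin_Sum_any flin_comp[OF flin_const_scale] flin_comp[OF flin_Y] 
    flin_comp[OF flin_Y_left] flin_Y_left flin_Y ev0_scale ev0_diff ev0_YY ev0_YY_left)

lemma B_err_states_on:
  "a \<in> states_on I \<Longrightarrow> b \<in> states_on I \<Longrightarrow> v \<in> states_on I \<Longrightarrow> B_err l m n a b v \<in> states_on I"
  unfolding B_err_def B_lhs_def B_rhs_def
  by (intro fs.subspace_diff[OF subspace_states_on] fs.subspace_scale[OF subspace_states_on]
     Sum_any_mem subspace_states_on Y_states_on)

lemma B_err_graded:
  assumes "a \<in> graded {d}" "b \<in> graded {e}" "v \<in> graded {f}"
  shows "B_err l m n a b v \<in> graded {d + e + f - l - m - n - 2}"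
proof -
  have s: "d' = d'' \<Longrightarrow> p \<in> graded {d'} \<Longrightarrow> p \<in> graded {d''}" for p d' d'' by simp
  show ?thesis
    unfolding B_err_def B_lhs_def B_rhs_def
    by (intro fs.subspace_diff[OF subspace_supp_in] fs.subspace_scale[OF subspace_supp_in]
       Sum_any_mem subspace_supp_in; (rule s[OF _ Y_graded1[OF Y_graded1[OF assms(1,2)] assms(3)]]
        | rule s[OF _ Y_graded1[OF assms(1) Y_graded1[OF assms(2,3)]]]
        | rule s[OF _ Y_graded1[OF assms(2) Y_graded1[OF assms(1,3)]]]); simp)
qed

text \<open>A boson acts as a derivation on \<open>a\<close>, \<open>b\<close> and \<open>v\<close>,
  shifting \<open>m\<close> or \<open>n\<close>. Two nested commutators produce binom(m, i) binom(p,
  s) binom(s, t); trinomial revision rewrites the last two as binom(p, t) binom(p-t, s-t), and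
  Vandermonde sums the rest to binom(m+p-t, r).\<close>

lemma alpha_B_lhs:
  assumes a: "a \<in> St" and b: "b \<in> St" and v: "v \<in> St"
  shows "alpha k p (B_lhs l m n a b v) = B_lhs l m n a b (alpha k p v)
    + Sum_any (\<lambda>s. fock_scale (of_int p gchoose s) (B_lhs l m (p + n - int s) a (alpha k (int s) b) v))
    + Sum_any (\<lambda>t. fock_scale (of_int p gchoose t) (B_lhs l (m + p - int t) n (alpha k (int t) a) b v))"
proof -
  obtain Sb where Sb: "\<And>s. s \<ge> Sb \<Longrightarrow> alpha k (int s) b = 0" using ev0_alpha[of k b] unfolding ev0_def by blast
  obtain Ta where Ta: "\<And>s. s \<ge> Ta \<Longrightarrow> alpha k (int s) a = 0" using ev0_alpha[of k a] unfolding ev0_def by blast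
  \<comment> \<open>\<open>P\<close> collects the contractions with \<open>b\<close>, and
    \<open>Q\<close> those with \<open>a\<close>; \<open>G t r\<close> are the vectors occurring in
    the sum whose upper index is to become \<open>m + p - t\<close>.\<close>
  define P where "P i s = fock_scale ((of_int m gchoose i) * (of_int p gchoose s)) (Y (Y a (l + int i) (alpha k (int s) b)) (p + m + n - int i - int s) v)" for i s
  define G where "G t r = Y (Y (alpha k (int t) a) (l + int r) b) (p + m + n - int t - int r) v" for t r
  define Q where "Q i s t = fock_scale ((of_int m gchoose i) * (of_int p gchoose s) * (of_int (int s) gchoose t))
     (Y (Y (alpha k (int t) a) (l + (int i + int s - int t)) b) (p + m + n - int i - int s) v)" for i s t
  have G: "ev0 (G t)" for t unfolding G_def by (rule ev0_YY_left)
  have Qlow: "Q i s t = 0" if "s < t" for i s t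
    using that by (simp add: Q_def binomial_eq_0 flip: binomial_gbinomial)
  \<comment> \<open>Terms with \<open>s < t\<close> vanish, so \<open>s\<close> may be replaced by
    \<open>s + t\<close>; trinomial revision then frees the binomial in \<open>t\<close>.\<close>
  have Qshift: "Q i (s + t) t = fock_scale (of_int p gchoose t) (fock_scale ((of_int m gchoose i) * (of_int (p - int t) gchoose s)) (G t (i + s)))" for i s t
  proof -
    have "(of_int p gchoose (s + t)) * (of_nat (s + t) gchoose t) = (of_int p gchoose t) * (of_int (p - int t) gchoose s :: complex)"
      using gbinomial_trinomial_revision[of t "s + t" "of_int p :: complex"] by simp
    then have "(of_int m gchoose i) * (of_int p gchoose (s + t)) * (of_int (int (s + t)) gchoose t) =
      (of_int p gchoose t) * ((of_int m gchoose i) * (of_int (p - int t) gchoose s :: complex))"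
      by (simp only: of_int_of_nat_eq mult_ac)
    then show ?thesis unfolding Q_def G_def by (simp add: algebra_simps)
  qed
  have Qev: "ev0 (\<lambda>s. Q i s t)" for i t
  proof -
    obtain N where N: "\<And>r. r \<ge> N \<Longrightarrow> G t r = 0" using G[of t] unfolding ev0_def by blast
    have "Q i s t = 0" if "s \<ge> N + t" for s
      using Qshift[of i "s - t" t] N[of "i + (s - t)"] that by simp
    then show ?thesis unfolding ev0_def by blast
  qed
  have Qsum: "Sum_any (\<lambda>s. Q i s t) = fock_scale (of_int p gchoose t)
      (Sum_any (\<lambda>s. fock_scale ((of_int m gchoose i) * (of_int (p - int t) gchoose s)) (G t (i + s))))" for i t
  proof -
    have e: "ev0 (\<lambda>s. G t (i + s))" using ev0_shift[OF G[of t], of i] by (simp add: add.commute)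
    have "Sum_any (\<lambda>s. Q i s t) = Sum_any (\<lambda>s. Q i (s + t) t)"
      by (rule Sum_any_shift[OF Qev Qlow])
    then show ?thesis by (simp only: Qshift Sum_any_scale[OF ev0_scale[OF e]])
  qed
  have trm: "alpha k p (Y (Y a (l + int i) b) (m + n - int i) v) = Y (Y a (l + int i) b) (m + n - int i) (alpha k p v)
     + Sum_any (\<lambda>s. fock_scale (of_int p gchoose s) (Y (Y a (l + int i) (alpha k (int s) b)) (p + m + n - int i - int s) v))
     + Sum_any (\<lambda>s. fock_scale (of_int p gchoose s) (Y (Sum_any (\<lambda>t. fock_scale (of_int (int s) gchoose t) (Y (alpha k (int t) a) (l + (int i + int s - int t)) b))) (p + m + n - int i - int s) v))" for i
  proof -
    have sp: "alpha k (int s) (Y a (l + int i) b) = Y a (l + int i) (alpha k (int s) b) + 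
       Sum_any (\<lambda>t. fock_scale (of_int (int s) gchoose t) (Y (alpha k (int t) a) (l + (int i + int s - int t)) b))" for s
      by (subst Y_comm[OF a b]) (simp add: algebra_simps)
    have "ev0 (\<lambda>s. alpha k (int s) (Y a (l + int i) b) - Y a (l + int i) (alpha k (int s) b))"
      by (intro ev0_diff ev0_alpha ev0_Y_alpha)
    then have e: "ev0 (\<lambda>s. Sum_any (\<lambda>t. fock_scale (of_int (int s) gchoose t) (Y (alpha k (int t) a) (l + (int i + int s - int t)) b)))"
      by (simp add: sp)
    have e1: "ev0 (\<lambda>s. fock_scale (of_int p gchoose s) (Y (Y a (l + int i) (alpha k (int s) b)) (p + m + n - int i - int s) v))"
      by (rule ev0_scale, rule ev0_cong0[OF ev0_alpha[of k b]]) simp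
    have e2: "ev0 (\<lambda>s. fock_scale (of_int p gchoose s) (Y (Sum_any (\<lambda>t. fock_scale (of_int (int s) gchoose t) (Y (alpha k (int t) a) (l + (int i + int s - int t)) b))) (p + m + n - int i - int s) v))"
      by (rule ev0_scale, rule ev0_cong0[OF e]) simp
    have r: "p + (m + n - int i) - int s = p + m + n - int i - int s" for s by simp
    show ?thesis
      unfolding Y_comm[OF Y_states_on[OF a b] v] sp r
      by (simp only: Y_add_left fs.scale_right_distrib Sum_any_add[OF e1 e2], simp only: add_ac)
  qed
  have inner: "fock_scale (of_int m gchoose i) (Sum_any (\<lambda>s. fock_scale (of_int p gchoose s) (Y (Sum_any (\<lambda>t. fock_scale (of_int (int s) gchoose t) (Y (alpha k (int t) a) (l + (int i + int s - int t)) b))) (p + m + n - int i - int s) v)))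
     = Sum_any (\<lambda>t. Sum_any (\<lambda>s. Q i s t))" for i
  proof -
    have e: "ev0 (\<lambda>t. fock_scale (of_int (int s) gchoose t) (Y (alpha k (int t) a) (l + (int i + int s - int t)) b))" for s
      by (intro ev0_scale ev0_Y_alpha_left)
    have "fock_scale (of_int p gchoose s) (Y (Sum_any (\<lambda>t. fock_scale (of_int (int s) gchoose t) (Y (alpha k (int t) a) (l + (int i + int s - int t)) b))) (p + m + n - int i - int s) v)
       = Sum_any (\<lambda>t. fock_scale (of_int p gchoose s) (Y (fock_scale (of_int (int s) gchoose t) (Y (alpha k (int t) a) (l + (int i + int s - int t)) b)) (p + m + n - int i - int s) v))" for s
    proof (subst Sum_any_flin[OF flin_Y_left e], rule Sum_any_scale[symmetric])
      show "ev0 (\<lambda>t. Y (fock_scale (of_int (int s) gchoose t) (Y (alpha k (int t) a) (l + (int i + int s - int t)) b)) (p + m + n - int i - int s) v)"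
        by (rule ev0_cong0[OF e[of s]]) (simp only: Y_zero_left)
    qed
    then have *: "fock_scale (of_int p gchoose s) (Y (Sum_any (\<lambda>t. fock_scale (of_int (int s) gchoose t) (Y (alpha k (int t) a) (l + (int i + int s - int t)) b))) (p + m + n - int i - int s) v)
       = Sum_any (\<lambda>t. fock_scale ((of_int p gchoose s) * (of_int (int s) gchoose t)) (Y (Y (alpha k (int t) a) (l + (int i + int s - int t)) b) (p + m + n - int i - int s) v))" for s
      by (simp add: Y_scale_left)
    define Q' where "Q' s t = fock_scale ((of_int p gchoose s) * (of_int (int s) gchoose t)) (Y (Y (alpha k (int t) a) (l + (int i + int s - int t)) b) (p + m + n - int i - int s) v)" for s t
    have "Q 0 s t = Q' s t" if "i = 0" for s t using that by (simp add: Q_def Q'_def)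
    have Q'ev: "ev0 (\<lambda>s. Q' s t)" for t
    proof -
      obtain N where N: "\<And>r. r \<ge> N \<Longrightarrow> G t r = 0" using G[of t] unfolding ev0_def by blast
      have "Q' s t = 0" if "s \<ge> N + t" for s
      proof -
        have "Y (Y (alpha k (int t) a) (l + (int i + int s - int t)) b) (p + m + n - int i - int s) v = G t (i + (s - t))"
          using that unfolding G_def by (simp add: of_nat_diff algebra_simps)
        then show ?thesis using N[of "i + (s - t)"] that by (simp add: Q'_def)
      qed
      then show ?thesis unfolding ev0_def by blast
    qed
    have "Sum_any (\<lambda>s. Sum_any (\<lambda>t. Q' s t)) = Sum_any (\<lambda>t. Sum_any (\<lambda>s. Q' s t))"
    proof (rule Sum_any_swap(1))
      show "\<exists>S. \<forall>t\<ge>S. \<forall>s. Q' s t = 0" by (rule exI[of _ Ta]) (simp add: Q'_def Ta)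
    qed (rule Q'ev)
    then have "fock_scale (of_int m gchoose i) (Sum_any (\<lambda>s. Sum_any (\<lambda>t. Q' s t))) =
       Sum_any (\<lambda>t. fock_scale (of_int m gchoose i) (Sum_any (\<lambda>s. Q' s t)))"
    proof (simp, subst Sum_any_scale)
      show "ev0 (\<lambda>t. Sum_any (\<lambda>s. Q' s t))"
        unfolding ev0_def by (rule exI[of _ Ta]) (simp add: Q'_def Ta)
    qed simp
    also have "\<dots> = Sum_any (\<lambda>t. Sum_any (\<lambda>s. Q i s t))"
      by (simp add: Sum_any_scale[OF Q'ev, symmetric]) (simp add: Q_def Q'_def mult.assoc)
    finally show ?thesis unfolding * Q'_def .
  qed
  have Pev: "ev0 (\<lambda>i. P i s)" for s
    unfolding P_def by (intro ev0_scale ev0_YY_left)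
  have P0: "\<exists>S. \<forall>s\<ge>S. \<forall>i. P i s = 0" unfolding P_def by (rule exI[of _ Sb]) (simp add: Sb)
  note Psw = Sum_any_swap[OF P0 Pev]
  have Psum: "Sum_any (\<lambda>s. Sum_any (\<lambda>i. P i s)) = Sum_any (\<lambda>s. fock_scale (of_int p gchoose s) (B_lhs l m (p + n - int s) a (alpha k (int s) b) v))"
    unfolding B_lhs_def P_def
    by (simp add: Sum_any_scale[OF ev0_scale[OF ev0_YY_left], symmetric] algebra_simps)
  have evQ: "ev0 (\<lambda>i. Sum_any (\<lambda>s. fock_scale ((of_int m gchoose i) * (of_int (p - int t) gchoose s)) (G t (i + s))))" for t
  proof -
    obtain N where N: "\<And>r. r \<ge> N \<Longrightarrow> G t r = 0" using G[of t] unfolding ev0_def by blast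
    then show ?thesis unfolding ev0_def by (intro exI[of _ N]) simp
  qed
  have Q0: "\<exists>S. \<forall>t\<ge>S. \<forall>i. Sum_any (\<lambda>s. Q i s t) = 0"
    by (rule exI[of _ Ta]) (simp add: Q_def Ta)
  have Qev': "ev0 (\<lambda>i. Sum_any (\<lambda>s. Q i s t))" for t
    unfolding Qsum by (rule ev0_scale[OF evQ])
  note Qsw = Sum_any_swap[OF Q0 Qev']
  have Qsum2: "Sum_any (\<lambda>t. Sum_any (\<lambda>i. Sum_any (\<lambda>s. Q i s t))) =
     Sum_any (\<lambda>t. fock_scale (of_int p gchoose t) (B_lhs l (m + p - int t) n (alpha k (int t) a) b v))"
    unfolding Qsum Sum_any_scale[OF evQ] Sum_any_Vandermonde[OF G] B_lhs_def
    by (simp add: G_def algebra_simps)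
  have e0: "ev0 (\<lambda>i. fock_scale (of_int m gchoose i) (Y (Y a (l + int i) b) (m + n - int i) w))" for w
    by (intro ev0_scale ev0_YY_left)
  have "alpha k p (B_lhs l m n a b v) =
     Sum_any (\<lambda>i. fock_scale (of_int m gchoose i) (alpha k p (Y (Y a (l + int i) b) (m + n - int i) v)))"
    unfolding B_lhs_def by (simp add: Sum_any_flin[OF flin_alpha e0] flin_scale[OF flin_alpha])
  also have "\<dots> = Sum_any (\<lambda>i. fock_scale (of_int m gchoose i) (Y (Y a (l + int i) b) (m + n - int i) (alpha k p v))
     + Sum_any (\<lambda>s. P i s) + Sum_any (\<lambda>t. Sum_any (\<lambda>s. Q i s t)))"
  proof (intro Sum_any.cong)
    fix i
    have "ev0 (\<lambda>s. fock_scale (of_int p gchoose s) (Y (Y a (l + int i) (alpha k (int s) b)) (p + m + n - int i - int s) v))"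
      by (rule ev0_scale, rule ev0_cong0[OF ev0_alpha[of k b]]) simp
    from Sum_any_scale[OF this, of "of_int m gchoose i"]
    have "fock_scale (of_int m gchoose i) (Sum_any (\<lambda>s. fock_scale (of_int p gchoose s) (Y (Y a (l + int i) (alpha k (int s) b)) (p + m + n - int i - int s) v)))
      = Sum_any (\<lambda>s. P i s)" by (simp add: P_def)
    then show "fock_scale (of_int m gchoose i) (alpha k p (Y (Y a (l + int i) b) (m + n - int i) v)) =
      fock_scale (of_int m gchoose i) (Y (Y a (l + int i) b) (m + n - int i) (alpha k p v))
       + Sum_any (\<lambda>s. P i s) + Sum_any (\<lambda>t. Sum_any (\<lambda>s. Q i s t))"
      by (simp only: trm fs.scale_right_distrib inner)
  qed
  also have "\<dots> = B_lhs l m n a b (alpha k p v) + Sum_any (\<lambda>s. Sum_any (\<lambda>i. P i s)) + Sum_any (\<lambda>t. Sum_any (\<lambda>i. Sum_any (\<lambda>s. Q i s t)))"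
    by (simp only: Sum_any_add ev0_add e0 Psw Qsw) (simp add: B_lhs_def)
  finally show ?thesis unfolding Psum Qsum2 .
qed

text \<open>The correction terms have the same shape as for \<open>B_lhs\<close>, so the deviation
  \<open>B_err\<close> commutes with a boson up to deviations in which one letter has been
  contracted.\<close>

lemma alpha_B_rhs:
  assumes a: "a \<in> St" and b: "b \<in> St" and v: "v \<in> St"
  shows "alpha k p (B_rhs l m n a b v) = B_rhs l m n a b (alpha k p v)
    + Sum_any (\<lambda>s. fock_scale (of_int p gchoose s) (B_rhs l m (p + n - int s) a (alpha k (int s) b) v))
    + Sum_any (\<lambda>t. fock_scale (of_int p gchoose t) (B_rhs l (m + p - int t) n (alpha k (int t) a) b v))"
proof -
  obtain Sb where Sb: "\<And>s. s \<ge> Sb \<Longrightarrow> alpha k (int s) b = 0" using ev0_alpha[of k b] unfolding ev0_def by blast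
  obtain Ta where Ta: "\<And>s. s \<ge> Ta \<Longrightarrow> alpha k (int s) a = 0" using ev0_alpha[of k a] unfolding ev0_def by blast
  define c where "c i = ((-1) ^ i * (of_int l gchoose i) :: complex)" for i
  define \<epsilon> where "\<epsilon> = ((-1) powi l :: complex)"
  define t where "t m n a b v i = fock_scale (c i) (Y a (l + m - int i) (Y b (n + int i) v) - fock_scale \<epsilon> (Y b (l + n - int i) (Y a (m + int i) v)))" for m n a b v i
  have B: "B_rhs l m n a b v = Sum_any (t m n a b v)" for m n a b v
    by (simp add: B_rhs_def t_def c_def \<epsilon>_def)
  have et: "ev0 (t m n a b v)" for m n a b v
    unfolding t_def by (intro ev0_scale ev0_diff ev0_YY)
  define P where "P i s = fock_scale (of_int p gchoose s) (t m (p + n - int s) a (alpha k (int s) b) v i)" for i s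
  define Q where "Q i s = fock_scale (of_int p gchoose s) (t (m + p - int s) n (alpha k (int s) a) b v i)" for i s
  have sw: "\<exists>S. \<forall>s\<ge>S. \<forall>i. P i s = 0" "\<exists>S. \<forall>s\<ge>S. \<forall>i. Q i s = 0" "ev0 (\<lambda>i. P i s)" "ev0 (\<lambda>i. Q i s)" for s
  proof -
    show "\<exists>S. \<forall>s\<ge>S. \<forall>i. P i s = 0" by (rule exI[of _ Sb]) (simp add: P_def t_def Sb)
    show "\<exists>S. \<forall>s\<ge>S. \<forall>i. Q i s = 0" by (rule exI[of _ Ta]) (simp add: Q_def t_def Ta)
    show "ev0 (\<lambda>i. P i s)" "ev0 (\<lambda>i. Q i s)" unfolding P_def Q_def by (intro ev0_scale et)+
  qed
  have step: "alpha k p (t m n a b v i) = t m n a b (alpha k p v) i + Sum_any (\<lambda>s. P i s) + Sum_any (\<lambda>s. Q i s)" for i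
  proof -
    have YY: "alpha k p (Y x q (Y y r v)) = Y x q (Y y r (alpha k p v))
      + Sum_any (\<lambda>s. fock_scale (of_int p gchoose s) (Y x q (Y (alpha k (int s) y) (p + r - int s) v)))
      + Sum_any (\<lambda>s. fock_scale (of_int p gchoose s) (Y (alpha k (int s) x) (p + q - int s) (Y y r v)))"
      if "x \<in> St" "y \<in> St" for x y q r
      using that v
      by (simp add: Y_comm Y_states_on Y_add Sum_any_flin[OF flin_Y ev0_scale[OF ev0_Y_alpha_left]] Y_scale)
    have e: "ev0 (\<lambda>s. fock_scale (of_int p gchoose s) (Y x q (Y (alpha k (int s) y) (r s) v)))"
      "ev0 (\<lambda>s. fock_scale (of_int p gchoose s) (Y (alpha k (int s) x) (r s) (Y y q v)))" for x y q r
      by (rule ev0_scale, rule ev0_cong0[OF ev0_alpha[of k y]], simp)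
        (rule ev0_scale, rule ev0_cong0[OF ev0_alpha[of k x]], simp)
    have P: "Sum_any (\<lambda>s. P i s) = fock_scale (c i)
       (Sum_any (\<lambda>s. fock_scale (of_int p gchoose s) (Y a (l + m - int i) (Y (alpha k (int s) b) (p + (n + int i) - int s) v)))
        - fock_scale \<epsilon> (Sum_any (\<lambda>s. fock_scale (of_int p gchoose s) (Y (alpha k (int s) b) (p + (l + n - int i) - int s) (Y a (m + int i) v)))))"
    proof -
      have r: "p + n - int s + int i = p + (n + int i) - int s" "l + (p + n - int s) - int i = p + (l + n - int i) - int s" for s
        by simp_all
      show ?thesis unfolding P_def t_def r by (rule Sum_any_lincomb[OF e])
    qed
    have Q: "Sum_any (\<lambda>s. Q i s) = fock_scale (c i)
       (Sum_any (\<lambda>s. fock_scale (of_int p gchoose s) (Y (alpha k (int s) a) (p + (l + m - int i) - int s) (Y b (n + int i) v)))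
        - fock_scale \<epsilon> (Sum_any (\<lambda>s. fock_scale (of_int p gchoose s) (Y b (l + n - int i) (Y (alpha k (int s) a) (p + (m + int i) - int s) v)))))"
    proof -
      have r: "m + p - int s + int i = p + (m + int i) - int s" "l + (m + p - int s) - int i = p + (l + m - int i) - int s" for s
        by simp_all
      show ?thesis unfolding Q_def t_def r by (rule Sum_any_lincomb[OF e(2,1)])
    qed
    show ?thesis
      unfolding P Q
      by (simp add: t_def flin_scale[OF flin_alpha] flin_diff[OF flin_alpha] YY a b
          fs.scale_right_distrib fs.scale_right_diff_distrib)
  qed
  have "alpha k p (B_rhs l m n a b v) = Sum_any (\<lambda>i. t m n a b (alpha k p v) i + Sum_any (\<lambda>s. P i s) + Sum_any (\<lambda>s. Q i s))"
    by (simp add: B Sum_any_flin[OF flin_alpha et] step)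
  also have "\<dots> = B_rhs l m n a b (alpha k p v) + Sum_any (\<lambda>s. Sum_any (\<lambda>i. P i s)) + Sum_any (\<lambda>s. Sum_any (\<lambda>i. Q i s))"
    using Sum_any_swap[OF sw(1,3)] Sum_any_swap[OF sw(2,4)] by (simp add: Sum_any_add ev0_add et B)
  finally show ?thesis
    by (simp add: P_def Q_def B Sum_any_scale et)
qed

text \<open>In generating functions both sides are multiplied by the difference of the two
  variables; in components this is Pascal's rule, for the upper index \<open>m\<close> on the left
  and \<open>l\<close> on the right.\<close>

lemma B_err_Suc_l: "B_err (l + 1) m n a b v = B_err l (m + 1) n a b v - B_err l m (n + 1) a b v"
proof -
  define F where "F i = Y (Y a (l + int i) b) (m + n + 1 - int i) v" for i
  have F: "ev0 F" unfolding F_def by (rule ev0_YY_left)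
  have pascal: "((x + 1 gchoose Suc i) :: complex) = (x gchoose i) + (x gchoose Suc i)" for x i
    by (rule gbinomial_Suc_Suc)
  have L: "B_lhs l (m + 1) n a b v - B_lhs l m (n + 1) a b v = B_lhs (l + 1) m n a b v"
  proof -
    have 1: "B_lhs l (m + 1) n a b v = F 0 + Sum_any (\<lambda>i. fock_scale (of_int m + 1 gchoose Suc i) (F (Suc i)))"
      unfolding B_lhs_def
      by (subst Sum_any_Suc) (auto intro!: ev0_scale ev0_YY_left simp: F_def algebra_simps)
    have 2: "B_lhs l m (n + 1) a b v = F 0 + Sum_any (\<lambda>i. fock_scale (of_int m gchoose Suc i) (F (Suc i)))"
      unfolding B_lhs_def
      by (subst Sum_any_Suc) (auto intro!: ev0_scale ev0_YY_left simp: F_def algebra_simps)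
    have F1: "ev0 (\<lambda>i. F (Suc i))" using ev0_shift[OF F, of 1] by simp
    have "B_lhs l (m + 1) n a b v - B_lhs l m (n + 1) a b v = Sum_any (\<lambda>i. fock_scale (of_int m gchoose i) (F (Suc i)))"
      unfolding 1 2 pascal by (simp add: Sum_any_add ev0_scale F1 fs.scale_left_distrib)
    also have "\<dots> = B_lhs (l + 1) m n a b v"
      unfolding B_lhs_def F_def by (simp add: algebra_simps)
    finally show ?thesis .
  qed
  define \<epsilon> where "\<epsilon> = ((-1) powi l :: complex)"
  define H where "H i = Y a (l + m + 1 - int i) (Y b (n + int i) v) + fock_scale \<epsilon> (Y b (l + n + 1 - int i) (Y a (m + int i) v))" for i
  have H: "ev0 H" unfolding H_def by (intro ev0_add ev0_scale ev0_YY)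
  have H1: "ev0 (\<lambda>i. H (Suc i))" using ev0_shift[OF H, of 1] by simp
  have R: "B_rhs l (m + 1) n a b v - B_rhs l m (n + 1) a b v = B_rhs (l + 1) m n a b v"
  proof -
    define c where "c i = ((-1) ^ i * (of_int l gchoose i) :: complex)" for i
    have eps: "(-1) powi (l + 1) = - \<epsilon>" by (simp add: \<epsilon>_def power_int_add)
    define t where "t m n i = fock_scale (c i) (Y a (l + m - int i) (Y b (n + int i) v) - fock_scale \<epsilon> (Y b (l + n - int i) (Y a (m + int i) v)))" for m n i
    have B: "B_rhs l m n a b v = Sum_any (t m n)" for m n
      by (simp add: B_rhs_def t_def c_def \<epsilon>_def)
    have et: "ev0 (t m n)" for m n
      unfolding t_def by (intro ev0_scale ev0_diff ev0_YY)
    have "t (m + 1) n i - t m (n + 1) i = fock_scale (c i) (H i) - fock_scale (c i) (H (Suc i))" for i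
      by (simp add: t_def H_def fs.scale_right_distrib fs.scale_right_diff_distrib algebra_simps)
    then have "B_rhs l (m + 1) n a b v - B_rhs l m (n + 1) a b v = Sum_any (\<lambda>i. fock_scale (c i) (H i) - fock_scale (c i) (H (Suc i)))"
      by (simp add: B Sum_any_diff[symmetric] et)
    also have "\<dots> = H 0 + Sum_any (\<lambda>i. fock_scale (c (Suc i)) (H (Suc i))) - Sum_any (\<lambda>i. fock_scale (c i) (H (Suc i)))"
      by (subst Sum_any_diff[OF ev0_scale[OF H] ev0_scale[OF H1]], subst Sum_any_Suc[OF ev0_scale[OF H]]) (simp add: c_def)
    also have "\<dots> = H 0 + Sum_any (\<lambda>i. fock_scale ((-1) ^ Suc i * (of_int l + 1 gchoose Suc i)) (H (Suc i)))"
    proof -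
      have "fock_scale ((-1) ^ Suc i * (of_int l + 1 gchoose Suc i)) h = fock_scale (c (Suc i)) h - fock_scale (c i) h" for i h
        unfolding pascal c_def by (simp flip: fs.scale_left_diff_distrib add: algebra_simps)
      then show ?thesis by (simp only: Sum_any_diff ev0_scale H1 add_diff_eq)
    qed
    also have "\<dots> = Sum_any (\<lambda>i. fock_scale ((-1) ^ i * (of_int l + 1 gchoose i)) (H i))"
      using Sum_any_Suc[OF ev0_scale[OF H], of "\<lambda>i. (-1) ^ i * (of_int l + 1 gchoose i)"] by simp
    also have "\<dots> = B_rhs (l + 1) m n a b v"
      unfolding B_rhs_def eps H_def by (simp add: algebra_simps)
    finally show ?thesis .
  qed
  show ?thesis unfolding B_err_def using L R by (simp add: algebra_simps)
qed

lemma B_rhs_0: "B_rhs 0 m n a b v = Y a m (Y b n v) - Y b n (Y a m v)"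
proof -
  have "B_rhs 0 m n a b v = Sum_any (\<lambda>i::nat. if i = 0 then Y a m (Y b n v) - Y b n (Y a m v) else 0)"
    unfolding B_rhs_def by (intro Sum_any.cong) (auto simp: gbinomial_0_left)
  then show ?thesis by simp
qed

text \<open>Both sides of the identity are compatible with translation. Once the deviation is a
  scalar, this becomes a linear recursion between its values at neighbouring \<open>m\<close> and
  \<open>n\<close>.\<close>

lemma T_B_err_0:
  assumes "a \<in> St" "b \<in> St" "v \<in> St"
  shows "T (B_err 0 m n a b v) = B_err 0 m n a b (T v)
     - fock_scale (of_int m) (B_err 0 (m - 1) n a b v) - fock_scale (of_int n) (B_err 0 m (n - 1) a b v)"
proof -
  define F where "F i = Y (Y a (int i) b) (m + n - 1 - int i) v" for i
  have F: "ev0 F" unfolding F_def using ev0_YY_left[of a 0] by simp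
  have ev: "ev0 (\<lambda>i. fock_scale (c i) (Y (Y a (int i) b) (r i) w))" for c r w
    using ev0_YY_left[of a 0] by (intro ev0_scale) simp
  have id: "(of_int m gchoose i) * of_int (m + n - int i) = of_int m * (of_int (m - 1) gchoose i) + of_int n * (of_int m gchoose i :: complex)" for i
    using gbinomial_absorb_comp[of "of_int m :: complex" i] by (simp add: algebra_simps)
  have "T (B_lhs 0 m n a b v) = B_lhs 0 m n a b (T v) - Sum_any (\<lambda>i. fock_scale ((of_int m gchoose i) * of_int (m + n - int i)) (F i))"
    unfolding B_lhs_def using assms
    by (simp add: Sum_any_flin[OF flin_T ev] flin_scale[OF flin_T] T_Y Y_states_on fs.scale_right_diff_distrib
        Sum_any_diff ev F_def) (simp add: algebra_simps)
  also have "Sum_any (\<lambda>i. fock_scale ((of_int m gchoose i) * of_int (m + n - int i)) (F i)) =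
      fock_scale (of_int m) (B_lhs 0 (m - 1) n a b v) + fock_scale (of_int n) (B_lhs 0 m (n - 1) a b v)"
    unfolding id B_lhs_def
    by (simp add: fs.scale_left_distrib Sum_any_add ev0_scale F flip: Sum_any_scale[OF ev])
      (simp add: F_def algebra_simps)
  finally have L: "T (B_lhs 0 m n a b v) = B_lhs 0 m n a b (T v)
     - fock_scale (of_int m) (B_lhs 0 (m - 1) n a b v) - fock_scale (of_int n) (B_lhs 0 m (n - 1) a b v)"
    by (simp add: algebra_simps)
  have R: "T (B_rhs 0 m n a b v) = B_rhs 0 m n a b (T v)
     - fock_scale (of_int m) (B_rhs 0 (m - 1) n a b v) - fock_scale (of_int n) (B_rhs 0 m (n - 1) a b v)"
    unfolding B_rhs_0 using assms
    by (simp add: T_Y Y_states_on flin_diff[OF flin_T] Y_diff Y_scale algebra_simps)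
  show ?thesis
    unfolding B_err_def flin_diff[OF flin_T] L R by (simp add: algebra_simps)
qed

text \<open>Induction on the number of letters makes the deviation commute with all bosons, hence a
  scalar \<open>e l m n\<close>. The vacuum and skew-symmetry give boundary values,
  \<open>Trel\<close> spreads them over the plane \<open>l = 0\<close>, and \<open>rec\<close>
  carries the vanishing to all \<open>l\<close>.\<close>

lemma B_err_mon:
  assumes "set_mset M \<subseteq> UNIV \<times> {1..}" "set_mset N \<subseteq> UNIV \<times> {1..}" "v \<in> St"
  shows "B_err l m n (mon M) (mon N) v = 0"
  using assms
proof (induction "size M + size N" arbitrary: M N l m n v rule: less_induct)
  case less
  let ?a = "mon M" and ?b = "mon N"
  define K where "K = int (wt M + wt N)"
  have a: "?a \<in> St" and b: "?b \<in> St" using less.prems by auto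
  have IHa: "B_err l m n (alpha k (int j) ?a) ?b v = 0" if "v \<in> St" for l m n k j v
  proof (cases "(k, j) \<in># M")
    case True
    then have "size (M - {#(k, j)#}) + size N < size M + size N" by (simp add: size_Diff1_less)
    moreover have "set_mset (M - {#(k, j)#}) \<subseteq> UNIV \<times> {1..}" using less.prems(1) by (auto dest: in_diffD)
    ultimately show ?thesis using less.hyps[of "M - {#(k, j)#}" N v l m n] that less.prems(2)
      by (simp add: alpha_mon' flin_scale[OF flin_B_err_a])
  next
    case False
    then show ?thesis by (simp add: alpha_mon' not_in_iff flin_zero[OF flin_B_err_a])
  qed
  have IHb: "B_err l m n ?a (alpha k (int j) ?b) v = 0" if "v \<in> St" for l m n k j v
  proof (cases "(k, j) \<in># N")
    case True
    then have "size M + size (N - {#(k, j)#}) < size M + size N" by (simp add: size_Diff1_less)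
    moreover have "set_mset (N - {#(k, j)#}) \<subseteq> UNIV \<times> {1..}" using less.prems(2) by (auto dest: in_diffD)
    ultimately show ?thesis using less.hyps[of M "N - {#(k, j)#}" v l m n] that less.prems(1)
      by (simp add: alpha_mon' flin_scale[OF flin_B_err_b])
  next
    case False
    then show ?thesis by (simp add: alpha_mon' not_in_iff flin_zero[OF flin_B_err_b])
  qed
  have comm: "B_err l m n ?a ?b (alpha k p v) = alpha k p (B_err l m n ?a ?b v)" if "v \<in> St" for l m n k p v
  proof -
    have "B_lhs l m n (alpha k (int j) ?a) ?b v = B_rhs l m n (alpha k (int j) ?a) ?b v"
      "B_lhs l m n ?a (alpha k (int j) ?b) v = B_rhs l m n ?a (alpha k (int j) ?b) v" for l m n j
      using IHa[OF that, of l m n k j] IHb[OF that, of l m n k j] by (simp_all add: B_err_def)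
    then show ?thesis
      unfolding B_err_def flin_diff[OF flin_alpha] alpha_B_lhs[OF a b that] alpha_B_rhs[OF a b that] by simp
  qed
  define e where "e l m n = vcoeff (B_err l m n ?a ?b 1)" for l m n
  have E: "B_err l m n ?a ?b v = fock_scale (e l m n) v" if "v \<in> St" for l m n v
    unfolding e_def
    by (rule fock_op_scalar[OF flin_B_err B_err_states_on[OF a b] comm that])
  have E1: "B_err l m n ?a ?b 1 = fock_scale (e l m n) 1" for l m n by (rule E) simp
  have wt0: "e l m n = 0" if "l + m + n + 2 \<noteq> K" for l m n
  proof -
    have o: "1 \<in> graded {0}" by simp
    have "B_err l m n ?a ?b 1 \<in> graded {K - l - m - n - 2}"
      using B_err_graded[OF mon_graded mon_graded o, of l m n M N] by (simp add: K_def)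
    then show ?thesis using that by (auto simp: e_def supp_in_def in_keys_iff)
  qed
  have rec: "e (l + 1) m n = e l (m + 1) n - e l m (n + 1)" for l m n
    unfolding e_def B_err_Suc_l by (simp add: lookup_minus)
  \<comment> \<open>\<open>T\<close> kills the vacuum and the deviation is a scalar, so only the two
    shifted terms of the translated relation are left.\<close>
  have Trel: "of_int m * e 0 (m - 1) n + of_int n * e 0 m (n - 1) = 0" for m n
  proof -
    have "T (B_err 0 m n ?a ?b 1) = 0" unfolding E1 by (simp add: flin_scale[OF flin_T])
    then have "fock_scale (of_int m * e 0 (m - 1) n + of_int n * e 0 m (n - 1)) 1 = 0"
      using T_B_err_0[OF a b one_states_on, of m n]
        \<open>T (B_err 0 m n ?a ?b 1) = 0\<close>
      by (simp add: E1 flin_zero[OF flin_B_err] fs.scale_left_distrib neg_eq_iff_add_eq_0)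
    then show ?thesis by (metis fs.scale_eq_0_iff one_neq_zero)
  qed
  have V1: "e l 0 n = 0" if "n \<ge> -1" for l n
  proof -
    have "B_lhs l 0 n ?a ?b 1 = Sum_any (\<lambda>i::nat. if i = 0 then Y (Y ?a l ?b) n 1 else 0)"
      unfolding B_lhs_def by (intro Sum_any.cong) (auto simp: gbinomial_0_left)
    then have L: "B_lhs l 0 n ?a ?b 1 = Y (Y ?a l ?b) n 1" by simp
    have "B_rhs l 0 n ?a ?b 1 = Sum_any (\<lambda>i::nat. if i = 0 then Y ?a l (Y ?b n 1) else 0)"
      unfolding B_rhs_def using that by (intro Sum_any.cong) (auto simp: Y_vac)
    then have R: "B_rhs l 0 n ?a ?b 1 = Y ?a l (Y ?b n 1)" by simp
    have "B_err l 0 n ?a ?b 1 = 0"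
      using that a b unfolding B_err_def L R by (cases "n = -1") (auto simp: Y_vac Y_states_on)
    then show ?thesis by (simp add: e_def)
  qed
  \<comment> \<open>For \<open>l < 0\<close> and \<open>n < -1\<close> the weight condition would
    need a negative \<open>K\<close>.\<close>
  have V1': "e l 0 n = 0" if "l < 0" for l n
    using V1[of n l] wt0[of l 0 n] that by (cases "n \<ge> -1") (auto simp: K_def)
  have triv: "M = {#} \<and> N = {#}" if "K \<le> 0"
    using that less.prems by (cases M; cases N) (auto simp: K_def)
  \<comment> \<open>\<open>Trel\<close> at \<open>(m + 1, n + 1)\<close> determines the next value
    except for \<open>n = -1\<close>, where its coefficient vanishes; there the creation property
    evaluates both sides.\<close>
  have V2: "e 0 (int m) n = 0" for m n
  proof (induction m arbitrary: n)
    case 0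
    show ?case
    proof (cases "n \<ge> -1 \<or> n + 2 \<noteq> K")
      case True
      then show ?thesis using V1[of n 0] wt0[of 0 0 n] by auto
    next
      case False
      then have MN: "M = {#} \<and> N = {#}" by (intro triv) auto
      have "B_lhs 0 0 n 1 1 1 = Sum_any (\<lambda>i::nat. 0)"
        unfolding B_lhs_def by (intro Sum_any.cong) (auto simp: Y_one gbinomial_0_left)
      moreover have "B_rhs 0 0 n 1 1 1 = Sum_any (\<lambda>i::nat. 0)"
        unfolding B_rhs_def by (intro Sum_any.cong) (auto simp: Y_one gbinomial_0_left)
      ultimately show ?thesis using MN by (simp add: e_def B_err_def)
    qed
  next
    case (Suc m)
    show ?case
    proof (cases "n = -1")
      case False
      then have "of_int (n + 1) \<noteq> (0 :: complex)" by (subst of_int_eq_0_iff) simp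
      then show ?thesis using Trel[of "int (Suc m)" "n + 1"] Suc[of "n + 1"] by simp
    next
      case True
      have "B_lhs 0 (int (Suc m)) (-1) ?a ?b 1 = Sum_any (\<lambda>i. if i = Suc m then Y ?a (int (Suc m)) ?b else 0)"
        unfolding B_lhs_def
      proof (intro Sum_any.cong)
        fix i
        consider "i < Suc m" | "i = Suc m" | "i > Suc m" by linarith
        then show "fock_scale (of_int (int (Suc m)) gchoose i) (Y (Y ?a (0 + int i) ?b) (int (Suc m) + - 1 - int i) 1) =
          (if i = Suc m then Y ?a (int (Suc m)) ?b else 0)"
        proof cases
          case 1
          then show ?thesis by (simp add: Y_vac)
        next
          case 2
          have "(of_int (int (Suc m)) gchoose Suc m :: complex) = of_nat (Suc m choose Suc m)"
            by (simp only: of_int_of_nat_eq binomial_gbinomial)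
          then show ?thesis using 2 a b by (simp add: Y_vac Y_states_on)
        next
          case 3
          have "(of_int (int (Suc m)) gchoose i :: complex) = of_nat (Suc m choose i)"
            by (simp only: of_int_of_nat_eq binomial_gbinomial)
          then show ?thesis using 3 by (simp add: binomial_eq_0)
        qed
      qed
      then have L: "B_lhs 0 (int (Suc m)) (-1) ?a ?b 1 = Y ?a (int (Suc m)) ?b" by simp
      have "B_rhs 0 (int (Suc m)) (-1) ?a ?b 1 = Sum_any (\<lambda>i::nat. if i = 0 then Y ?a (int (Suc m)) ?b else 0)"
        unfolding B_rhs_def using b by (intro Sum_any.cong) (auto simp: Y_vac gbinomial_0_left)
      then have "B_err 0 (int (Suc m)) (-1) ?a ?b 1 = 0" using L by (simp add: B_err_def)
      then show ?thesis using True by (simp add: e_def)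
    qed
  qed
  \<comment> \<open>Negative \<open>m\<close> need a fresh start at -1, since the coefficient of
    \<open>e 0 (m - 1) n\<close> in \<open>Trel\<close> vanishes at \<open>m = 0\<close>. In the
    only critical weight the claim is skew-symmetry of vacuum components.\<close>
  have V4: "e 0 (-1) n = 0" for n
  proof (cases "n = K - 1")
    case False
    then show ?thesis by (intro wt0) auto
  next
    case n: True
    show ?thesis
    proof (cases "K \<le> 0")
      case True
      then have "M = {#} \<and> N = {#}" by (rule triv)
      moreover have "n = -1" using calculation n by (simp add: K_def)
      ultimately show ?thesis
        by (simp add: e_def B_err_def B_lhs_def B_rhs_def Y_one)
    next
      case False
      define k where "k = nat (K - 1)"
      have k: "K = int k + 1" "n = int k" "wt M + wt N = Suc k" using False n by (auto simp: k_def K_def)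
      have "B_lhs 0 (-1) n ?a ?b 1 = Sum_any (\<lambda>i. if i = k then fock_scale ((-1) ^ k) (Y ?a (int k) ?b) else 0)"
        unfolding B_lhs_def
      proof (intro Sum_any.cong)
        fix i
        consider "i < k" | "i = k" | "i > k" by linarith
        then show "fock_scale (of_int (- 1) gchoose i) (Y (Y ?a (0 + int i) ?b) (- 1 + n - int i) 1) =
          (if i = k then fock_scale ((-1) ^ k) (Y ?a (int k) ?b) else 0)"
        proof cases
          case 1
          then show ?thesis by (simp add: Y_vac k)
        next
          case 2
          have "(of_int (- 1) gchoose k :: complex) = (-1) ^ k"
            using gchoose_neg_nat[of 1 k] by simp
          then show ?thesis using 2 a b by (simp add: Y_vac k Y_states_on)
        next
          case 3
          have "Y ?a (int i) ?b \<in> graded {int (wt M) + int (wt N) - int i - 1}"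
            by (rule Y_graded1[OF mon_graded mon_graded])
          then have "Y ?a (int i) ?b = 0"
            by (rule graded_neg[rotated]) (use 3 k(3) in auto)
          then show ?thesis using 3 by simp
        qed
      qed
      then have L: "B_lhs 0 (-1) n ?a ?b 1 = fock_scale ((-1) ^ k) (Y ?a (int k) ?b)" by simp
      have "B_rhs 0 (-1) n ?a ?b 1 = Sum_any (\<lambda>i::nat. if i = 0 then - Y ?b (int k) ?a else 0)"
        unfolding B_rhs_def using a by (intro Sum_any.cong) (auto simp: Y_vac gbinomial_0_left k(2))
      then have "B_err 0 (-1) n ?a ?b 1 = fock_scale ((-1) ^ k) (Y ?a (int k) ?b) + Y ?b (int k) ?a"
        by (simp add: B_err_def L)
      moreover have "vcoeff (Y ?a (int k) ?b) = (-1) ^ Suc k * vcoeff (Y ?b (int k) ?a)"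
        using vcoeff_skew[OF less.prems(1,2)] by (simp add: k(3))
      ultimately show ?thesis
        by (simp add: e_def lookup_add flip: power_add power_mult_distrib)
    qed
  qed
  have V5: "e 0 (- int (Suc m)) n = 0" for m n
  proof (induction m arbitrary: n)
    case 0
    then show ?case using V4 by simp
  next
    case (Suc m)
    have "of_int (- int (Suc m)) * e 0 (- int (Suc m) - 1) n = 0"
      using Trel[of "- int (Suc m)" n] Suc[of "n - 1"] by (simp only: mult_zero_right add_0_right)
    moreover have "of_int (- int (Suc m)) \<noteq> (0 :: complex)" by (subst of_int_eq_0_iff) simp
    moreover have "- int (Suc m) - 1 = - int (Suc (Suc m))" by simp
    ultimately show ?case by (metis mult_eq_0_iff)
  qed
  have V0: "e 0 m n = 0" for m n
  proof (cases "m \<ge> 0")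
    case True
    then show ?thesis using V2[of "nat m" n] by simp
  next
    case False
    then have "m = - int (Suc (nat (- m - 1)))" by simp
    then show ?thesis using V5[of "nat (- m - 1)" n] by simp
  qed
  have Vpos: "e (int l) m n = 0" for l m n
  proof (induction l arbitrary: m n)
    case (Suc l)
    then show ?case using rec[of "int l" m n] by (simp add: add.commute)
  qed (simp add: V0)
  have Vneg: "e (- int l) m n = 0" for l m n
  proof (induction l arbitrary: m n)
    case (Suc l)
    \<comment> \<open>Vanishing one level above makes the scalars equal at \<open>(m + 1, n)\<close>
      and \<open>(m, n + 1)\<close>; sliding to \<open>m = 0\<close> reaches the values known from
      \<open>V1'\<close>.\<close>
    have s: "e (- int (Suc l)) (m + 1) n = e (- int (Suc l)) m (n + 1)" for m n
      using rec[of "- int (Suc l)" m n] Suc[of m n] by simp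
    have "e (- int (Suc l)) (int t) n = e (- int (Suc l)) 0 (n + int t)" for t n
    proof (induction t arbitrary: n)
      case (Suc t)
      show ?case using s[of "int t" n] Suc[of "n + 1"] by (simp add: algebra_simps)
    qed simp
    moreover have "e (- int (Suc l)) (- int t) n = e (- int (Suc l)) 0 (n - int t)" for t n
    proof (induction t arbitrary: n)
      case (Suc t)
      show ?case using s[of "- int (Suc t)" "n - 1"] Suc[of "n - 1"] by (simp add: algebra_simps)
    qed simp
    ultimately show ?case
      using V1'[of "- int (Suc l)"] by (cases m rule: int_cases2) auto
  qed (simp add: V0)
  have "e l m n = 0"
    using Vpos[of "nat l"] Vneg[of "nat (- l)"] by (cases "l \<ge> 0") auto
  then show ?case using E[OF less.prems(3), of l m n] by simp
qed

lemma borcherds: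
  assumes "a \<in> St" "b \<in> St" "v \<in> St"
  shows "B_lhs l m n a b v = B_rhs l m n a b v"
proof -
  have "B_err l m n a b v = 0"
  proof (rule supp_in_eqI[OF flin_B_err_a fp.module_hom_zero assms(1)[unfolded states_on_def]])
    fix M :: "(nat \<times> nat) multiset" assume M: "M \<in> {M. set_mset M \<subseteq> UNIV \<times> {1..}}"
    show "B_err l m n (mon M) b v = 0"
      by (rule supp_in_eqI[OF flin_B_err_b fp.module_hom_zero assms(2)[unfolded states_on_def]])
        (use M assms(3) in \<open>auto simp: B_err_mon\<close>)
  qed
  then show ?thesis by (simp add: B_err_def)
qed

section \<open>Virasoro relations for subspaces closed under all products\<close>

section \<open>Vertex operator algebras inside the Fock space\<close>

definition sub_voa :: "fock set \<Rightarrow> fock \<Rightarrow> fock voa" where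
  "sub_voa U \<omega> = \<lparr>states = U, vscale = fock_scale, nprod = Y, vac = 1, conf = \<omega>\<rparr>"

lemma sub_voa_simps [simp]:
  "states (sub_voa U \<omega>) = U" "vscale (sub_voa U \<omega>) = fock_scale" "nprod (sub_voa U \<omega>) = Y"
  "vac (sub_voa U \<omega>) = 1" "conf (sub_voa U \<omega>) = \<omega>"
  by (simp_all add: sub_voa_def)

lemma vertex_algebra_sub_voa:
  assumes "U \<subseteq> St" "fs.subspace U" "1 \<in> U" "\<And>a n b. a \<in> U \<Longrightarrow> b \<in> U \<Longrightarrow> Y a n b \<in> U"
  shows "vertex_algebra (sub_voa U \<omega>)"
  unfolding vertex_algebra_def sub_voa_simps linear_on_states_def
proof (intro conjI ballI allI impI)
  show "Sum_any (\<lambda>i. fock_scale (of_int m gchoose i) (Y (Y a (l + int i) b) (m + n - int i) c)) =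
        Sum_any (\<lambda>i. fock_scale ((-1) ^ i * (of_int l gchoose i))
          (Y a (l + m - int i) (Y b (n + int i) c)
            - fock_scale ((-1) powi l) (Y b (l + n - int i) (Y a (m + int i) c))))"
    if "a \<in> U" "b \<in> U" "c \<in> U" for a b c l m n
    using borcherds[of a b c l m n] that assms(1) unfolding B_lhs_def B_rhs_def by auto
qed (use assms in \<open>auto simp: fs.vector_space_axioms Y_trunc Y_one Y_vac Y_add Y_scale Y_add_left Y_scale_left\<close>)

text \<open>The Borcherds identity with the vacuum as second vector, at \<open>l = -2\<close> and
  \<open>m = 0\<close>.\<close>

lemma Y_T:
  assumes "a \<in> St" "v \<in> St"
  shows "Y (T a) n v = fock_scale (- of_int n) (Y a (n - 1) v)"
proof -
  have "B_lhs (-2) 0 n a 1 v = Sum_any (\<lambda>i::nat. if i = 0 then Y (T a) n v else 0)"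
    unfolding B_lhs_def by (intro Sum_any.cong) (auto simp: gbinomial_0_left T_def)
  then have L: "B_lhs (-2) 0 n a 1 v = Y (T a) n v" by simp
  have g: "(-1) ^ i * (of_int (-2) gchoose i :: complex) = of_nat (Suc i)" for i
    using gchoose_neg_nat[of 2 i] by (simp add: binomial_symmetric[of i "Suc i"] flip: power_add power_mult_distrib mult.assoc)
  \<comment> \<open>The vacuum acts only in mode -1, so the first product survives at
    \<open>i = - n - 1\<close> and the second at \<open>i = n - 1\<close>; these indices are never
    both natural numbers.\<close>
  have "B_rhs (-2) 0 n a 1 v = Sum_any (\<lambda>i. (if int i = - n - 1 then fock_scale (- of_int n) (Y a (n - 1) v) else 0)
      - (if int i = n - 1 then fock_scale (of_int n) (Y a (n - 1) v) else 0))"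
    unfolding B_rhs_def
  proof (intro Sum_any.cong)
    fix i
    have "- 2 + 0 - int i = n - 1" "of_nat (Suc i) = (- of_int n :: complex)" if "int i = - n - 1"
      using that by simp (metis add.commute diff_add_cancel of_int_minus of_int_of_nat_eq of_nat_Suc that)
    moreover have "0 + int i = n - 1" "of_nat (Suc i) = (of_int n :: complex)" if "int i = n - 1"
      using that by simp (metis add.commute diff_add_cancel of_int_of_nat_eq of_nat_Suc that)
    ultimately show "fock_scale ((-1) ^ i * (of_int (-2) gchoose i)) (Y a (- 2 + 0 - int i) (Y 1 (n + int i) v) -
         fock_scale ((-1) powi - 2) (Y 1 (- 2 + n - int i) (Y a (0 + int i) v))) =
      (if int i = - n - 1 then fock_scale (- of_int n) (Y a (n - 1) v) else 0)
      - (if int i = n - 1 then fock_scale (of_int n) (Y a (n - 1) v) else 0)"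
      unfolding g by (auto simp: Y_one power_int_def)
  qed
  also have "\<dots> = fock_scale (- of_int n) (Y a (n - 1) v)"
    by (subst Sum_any_diff) (auto simp: Sum_any_delta_int ev0_def intro!: exI[of _ "nat \<bar>n\<bar> + 1"])
  finally have "B_rhs (-2) 0 n a 1 v = fock_scale (- of_int n) (Y a (n - 1) v)" .
  then show ?thesis using borcherds[OF assms(1) one_states_on assms(2), of "-2" 0 n] L by simp
qed

lemma Y_commutator:
  assumes "a \<in> St" "b \<in> St" "v \<in> St"
  shows "Y a m (Y b n v) - Y b n (Y a m v) = Sum_any (\<lambda>i. fock_scale (of_int m gchoose i) (Y (Y a (int i) b) (m + n - int i) v))"
  using borcherds[OF assms, of 0 m n] by (simp add: B_rhs_0 B_lhs_def)

lemma finite_multisets_wt: "finite {M. set_mset M \<subseteq> {1..r} \<times> {1..} \<and> wt M = d}"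
proof -
  have "set_mset M \<subseteq> {1..r} \<times> {1..d} \<and> size M \<le> d" if "set_mset M \<subseteq> {1..r} \<times> {1..} \<and> wt M = d" for M
  proof -
    have "size M \<le> wt M \<and> (\<forall>x \<in># M. snd x \<le> wt M)"
      using that by (induction M arbitrary: d) fastforce+
    then show ?thesis using that by fastforce
  qed
  then have "{M. set_mset M \<subseteq> {1..r} \<times> {1..} \<and> wt M = d} \<subseteq> mset ` {xs. set xs \<subseteq> {1..r} \<times> {1..d} \<and> length xs \<le> d}"
    by (smt (verit) ex_mset image_eqI mem_Collect_eq set_mset_mset size_mset subsetI)
  moreover have "finite {xs. set xs \<subseteq> {1..r} \<times> {1..d} \<and> length xs \<le> d}"
    by (intro finite_lists_length_le) auto
  ultimately show ?thesis using finite_surj by blast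
qed

lemma subspace_finite_basis:
  assumes "fs.subspace U" "U \<subseteq> fs.span S" "finite S"
  obtains B where "finite B" "B \<subseteq> U" "U = fs.span B" "fs.independent B"
proof -
  obtain B where B: "B \<subseteq> U" "fs.independent B" "U \<subseteq> fs.span B" by (metis fs.basis_exists)
  then have "finite B" using fs.independent_span_bound[of S B] assms(2,3) by auto
  moreover have "U = fs.span B" using B assms(1) by (simp add: fs.span_minimal subset_antisym)
  ultimately show thesis using that B by blast
qed

lemma states_on_graded: "states_on I \<inter> graded {int d} = supp_in {M. set_mset M \<subseteq> I \<times> {1..} \<and> wt M = d}"
  by (auto simp: states_on_def supp_in_def)

text \<open>Multiplication by the weight; \<open>omega3_1\<close> identifies it with L(0). Its
  eigenspaces link \<open>graded\<close> with the abstract weight spaces.\<close>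

definition euler :: "fock \<Rightarrow> fock" where
  "euler = lin (\<lambda>M. fock_scale (of_nat (wt M)) (mon M))"

lemma flin_euler: "flin euler"
  unfolding euler_def by (rule flin_lin)

lemma lookup_euler: "Poly_Mapping.lookup (euler p) M = of_nat (wt M) * Poly_Mapping.lookup p M"
proof -
  have "(\<Sum>K \<in> Poly_Mapping.keys p. Poly_Mapping.lookup p K * of_nat (wt K) * (if K = M then 1 else 0)) =
    (\<Sum>K \<in> Poly_Mapping.keys p. if K = M then of_nat (wt K) * Poly_Mapping.lookup p K else 0)"
    by (intro sum.cong) auto
  then show ?thesis
    by (simp add: euler_def lin_def lookup_sum lookup_single when_def in_keys_iff)
qed

lemma graded_iff_euler: "p \<in> graded {d} \<longleftrightarrow> euler p = fock_scale (of_int d) p"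
proof -
  have "p \<in> graded {d} \<longleftrightarrow> (\<forall>M. (of_nat (wt M) - of_int d) * Poly_Mapping.lookup p M = 0)"
  proof -
    have "(of_nat (wt M) - of_int d :: complex) = of_int (int (wt M) - d)" for M by simp
    then have "(of_nat (wt M) - of_int d :: complex) = 0 \<longleftrightarrow> int (wt M) = d" for M
      by (metis (no_types, lifting) diff_eq_diff_eq eq_iff_diff_eq_0 of_int_eq_0_iff)
    then show ?thesis by (auto simp: supp_in_def in_keys_iff)
  qed
  also have "\<dots> \<longleftrightarrow> euler p = fock_scale (of_int d) p"
    by (simp add: poly_mapping_eq_iff fun_eq_iff lookup_euler algebra_simps)
  finally show ?thesis .
qed

text \<open>By the commutator formula the Virasoro relations depend only on the products of the
  conformal vector with itself, and those of negative weight vanish. The locale serves the orbifold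
  and the commutant alike.\<close>

locale fock_voa =
  fixes U :: "fock set" and r :: nat and \<omega> :: fock and c :: complex
  assumes U_states: "U \<subseteq> states_on {1..r}" and U_subspace: "fs.subspace U" and U_one: "1 \<in> U"
    and U_closed: "\<And>a n b. a \<in> U \<Longrightarrow> b \<in> U \<Longrightarrow> Y a n b \<in> U"
    and omega_in: "\<omega> \<in> U"
    and omega_0: "\<And>v. v \<in> U \<Longrightarrow> Y \<omega> 0 v = T v"
    and omega_1: "\<And>v. v \<in> U \<Longrightarrow> Y \<omega> 1 v = euler v"
    and omega_omega: "\<omega> \<in> graded {2}" "Y \<omega> 2 \<omega> = 0" "Y \<omega> 3 \<omega> = fock_scale (c / 2) 1"
    and U_homogeneous: "U \<subseteq> fs.span (\<Union>d. U \<inter> graded {int d})"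
begin

lemma U_St: "U \<subseteq> St"
  using U_states states_on_St by blast

lemma weight_space_eq: "weight_space (sub_voa U \<omega>) d = U \<inter> graded {d}"
  using graded_iff_euler by (auto simp: weight_space_def Lop_def omega_1)

lemma virasoro:
  assumes v: "v \<in> U"
  shows "Lop (sub_voa U \<omega>) m (Lop (sub_voa U \<omega>) n v) - Lop (sub_voa U \<omega>) n (Lop (sub_voa U \<omega>) m v) =
        fock_scale (of_int (m - n)) (Lop (sub_voa U \<omega>) (m + n) v) +
        fock_scale (if m + n = 0 then (of_int m ^ 3 - of_int m) / 12 * c else 0) v"
proof -
  have w: "\<omega> \<in> St" and v': "v \<in> St" using omega_in v U_St by auto
  define t where "t i = fock_scale (of_int (m + 1) gchoose i) (Y (Y \<omega> (int i) \<omega>) (m + 1 + (n + 1) - int i) v)" for i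
  \<comment> \<open>The product has weight \<open>3 - i\<close>, negative from \<open>i = 4\<close>
    on.\<close>
  have high: "t i = 0" if "i \<ge> 4" for i
  proof -
    have "Y \<omega> (int i) \<omega> \<in> graded {2 + 2 - int i - 1}" by (rule Y_graded1[OF omega_omega(1,1)])
    then have "Y \<omega> (int i) \<omega> = 0" by (rule graded_neg[rotated]) (use that in auto)
    then show ?thesis by (simp add: t_def)
  qed
  have w1: "Y \<omega> 1 \<omega> = fock_scale 2 \<omega>" using omega_omega(1) graded_iff_euler[of \<omega> 2] by (simp add: omega_1 omega_in)
  have idx: "m + 1 + (n + 1) - int 0 = m + n + 2" "m + 1 + (n + 1) - int 1 = m + n + 1" "m + n + 2 - 1 = m + n + 1"
    by simp_all
  have t0: "t 0 = fock_scale (- of_int (m + n + 2)) (Y \<omega> (m + n + 1) v)"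
    unfolding t_def idx(1) using Y_T[OF w v', of "m + n + 2"]
    by (simp only: idx(3) gbinomial_0 fs.scale_one of_nat_0 omega_0[OF omega_in])
  have t1: "t 1 = fock_scale (of_int (m + 1) * 2) (Y \<omega> (m + n + 1) v)"
    unfolding t_def idx(2) unfolding of_nat_1 w1 Y_scale_left by (simp only: gbinomial_1 fs.scale_scale)
  have t2: "t 2 = 0" by (simp add: t_def omega_omega)
  \<comment> \<open>Source of the central term: c / 2 times the cubic binomial (m^3 - m) /
    6.\<close>
  have g: "(of_int (m + 1) gchoose 3 :: complex) = (of_int m ^ 3 - of_int m) / 6"
    by (simp add: gbinomial_prod_rev numeral_3_eq_3 atLeast0_lessThan_Suc) (simp add: algebra_simps power_Suc)
  have "t 3 = fock_scale ((of_int m ^ 3 - of_int m) / 6) (fock_scale (c / 2) (Y 1 (m + 1 + (n + 1) - 3) v))"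
    unfolding t_def of_nat_numeral omega_omega(3) g by (simp only: Y_scale_left)
  then have t3: "t 3 = fock_scale (if m + n = 0 then (of_int m ^ 3 - of_int m) / 12 * c else 0) v"
    by (cases "m + n = 0") (simp_all add: Y_one)
  have "Y \<omega> (m + 1) (Y \<omega> (n + 1) v) - Y \<omega> (n + 1) (Y \<omega> (m + 1) v) = Sum_any t"
    unfolding t_def by (rule Y_commutator[OF w w v'])
  also have "\<dots> = sum t {..<4}" by (rule Sum_any_upto) (rule high)
  also have "\<dots> = t 0 + t 1 + t 2 + t 3" by (simp add: eval_nat_numeral)
  also have "t 0 + t 1 + t 2 = fock_scale (- of_int (m + n + 2) + of_int (m + 1) * 2) (Y \<omega> (m + n + 1) v)"
    unfolding t0 t1 t2 fs.scale_left_distrib by simp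
  also have "- of_int (m + n + 2) + of_int (m + 1) * 2 = (of_int (m - n) :: complex)" by simp
  finally show ?thesis by (simp add: Lop_def t3)
qed

lemma voa: "vertex_operator_algebra (sub_voa U \<omega>)"
  unfolding vertex_operator_algebra_def sub_voa_simps weight_space_eq
proof (intro conjI allI ballI)
  have negative: "U \<inter> graded {d} = {0}" if "d < 0" for d
  proof -
    have "x = 0" if x: "x \<in> graded {d}" for x
      by (rule graded_neg[OF _ x]) (use \<open>d < 0\<close> in simp)
    then show ?thesis
      using fs.subspace_0[OF U_subspace] fs.subspace_0[OF subspace_supp_in] by blast
  qed
  show "vertex_algebra (sub_voa U \<omega>)"
    by (rule vertex_algebra_sub_voa[OF U_St U_subspace U_one U_closed])
  show "\<omega> \<in> U" by (rule omega_in)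
  show "\<exists>c. \<forall>m n. \<forall>v\<in>U. Lop (sub_voa U \<omega>) m (Lop (sub_voa U \<omega>) n v) - Lop (sub_voa U \<omega>) n (Lop (sub_voa U \<omega>) m v) =
    fock_scale (of_int (m - n)) (Lop (sub_voa U \<omega>) (m + n) v) +
    fock_scale (if m + n = 0 then (of_int m ^ 3 - of_int m) / 12 * c else 0) v"
    using virasoro by blast
  show "Y (Lop (sub_voa U \<omega>) (- 1) a) n b = fock_scale (- of_int n) (Y a (n - 1) b)" if "a \<in> U" "b \<in> U" for a n b
    using that U_St Y_T[of a b n] by (auto simp: Lop_def omega_0)
  have "U \<subseteq> fs.span (\<Union>d. U \<inter> graded {d})"
  proof (rule order_trans[OF U_homogeneous], rule fs.span_mono, rule UN_least)
    show "U \<inter> graded {int d} \<subseteq> (\<Union>d. U \<inter> graded {d})" for d :: nat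
      by (rule UN_upper) (rule UNIV_I)
  qed
  moreover have "fs.span (\<Union>d. U \<inter> graded {d}) \<subseteq> U"
    by (intro fs.span_minimal U_subspace) auto
  ultimately show "U = fs.span (\<Union>d. U \<inter> graded {d})" by blast
  show "\<exists>B. finite B \<and> U \<inter> graded {d} = fs.span B" for d
  proof (cases "d < 0")
    case True
    then show ?thesis using negative by (intro exI[of _ "{}"]) simp
  next
    case False
    have "U \<inter> graded {d} \<subseteq> fs.span (mon ` {M. set_mset M \<subseteq> {1..r} \<times> {1..} \<and> wt M = nat d})"
    proof -
      have "d = int (nat d)" using False by simp
      then have "U \<inter> graded {d} \<subseteq> states_on {1..r} \<inter> graded {int (nat d)}" using U_states by auto
      then show ?thesis unfolding states_on_graded by (subst supp_in_span[symmetric])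
    qed
    from subspace_finite_basis[OF fs.subspace_inter[OF U_subspace subspace_supp_in] this finite_imageI[OF finite_multisets_wt]]
    obtain B where "finite B" "U \<inter> graded {d} = fs.span B" by metis
    then show ?thesis by blast
  qed
  show "\<exists>N. \<forall>d<N. U \<inter> graded {d} = {0}"
    by (intro exI[of _ 0] allI impI negative)
qed

end

section \<open>Bosons attached to coefficient vectors, and the conformal vector of rank
  three\<close>

section \<open>Linear combinations of the Heisenberg fields\<close>

definition bos :: "(nat \<Rightarrow> complex) \<Rightarrow> int \<Rightarrow> fock \<Rightarrow> fock" where
  "bos c n p = (\<Sum>i \<in> {1..3}. fock_scale (c i) (alpha i n p))"

definition bvar :: "(nat \<Rightarrow> complex) \<Rightarrow> nat \<Rightarrow> fock" where
  "bvar c n = (\<Sum>i \<in> {1..3}. fock_scale (c i) (var i n))"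

text \<open>Bilinear rather than Hermitian, as it governs commutators; an eigenvector of the shift
  therefore pairs with the one of inverse eigenvalue.\<close>

definition pair :: "(nat \<Rightarrow> complex) \<Rightarrow> (nat \<Rightarrow> complex) \<Rightarrow> complex" where
  "pair c d = (\<Sum>i \<in> {1..3}. c i * d i)"

lemma flin_bos: "flin (bos c n)"
proof -
  have "flin (\<lambda>p. \<Sum>i \<in> {1..3}. fock_scale (c i) (alpha i n p))"
    by (intro fp.module_hom_sum flin_comp[OF flin_const_scale] flin_alpha) (auto intro: fs.module_axioms)
  then show ?thesis unfolding bos_def .
qed

lemma bos_neg: "n \<ge> 1 \<Longrightarrow> bos c (- int n) p = bvar c n * p"
  by (simp add: bos_def bvar_def alpha_neg sum_distrib_right)

lemma bos_0 [simp]: "bos c 0 p = 0"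
  by (simp add: bos_def)

lemma bos_one: "n \<ge> 0 \<Longrightarrow> bos c n 1 = 0"
  by (simp add: bos_def alpha_one)

lemma bos_derivation: "n \<ge> 0 \<Longrightarrow> bos c n (p * q) = bos c n p * q + p * bos c n q"
  by (simp add: bos_def alpha_derivation sum_distrib_left sum_distrib_right fs.scale_right_distrib sum.distrib)

lemma bos_commutator:
  "bos c m (bos d n p) = bos d n (bos c m p) + (if m + n = 0 then fock_scale (of_int m * pair c d) p else 0)"
proof -
  have "bos c m (bos d n p) = (\<Sum>i \<in> {1..3}. \<Sum>k \<in> {1..3}. fock_scale (c i * d k) (alpha i m (alpha k n p)))"
    by (simp add: bos_def flin_sum[OF flin_alpha] flin_scale[OF flin_alpha] fs.scale_sum_right)
  also have "\<dots> = (\<Sum>i \<in> {1..3}. \<Sum>k \<in> {1..3}. fock_scale (c i * d k) (alpha k n (alpha i m p))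
     + (if i = k then if m + n = 0 then fock_scale (of_int m * (c i * d i)) p else 0 else 0))"
  proof (intro sum.cong refl)
    fix i k
    show "fock_scale (c i * d k) (alpha i m (alpha k n p)) = fock_scale (c i * d k) (alpha k n (alpha i m p))
     + (if i = k then if m + n = 0 then fock_scale (of_int m * (c i * d i)) p else 0 else 0)"
      by (subst alpha_commutator) (auto simp: fs.scale_right_distrib mult_ac)
  qed
  also have "\<dots> = (\<Sum>i \<in> {1..3}. \<Sum>k \<in> {1..3}. fock_scale (c i * d k) (alpha k n (alpha i m p)))
     + (\<Sum>i \<in> {1..3}. \<Sum>k \<in> {1..3}. if i = k then if m + n = 0 then fock_scale (of_int m * (c i * d i)) p else 0 else 0)"
    by (simp only: sum.distrib)
  also have "(\<Sum>i \<in> {1..3}. \<Sum>k \<in> {1..3}. fock_scale (c i * d k) (alpha k n (alpha i m p))) = bos d n (bos c m p)"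
    by (subst sum.swap)
      (simp add: bos_def flin_sum[OF flin_alpha] flin_scale[OF flin_alpha] fs.scale_sum_right mult.commute)
  also have "(\<Sum>i \<in> {1..3}. \<Sum>k \<in> {1..3}. if i = k then if m + n = 0 then fock_scale (of_int m * (c i * d i)) p else 0 else 0)
     = (\<Sum>i \<in> {1..3}. if m + n = 0 then fock_scale (of_int m * (c i * d i)) p else 0)"
    by (intro sum.cong) (auto simp: sum.delta')
  also have "\<dots> = (if m + n = 0 then fock_scale (of_int m * pair c d) p else 0)"
    by (simp add: pair_def sum_distrib_left fs.scale_sum_left)
  finally show ?thesis .
qed

lemma bos_states: "p \<in> states_on {1..3} \<Longrightarrow> bos c n p \<in> states_on {1..3}"
  unfolding bos_def
  by (intro fs.subspace_sum fs.subspace_scale subspace_states_on alpha_states_on) auto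

lemma bos_St: "p \<in> St \<Longrightarrow> bos c n p \<in> St"
  unfolding bos_def
  by (intro fs.subspace_sum fs.subspace_scale subspace_states_on alpha_states_on) auto

lemma bos_graded: "p \<in> graded {d} \<Longrightarrow> bos c n p \<in> graded {d - n}"
  unfolding bos_def
  by (intro fs.subspace_sum fs.subspace_scale subspace_supp_in alpha_graded[where A = "{d}"]) auto

lemma ev0_bos: "ev0 (\<lambda>j. bos c (int j) v)"
proof -
  have "ev0 (\<lambda>j. \<Sum>i \<in> A. fock_scale (c i) (alpha i (int j) v))" if "finite A" for A
    using that by (induction A) (auto intro!: ev0_zero ev0_add ev0_scale ev0_alpha)
  then show ?thesis by (simp add: bos_def)
qed

lemma bos_T:
  assumes "a \<in> St"
  shows "bos c p (T a) = T (bos c p a) + fock_scale (of_int p) (bos c (p - 1) a)"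
  using assms
  by (simp add: bos_def alpha_T flin_sum[OF flin_T] flin_scale[OF flin_T] fs.scale_right_distrib sum.distrib
      fs.scale_sum_right mult.commute)

lemma ev0_Y_bos: "ev0 (\<lambda>j. Y a (n j) (bos c (int j) v))"
  by (rule ev0_cong0[OF ev0_bos[of c v]]) simp

lemma Sum_any_sum:
  assumes "finite A" "\<And>i. i \<in> A \<Longrightarrow> ev0 (f i)"
  shows "Sum_any (\<lambda>j. \<Sum>i \<in> A. f i j :: fock) = (\<Sum>i \<in> A. Sum_any (f i)) \<and> ev0 (\<lambda>j. \<Sum>i \<in> A. f i j)"
  using assms by (induction A) (auto simp: Sum_any_add ev0_add ev0_zero)

lemma Y_bos_comm:
  assumes "a \<in> St" "v \<in> St"
  shows "bos c p (Y a n v) = Y a n (bos c p v) +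
     Sum_any (\<lambda>j. fock_scale (of_int p gchoose j) (Y (bos c (int j) a) (p + n - int j) v))"
proof -
  have e: "ev0 (\<lambda>j. fock_scale (c i) (fock_scale (of_int p gchoose j) (Y (alpha i (int j) a) (p + n - int j) v)))" for i
    by (intro ev0_scale ev0_Y_alpha_left)
  have "bos c p (Y a n v) = Y a n (bos c p v) + (\<Sum>i \<in> {1..3}. Sum_any (\<lambda>j. fock_scale (c i) (fock_scale (of_int p gchoose j) (Y (alpha i (int j) a) (p + n - int j) v))))"
    using assms by (simp add: bos_def Y_comm flin_sum[OF flin_Y] Y_scale fs.scale_right_distrib sum.distrib
        Sum_any_scale[OF ev0_scale[OF ev0_Y_alpha_left], symmetric])
  also have "(\<Sum>i \<in> {1..3}. Sum_any (\<lambda>j. fock_scale (c i) (fock_scale (of_int p gchoose j) (Y (alpha i (int j) a) (p + n - int j) v))))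
     = Sum_any (\<lambda>j. \<Sum>i \<in> {1..3}. fock_scale (c i) (fock_scale (of_int p gchoose j) (Y (alpha i (int j) a) (p + n - int j) v)))"
    by (rule conjunct1[OF Sum_any_sum[OF finite_atLeastAtMost e], symmetric])
  also have "\<dots> = Sum_any (\<lambda>j. fock_scale (of_int p gchoose j) (Y (bos c (int j) a) (p + n - int j) v))"
    by (simp add: bos_def flin_sum[OF flin_Y_left] Y_scale_left fs.scale_sum_right mult.commute)
  finally show ?thesis .
qed

lemma Y_bos_iterate:
  assumes "a \<in> St" "v \<in> St" "m \<ge> 1"
  shows "Y (bos c (- int m) a) n v = Sum_any (\<lambda>j. fock_scale (of_nat ((m + j - 1) choose j))
      (bos c (- int m - int j) (Y a (n + int j) v)
        - fock_scale ((-1) ^ m) (Y a (n - int m - int j) (bos c (int j) v))))"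
proof -
  define t where "t i j = fock_scale (c i) (fock_scale (of_nat ((m + j - 1) choose j))
      (alpha i (- int m - int j) (Y a (n + int j) v) - fock_scale ((-1) ^ m) (Y a (n - int m - int j) (alpha i (int j) v))))" for i j
  have e: "ev0 (t i)" for i unfolding t_def by (rule ev0_scale[OF ev0_Y_iterate])
  have "Y (bos c (- int m) a) n v = (\<Sum>i \<in> {1..3}. Sum_any (t i))"
    using assms by (simp add: bos_def flin_sum[OF flin_Y_left] Y_scale_left Y_iterate t_def Sum_any_scale[OF ev0_Y_iterate, symmetric])
  also have "\<dots> = Sum_any (\<lambda>j. \<Sum>i \<in> {1..3}. t i j)"
    using Sum_any_sum[of "{1..3}" t] e by simp
  also have "(\<lambda>j. \<Sum>i \<in> {1..3}. t i j) = (\<lambda>j. fock_scale (of_nat ((m + j - 1) choose j))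
      (bos c (- int m - int j) (Y a (n + int j) v)
        - fock_scale ((-1) ^ m) (Y a (n - int m - int j) (bos c (int j) v))))"
    by (intro ext) (simp add: t_def bos_def flin_sum[OF flin_Y] Y_scale fs.scale_right_diff_distrib
        fs.scale_sum_right sum_subtractf mult_ac)
  finally show ?thesis .
qed

lemma Y_bos_1: "v \<in> St \<Longrightarrow> Y (bos c (-1) 1) n v = bos c n v"
proof -
  assume v: "v \<in> St"
  have "Y (bos c (- int 1) 1) n v = Sum_any (\<lambda>j. (if int j = - n - 1 then bos c n v else 0) + (if int j = n then bos c n v else 0))"
    unfolding Y_bos_iterate[OF one_states_on v order_refl]
    by (intro Sum_any.cong) (auto simp: Y_one flin_zero[OF flin_bos])
  also have "\<dots> = bos c n v"
    by (subst Sum_any_add) (auto simp: Sum_any_delta_int ev0_def intro!: exI[of _ "nat \<bar>n\<bar> + 1"])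
  finally show ?thesis by simp
qed

abbreviation omega3 :: fock where "omega3 \<equiv> conf (heisenberg 3)"

lemma states_heisenberg: "states (heisenberg r) = states_on {1..r}"
  by (auto simp: heisenberg_def states_on_def supp_in_def)

lemma heisenberg_simps [simp]:
  "vscale (heisenberg r) = fock_scale" "nprod (heisenberg r) = Y" "vac (heisenberg r) = 1"
  by (simp_all add: heisenberg_def)

lemma omega3_eq: "omega3 = fock_scale (1 / 2) (\<Sum>i \<in> {1..3}. alpha i (-1) (alpha i (-1) 1))"
  by (simp add: heisenberg_def)

lemma omega3_states: "omega3 \<in> states_on {1..3}"
  unfolding omega3_eq
  by (intro fs.subspace_sum fs.subspace_scale subspace_states_on alpha_states_on one_states_on) auto

lemma omega3_graded: "omega3 \<in> graded {2}"
proof -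
  have "1 \<in> graded {0}" by simp
  then have "alpha i (-1) (alpha i (-1) 1) \<in> graded {2}" for i
    by (intro alpha_graded[where A = "{1}"] alpha_graded[where A = "{0}"]) auto
  then show ?thesis unfolding omega3_eq
    by (intro fs.subspace_sum fs.subspace_scale subspace_supp_in)
qed

text \<open>Either factor of a summand can be contracted, which cancels the factor 1/2.\<close>

lemma alpha_omega3: "k \<in> {1..3} \<Longrightarrow> p \<ge> 0 \<Longrightarrow> alpha k p omega3 = (if p = 1 then alpha k (-1) 1 else 0)"
proof -
  assume k: "k \<in> {1..3}" and p: "p \<ge> 0"
  have "alpha k p (alpha i (-1) (alpha i (-1) 1)) = (if i = k then if p = 1 then fock_scale 2 (alpha i (-1) 1) else 0 else 0)" for i
  proof -
    have "alpha k p (alpha i (-1) (alpha i (-1) 1)) = alpha i (-1) (alpha k p (alpha i (-1) 1)) + (if k = i \<and> p - 1 = 0 then alpha i (-1) 1 else 0)"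
      by (subst alpha_commutator) auto
    also have "alpha k p (alpha i (-1) 1) = (if k = i \<and> p - 1 = 0 then 1 else 0)"
      by (subst alpha_commutator) (auto simp: alpha_one p flin_zero[OF flin_alpha])
    finally show ?thesis using fs.scale_left_distrib[of 1 1 "alpha k (-1) 1"]
      by (auto simp: flin_zero[OF flin_alpha])
  qed
  then show ?thesis using k unfolding omega3_eq
    by (simp add: flin_scale[OF flin_alpha] flin_sum[OF flin_alpha])
qed

text \<open>The conformal vector contracts with a boson only at \<open>j = 1\<close>, so the
  commutator formula has a single term: bosons are primary of weight 1.\<close>

lemma bos_omega3:
  assumes "v \<in> St"
  shows "bos c p (Y omega3 n v) = Y omega3 n (bos c p v) + fock_scale (of_int p) (bos c (p + n - 1) v)"
proof -
  have w: "omega3 \<in> St" using omega3_states by (rule states_on_St)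
  have "bos c (int j) omega3 = (if j = 1 then bos c (-1) 1 else 0)" for j
    unfolding bos_def by (auto simp: alpha_omega3)
  then have "Sum_any (\<lambda>j. fock_scale (of_int p gchoose j) (Y (bos c (int j) omega3) (p + n - int j) v)) =
    Sum_any (\<lambda>j::nat. if j = 1 then fock_scale (of_int p) (bos c (p + n - 1) v) else 0)"
    by (intro Sum_any.cong) (auto simp: Y_bos_1 assms)
  then show ?thesis unfolding Y_bos_comm[OF w assms] by simp
qed

section \<open>The eigenbasis of the cyclic shift and the change of coordinates\<close>

section \<open>The diagonalised Heisenberg fields\<close>

definition zeta :: complex where "zeta = cis (2 * pi / 3)"

lemma zeta_cubed: "zeta ^ 3 = 1"
  by (simp add: zeta_def DeMoivre)

lemma zeta_neq_1: "zeta \<noteq> 1"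
proof
  assume "zeta = 1"
  then have "Re zeta = 1" by simp
  then show False by (simp add: zeta_def cos_120)
qed

lemma zeta_sum: "1 + zeta + zeta ^ 2 = 0"
proof -
  have "(zeta - 1) * (1 + zeta + zeta ^ 2) = zeta ^ 3 - 1"
    by (simp add: algebra_simps power2_eq_square power3_eq_cube)
  then show ?thesis using zeta_cubed zeta_neq_1 by simp
qed

lemma zeta_pow_eq_1_iff: "zeta ^ n = 1 \<longleftrightarrow> 3 dvd n"
proof -
  have "zeta ^ n = zeta ^ (n mod 3)"
    by (metis mod_div_mult_eq power_add power_mult mult.commute power_one zeta_cubed mult.right_neutral)
  moreover have "zeta ^ 2 \<noteq> 1"
  proof
    assume "zeta ^ 2 = 1"
    then have "zeta ^ 3 = zeta" by (simp add: power3_eq_cube power2_eq_square)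
    then show False using zeta_cubed zeta_neq_1 by simp
  qed
  moreover have "n mod 3 = 0 \<or> n mod 3 = 1 \<or> n mod 3 = 2" by linarith
  ultimately show ?thesis using zeta_neq_1 by (auto simp: mod_eq_0_iff_dvd[symmetric])
qed

text \<open>
  The coefficients of the eigenvectors of the cyclic shift.  The eigenvectors \<open>1\<close> and \<open>2\<close> are
  isotropic and dual to each other; only \<open>2\<close> carries the normalising factor.
\<close>

definition cf :: "nat \<Rightarrow> nat \<Rightarrow> complex" where
  "cf s i = (if s = 0 then complex_of_real (1 / sqrt 3) else if s = 1 then zeta ^ i else zeta ^ (2 * i) / 3)"

definition dual :: "nat \<Rightarrow> nat" where
  "dual s = (if s = 1 then 2 else if s = 2 then 1 else s)"

lemma dual_simps [simp]: "dual 0 = 0" "dual (Suc 0) = 2" "dual 2 = Suc 0"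
  by (simp_all add: dual_def)

lemma atLeast1_atMost3: "{1..3} = {1, 2, 3 :: nat}"
  by auto

lemma lessThan3: "{..<3} = {0, 1, 2 :: nat}"
  by auto

lemma sqrt3_square: "complex_of_real (sqrt 3) * complex_of_real (sqrt 3) = 3"
  by (simp flip: of_real_mult)

text \<open>Normal forms in the basis 1, zeta, enough to let the simplifier decide the finite tables
  of pairings and eigenvalues.\<close>

lemma zeta_pows: "zeta * zeta * zeta = 1" "zeta ^ 2 = - 1 - zeta" "zeta ^ 3 = 1" "zeta ^ 4 = zeta" "zeta ^ 5 = - 1 - zeta" "zeta ^ 6 = 1"
  "zeta ^ 7 = zeta" "zeta ^ 8 = - 1 - zeta" "zeta ^ 9 = 1" "zeta ^ 12 = 1"
  "zeta ^ Suc (Suc 0) = - 1 - zeta"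
proof -
  show 3: "zeta ^ 3 = 1" by (rule zeta_cubed)
  show "zeta * zeta * zeta = 1" using 3 by (simp add: power3_eq_cube)
  show 2: "zeta ^ 2 = - 1 - zeta" using zeta_sum by (simp add: algebra_simps add_eq_0_iff)
  have "zeta ^ 4 = zeta ^ 3 * zeta ^ 1" "zeta ^ 5 = zeta ^ 3 * zeta ^ 2" "zeta ^ 6 = zeta ^ 3 * zeta ^ 3"
    "zeta ^ 7 = zeta ^ 3 * zeta ^ 3 * zeta ^ 1" "zeta ^ 8 = zeta ^ 3 * zeta ^ 3 * zeta ^ 2" "zeta ^ 9 = zeta ^ 3 * zeta ^ 3 * zeta ^ 3" "zeta ^ 12 = zeta ^ 3 * zeta ^ 3 * zeta ^ 3 * zeta ^ 3"
    by (simp_all only: power_add[symmetric], simp_all)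
  then show "zeta ^ 4 = zeta" "zeta ^ 5 = - 1 - zeta" "zeta ^ 6 = 1" "zeta ^ 7 = zeta" "zeta ^ 8 = - 1 - zeta" "zeta ^ 9 = 1" "zeta ^ 12 = 1"
    by (simp_all add: 2 3)
  show "zeta ^ Suc (Suc 0) = - 1 - zeta" using 2 by (simp only: numeral_2_eq_2)
qed

lemma zeta_sq: "zeta * zeta = - 1 - zeta" "zeta * (zeta * x) = (- 1 - zeta) * x"
  using zeta_pows(2) by (simp_all add: power2_eq_square flip: mult.assoc)

lemma zeta_mult_pow: "zeta ^ m * zeta ^ n = zeta ^ (m + n)"
  by (simp add: power_add)

lemma pair_cf:
  assumes "s < 3" "t < 3"
  shows "pair (cf s) (cf t) = (if t = dual s then 1 else 0)"
proof -
  have "s = 0 \<or> s = 1 \<or> s = 2" "t = 0 \<or> t = 1 \<or> t = 2" using assms by auto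
  then show ?thesis
    unfolding pair_def atLeast1_atMost3
    by (elim disjE) (simp_all add: cf_def dual_def zeta_mult_pow zeta_pows zeta_sq sqrt3_square field_simps del: power_Suc)
qed

text \<open>The matrices of the eigenvectors and of their duals are inverse to each other; this
  direction expresses the original bosons through the eigenbosons.\<close>

lemma cf_complete:
  assumes "i \<in> {1..3}" "k \<in> {1..3}"
  shows "(\<Sum>s<3. cf (dual s) i * cf s k) = (if i = k then 1 else 0)"
proof -
  have "i = 1 \<or> i = 2 \<or> i = 3" "k = 1 \<or> k = 2 \<or> k = 3" using assms by auto
  then show ?thesis
    unfolding lessThan3
    by (elim disjE) (simp_all add: cf_def dual_def zeta_mult_pow zeta_pows zeta_sq sqrt3_square field_simps del: power_Suc)
qed

abbreviation bs :: "nat \<Rightarrow> int \<Rightarrow> fock \<Rightarrow> fock" where "bs s \<equiv> bos (cf s)"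
abbreviation bv :: "nat \<Rightarrow> nat \<Rightarrow> fock" where "bv s \<equiv> bvar (cf s)"

lemma alpha_bs:
  assumes "i \<in> {1..3}"
  shows "alpha i n p = (\<Sum>s<3. fock_scale (cf (dual s) i) (bs s n p))"
proof -
  have "(\<Sum>s<3. fock_scale (cf (dual s) i) (bs s n p)) = (\<Sum>k \<in> {1..3}. fock_scale (\<Sum>s<3. cf (dual s) i * cf s k) (alpha k n p))"
    unfolding bos_def fs.scale_sum_right fs.scale_sum_left by (subst sum.swap) simp
  also have "\<dots> = (\<Sum>k \<in> {1..3}. if i = k then alpha k n p else 0)"
    by (intro sum.cong) (use assms cf_complete in auto)
  finally show ?thesis using assms by simp
qed

subsection \<open>Substitution homomorphisms\<close>

definition subst_hom :: "(nat \<times> nat \<Rightarrow> fock) \<Rightarrow> fock \<Rightarrow> fock" where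
  "subst_hom f = lin (\<lambda>M. \<Prod>x \<in># M. f x)"

lemma flin_subst_hom: "flin (subst_hom f)"
  unfolding subst_hom_def by (rule flin_lin)

lemma subst_hom_mon: "subst_hom f (mon M) = (\<Prod>x \<in># M. f x)"
  by (simp add: subst_hom_def)

lemma subst_hom_one [simp]: "subst_hom f 1 = 1"
  by (simp add: subst_hom_def)

lemma subst_hom_mult: "subst_hom f (p * q) = subst_hom f p * subst_hom f q"
proof -
  have m: "subst_hom f (mon M * q) = subst_hom f (mon M) * subst_hom f q" for M q
  proof (rule fock_eq_on_keysI[where p = q])
    show "flin (\<lambda>q. subst_hom f (mon M * q))" by (intro flin_comp[OF flin_subst_hom] flin_mult)
    show "flin (\<lambda>q. subst_hom f (mon M) * subst_hom f q)" by (intro flin_comp[OF flin_mult] flin_subst_hom)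
  qed (simp add: mon_mult subst_hom_mon)
  show ?thesis
  proof (rule fock_eq_on_keysI[where p = p])
    show "flin (\<lambda>p. subst_hom f (p * q))"
      by (rule flinI) (simp_all add: algebra_simps flin_add[OF flin_subst_hom] flin_scale[OF flin_subst_hom])
    show "flin (\<lambda>p. subst_hom f p * subst_hom f q)"
      by (rule flinI) (simp_all add: algebra_simps flin_add[OF flin_subst_hom] flin_scale[OF flin_subst_hom])
  qed (rule m)
qed

lemma subst_hom_prod: "subst_hom f (\<Prod>x \<in># M. g x) = (\<Prod>x \<in># M. subst_hom f (g x))"
  by (induction M) (simp_all add: subst_hom_mult)

definition Bm :: "(nat \<times> nat) multiset \<Rightarrow> fock" where
  "Bm M = (\<Prod>x \<in># M. bv (fst x) (snd x))"

text \<open>The first component is now the charge 0, 1, 2 of an eigenboson, not the number 1, 2, 3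
  of a tensor factor; the same type of multisets carries both meanings.\<close>

definition letters :: "(nat \<times> nat) multiset set" where
  "letters = {M. set_mset M \<subseteq> {..<3} \<times> {1..}}"

lemma letters_diff: "M \<in> letters \<Longrightarrow> M - N \<in> letters"
  unfolding letters_def by (auto dest!: in_diffD)

definition theta :: "fock \<Rightarrow> fock" where
  "theta = subst_hom (\<lambda>x. bv (fst x) (snd x))"

text \<open>The inverse substitution, with the coefficients of \<open>cf_complete\<close>: it reads
  off coordinates with respect to the eigenmonomials \<open>Bm\<close>.\<close>

definition theta_inv :: "fock \<Rightarrow> fock" where
  "theta_inv = subst_hom (\<lambda>x. \<Sum>s<3. fock_scale (cf (dual s) (fst x)) (var s (snd x)))"

lemma flin_theta: "flin theta" and flin_theta_inv: "flin theta_inv"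
  by (simp_all add: theta_def theta_inv_def flin_subst_hom)

lemma theta_mon: "theta (mon M) = Bm M"
  by (simp add: theta_def Bm_def subst_hom_mon)

lemma Bm_simps: "Bm {#} = 1" "Bm (add_mset x M) = bv (fst x) (snd x) * Bm M" "Bm (M + N) = Bm M * Bm N"
  by (simp_all add: Bm_def)

lemma theta_mult: "theta (p * q) = theta p * theta q"
  by (simp add: theta_def subst_hom_mult)

lemma theta_inv_Bm:
  assumes "M \<in> letters"
  shows "theta_inv (Bm M) = mon M"
proof -
  have "theta_inv (bv s n) = var s n" if "s < 3" for s n
  proof -
    have "theta_inv (bv s n) = (\<Sum>i \<in> {1..3}. fock_scale (cf s i) (\<Sum>t<3. fock_scale (cf (dual t) i) (var t n)))"
      by (simp add: bvar_def flin_sum[OF flin_theta_inv] flin_scale[OF flin_theta_inv])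
        (simp add: theta_inv_def subst_hom_mon)
    also have "\<dots> = (\<Sum>t<3. fock_scale (pair (cf s) (cf (dual t))) (var t n))"
      unfolding pair_def fs.scale_sum_right fs.scale_sum_left by (subst sum.swap) simp
    also have "\<dots> = (\<Sum>t<3. if t = s then var t n else 0)"
    proof (intro sum.cong refl)
      fix t :: nat assume "t \<in> {..<3}"
      then have "t < 3" "dual t < 3" "dual t = dual s \<longleftrightarrow> t = s" using that by (auto simp: dual_def)
      then show "fock_scale (pair (cf s) (cf (dual t))) (var t n) = (if t = s then var t n else 0)"
        using that by (simp add: pair_cf)
    qed
    finally show ?thesis using that by simp
  qed
  then have "theta_inv (Bm M) = (\<Prod>x \<in># M. var (fst x) (snd x))"
    using assms unfolding Bm_def theta_inv_def subst_hom_prod letters_def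
    by (intro arg_cong[of _ _ prod_mset] image_mset_cong) auto
  also have "\<dots> = mon M" by (induction M) (simp_all add: mon_mult)
  finally show ?thesis .
qed

lemma theta_inv_theta: "p \<in> supp_in letters \<Longrightarrow> theta_inv (theta p) = p"
  by (rule supp_in_eqI[OF flin_comp[OF flin_theta_inv flin_theta] flin_ident, where A = letters])
    (simp_all add: theta_mon theta_inv_Bm)

lemma theta_theta_inv:
  assumes "p \<in> states_on {1..3}"
  shows "theta (theta_inv p) = p"
proof (rule supp_in_eqI[OF flin_comp[OF flin_theta flin_theta_inv] flin_ident assms[unfolded states_on_def]])
  fix M :: "(nat \<times> nat) multiset" assume M: "M \<in> {M. set_mset M \<subseteq> {1..3} \<times> {1..}}"
  have "theta (\<Sum>s<3. fock_scale (cf (dual s) i) (var s n)) = var i n" if "i \<in> {1..3}" "n \<ge> 1" for i n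
  proof -
    have "theta (\<Sum>s<3. fock_scale (cf (dual s) i) (var s n)) = (\<Sum>s<3. fock_scale (cf (dual s) i) (bs s (- int n) 1))"
      using that by (simp add: flin_sum[OF flin_theta] flin_scale[OF flin_theta] theta_mon Bm_def bos_neg)
    also have "\<dots> = alpha i (- int n) 1" using alpha_bs[OF that(1)] by simp
    finally show ?thesis using that by (simp add: alpha_neg)
  qed
  then have "theta (theta_inv (mon M)) = (\<Prod>x \<in># M. var (fst x) (snd x))"
    using M unfolding theta_inv_def subst_hom_mon unfolding theta_def subst_hom_prod
    by (intro arg_cong[of _ _ prod_mset] image_mset_cong) auto
  also have "\<dots> = mon M" by (induction M) (simp_all add: mon_mult)
  finally show "theta (theta_inv (mon M)) = mon M" .
qed

lemma Bm_states: "M \<in> letters \<Longrightarrow> Bm M \<in> states_on {1..3}"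
proof (induction M)
  case (add x M)
  then have "snd x \<ge> 1" "M \<in> letters" by (auto simp: letters_def)
  then show ?case using add.IH bos_states by (simp add: Bm_simps flip: bos_neg)
qed (simp add: Bm_simps)

lemma Bm_graded: "M \<in> letters \<Longrightarrow> Bm M \<in> graded {int (wt M)}"
proof (induction M)
  case (add x M)
  then have x: "snd x \<ge> 1" "M \<in> letters" by (auto simp: letters_def)
  show ?case using bos_graded[OF add.IH[OF x(2)], of "cf (fst x)" "- int (snd x)"] x(1)
    by (simp add: Bm_simps bos_neg add.commute)
qed (simp add: Bm_simps)

lemma theta_inv_supp:
  assumes "p \<in> states_on {1..3}"
  shows "theta_inv p \<in> supp_in letters"
proof (rule flin_supp_inI[OF flin_theta_inv assms[unfolded states_on_def] subspace_supp_in])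
  fix M :: "(nat \<times> nat) multiset" assume "M \<in> {M. set_mset M \<subseteq> {1..3} \<times> {1..}}"
  then show "theta_inv (mon M) \<in> supp_in letters"
  proof (induction M)
    case empty
    then show ?case by (simp add: theta_inv_def letters_def)
  next
    case (add x M)
    have IH: "theta_inv (mon M) \<in> supp_in letters" using add by auto
    have v: "var s (snd x) * q \<in> supp_in letters" if "s < 3" "q \<in> supp_in letters" for s q
    proof (rule flin_supp_inI[OF flin_mult that(2) subspace_supp_in])
      show "var s (snd x) * mon K \<in> supp_in letters" if "K \<in> letters" for K
        using that add.prems \<open>s < 3\<close> by (auto simp: mon_mult letters_def)
    qed
    have "theta_inv (mon (add_mset x M)) = (\<Sum>s<3. fock_scale (cf (dual s) (fst x)) (var s (snd x) * theta_inv (mon M)))"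
      by (simp add: theta_inv_def subst_hom_mon sum_distrib_right)
    also have "\<dots> \<in> supp_in letters"
      by (intro fs.subspace_sum fs.subspace_scale subspace_supp_in v IH) auto
    finally show ?case .
  qed
qed

text \<open>The pairing of the eigenbosons is off-diagonal for charges 1 and 2, so annihilation by
  one eigenboson is differentiation by the variable of its dual.\<close>

lemma bs_theta:
  assumes "s < 3" "n \<ge> 1" "p \<in> supp_in letters"
  shows "bs s (int n) (theta p) = theta (alpha (dual s) (int n) p)"
proof (rule supp_in_eqI[OF flin_comp[OF flin_bos flin_theta] flin_comp[OF flin_theta flin_alpha] assms(3)])
  fix M assume "M \<in> letters"
  then show "bs s (int n) (theta (mon M)) = theta (alpha (dual s) (int n) (mon M))"
  proof (induction M)
    case empty
    have "theta 1 = 1" by (simp add: theta_def)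
    then show ?case by (simp add: bos_one alpha_one flin_zero[OF flin_theta])
  next
    case (add x M)
    obtain t m where x: "x = (t, m)" by force
    have t: "t < 3" "m \<ge> 1" "M \<in> letters" using add.prems by (auto simp: letters_def x)
    have "bs s (int n) (bv t m) = bs s (int n) (bs t (- int m) 1)" using t by (simp add: bos_neg)
    also have "\<dots> = (if dual s = t \<and> n = m then fock_scale (of_nat n) 1 else 0)"
      using assms t by (subst bos_commutator) (auto simp: bos_one flin_zero[OF flin_bos] pair_cf)
    finally have b: "bs s (int n) (bv t m) = (if dual s = t \<and> n = m then fock_scale (of_nat n) 1 else 0)" .
    have "theta (mon (add_mset x M)) = bv t m * theta (mon M)" by (simp add: theta_mon Bm_simps x)
    moreover have "alpha (dual s) (int n) (mon (add_mset x M)) = alpha (dual s) (int n) (var t m) * mon M + var t m * alpha (dual s) (int n) (mon M)"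
      by (simp add: x mon_mult flip: alpha_derivation)
    moreover have "theta 1 = 1" "theta 0 = 0" by (simp_all add: theta_def flin_zero[OF flin_subst_hom])
    moreover have "theta (var t m) = bv t m" by (simp add: theta_mon Bm_simps)
    ultimately show ?case
      using add.IH[OF t(3)]
      by (simp add: bos_derivation b alpha_var flin_add[OF flin_theta] flin_scale[OF flin_theta] theta_mult)
  qed
qed

section \<open>Invariants as combinations of eigenmonomials of charge divisible by 3\<close>

section \<open>The orbifold and the commutant of the diagonal boson\<close>

definition charge :: "(nat \<times> nat) multiset \<Rightarrow> nat" where
  "charge M = (\<Sum>x \<in># M. fst x)"

lemma charge_simps [simp]: "charge {#} = 0" "charge (add_mset x M) = fst x + charge M" "charge (M + N) = charge M + charge N"
  by (simp_all add: charge_def)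

definition Vkeys :: "(nat \<times> nat) multiset set" where
  "Vkeys = {M \<in> letters. 3 dvd charge M}"

definition Wkeys :: "(nat \<times> nat) multiset set" where
  "Wkeys = {M \<in> Vkeys. 0 \<notin> fst ` set_mset M}"

definition VV :: "fock set" where "VV = {v \<in> states_on {1..3}. \<forall>g \<in> perm_act ` Z3. g v = v}"

text \<open>The commutant of the invariant boson inside the orbifold, given by its annihilation
  operators. In eigencoordinates it consists of the vectors without boson 0
  (\<open>WW_eq\<close>).\<close>

definition WW :: "fock set" where "WW = {v \<in> VV. \<forall>n\<ge>1. bs 0 (int n) v = 0}"

lemma heisenberg3_Z3_eq: "heisenberg3_Z3 = sub_voa VV omega3"
  by (simp add: heisenberg3_Z3_def fixed_points_def heisenberg_def sub_voa_def VV_def states_on_def supp_in_def)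
    (auto simp: fock_nprod_def[abs_def])

definition sigma :: "nat \<Rightarrow> nat" where "sigma = cycle_of_list [1, 2, 3]"

lemma sigma_simps: "sigma 1 = 2" "sigma 2 = 3" "sigma 3 = 1"
  by (simp_all add: sigma_def transpose_def)

lemma perm_act_subst: "perm_act \<sigma> = subst_hom (\<lambda>x. var (\<sigma> (fst x)) (snd x))"
proof -
  have "(\<Prod>x \<in># M. var (\<sigma> (fst x)) (snd x)) = mon (image_mset (\<lambda>(i, n). (\<sigma> i, n)) M)" for M
    by (induction M) (auto simp: mon_mult)
  then show ?thesis
    by (intro ext) (simp add: subst_hom_def lin_def perm_act_def fock_scale_mon)
qed

lemma flin_perm_act: "flin (perm_act \<sigma>)"
  by (simp add: perm_act_subst flin_subst_hom)

lemma perm_act_mult: "perm_act \<sigma> (p * q) = perm_act \<sigma> p * perm_act \<sigma> q"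
  by (simp add: perm_act_subst subst_hom_mult)

lemma perm_act_one [simp]: "perm_act \<sigma> 1 = 1"
  by (simp add: perm_act_subst)

lemma perm_act_mon: "perm_act \<sigma> (mon M) = mon (image_mset (\<lambda>(i, n). (\<sigma> i, n)) M)"
  by (simp add: perm_act_def)

lemma perm_act_comp: "perm_act (\<sigma> \<circ> \<tau>) p = perm_act \<sigma> (perm_act \<tau> p)"
proof (rule fock_eq_on_keysI[where p = p, OF flin_perm_act flin_comp[OF flin_perm_act flin_perm_act]])
  show "perm_act (\<sigma> \<circ> \<tau>) (mon M) = perm_act \<sigma> (perm_act \<tau> (mon M))" for M
    by (simp add: perm_act_mon image_mset.compositionality o_def case_prod_unfold)
qed

lemma perm_act_id: "perm_act id p = p"
proof (rule fock_eq_on_keysI[where p = p, OF flin_perm_act flin_ident])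
  show "perm_act id (mon M) = mon M" for M
    by (simp add: perm_act_mon id_def)
qed

lemma Z3_invariant_iff: "(\<forall>g \<in> perm_act ` Z3. g v = v) \<longleftrightarrow> perm_act sigma v = v"
proof
  assume "\<forall>g \<in> perm_act ` Z3. g v = v"
  moreover have "sigma \<in> Z3" unfolding Z3_def sigma_def by (rule CollectI, rule exI[of _ 1]) simp
  ultimately show "perm_act sigma v = v" by blast
next
  assume v: "perm_act sigma v = v"
  have "perm_act (sigma ^^ k) v = v" for k
  proof (induction k)
    case 0
    show ?case using perm_act_id by (simp add: id_def)
  next
    case (Suc k)
    have "perm_act (sigma ^^ Suc k) v = perm_act sigma (perm_act (sigma ^^ k) v)"
      using perm_act_comp[of sigma "sigma ^^ k" v] by (simp only: funpow.simps)
    then show ?case using Suc v by (simp only:)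
  qed
  then show "\<forall>g \<in> perm_act ` Z3. g v = v" unfolding Z3_def sigma_def by blast
qed

text \<open>The shift sends factor \<open>i\<close> to the next one, so the eigenvalue is zeta^(-s);
  the exponent \<open>2 * s\<close> avoids the negative power.\<close>

lemma perm_act_bv:
  assumes "s < 3"
  shows "perm_act sigma (bv s n) = fock_scale (zeta ^ (2 * s)) (bv s n)"
proof -
  have "s = 0 \<or> s = 1 \<or> s = 2" using assms by auto
  then have "cf s 1 = zeta ^ (2 * s) * cf s 2" "cf s 2 = zeta ^ (2 * s) * cf s 3" "cf s 3 = zeta ^ (2 * s) * cf s 1"
    by (auto simp: cf_def zeta_mult_pow zeta_pows zeta_sq algebra_simps simp del: power_Suc)
  moreover have "perm_act sigma (bv s n) = fock_scale (cf s 1) (var 2 n) + fock_scale (cf s 2) (var 3 n) + fock_scale (cf s 3) (var 1 n)"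
    unfolding bvar_def atLeast1_atMost3
    using sigma_simps
    by (simp add: flin_add[OF flin_perm_act] flin_scale[OF flin_perm_act] perm_act_mon)
  ultimately show ?thesis
    unfolding bvar_def atLeast1_atMost3 by (simp add: fs.scale_right_distrib add_ac)
qed

lemma perm_act_Bm: "M \<in> letters \<Longrightarrow> perm_act sigma (Bm M) = fock_scale (zeta ^ (2 * charge M)) (Bm M)"
  by (induction M) (auto simp: Bm_simps perm_act_mult perm_act_bv letters_def power_add algebra_simps)

text \<open>In eigencoordinates the shift is diagonal with eigenvalue zeta^(2 charge), so invariance
  allows coefficients only where this is 1; and 2 is invertible modulo 3.\<close>

lemma perm_act_invariant_supp:
  assumes "v \<in> states_on {1..3}"
  shows "perm_act sigma v = v \<longleftrightarrow> theta_inv v \<in> supp_in Vkeys"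
proof -
  let ?p = "theta_inv v"
  let ?g = "lin (\<lambda>M. fock_scale (zeta ^ (2 * charge M)) (mon M))"
  have p: "?p \<in> supp_in letters" by (rule theta_inv_supp[OF assms])
  have look: "Poly_Mapping.lookup (?g q) M = zeta ^ (2 * charge M) * Poly_Mapping.lookup q M" for q M
  proof -
    have "(\<Sum>K \<in> Poly_Mapping.keys q. Poly_Mapping.lookup q K * zeta ^ (2 * charge K) * (if K = M then 1 else 0)) =
      (\<Sum>K \<in> Poly_Mapping.keys q. if K = M then zeta ^ (2 * charge K) * Poly_Mapping.lookup q K else 0)"
      by (intro sum.cong) auto
    then show ?thesis
      by (simp add: lin_def lookup_sum lookup_single when_def in_keys_iff)
  qed
  have "perm_act sigma (theta ?p) = theta (?g ?p)"
    by (rule supp_in_eqI[OF flin_comp[OF flin_perm_act flin_theta] flin_comp[OF flin_theta flin_lin] p])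
      (simp add: theta_mon perm_act_Bm flin_scale[OF flin_theta])
  moreover have gp: "?g ?p \<in> supp_in letters"
    using p by (auto simp: supp_in_def in_keys_iff look)
  ultimately have "perm_act sigma v = v \<longleftrightarrow> ?g ?p = ?p"
    using theta_theta_inv[OF assms] theta_inv_theta[OF gp] by metis
  also have "\<dots> \<longleftrightarrow> (\<forall>M. (zeta ^ (2 * charge M) - 1) * Poly_Mapping.lookup ?p M = 0)"
    by (simp add: poly_mapping_eq_iff fun_eq_iff look left_diff_distrib del: mult_cancel_right1)
  also have "\<dots> \<longleftrightarrow> (\<forall>M. 3 dvd charge M \<or> Poly_Mapping.lookup ?p M = 0)"
    by (simp add: zeta_pow_eq_1_iff) (metis (no_types) coprime_dvd_mult_right_iff coprime_Suc_left_nat numeral_2_eq_2 numeral_3_eq_3)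
  also have "\<dots> \<longleftrightarrow> ?p \<in> supp_in Vkeys"
    using p by (auto simp: supp_in_def Vkeys_def in_keys_iff)
  finally show ?thesis .
qed

lemma VV_iff: "v \<in> VV \<longleftrightarrow> v \<in> states_on {1..3} \<and> theta_inv v \<in> supp_in Vkeys"
  unfolding VV_def Z3_invariant_iff using perm_act_invariant_supp by blast

lemma theta_states: "p \<in> supp_in letters \<Longrightarrow> theta p \<in> states_on {1..3}"
  by (erule flin_supp_inI[OF flin_theta _ subspace_states_on]) (simp only: theta_mon Bm_states)

lemma VV_eq: "VV = theta ` supp_in Vkeys"
proof -
  have sub: "supp_in Vkeys \<subseteq> supp_in letters" by (rule supp_in_mono) (auto simp: Vkeys_def)
  show ?thesis
  proof (intro subset_antisym subsetI)
    fix v assume "v \<in> VV"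
    then show "v \<in> theta ` supp_in Vkeys" by (metis VV_iff image_eqI theta_theta_inv)
  next
    fix v assume "v \<in> theta ` supp_in Vkeys"
    then obtain p where "p \<in> supp_in Vkeys" "v = theta p" by blast
    then show "v \<in> VV" unfolding VV_iff using sub theta_inv_theta[of p] theta_states[of p] by auto
  qed
qed

lemma WW_eq: "WW = theta ` supp_in Wkeys"
proof (intro subset_antisym subsetI)
  have sub: "supp_in Wkeys \<subseteq> supp_in Vkeys" "supp_in Vkeys \<subseteq> supp_in letters"
    by (auto intro!: supp_in_mono simp: Vkeys_def Wkeys_def)
  fix v assume "v \<in> WW"
  then obtain p where p: "p \<in> supp_in Vkeys" "v = theta p" and k: "\<And>n. n \<ge> 1 \<Longrightarrow> bs 0 (int n) v = 0"
    by (auto simp: WW_def VV_eq)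
  \<comment> \<open>A letter \<open>(0, n)\<close> in a key would leave a nonzero coefficient after
    differentiating by it; but boson 0 is its own dual and kills \<open>v\<close>.\<close>
  have "M \<in> Wkeys" if M: "M \<in> Poly_Mapping.keys p" for M
  proof (rule ccontr)
    have MV: "M \<in> Vkeys" using p M by (auto simp: supp_in_def)
    assume "M \<notin> Wkeys"
    then obtain n where n: "(0, n) \<in># M" using MV by (auto simp: Wkeys_def)
    then have n1: "n \<ge> 1" using MV by (auto simp: Vkeys_def letters_def)
    obtain N where N: "M = add_mset (0, n) N" using n by (metis insert_DiffM)
    have pl: "p \<in> supp_in letters" using p sub by auto
    have "alpha 0 (int n) p \<in> supp_in letters"
    proof (rule flin_supp_inI[OF flin_alpha pl subspace_supp_in])
      show "alpha 0 (int n) (mon K) \<in> supp_in letters" if "K \<in> letters" for K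
        using letters_diff[OF that] by (simp add: alpha_mon' fs.subspace_scale[OF subspace_supp_in])
    qed
    moreover have "theta (alpha 0 (int n) p) = 0"
      using bs_theta[of 0 n p] k[OF n1] n1 pl p(2) by simp
    ultimately have "alpha 0 (int n) p = 0"
      by (metis flin_theta_inv flin_zero theta_inv_theta)
    then have "of_nat n * of_nat (count N (0, n) + 1) * Poly_Mapping.lookup p M = 0"
      using lookup_alpha[OF n1, of 0 p N] by (simp add: N)
    then show False using M n1 by (simp add: in_keys_iff del: of_nat_Suc of_nat_add) 
  qed
  then show "v \<in> theta ` supp_in Wkeys" using p by (auto simp: supp_in_def)
next
  have sub: "supp_in Wkeys \<subseteq> supp_in Vkeys" "supp_in Vkeys \<subseteq> supp_in letters"
    by (auto intro!: supp_in_mono simp: Vkeys_def Wkeys_def)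
  fix v assume "v \<in> theta ` supp_in Wkeys"
  then obtain p where p: "p \<in> supp_in Wkeys" "v = theta p" by auto
  have "bs 0 (int n) v = 0" if "n \<ge> 1" for n
  proof -
    have "alpha 0 (int n) p = 0"
    proof (rule supp_in_eqI[OF flin_alpha fp.module_hom_zero p(1)])
      fix M assume "M \<in> Wkeys"
      then have "count M (0, n) = 0" by (force simp: Wkeys_def not_in_iff[symmetric])
      then show "alpha 0 (int n) (mon M) = 0" by (simp add: alpha_mon')
    qed
    moreover have "bs 0 (int n) v = theta (alpha (dual 0) (int n) p)"
      unfolding p(2) using that p(1) sub by (intro bs_theta) auto
    ultimately show ?thesis by (simp add: flin_zero[OF flin_theta])
  qed
  moreover have "v \<in> VV" unfolding VV_eq using p sub(1) by blast
  ultimately show "v \<in> WW" unfolding WW_def by blast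
qed

section \<open>Closure under products, the two conformal vectors, and simplicity\<close>

section \<open>Both are simple vertex operator algebras\<close>

lemma sigma_inj: "inj sigma"
  unfolding sigma_def by (rule permutes_inj[OF cycle_permutes])

lemma perm_act_alpha:
  assumes "inj \<sigma>"
  shows "perm_act \<sigma> (alpha i n p) = alpha (\<sigma> i) n (perm_act \<sigma> p)"
proof (rule fock_eq_on_keysI[where p = p, OF flin_comp[OF flin_perm_act flin_alpha] flin_comp[OF flin_alpha flin_perm_act]])
  fix M
  let ?f = "\<lambda>(i, n). (\<sigma> i, n :: nat)"
  have inj: "inj ?f" using assms by (auto simp: inj_on_def)
  show "perm_act \<sigma> (alpha i n (mon M)) = alpha (\<sigma> i) n (perm_act \<sigma> (mon M))"
  proof (cases "n < 0")
    case True
    then show ?thesis by (simp add: alpha_mon_neg perm_act_mon)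
  next
    case False
    have c: "count (image_mset ?f M) (\<sigma> i, nat n) = count M (i, nat n)"
      using assms by (induction M) (auto simp: inj_eq)
    show ?thesis
    proof (cases "(i, nat n) \<in># M")
      case True
      then have "image_mset ?f (M - {#(i, nat n)#}) = image_mset ?f M - {#(\<sigma> i, nat n)#}"
        by (simp add: image_mset_Diff)
      then show ?thesis using False c by (simp add: alpha_mon' perm_act_mon flin_scale[OF flin_perm_act])
    next
      case nin: False
      then have "count M (i, nat n) = 0" by (simp add: not_in_iff)
      then show ?thesis using False c
        by (simp add: alpha_mon' perm_act_mon flin_scale[OF flin_perm_act] flin_zero[OF flin_perm_act])
    qed
  qed
qed

lemma perm_act_list_mode:
  assumes "inj \<sigma>"
  shows "perm_act \<sigma> (list_mode xs n v) = list_mode (map (\<lambda>(i, n). (\<sigma> i, n)) xs) n (perm_act \<sigma> v)"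
proof (induction xs n v rule: list_mode.induct)
  case (1 n v)
  show ?case by (simp add: flin_zero[OF flin_perm_act])
next
  case (2 i m xs n v)
  have "perm_act \<sigma> (list_mode ((i, m) # xs) n v) =
    Sum_any (\<lambda>j. perm_act \<sigma> (fock_scale (of_nat ((m + j - 1) choose j)) (alpha i (- int m - int j) (list_mode xs (n + int j) v)
         - fock_scale ((-1) ^ m) (list_mode xs (n - int m - int j) (alpha i (int j) v)))))"
    unfolding list_mode.simps by (rule Sum_any_flin[OF flin_perm_act ev0_list_mode_Cons])
  then show ?case using 2
    by (simp add: flin_scale[OF flin_perm_act] flin_diff[OF flin_perm_act] perm_act_alpha[OF assms])
qed

lemma perm_act_states: "p \<in> St \<Longrightarrow> perm_act \<sigma> p \<in> St"
  unfolding states_on_def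
  by (erule flin_supp_inI[OF flin_perm_act _ subspace_supp_in]) (fastforce simp: perm_act_mon)

lemma perm_act_Y:
  assumes "inj \<sigma>" "a \<in> St" "v \<in> St"
  shows "perm_act \<sigma> (Y a n v) = Y (perm_act \<sigma> a) n (perm_act \<sigma> v)"
proof (rule supp_in_eqI[OF flin_comp[OF flin_perm_act flin_Y_left] flin_comp[OF flin_Y_left flin_perm_act] assms(2)[unfolded states_on_def]])
  fix M :: "(nat \<times> nat) multiset" assume M: "M \<in> {M. set_mset M \<subseteq> UNIV \<times> {1..}}"
  obtain xs where xs: "M = mset xs" by (metis ex_mset)
  have "perm_act \<sigma> (Y (mon M) n v) = list_mode (map (\<lambda>(i, n). (\<sigma> i, n)) xs) n (perm_act \<sigma> v)"
    using M assms by (simp add: xs perm_act_list_mode flip: list_mode_eq_Y)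
  also have "\<dots> = Y (mon (mset (map (\<lambda>(i, n). (\<sigma> i, n)) xs))) n (perm_act \<sigma> v)"
    using M assms(3) by (intro list_mode_eq_Y perm_act_states) (auto simp: xs)
  finally show "perm_act \<sigma> (Y (mon M) n v) = Y (perm_act \<sigma> (mon M)) n (perm_act \<sigma> v)"
    by (simp add: perm_act_mon xs)
qed

lemma VV_states: "v \<in> VV \<Longrightarrow> v \<in> states_on {1..3}"
  by (simp add: VV_def)

lemma VV_St: "v \<in> VV \<Longrightarrow> v \<in> St"
  using VV_states states_on_St by blast

lemma VV_perm: "v \<in> VV \<longleftrightarrow> v \<in> states_on {1..3} \<and> perm_act sigma v = v"
  unfolding VV_def Z3_invariant_iff by simp

lemma VV_closed: "a \<in> VV \<Longrightarrow> b \<in> VV \<Longrightarrow> Y a n b \<in> VV"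
  unfolding VV_perm using perm_act_Y[OF sigma_inj] states_on_St by (auto simp: Y_states_on)

lemma WW_VV: "v \<in> WW \<Longrightarrow> v \<in> VV"
  by (simp add: WW_def)

lemma bs0_WW: "v \<in> WW \<Longrightarrow> n \<ge> 0 \<Longrightarrow> bs 0 n v = 0"
proof -
  assume "v \<in> WW" "n \<ge> 0"
  then show "bs 0 n v = 0" by (cases "n = 0") (auto simp: WW_def elim!: allE[of _ "nat n"])
qed

text \<open>All contractions of boson 0 with either argument vanish, so the commutator formula lets
  it pass through the product.\<close>

lemma WW_closed:
  assumes "a \<in> WW" "b \<in> WW"
  shows "Y a n b \<in> WW"
proof -
  have "bs 0 (int k) (Y a n b) = 0" if "k \<ge> 1" for k
    using assms VV_St WW_VV by (simp add: Y_bos_comm bs0_WW)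
  then show ?thesis using VV_closed assms WW_VV unfolding WW_def by blast
qed

lemma subspace_theta_image: "fs.subspace (theta ` supp_in A)"
  by (rule module_hom.subspace_image[OF flin_theta subspace_supp_in])

lemma subspace_VV: "fs.subspace VV" and subspace_WW: "fs.subspace WW"
  by (simp_all only: VV_eq WW_eq subspace_theta_image)

lemma theta_image_span: "theta ` supp_in A = fs.span (Bm ` A)"
proof -
  have "theta ` mon ` A = Bm ` A" by (simp add: image_image theta_mon)
  then show ?thesis by (simp add: supp_in_span flip: module_hom.span_image[OF flin_theta])
qed

lemma VV_span: "VV = fs.span (Bm ` Vkeys)" and WW_span: "WW = fs.span (Bm ` Wkeys)"
  by (simp_all only: VV_eq WW_eq theta_image_span)

lemma one_VV [simp]: "1 \<in> VV" and one_WW [simp]: "1 \<in> WW"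
proof -
  have k: "{#} \<in> Vkeys" "{#} \<in> Wkeys" by (auto simp: Vkeys_def Wkeys_def letters_def)
  show "1 \<in> VV" unfolding VV_span by (rule fs.span_base) (metis Bm_simps(1) imageI k(1))
  show "1 \<in> WW" unfolding WW_span by (rule fs.span_base) (metis Bm_simps(1) imageI k(2))
qed

lemma homogeneous_span:
  assumes "A \<subseteq> letters"
  shows "fs.span (Bm ` A) \<subseteq> fs.span (\<Union>d. fs.span (Bm ` A) \<inter> graded {int d})"
proof (rule fs.span_minimal[OF _ fs.subspace_span], rule image_subsetI)
  fix M assume "M \<in> A"
  then have "Bm M \<in> fs.span (Bm ` A) \<inter> graded {int (wt M)}"
    using assms Bm_graded by (blast intro: fs.span_base)
  then show "Bm M \<in> fs.span (\<Union>d. fs.span (Bm ` A) \<inter> graded {int d})"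
    by (intro fs.span_base UN_I[of "wt M"]) auto
qed

lemma alpha_eq_bos: "k \<in> {1..3} \<Longrightarrow> alpha k n p = bos (\<lambda>i. if i = k then 1 else 0) n p"
proof -
  assume k: "k \<in> {1..3}"
  have "bos (\<lambda>i. if i = k then 1 else 0) n p = (\<Sum>i \<in> {1..3}. if i = k then alpha k n p else 0)"
    unfolding bos_def by (intro sum.cong) auto
  then show ?thesis using k by simp
qed

lemma alpha_Y_omega3:
  assumes "v \<in> St" "k \<in> {1..3}"
  shows "alpha k p (Y omega3 n v) = Y omega3 n (alpha k p v) + fock_scale (of_int p) (alpha k (p + n - 1) v)"
  using assms by (simp only: alpha_eq_bos bos_omega3)

text \<open>Creation operators build the Fock space from the vacuum. The lemma compares modes of the
  conformal vector with \<open>T\<close> and \<open>euler\<close> through their commutators with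
  creation operators.\<close>

lemma states_ext:
  assumes "flin f" "flin g" "f 1 = g 1" "v \<in> states_on I"
    and "\<And>k n v. k \<in> I \<Longrightarrow> n \<ge> 1 \<Longrightarrow> v \<in> states_on I \<Longrightarrow> f v = g v \<Longrightarrow> f (alpha k (- int n) v) = g (alpha k (- int n) v)"
  shows "f v = g v"
proof (rule supp_in_eqI[OF assms(1,2) assms(4)[unfolded states_on_def]])
  fix M :: "(nat \<times> nat) multiset" assume "M \<in> {M. set_mset M \<subseteq> I \<times> {1..}}"
  then show "f (mon M) = g (mon M)"
  proof (induction M)
    case empty
    then show ?case using assms(3) by simp
  next
    case (add x M)
    obtain k n where x: "x = (k, n)" by force
    have n: "k \<in> I" "n \<ge> 1" and M: "set_mset M \<subseteq> I \<times> {1..}" using add.prems x by auto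
    have "mon (add_mset x M) = alpha k (- int n) (mon M)" using n by (simp add: alpha_mon_neg x)
    moreover have "mon M \<in> states_on I" using M by simp
    ultimately show ?case using assms(5)[OF n] add.IH M by simp
  qed
qed

lemma omega3_0:
  assumes "v \<in> states_on {1..3}"
  shows "Y omega3 0 v = T v"
proof (rule states_ext[OF flin_Y flin_T _ assms])
  show "Y omega3 0 1 = T 1" by (simp add: Y_vac)
next
  fix k n :: nat and v assume v: "k \<in> {1..3}" "v \<in> states_on {1..3}" "Y omega3 0 v = T v"
  have "v \<in> St" using v(2) by (rule states_on_St)
  then show "Y omega3 0 (alpha k (- int n) v) = T (alpha k (- int n) v)"
    using alpha_Y_omega3[of v k "- int n" 0] alpha_T[of v k "- int n"] v by simp
qed

lemma omega3_1:
  assumes "v \<in> states_on {1..3}"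
  shows "Y omega3 1 v = euler v"
proof (rule states_ext[OF flin_Y flin_euler _ assms])
  show "Y omega3 1 1 = euler 1" by (simp add: Y_vac euler_def)
next
  fix k n :: nat and v assume v: "k \<in> {1..3}" "v \<in> states_on {1..3}" "Y omega3 1 v = euler v" "n \<ge> (1 :: nat)"
  have "v \<in> St" using v(2) by (rule states_on_St)
  moreover have "euler (alpha k (- int n) v) = alpha k (- int n) (euler v) + fock_scale (of_nat n) (alpha k (- int n) v)"
  proof (rule fock_eq_on_keysI[where p = v])
    show "flin (\<lambda>v. euler (alpha k (- int n) v))" by (intro flin_comp[OF flin_euler] flin_alpha)
    show "flin (\<lambda>v. alpha k (- int n) (euler v) + fock_scale (of_nat n) (alpha k (- int n) v))"
      by (intro fp.module_hom_add flin_comp[OF flin_alpha] flin_euler flin_comp[OF flin_const_scale] flin_alpha)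
    show "euler (alpha k (- int n) (mon M)) = alpha k (- int n) (euler (mon M)) + fock_scale (of_nat n) (alpha k (- int n) (mon M))" for M
      using v(4) by (simp add: alpha_mon_neg euler_def flin_scale[OF flin_alpha] fs.scale_left_distrib add.commute)
  qed
  ultimately show "Y omega3 1 (alpha k (- int n) v) = euler (alpha k (- int n) v)"
    using alpha_Y_omega3[of v k "- int n" 1] v by (simp add: algebra_simps)
qed

definition qd :: "(nat \<Rightarrow> complex) \<Rightarrow> (nat \<Rightarrow> complex) \<Rightarrow> fock" where
  "qd c d = bos c (-1) (bos d (-1) 1)"

lemma qd_states: "qd c d \<in> states_on {1..3}"
  unfolding qd_def by (intro bos_states one_states_on)

lemma qd_graded: "qd c d \<in> graded {2}"
proof -
  have "1 \<in> graded {0}" by simp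
  from bos_graded[OF bos_graded[OF this], of c "-1" d "-1"] show ?thesis by (simp add: qd_def)
qed

lemma bos_qd:
  assumes "p \<ge> 1"
  shows "bos c p (qd d e) = (if p = 1 then fock_scale (pair c d) (bos e (-1) 1) + fock_scale (pair c e) (bos d (-1) 1) else 0)"
proof -
  have 1: "bos c p (bos e (-1) 1) = (if p = 1 then fock_scale (pair c e) 1 else 0)"
    using assms by (subst bos_commutator) (auto simp: bos_one flin_zero[OF flin_bos])
  show ?thesis unfolding qd_def using assms
    by (subst bos_commutator) (auto simp: 1 flin_zero[OF flin_bos] flin_scale[OF flin_bos] add.commute)
qed

lemma bos_on_omega3: "p \<ge> 1 \<Longrightarrow> bos c p omega3 = (if p = 1 then bos c (-1) 1 else 0)"
  unfolding bos_def by (auto simp: alpha_omega3)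

lemma omega3_qd:
  "Y omega3 2 (qd c d) = 0" "Y omega3 3 (qd c d) = fock_scale (pair c d) 1"
proof -
  have c: "Y omega3 n (bos c (-1) v) = bos c (-1) (Y omega3 n v) + bos c (n - 2) v" if "v \<in> St" for n v c
    using bos_omega3[OF that, of c "-1" n] by simp
  have St: "bos d (-1) 1 \<in> St" by (intro bos_St one_states_on)
  have d: "Y omega3 n (qd c d) = bos c (n - 2) (bos d (-1) 1)" if "n \<ge> 2" for n
    unfolding qd_def c[OF St] c[OF one_states_on] using that by (simp add: Y_vac bos_one flin_zero[OF flin_bos])
  show "Y omega3 2 (qd c d) = 0" by (simp add: d)
  have "bos c 1 (bos d (-1) 1) = fock_scale (pair c d) 1"
    by (subst bos_commutator) (simp add: bos_one flin_zero[OF flin_bos])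
  then show "Y omega3 3 (qd c d) = fock_scale (pair c d) 1" by (simp add: d)
qed

lemma omega3_qd_sum: "omega3 = fock_scale (1 / 2) (\<Sum>i \<in> {1..3}. qd (\<lambda>k. if k = i then 1 else 0) (\<lambda>k. if k = i then 1 else 0))"
  unfolding omega3_eq qd_def by (simp add: alpha_eq_bos)

lemma omega3_omega3: "Y omega3 2 omega3 = 0" "Y omega3 3 omega3 = fock_scale (3 / 2) 1"
proof -
  have e: "Y omega3 n omega3 = fock_scale (1 / 2) (\<Sum>i \<in> {1..3}. Y omega3 n (qd (\<lambda>k. if k = i then 1 else 0) (\<lambda>k. if k = i then 1 else 0)))" for n
    by (subst (2) omega3_qd_sum) (simp only: flin_scale[OF flin_Y] flin_sum[OF flin_Y])
  show "Y omega3 2 omega3 = 0" unfolding e by (simp add: omega3_qd)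
  have "pair (\<lambda>k. if k = i then 1 else 0) (\<lambda>k. if k = i then 1 else 0) = 1" if "i \<in> {1..3}" for i
  proof -
    have "pair (\<lambda>k. if k = i then 1 else 0) (\<lambda>k. if k = i then 1 else 0) = (\<Sum>k \<in> {1..3}. if k = i then 1 else 0)"
      unfolding pair_def by (intro sum.cong) auto
    then show ?thesis using that by simp
  qed
  then have "Y omega3 3 omega3 = fock_scale (1 / 2) (\<Sum>i \<in> {1..3::nat}. 1)"
    unfolding e omega3_qd by (intro arg_cong[of _ _ "fock_scale _"] sum.cong) auto
  also have "(\<Sum>i \<in> {1..3::nat}. 1 :: fock) = fock_scale 3 1"
    by (simp add: fock_scale_mon[of _ "{#}", simplified])
  finally show "Y omega3 3 omega3 = fock_scale (3 / 2) 1" by simp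
qed

lemma omega3_VV: "omega3 \<in> VV"
proof -
  have "\<And>i n. perm_act sigma (alpha i n p) = alpha (sigma i) n (perm_act sigma p)" for p
    by (rule perm_act_alpha[OF sigma_inj])
  then have "perm_act sigma omega3 = fock_scale (1 / 2) (\<Sum>i \<in> {1..3}. alpha (sigma i) (-1) (alpha (sigma i) (-1) 1))"
    unfolding omega3_eq by (simp add: flin_scale[OF flin_perm_act] flin_sum[OF flin_perm_act])
  also have "\<dots> = omega3" unfolding omega3_eq atLeast1_atMost3 using sigma_simps by (simp add: add_ac)
  finally show ?thesis unfolding VV_perm using omega3_states by blast
qed

interpretation V: fock_voa VV 3 omega3 3
proof
  show "VV \<subseteq> states_on {1..3}" using VV_states by blast
  show "VV \<subseteq> fs.span (\<Union>d. VV \<inter> graded {int d})"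
    unfolding VV_span by (rule homogeneous_span) (auto simp: Vkeys_def)
qed (use subspace_VV VV_closed omega3_VV omega3_0 omega3_1 VV_states omega3_graded omega3_omega3 in auto)

definition omegaW :: fock where "omegaW = qd (cf 1) (cf 2)"

lemma alpha_outside: "p \<in> states_on I \<Longrightarrow> k \<notin> I \<Longrightarrow> n \<ge> 0 \<Longrightarrow> alpha k n p = 0"
  unfolding states_on_def
proof (erule supp_in_eqI[OF flin_alpha fp.module_hom_zero])
  fix M :: "(nat \<times> nat) multiset" assume "k \<notin> I" "n \<ge> 0" "M \<in> {M. set_mset M \<subseteq> I \<times> {1..}}"
  then have "(k, nat n) \<notin># M" by auto
  then show "alpha k n (mon M) = 0" using \<open>n \<ge> 0\<close> by (simp add: alpha_mon' not_in_iff)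
qed

text \<open>The difference is killed by all annihilation operators, which is tested on the
  eigenbosons, so it is a multiple of the vacuum; being of weight 2 it is 0. The mixed term has no
  factor 1/2 because it stands for both orders.\<close>

lemma omega3_decomp: "omega3 = fock_scale (1 / 2) (qd (cf 0) (cf 0)) + omegaW"
proof -
  define E where "E = omega3 - fock_scale (1 / 2) (qd (cf 0) (cf 0)) - omegaW"
  have E: "E \<in> states_on {1..3}"
    unfolding E_def omegaW_def
    by (intro fs.subspace_diff fs.subspace_scale subspace_states_on qd_states omega3_states)
  have bsE: "bs s p E = 0" if "s < 3" "p \<ge> 1" for s p
  proof -
    have "s = 0 \<or> s = 1 \<or> s = 2" using that by auto
    moreover have "fock_scale (1 / 2) (x + x) = x" for x
      using fs.scale_left_distrib[of "1/2" "1/2" x] by (simp add: fs.scale_right_distrib)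
    ultimately show ?thesis using that
      by (elim disjE) (simp_all add: E_def omegaW_def flin_diff[OF flin_bos] flin_scale[OF flin_bos] bos_on_omega3 bos_qd pair_cf)
  qed
  have "alpha k (int p) E = 0" if "p \<ge> 1" for k p
  proof (cases "k \<in> {1..3}")
    case True
    have "bs s (int p) E = 0" if "s < 3" for s using bsE[OF that, of "int p"] \<open>p \<ge> 1\<close> by simp
    then show ?thesis unfolding alpha_bs[OF True] by (intro sum.neutral) auto
  next
    case False
    then show ?thesis using alpha_outside[OF E] by simp
  qed
  then have "E = fock_scale (vcoeff E) 1" by (intro vacuum_line states_on_St[OF E])
  moreover have "vcoeff E = 0"
  proof -
    have "E \<in> graded {2}" unfolding E_def omegaW_def
      by (intro fs.subspace_diff fs.subspace_scale subspace_supp_in qd_graded omega3_graded)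
    then show ?thesis by (auto simp: supp_in_def in_keys_iff)
  qed
  ultimately have "E = 0" by simp
  then show ?thesis by (simp add: E_def algebra_simps)
qed

lemma omegaW_Bm: "omegaW = Bm {#(1, 1), (2, 1)#}"
  using bos_neg[of 1 "cf 1"] bos_neg[of 1 "cf 2"] by (simp add: omegaW_def qd_def Bm_simps)

lemma omegaW_WW: "omegaW \<in> WW"
  unfolding WW_span omegaW_Bm by (rule fs.span_base, rule imageI) (auto simp: Wkeys_def Vkeys_def letters_def numeral_3_eq_3[symmetric])

text \<open>In either half of the iterate formula a nonnegative mode of boson 0 acts first on
  \<open>v\<close>. Hence \<open>omegaW\<close> and \<open>omega3\<close> agree on \<open>WW\<close>
  in all nonnegative modes.\<close>

lemma Y_qd0_WW: "v \<in> WW \<Longrightarrow> n \<ge> 0 \<Longrightarrow> Y (qd (cf 0) (cf 0)) n v = 0"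
proof -
  assume v: "v \<in> WW" and n: "n \<ge> 0"
  have vS: "v \<in> St" using v VV_St WW_VV by blast
  have St: "bs 0 (-1) 1 \<in> St" by (intro bos_St one_states_on)
  show ?thesis
    using Y_bos_iterate[OF St vS order_refl, of "cf 0" n] n v
    by (simp add: qd_def Y_bos_1 vS bs0_WW flin_zero[OF flin_bos])
qed

lemma Y_omegaW: "v \<in> WW \<Longrightarrow> n \<ge> 0 \<Longrightarrow> Y omegaW n v = Y omega3 n v"
  unfolding omega3_decomp by (simp add: Y_add_left Y_scale_left Y_qd0_WW)

text \<open>Central charge 3 - 1: splitting off the invariant boson takes away 1.\<close>

interpretation W: fock_voa WW 3 omegaW 2
proof
  have e: "omegaW = omega3 - fock_scale (1 / 2) (qd (cf 0) (cf 0))" unfolding omega3_decomp by simp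
  show "WW \<subseteq> states_on {1..3}" using VV_states WW_VV by blast
  show "WW \<subseteq> fs.span (\<Union>d. WW \<inter> graded {int d})"
    unfolding WW_span by (rule homogeneous_span) (auto simp: Vkeys_def Wkeys_def)
  show "Y omegaW 2 omegaW = 0"
    unfolding Y_omegaW[OF omegaW_WW zero_le_numeral] by (simp add: e Y_diff Y_scale omega3_qd omega3_omega3)
  show "Y omegaW 3 omegaW = fock_scale (2 / 2) 1"
    unfolding Y_omegaW[OF omegaW_WW zero_le_numeral]
    by (simp add: e Y_diff Y_scale omega3_qd omega3_omega3 pair_cf flip: fs.scale_left_diff_distrib)
  show "omegaW \<in> graded {2}" unfolding omegaW_def by (rule qd_graded)
qed (use subspace_WW WW_closed omegaW_WW omega3_0 omega3_1 VV_states WW_VV Y_omegaW in auto)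

section \<open>Simplicity of the orbifold\<close>

lemma VV_voa: "vertex_operator_algebra heisenberg3_Z3"
  unfolding heisenberg3_Z3_eq by (rule V.voa)

text \<open>A form of associativity: iterated products applied to \<open>v\<close> are combinations
  of single ones. The induction runs upwards in \<open>n\<close> to the truncation bound of
  \<open>b\<close> on \<open>v\<close>.\<close>

lemma YY_span:
  assumes a: "a \<in> states_on I" and b: "b \<in> states_on I" and v: "v \<in> St"
  shows "Y a m (Y b n v) \<in> fs.span {Y c k v | c k. c \<in> states_on I}"
proof -
  let ?S = "fs.span {Y c k v | c k. c \<in> states_on I}"
  obtain N where N: "\<And>n. n \<ge> N \<Longrightarrow> Y b n v = 0" using Y_trunc by blast
  obtain M where M: "\<And>n. n \<ge> M \<Longrightarrow> Y a n v = 0" using Y_trunc by blast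
  have "\<forall>m n. nat (N - n) = k \<longrightarrow> Y a m (Y b n v) \<in> ?S" for k
  proof (induction k rule: less_induct)
    case (less k)
    show ?case
    proof (intro allI impI)
      fix m n assume k: "nat (N - n) = k"
      show "Y a m (Y b n v) \<in> ?S"
      proof (cases "n \<ge> N")
        case True
        then show ?thesis by (simp add: N fs.span_zero)
      next
        case False
        \<comment> \<open>With outer index \<open>m - M\<close> and middle index \<open>M\<close>
          the reversed products vanish, as \<open>a\<close> kills \<open>v\<close> from mode
          \<open>M\<close> on; the remaining sum starts with the wanted vector and continues with
          larger modes of \<open>b\<close>.\<close>
        define t where "t i = fock_scale ((-1) ^ i * (of_int (m - M) gchoose i)) (Y a (m - int i) (Y b (n + int i) v))" for i
        have t: "ev0 t" unfolding t_def by (intro ev0_scale ev0_YY)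
        have "B_rhs (m - M) M n a b v = Sum_any t"
          unfolding B_rhs_def t_def by (intro Sum_any.cong) (simp add: M)
        moreover have "B_lhs (m - M) M n a b v \<in> ?S"
          unfolding B_lhs_def
          by (intro Sum_any_mem fs.subspace_span fs.span_scale fs.span_base) (use a b Y_states_on in blast)
        ultimately have "Sum_any t \<in> ?S"
          using borcherds[OF states_on_St[OF a] states_on_St[OF b] v, of "m - M" M n] by simp
        moreover have "Sum_any (\<lambda>i. t (Suc i)) \<in> ?S"
        proof (intro Sum_any_mem fs.subspace_span)
          fix i
          have "nat (N - (n + int (Suc i))) < k" using False k by linarith
          then show "t (Suc i) \<in> ?S" unfolding t_def using less.IH by (intro fs.span_scale) blast
        qed
        ultimately have "Sum_any t - Sum_any (\<lambda>i. t (Suc i)) \<in> ?S" by (rule fs.span_diff)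
        moreover have "t 0 = Y a m (Y b n v)" by (simp add: t_def)
        ultimately show ?thesis using Sum_any_Suc[OF t] by (simp only: add_diff_cancel_right')
      qed
    qed
  qed
  then show ?thesis by blast
qed

text \<open>Annihilation operators lower the weight; when all of them give 0, the vector is a
  nonzero multiple of the vacuum.\<close>

lemma submodule_contains_one:
  assumes J: "fs.subspace J" and closed: "\<And>k p w. k \<in> {1..3} \<Longrightarrow> p \<ge> 1 \<Longrightarrow> w \<in> J \<Longrightarrow> alpha k (int p) w \<in> J"
    and v: "v \<in> J" "v \<noteq> 0" "v \<in> states_on {1..3}"
  shows "1 \<in> J"
proof -
  have "v \<in> J \<Longrightarrow> v \<noteq> 0 \<Longrightarrow> v \<in> states_on {1..3} \<Longrightarrow> v \<in> graded {..int D} \<Longrightarrow> 1 \<in> J" for D v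
  proof (induction D arbitrary: v rule: less_induct)
    case (less D)
    show ?case
    proof (cases "\<exists>k p. p \<ge> 1 \<and> alpha k (int p) v \<noteq> 0")
      case True
      then obtain k p where p: "p \<ge> 1" "alpha k (int p) v \<noteq> 0" by blast
      have k: "k \<in> {1..3}" using p alpha_outside[OF less.prems(3)] by fastforce
      have g: "alpha k (int p) v \<in> graded {..int D - int p}"
        by (rule alpha_graded[OF less.prems(4)]) auto
      have "D \<ge> p"
      proof (rule ccontr)
        assume "\<not> D \<ge> p"
        then have "alpha k (int p) v = 0" by (intro graded_neg[OF _ g]) auto
        then show False using p by simp
      qed
      then have eq: "int D - int p = int (D - p)" by (simp only: of_nat_diff)
      have g': "alpha k (int p) v \<in> graded {..int (D - p)}" using g unfolding eq .
      show ?thesis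
        by (rule less.IH[OF _ closed[OF k p(1) less.prems(1)] p(2) alpha_states_on[OF less.prems(3)] g'])
          (use \<open>D \<ge> p\<close> p in auto)
    next
      case False
      then have "v = fock_scale (vcoeff v) 1"
        by (intro vacuum_line states_on_St[OF less.prems(3)]) auto
      moreover have "vcoeff v \<noteq> 0"
      proof
        assume "vcoeff v = 0"
        then show False using calculation less.prems(2) by simp
      qed
      ultimately have "1 = fock_scale (1 / vcoeff v) v" by (metis fs.scale_one fs.scale_scale nonzero_eq_divide_eq mult.commute)
      then show ?thesis using fs.subspace_scale[OF J less.prems(1)] by metis
    qed
  qed
  moreover obtain D where "v \<in> graded {..D}" using graded_bound by blast
  then have "v \<in> graded {..int (nat D)}" using supp_in_mono[of "{M. int (wt M) \<in> {..D}}" "{M. int (wt M) \<in> {..int (nat D)}}"] by auto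
  ultimately show ?thesis using v by blast
qed

lemma perm_act_order_3:
  assumes "a \<in> states_on {1..3}"
  shows "perm_act sigma (perm_act sigma (perm_act sigma a)) = a"
proof -
  let ?s = "perm_act sigma"
  have "?s (?s (?s (theta (theta_inv a)))) = theta (theta_inv a)"
  proof (rule supp_in_eqI[OF _ flin_theta theta_inv_supp[OF assms]])
    show "flin (\<lambda>p. ?s (?s (?s (theta p))))" by (intro flin_comp[OF flin_perm_act] flin_theta)
    fix M assume M: "M \<in> letters"
    have "zeta ^ (2 * charge M) * (zeta ^ (2 * charge M) * zeta ^ (2 * charge M)) = 1"
      by (simp add: zeta_mult_pow zeta_pow_eq_1_iff)
    then show "?s (?s (?s (theta (mon M)))) = theta (mon M)"
      by (simp add: theta_mon perm_act_Bm[OF M] flin_scale[OF flin_perm_act] mult.assoc)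
  qed
  then show ?thesis by (simp add: theta_theta_inv[OF assms])
qed

lemma perm_act_states3:
  assumes "a \<in> states_on {1..3}"
  shows "perm_act sigma a \<in> states_on {1..3}"
proof -
  have "perm_act sigma (theta (theta_inv a)) \<in> states_on {1..3}"
  proof (rule flin_supp_inI[OF flin_comp[OF flin_perm_act flin_theta] theta_inv_supp[OF assms] subspace_states_on])
    show "perm_act sigma (theta (mon M)) \<in> states_on {1..3}" if "M \<in> letters" for M
      using Bm_states[OF that] by (simp only: theta_mon perm_act_Bm[OF that] fs.subspace_scale[OF subspace_states_on])
  qed
  then show ?thesis by (simp only: theta_theta_inv[OF assms])
qed

text \<open>
  The orbifold is simple because the whole Fock space is: the Fock submodule generated by an ideal of
  the orbifold contains the vacuum, and averaging over the group brings it back into the ideal.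
\<close>

lemma VV_simple: "simple_voa heisenberg3_Z3"
  unfolding simple_voa_def
proof (intro conjI allI impI)
  show "vertex_operator_algebra heisenberg3_Z3" by (rule VV_voa)
  show "states heisenberg3_Z3 \<noteq> {0}"
    unfolding heisenberg3_Z3_eq using one_VV by (metis one_neq_zero singletonD sub_voa_simps(1))
next
  fix I assume "va_ideal heisenberg3_Z3 I"
  then have I: "I \<subseteq> VV" "fs.subspace I" "\<And>a n v. a \<in> VV \<Longrightarrow> v \<in> I \<Longrightarrow> Y a n v \<in> I"
    by (auto simp: va_ideal_def heisenberg3_Z3_eq)
  show "I = {0} \<or> I = states heisenberg3_Z3"
  proof (cases "I = {0}")
    case False
    then obtain v where v: "v \<in> I" "v \<noteq> 0" using fs.subspace_0[OF I(2)] by blast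
    \<comment> \<open>Products of arbitrary states with elements of the ideal; by
      \<open>YY_span\<close> their span is stable under the bosons.\<close>
    define G where "G = {Y a n v | a n v. a \<in> states_on {1..3} \<and> v \<in> I}"
    define J where "J = fs.span G"
    have "1 \<in> J"
    proof (rule submodule_contains_one[OF _ _ _ v(2)])
      show "fs.subspace J" by (simp add: J_def)
      show "v \<in> states_on {1..3}" using v I(1) VV_states by blast
      have "Y 1 (-1) v \<in> G" unfolding G_def using v by force
      then show "v \<in> J" unfolding J_def by (metis Y_one fs.span_base)
      fix k p :: nat and w assume k: "k \<in> {1..3}" and w: "w \<in> J"
      have "alpha k (int p) w \<in> J" if wG: "w \<in> G" for w
      proof -
        obtain a n u where u: "w = Y a n u" "a \<in> states_on {1..3}" "u \<in> I" using wG unfolding G_def by blast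
        have uS: "u \<in> St" using u(3) I(1) VV_St by blast
        have "w \<in> St" unfolding u(1) by (intro Y_states_on states_on_St[OF u(2)] uS)
        moreover have e1: "alpha k (-1) 1 \<in> states_on {1..3}" using k by (intro alpha_states_on) auto
        ultimately have "alpha k (int p) w = Y (alpha k (-1) 1) (int p) (Y a n u)"
          using Y_bos_1[of w "\<lambda>i. if i = k then 1 else 0" "int p"] k by (simp only: alpha_eq_bos u(1))
        also have "\<dots> \<in> fs.span {Y c k u | c k. c \<in> states_on {1..3}}" by (rule YY_span[OF e1 u(2) uS])
        also have "\<dots> \<subseteq> J" unfolding J_def G_def by (rule fs.span_mono) (use u(3) in blast)
        finally show ?thesis .
      qed
      then have "J \<subseteq> {w. alpha k (int p) w \<in> J}"
        unfolding J_def by (intro fs.span_minimal module_hom.subspace_linear_preimage[OF flin_alpha] fs.subspace_span) auto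
      then show "alpha k (int p) w \<in> J" using w by blast
    qed
    \<comment> \<open>The averaging projection of the group. As \<open>u\<close> is invariant,
      averaging \<open>Y a n u\<close> amounts to averaging \<open>a\<close>, which brings
      \<open>a\<close> into the orbifold.\<close>
    moreover define avg where "avg p = fock_scale (1 / 3) (p + perm_act sigma p + perm_act sigma (perm_act sigma p))" for p
    have flin_avg: "flin avg" unfolding avg_def
      by (intro flin_comp[OF flin_const_scale] fp.module_hom_add flin_ident flin_comp[OF flin_perm_act] flin_perm_act)
    have "J \<subseteq> {p. avg p \<in> I}"
      unfolding J_def
    proof (intro fs.span_minimal module_hom.subspace_linear_preimage[OF flin_avg I(2)] subsetI CollectI)
      fix w assume wG: "w \<in> G"
      obtain a n u where u: "w = Y a n u" "a \<in> states_on {1..3}" "u \<in> I" using wG unfolding G_def by blast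
      have uV: "u \<in> VV" "perm_act sigma u = u" using u(3) I(1) VV_perm by auto
      have p: "perm_act sigma (Y b n u) = Y (perm_act sigma b) n u" if "b \<in> states_on {1..3}" for b
        using perm_act_Y[OF sigma_inj states_on_St[OF that] VV_St[OF uV(1)], of n] uV(2) by simp
      have aa: "perm_act sigma a \<in> states_on {1..3}" "perm_act sigma (perm_act sigma a) \<in> states_on {1..3}"
        using u(2) by (blast intro: perm_act_states3)+
      have "avg w = Y (avg a) n u"
        unfolding avg_def u(1) p[OF u(2)] p[OF aa(1)] by (simp only: Y_scale_left Y_add_left)
      moreover have "avg a \<in> VV"
        unfolding VV_perm
      proof
        show "avg a \<in> states_on {1..3}" unfolding avg_def using u(2) aa
          by (intro fs.subspace_scale fs.subspace_add subspace_states_on)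
        show "perm_act sigma (avg a) = avg a"
          unfolding avg_def by (simp add: flin_scale[OF flin_perm_act] flin_add[OF flin_perm_act] perm_act_order_3[OF u(2)] add_ac)
      qed
      ultimately show "avg w \<in> I" using I(3) u(3) by simp
    qed
    ultimately have "avg 1 \<in> I" by blast
    moreover have "avg 1 = 1"
    proof -
      have "fock_scale (1/3) (x + x + x) = x" for x
        by (rule poly_mapping_eqI) (simp only: lookup_fock_scale lookup_add, simp)
      then show ?thesis by (simp only: avg_def perm_act_one)
    qed
    ultimately have "1 \<in> I" by simp
    then have "VV \<subseteq> I" using I(3)[of _ 1 "-1"] Y_vac(2) VV_St by fastforce
    then show ?thesis using I(1) by (simp add: heisenberg3_Z3_eq subset_antisym)
  qed simp
qed

section \<open>Gradings in eigencoordinates and leading terms of products\<close>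

section \<open>A criterion for strong generation\<close>

text \<open>\<open>theta\<close> respects the grading \<open>g\<close>, so the part of
  \<open>p\<close> with grades outside \<open>A\<close> is mapped to monomials with grades outside
  \<open>A\<close>; \<open>theta p\<close> has none, and \<open>theta\<close> is injective on
  \<open>supp_in letters\<close>, so this part is 0. Applied to conformal weight and to polynomial
  degree.\<close>

lemma theta_inv_grade:
  fixes g :: "(nat \<times> nat) multiset \<Rightarrow> nat"
  assumes g: "\<And>M. M \<in> letters \<Longrightarrow> Bm M \<in> supp_in {K. g K = g M}"
    and p: "p \<in> supp_in letters" and tp: "theta p \<in> supp_in {K. g K \<in> A}"
  shows "p \<in> supp_in {K. g K \<in> A}"
proof -
  define P where "P B = lin (\<lambda>M. if g M \<in> B then mon M else 0)" for B
  have look: "Poly_Mapping.lookup (P B p) M = (if g M \<in> B then Poly_Mapping.lookup p M else 0)" for B M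
  proof -
    have "Poly_Mapping.lookup (P B p) M = (\<Sum>K \<in> Poly_Mapping.keys p. if K = M then if g M \<in> B then Poly_Mapping.lookup p M else 0 else 0)"
      unfolding P_def lin_def lookup_sum
      by (intro sum.cong refl) (auto simp: lookup_single when_def)
    then show ?thesis by (auto simp: in_keys_iff)
  qed
  have PB: "P B p \<in> supp_in (letters \<inter> {K. g K \<in> B})" for B
    using p by (auto simp: supp_in_def in_keys_iff look split: if_splits)
  have tPB: "theta (P B p) \<in> supp_in {K. g K \<in> B}" for B
  proof (rule flin_supp_inI[OF flin_theta PB subspace_supp_in])
    fix M assume "M \<in> letters \<inter> {K. g K \<in> B}"
    then show "theta (mon M) \<in> supp_in {K. g K \<in> B}"
      unfolding theta_mon using g[of M] by (auto simp: supp_in_def)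
  qed
  have split: "p = P A p + P (- A) p"
    by (rule poly_mapping_eqI) (simp add: lookup_add look)
  have "theta (P (- A) p) = theta p - theta (P A p)"
    using arg_cong[OF split, of theta] by (simp add: flin_add[OF flin_theta])
  then have "theta (P (- A) p) \<in> supp_in {K. g K \<in> A}"
    using tp tPB[of A] by (simp add: fs.subspace_diff[OF subspace_supp_in])
  then have "theta (P (- A) p) = 0"
    using tPB[of "- A"] by (intro poly_mapping_eqI) (fastforce simp: supp_in_def simp flip: not_in_keys_iff_lookup_eq_zero)
  moreover have "P (- A) p \<in> supp_in letters" using PB[of "- A"] by (auto simp: supp_in_def)
  ultimately have "P (- A) p = 0" by (metis flin_theta_inv flin_zero theta_inv_theta)
  then show ?thesis using split PB[of A] by (auto simp: supp_in_def)
qed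

abbreviation degs :: "int set \<Rightarrow> fock set" where
  "degs A \<equiv> supp_in {M. int (size M) \<in> A}"

lemma bos_degs_neg:
  assumes "p \<in> degs A" "n \<ge> 1"
  shows "bos c (- int n) p \<in> degs ((\<lambda>d. d + 1) ` A)"
  unfolding bos_def
proof (intro fs.subspace_sum fs.subspace_scale subspace_supp_in)
  fix i
  show "alpha i (- int n) p \<in> degs ((\<lambda>d. d + 1) ` A)"
    by (rule flin_supp_inI[OF flin_alpha assms(1) subspace_supp_in])
      (use assms(2) in \<open>auto simp: alpha_mon_neg add.commute\<close>)
qed

lemma bos_degs_nonneg:
  assumes "p \<in> degs A" "n \<ge> 0"
  shows "bos c n p \<in> degs ((\<lambda>d. d - 1) ` A)"
  unfolding bos_def
proof (intro fs.subspace_sum fs.subspace_scale subspace_supp_in)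
  fix i
  show "alpha i n p \<in> degs ((\<lambda>d. d - 1) ` A)"
  proof (rule flin_supp_inI[OF flin_alpha assms(1) subspace_supp_in])
    fix M :: "(nat \<times> nat) multiset" assume M: "M \<in> {M. int (size M) \<in> A}"
    show "alpha i n (mon M) \<in> degs ((\<lambda>d. d - 1) ` A)"
    proof (cases "(i, nat n) \<in># M")
      case True
      then obtain N where N: "M = add_mset (i, nat n) N" by (metis insert_DiffM)
      have "int (size N) = int (size M) - 1" by (simp add: N)
      then have "int (size N) \<in> (\<lambda>d. d - 1) ` A" using M by (metis (no_types, lifting) image_eqI mem_Collect_eq)
      then have "M - {#(i, nat n)#} \<in> {M. int (size M) \<in> (\<lambda>d. d - 1) ` A}" by (simp add: N)
      then show ?thesis using assms(2) by (simp add: alpha_mon' fs.subspace_scale[OF subspace_supp_in])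
    next
      case False
      then show ?thesis using assms(2) by (simp add: alpha_mon' not_in_iff fs.subspace_0[OF subspace_supp_in])
    qed
  qed
qed

lemma Bm_degs: "M \<in> letters \<Longrightarrow> Bm M \<in> degs {int (size M)}"
proof (induction M)
  case (add x M)
  then have x: "snd x \<ge> 1" "M \<in> letters" by (auto simp: letters_def)
  show ?case using bos_degs_neg[OF add.IH[OF x(2)] x(1), of "cf (fst x)"] x(1)
    by (simp add: Bm_simps bos_neg add.commute)
qed (simp add: Bm_simps)

lemma degs_mono: "A \<subseteq> B \<Longrightarrow> p \<in> degs A \<Longrightarrow> p \<in> degs B"
  using supp_in_mono[of "{M. int (size M) \<in> A}" "{M. int (size M) \<in> B}"] by blast

text \<open>
  Up to terms of lower polynomial degree, which come from contractions, the normally ordered product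
  is the product of polynomials.
\<close>

lemma Y_Bm_leading:
  assumes "M \<in> letters" "v \<in> St" "v \<in> degs {..k}"
  shows "Y (Bm M) n v \<in> degs {..k + int (size M)}"
    and "n \<ge> 0 \<Longrightarrow> Y (Bm M) n v \<in> degs {..k + int (size M) - 2}"
    and "Y (Bm M) (-1) v - Bm M * v \<in> degs {..k + int (size M) - 2}"
proof -
  have "(\<forall>k n v. v \<in> St \<longrightarrow> v \<in> degs {..k} \<longrightarrow> Y (Bm M) n v \<in> degs {..k + int (size M)} \<and>
     (n \<ge> 0 \<longrightarrow> Y (Bm M) n v \<in> degs {..k + int (size M) - 2}) \<and>
     Y (Bm M) (-1) v - Bm M * v \<in> degs {..k + int (size M) - 2})"
    using assms(1)
  proof (induction M)
    case empty
    show ?case by (auto simp: Bm_simps Y_one fs.subspace_0[OF subspace_supp_in])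
  next
    case (add x M)
    obtain i m where x: "x = (i, m)" by force
    have m: "m \<ge> 1" and M: "M \<in> letters" using add.prems by (auto simp: letters_def x)
    have St: "Bm M \<in> St" using Bm_states[OF M] by (rule states_on_St)
    note IH = add.IH[OF M, rule_format]
    have low: "bs i n v \<in> degs {..k - 1}" if "v \<in> degs {..k}" "n \<ge> 0" for v k n
      by (rule degs_mono[OF _ bos_degs_nonneg[OF that]]) auto
    have up': "bs i (- int m - int j) v \<in> degs {..k + 1}" if "v \<in> degs {..k}" for v k j
    proof -
      have "bs i (- int (m + j)) v \<in> degs ((\<lambda>d. d + 1) ` {..k})"
        by (rule bos_degs_neg[OF that]) (use m in simp)
      moreover have "- int (m + j) = - int m - int j" by simp
      moreover have "(\<lambda>d. d + 1) ` {..k} \<subseteq> {..k + 1}" by auto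
      ultimately show ?thesis using degs_mono by metis
    qed
    define t where "t v n j = fock_scale (of_nat ((m + j - 1) choose j))
      (bs i (- int m - int j) (Y (Bm M) (n + int j) v)
        - fock_scale ((-1) ^ m) (Y (Bm M) (n - int m - int j) (bs i (int j) v)))" for v n j
    have BY: "Y (Bm (add_mset x M)) n v = Sum_any (t v n)" if "v \<in> St" for n v
    proof -
      have "Bm (add_mset x M) = bs i (- int m) (Bm M)" using m by (simp add: Bm_simps x bos_neg)
      then show ?thesis unfolding t_def by (simp only: Y_bos_iterate[OF St that m])
    qed
    have t1: "t v n j \<in> degs {..k + int (size M) + 1}" if v: "v \<in> St" "v \<in> degs {..k}" for v k n j
    proof -
      have "Y (Bm M) (n - int m - int j) (bs i (int j) v) \<in> degs {..k - 1 + int (size M)}"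
        using IH[OF bos_St[OF v(1)] low[OF v(2)], of "int j" "n - int m - int j"] by simp
      then have "Y (Bm M) (n - int m - int j) (bs i (int j) v) \<in> degs {..k + int (size M) + 1}"
        by (rule degs_mono[rotated]) auto
      then show ?thesis unfolding t_def
        using up'[of _ "k + int (size M)"] IH[OF v, of "n + int j"]
        by (intro fs.subspace_scale fs.subspace_diff subspace_supp_in) auto
    qed
    \<comment> \<open>A nonnegative inner mode loses two degrees by induction and the new boson
      regains one; in the second summand the annihilation operator loses one.\<close>
    have t2: "t v n j \<in> degs {..k + int (size M) - 1}" if v: "v \<in> St" "v \<in> degs {..k}" and n: "n + int j \<ge> 0" for v k n j
    proof -
      have "Y (Bm M) (n - int m - int j) (bs i (int j) v) \<in> degs {..k - 1 + int (size M)}"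
        using IH[OF bos_St[OF v(1)] low[OF v(2)], of "int j" "n - int m - int j"] by simp
      then have a: "Y (Bm M) (n - int m - int j) (bs i (int j) v) \<in> degs {..k + int (size M) - 1}"
        by (rule degs_mono[rotated]) auto
      have "bs i (- int m - int j) (Y (Bm M) (n + int j) v) \<in> degs {..k + int (size M) - 2 + 1}"
        using IH[OF v, of "n + int j"] n by (intro up') auto
      then have "bs i (- int m - int j) (Y (Bm M) (n + int j) v) \<in> degs {..k + int (size M) - 1}" by simp
      then show ?thesis unfolding t_def using a
        by (intro fs.subspace_scale fs.subspace_diff subspace_supp_in)
    qed
    show ?case
    proof (intro allI impI conjI)
      fix k n v assume v: "v \<in> St" "v \<in> degs {..k}"
      have sz: "k + int (size (add_mset x M)) = k + int (size M) + 1" by simp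
      show "Y (Bm (add_mset x M)) n v \<in> degs {..k + int (size (add_mset x M))}"
        unfolding BY[OF v(1)] sz by (intro Sum_any_mem subspace_supp_in t1 v)
      show "Y (Bm (add_mset x M)) n v \<in> degs {..k + int (size (add_mset x M)) - 2}" if "n \<ge> 0"
      proof -
        have "Sum_any (t v n) \<in> degs {..k + int (size M) - 1}"
          by (intro Sum_any_mem subspace_supp_in t2 v) (use that in simp)
        then show ?thesis unfolding BY[OF v(1)] by simp
      qed
      have ev: "ev0 (t v (-1))"
        unfolding t_def by (intro ev0_scale ev0_diff ev0_Y_bos) (rule ev0_cong0[OF ev0_Y[of "Bm M" "-1" v]], simp add: flin_zero[OF flin_bos])
      have a: "Sum_any (\<lambda>j. t v (-1) (Suc j)) \<in> degs {..k + int (size M) - 1}"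
        by (intro Sum_any_mem subspace_supp_in t2 v) simp
      have "t v (-1) 0 = bs i (- int m) (Y (Bm M) (-1) v)"
        by (simp add: t_def)
      then have b: "t v (-1) 0 - Bm (add_mset x M) * v = bs i (- int m) (Y (Bm M) (-1) v - Bm M * v)"
        using m by (simp add: bos_neg Bm_simps x right_diff_distrib mult.assoc)
      have "Y (Bm M) (-1) v - Bm M * v \<in> degs {..k + int (size M) - 2}" using IH[OF v] by blast
      from up'[OF this, of 0] have "t v (-1) 0 - Bm (add_mset x M) * v \<in> degs {..k + int (size M) - 1}"
        unfolding b by simp
      moreover have "Y (Bm (add_mset x M)) (-1) v - Bm (add_mset x M) * v = (t v (-1) 0 - Bm (add_mset x M) * v) + Sum_any (\<lambda>j. t v (-1) (Suc j))"
        unfolding BY[OF v(1)] Sum_any_Suc[OF ev] by simp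
      ultimately have "Y (Bm (add_mset x M)) (-1) v - Bm (add_mset x M) * v \<in> degs {..k + int (size M) - 1}"
        using a by (simp only: fs.subspace_add[OF subspace_supp_in])
      then show "Y (Bm (add_mset x M)) (-1) v - Bm (add_mset x M) * v \<in> degs {..k + int (size (add_mset x M)) - 2}"
        by simp
    qed
  qed
  then show "Y (Bm M) n v \<in> degs {..k + int (size M)}"
    and "n \<ge> 0 \<Longrightarrow> Y (Bm M) n v \<in> degs {..k + int (size M) - 2}"
    and "Y (Bm M) (-1) v - Bm M * v \<in> degs {..k + int (size M) - 2}"
    using assms(2,3) by auto
qed

lemma theta_image_grade_span:
  fixes g :: "(nat \<times> nat) multiset \<Rightarrow> nat"
  assumes g: "\<And>M. M \<in> letters \<Longrightarrow> Bm M \<in> supp_in {K. g K = g M}"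
    and A: "A \<subseteq> letters" and v: "v \<in> theta ` supp_in A" "v \<in> supp_in {K. g K \<in> B}"
  shows "v \<in> theta ` supp_in {M \<in> A. g M \<in> B}"
proof -
  obtain p where p: "p \<in> supp_in A" "v = theta p" using v by blast
  have "p \<in> supp_in letters" using p supp_in_mono[OF A] by blast
  then have "p \<in> supp_in {K. g K \<in> B}"
    using theta_inv_grade[of g p B] g v(2) p(2) by simp
  then have "p \<in> supp_in {M \<in> A. g M \<in> B}" using p by (auto simp: supp_in_def)
  then show ?thesis using p by blast
qed

lemma Bm_wt_supp: "M \<in> letters \<Longrightarrow> Bm M \<in> supp_in {K. wt K = wt M}"
  using Bm_graded[of M] by simp

lemma Bm_size_supp: "M \<in> letters \<Longrightarrow> Bm M \<in> supp_in {K. size K = size M}"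
  using Bm_degs[of M] by simp

lemma graded_piece_span:
  assumes "A \<subseteq> letters" "v \<in> fs.span (Bm ` A)" "v \<in> graded {int d}"
  shows "v \<in> fs.span (Bm ` {M \<in> A. wt M = d})"
  using theta_image_grade_span[of wt A v "{d}", OF Bm_wt_supp assms(1)] assms(2,3)
  by (simp add: theta_image_span)

lemma graded_deg_piece_span:
  assumes "A \<subseteq> letters" "v \<in> fs.span (Bm ` A)" "v \<in> graded {int d}" "v \<in> degs {..int k}"
  shows "v \<in> fs.span (Bm ` {M \<in> A. wt M = d \<and> size M \<le> k})"
  using theta_image_grade_span[of size "{M \<in> A. wt M = d}" v "{..k}", OF Bm_size_supp] 
    graded_piece_span[OF assms(1-3)] assms(1,4)
  by (auto simp: theta_image_span)

section \<open>Generation from generation modulo decomposable vectors\<close>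

definition Wd :: "nat \<Rightarrow> fock set" where "Wd d = WW \<inter> graded {int d}"

lemma Wd_span: "Wd d = fs.span (Bm ` {M \<in> Wkeys. wt M = d})"
proof (intro subset_antisym subsetI)
  fix v assume "v \<in> Wd d"
  then show "v \<in> fs.span (Bm ` {M \<in> Wkeys. wt M = d})"
    unfolding Wd_def WW_span by (intro graded_piece_span) (auto simp: Wkeys_def Vkeys_def)
next
  fix v assume "v \<in> fs.span (Bm ` {M \<in> Wkeys. wt M = d})"
  moreover have "fs.span (Bm ` {M \<in> Wkeys. wt M = d}) \<subseteq> Wd d"
    unfolding Wd_def
  proof (intro fs.span_minimal fs.subspace_inter subspace_WW subspace_supp_in image_subsetI)
    fix M assume M: "M \<in> {M \<in> Wkeys. wt M = d}"
    then have "Bm M \<in> WW" unfolding WW_span by (intro fs.span_base) auto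
    moreover have "M \<in> letters" using M by (auto simp: Wkeys_def Vkeys_def)
    then have "Bm M \<in> graded {int d}" using Bm_graded[of M] M by auto
    ultimately show "Bm M \<in> WW \<inter> graded {int d}" by blast
  qed
  ultimately show "v \<in> Wd d" by blast
qed

lemma Wd_0: "Wd 0 = fs.span {1}"
proof -
  have "M = {#}" if "M \<in> Wkeys" "wt M = 0" for M
    using that by (cases M) (auto simp: Wkeys_def Vkeys_def letters_def)
  then have "{M \<in> Wkeys. wt M = 0} = {{#}}" by (auto simp: Wkeys_def Vkeys_def letters_def)
  then show ?thesis by (simp add: Wd_span Bm_simps)
qed

lemma subspace_Wd: "fs.subspace (Wd d)"
  by (simp add: Wd_span)

lemma Wd_WW: "v \<in> Wd d \<Longrightarrow> v \<in> WW" and Wd_graded: "v \<in> Wd d \<Longrightarrow> v \<in> graded {int d}"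
  by (simp_all add: Wd_def)

lemma Wd_St: "v \<in> Wd d \<Longrightarrow> v \<in> St"
  using Wd_WW WW_VV VV_St by blast

lemma Y_Wd:
  assumes "a \<in> Wd d" "b \<in> Wd e" "int d + int e - n - 1 = int f"
  shows "Y a n b \<in> Wd f"
  using assms Y_graded1[of a "int d" b "int e" n] WW_closed[of a b n] by (auto simp: Wd_def)

text \<open>The decomposable vectors of weight \<open>d\<close>.\<close>

definition Dec :: "nat \<Rightarrow> fock set" where
  "Dec d = fs.span {Y u (- int k) w | u w k e f. u \<in> Wd e \<and> w \<in> Wd f \<and> 0 < e \<and> e < d \<and> k \<ge> 1 \<and> e + f + k = d + 1}"

text \<open>Monomials with their weight recorded. The side condition states the weight of the new
  vector, e + a + n - 1, without subtraction.\<close>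

inductive mons :: "fock set \<Rightarrow> nat \<Rightarrow> fock \<Rightarrow> bool" for S where
  mons_one: "mons S 0 1"
| mons_step: "s \<in> S \<Longrightarrow> s \<in> Wd a \<Longrightarrow> a \<ge> 1 \<Longrightarrow> n \<ge> 1 \<Longrightarrow> mons S e u \<Longrightarrow> d + 1 = e + a + n \<Longrightarrow> mons S d (Y s (- int n) u)"

lemma mons_Wd: "mons S d u \<Longrightarrow> u \<in> Wd d"
proof (induction rule: mons.induct)
  case mons_one
  then show ?case by (simp add: Wd_0 fs.span_base)
next
  case (mons_step s a n e u d)
  then show ?case by (intro Y_Wd[of s a u e]) auto
qed

lemma mons_0: "mons S d u \<Longrightarrow> d = 0 \<Longrightarrow> u = 1"
  by (induction rule: mons.induct) auto

lemma mons_monomial: "mons S d u \<Longrightarrow> u \<in> monomial (sub_voa U \<omega>) ` lists (S \<times> {1..})"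
proof (induction rule: mons.induct)
  case mons_one
  have "monomial (sub_voa U \<omega>) [] = 1" by (simp add: monomial_def)
  then show ?case by (metis image_eqI lists.Nil)
next
  case (mons_step s a n e u d)
  then obtain xs where xs: "xs \<in> lists (S \<times> {1..})" "u = monomial (sub_voa U \<omega>) xs" by blast
  have "monomial (sub_voa U \<omega>) ((s, n) # xs) = Y s (- int n) u"
    by (simp add: monomial_def xs(2))
  moreover have "(s, n) # xs \<in> lists (S \<times> {1..})" using xs mons_step by auto
  ultimately show ?case by (metis image_eqI)
qed

lemma mons_span_step:
  assumes "s \<in> S" "s \<in> Wd a" "a \<ge> 1" "n \<ge> 1" "w \<in> fs.span {u. mons S e u}" "d + 1 = e + a + n"
  shows "Y s (- int n) w \<in> fs.span {u. mons S d u}"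
proof -
  have "fs.span {u. mons S e u} \<subseteq> {w. Y s (- int n) w \<in> fs.span {u. mons S d u}}"
    by (intro fs.span_minimal module_hom.subspace_linear_preimage[OF flin_Y] fs.subspace_span)
      (use assms in \<open>auto intro!: fs.span_base mons_step\<close>)
  then show ?thesis using assms(5) by blast
qed

text \<open>A Nakayama argument: by induction on the weight, the factors of a decomposable vector
  are combinations of monomials, and the iterate formula rewrites such a product until a single
  generator stands in front of a vector of smaller weight.\<close>

lemma strong_generation_criterion:
  assumes gen: "\<And>d. d \<ge> 1 \<Longrightarrow> Wd d \<subseteq> fs.span (Dec d \<union> (S \<inter> Wd d))"
  shows "Wd d \<subseteq> fs.span {u. mons S d u}"
proof (induction d rule: less_induct)
  case (less d)
  let ?G = "\<lambda>e. fs.span {u. mons S e u}"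
  show ?case
  proof (cases "d = 0")
    case True
    then show ?thesis unfolding True Wd_0 by (intro fs.span_mono) (auto intro: mons_one)
  next
    case False
    have small: "Y s (- int n) w \<in> ?G d" if "s \<in> S" "s \<in> Wd a" "a \<ge> 1" "n \<ge> 1" "w \<in> WW" "w \<in> graded {f}" "int d + 1 = f + int a + int n" for s a n w f
    proof (cases "f < 0")
      case True
      then have "w = 0" using graded_neg[OF _ that(6)] by simp
      then show ?thesis by (simp add: fs.span_zero)
    next
      case nn: False
      then have "w \<in> Wd (nat f)" using that by (simp add: Wd_def)
      moreover have "nat f < d" using that nn by linarith
      ultimately have "w \<in> ?G (nat f)" using less.IH by blast
      then show ?thesis using that nn by (intro mons_span_step[of s S a n w "nat f" d]) auto
    qed
    \<comment> \<open>Induction on the monomial \<open>u\<close>: in the iterate formula for its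
      first letter \<open>s\<close>, one summand has \<open>s\<close> in front, the other the
      shorter monomial.\<close>
    have main: "mons S e u \<Longrightarrow> e \<ge> 1 \<Longrightarrow> w \<in> Wd f \<Longrightarrow> k \<ge> 1 \<Longrightarrow> e + f + k = d + 1 \<Longrightarrow> Y u (- int k) w \<in> ?G d" for u w k e f
    proof (induction arbitrary: w k f rule: mons.induct)
      case (mons_step s a n e' u e)
      have s: "s \<in> St" "s \<in> WW" using mons_step Wd_St Wd_WW by auto
      have u: "u \<in> St" "u \<in> WW" "u \<in> Wd e'" using mons_Wd[OF mons_step(5)] Wd_St Wd_WW by auto
      have w: "w \<in> St" "w \<in> WW" using mons_step Wd_St Wd_WW by auto
      have "B_lhs (- int n) 0 (- int k) s u w = Sum_any (\<lambda>i::nat. if i = 0 then Y (Y s (- int n) u) (- int k) w else 0)"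
        unfolding B_lhs_def by (intro Sum_any.cong) (auto simp: gbinomial_0_left)
      then have "Y (Y s (- int n) u) (- int k) w = B_rhs (- int n) 0 (- int k) s u w"
        using borcherds[OF s(1) u(1) w(1), of "- int n" 0 "- int k"] by simp
      also have "\<dots> \<in> ?G d"
        unfolding B_rhs_def
      proof (intro Sum_any_mem fs.subspace_span fs.span_scale fs.span_diff)
        fix i
        have g: "Y u (- int k + int i) w \<in> graded {int e' + int f - (- int k + int i) - 1}"
          by (rule Y_graded1[OF Wd_graded[OF u(3)] Wd_graded[OF mons_step(9)]])
        have "Y s (- int (n + i)) (Y u (- int k + int i) w) \<in> ?G d"
          by (rule small[OF mons_step(1,2,3) _ _ g]) (use mons_step u w WW_closed in auto)
        moreover have "- int n + 0 - int i = - int (n + i)" by simp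
        ultimately show "Y s (- int n + 0 - int i) (Y u (- int k + int i) w) \<in> ?G d" by simp
        have idx: "- int n + - int k - int i = - int (n + k + i)" by simp
        have g: "Y s (0 + int i) w \<in> graded {int a + int f - (0 + int i) - 1}"
          by (rule Y_graded1[OF Wd_graded[OF mons_step(2)] Wd_graded[OF mons_step(9)]])
        show "Y u (- int n + - int k - int i) (Y s (0 + int i) w) \<in> ?G d"
        \<comment> \<open>Weight 0 means \<open>u = 1\<close>, whose only nonzero mode is -1,
          whereas the mode here is at most -2.\<close>
        proof (cases "e' = 0")
          case True
          then have "u = 1" using mons_0[OF mons_step(5)] by simp
          then show ?thesis unfolding idx using mons_step by (simp add: Y_one fs.span_zero)
        next
          case e': False
          show ?thesis
          proof (cases "int a + int f - int i - 1 < 0")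
            case True
            then have "Y s (0 + int i) w = 0" using graded_neg[OF _ g] by simp
            then show ?thesis by (simp add: fs.span_zero)
          next
            case nn: False
            define f' where "f' = nat (int a + int f - int i - 1)"
            have "Y s (0 + int i) w \<in> Wd f'"
              using g s w WW_closed nn by (simp add: Wd_def f'_def)
            then show ?thesis unfolding idx
              by (rule mons_step.IH[rotated]) (use e' nn mons_step in \<open>auto simp: f'_def\<close>)
          qed
        qed
      qed
      finally show ?case .
    qed simp
    have "Dec d \<subseteq> ?G d"
      unfolding Dec_def
    proof (intro fs.span_minimal fs.subspace_span subsetI)
      fix x assume "x \<in> {Y u (- int k) w | u w k e f. u \<in> Wd e \<and> w \<in> Wd f \<and> 0 < e \<and> e < d \<and> k \<ge> 1 \<and> e + f + k = d + 1}"
      then obtain u w k e f where x: "x = Y u (- int k) w" "u \<in> Wd e" "w \<in> Wd f" "0 < e" "e < d" "k \<ge> 1" "e + f + k = d + 1"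
        by blast
      have "u \<in> ?G e" using less.IH x by blast
      moreover have "?G e \<subseteq> {u. Y u (- int k) w \<in> ?G d}"
        by (intro fs.span_minimal module_hom.subspace_linear_preimage[OF flin_Y_left] fs.subspace_span subsetI CollectI)
          (use main x in auto)
      ultimately show "x \<in> ?G d" using x by blast
    qed
    moreover have "S \<inter> Wd d \<subseteq> ?G d"
    proof
      fix s assume s: "s \<in> S \<inter> Wd d"
      then have "mons S d (Y s (- int 1) 1)" using False by (intro mons_step[of s S d 1 0 1] mons_one) auto
      moreover have "Y s (- int 1) 1 = s" using s Wd_St[of s d] Y_vac(2)[of s] by simp
      ultimately show "s \<in> ?G d" by (metis fs.span_base mem_Collect_eq)
    qed
    ultimately have "fs.span (Dec d \<union> (S \<inter> Wd d)) \<subseteq> ?G d"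
      by (intro fs.span_minimal fs.subspace_span) auto
    then show ?thesis using gen[of d] False by auto
  qed
qed

section \<open>Translation relations and quantum corrections for quadratics and cubics\<close>

section \<open>Reduction modulo decomposable vectors\<close>

lemma subspace_Dec: "fs.subspace (Dec d)"
  by (simp add: Dec_def)

lemma Dec_prod: "u \<in> Wd e \<Longrightarrow> w \<in> Wd f \<Longrightarrow> e \<ge> 1 \<Longrightarrow> f \<ge> 1 \<Longrightarrow> Y u (-1) w \<in> Dec (e + f)"
  unfolding Dec_def
  by (rule fs.span_base, rule CollectI, rule exI[of _ u], rule exI[of _ w], rule exI[of _ 1]) auto

lemma Dec_T: "w \<in> Wd e \<Longrightarrow> e \<ge> 1 \<Longrightarrow> T w \<in> Dec (e + 1)"
proof -
  assume w: "w \<in> Wd e" "e \<ge> 1"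
  have "1 \<in> Wd 0" by (simp add: Wd_0 fs.span_base)
  then show ?thesis
    unfolding Dec_def T_def using w
    by (intro fs.span_base CollectI exI[of _ w] exI[of _ 1] exI[of _ 2] exI[of _ e] exI[of _ 0]) auto
qed

lemma Bm_Wd: "M \<in> Wkeys \<Longrightarrow> wt M = d \<Longrightarrow> Bm M \<in> Wd d"
  unfolding Wd_span by (intro fs.span_base) auto

lemma ev0_delta: "ev0 (\<lambda>j. if j = a then f j else 0)"
  unfolding ev0_def by (rule exI[of _ "Suc a"]) auto

lemma Sum_any_delta: "Sum_any (\<lambda>j. if j = a then f j else 0) = (f a :: fock)"
  by (rule Sum_any.delta)

text \<open>Both orders of the dual eigenbosons share all computations, so the cubics in either of
  them are treated at once.\<close>

locale dual_pair =
  fixes s t :: nat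
  assumes st: "(s = 1 \<and> t = 2) \<or> (s = 2 \<and> t = 1)"
begin

definition x :: "nat \<Rightarrow> fock \<Rightarrow> fock" where "x n = bs s (- int n)"
definition y :: "nat \<Rightarrow> fock \<Rightarrow> fock" where "y n = bs t (- int n)"

lemma flin_x: "flin (x n)" and flin_y: "flin (y n)"
  unfolding x_def y_def by (rule flin_bos)+

lemma x_scale: "x n (fock_scale c v) = fock_scale c (x n v)" "y n (fock_scale c v) = fock_scale c (y n v)"
  by (simp_all add: flin_scale[OF flin_x] flin_scale[OF flin_y])

lemma x_add: "x n (u + v) = x n u + x n v" "y n (u + v) = y n u + y n v"
  by (simp_all add: flin_add[OF flin_x] flin_add[OF flin_y])

lemma x_zero [simp]: "x n 0 = 0" "y n 0 = 0"
  by (simp_all add: flin_zero[OF flin_x] flin_zero[OF flin_y])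

lemma pair_st [simp]: "pair (cf s) (cf t) = 1" "pair (cf t) (cf s) = 1" "pair (cf s) (cf s) = 0" "pair (cf t) (cf t) = 0"
  using st by (auto simp: pair_cf)

lemma xx_comm: "x a (x b v) = x b (x a v)"
  unfolding x_def y_def by (subst bos_commutator) simp

lemma xy_comm: "a \<ge> 1 \<Longrightarrow> x a (y b v) = y b (x a v)"
  unfolding x_def y_def by (subst bos_commutator) simp

lemma bt_x: "c \<ge> 1 \<Longrightarrow> bs t (int j) (x c v) = x c (bs t (int j) v) + (if j = c then fock_scale (of_nat c) v else 0)"
  unfolding x_def y_def by (subst bos_commutator) auto

lemma bt_y: "c \<ge> 1 \<Longrightarrow> bs t (int j) (y c v) = y c (bs t (int j) v)"
  unfolding x_def y_def by (subst bos_commutator) auto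

lemma bs_x: "c \<ge> 1 \<Longrightarrow> bs s (int j) (x c v) = x c (bs s (int j) v)"
  unfolding x_def y_def by (subst bos_commutator) auto

lemma bs_y: "c \<ge> 1 \<Longrightarrow> bs s (int j) (y c v) = y c (bs s (int j) v) + (if j = c then fock_scale (of_nat c) v else 0)"
  unfolding x_def y_def by (subst bos_commutator) auto

text \<open>The iterate formula at mode -1: its term at \<open>j = 0\<close> is the product of
  polynomials, the others are the contractions that act as quantum corrections.\<close>

lemma Y_q:
  assumes "v \<in> St" "a \<ge> 1"
  shows "Y (x a (y 1 1)) (-1) v = x a (y 1 v) + Sum_any (\<lambda>j. fock_scale (of_nat ((a + j) choose (j + 1)))
     (x (a + j + 1) (bs t (int j) v) - fock_scale ((-1) ^ a) (y (a + j + 2) (bs s (int (j + 1)) v))))"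
proof -
  have y1: "y 1 1 \<in> St" unfolding y_def by (intro bos_St one_states_on)
  have Yy: "Y (y 1 1) r w = bs t r w" if "w \<in> St" for r w using Y_bos_1[OF that, of "cf t" r] by (simp add: y_def)
  have bS: "bs s r v \<in> St" for r using assms(1) by (rule bos_St)
  define f where "f j = fock_scale (of_nat ((a + j - 1) choose j)) (bs s (- int a - int j) (bs t (-1 + int j) v) -
      fock_scale ((-1) ^ a) (bs t (- 1 - int a - int j) (bs s (int j) v)))" for j
  have "ev0 (\<lambda>j. bs t (-1 + int (j + 1)) v)" using ev0_bos[of "cf t" v] by simp
  then obtain N where N: "\<And>j. j \<ge> N \<Longrightarrow> bs t (-1 + int (j + 1)) v = 0" unfolding ev0_def by blast
  have "ev0 (\<lambda>j. bs t (-1 + int j) v)" unfolding ev0_def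
  proof (rule exI[of _ "N + 1"], intro allI impI)
    fix j assume "N + 1 \<le> j"
    then show "bs t (-1 + int j) v = 0" using N[of "j - 1"] by (simp add: of_nat_diff)
  qed
  then obtain N1 where N1: "\<And>j. j \<ge> N1 \<Longrightarrow> bs t (-1 + int j) v = 0" unfolding ev0_def by blast
  obtain N2 where N2: "\<And>j. j \<ge> N2 \<Longrightarrow> bs s (int j) v = 0" using ev0_bos[of "cf s" v] unfolding ev0_def by blast
  have f: "ev0 f" unfolding ev0_def
  proof (rule exI[of _ "max N1 N2"], intro allI impI)
    fix j assume "max N1 N2 \<le> j"
    then have "bs t (-1 + int j) v = 0" "bs s (int j) v = 0" using N1[of j] N2[of j] by simp_all
    then show "f j = 0" unfolding f_def by (simp only: flin_zero[OF flin_bos] fs.scale_zero_right diff_zero)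
  qed
  have "Y (x a (y 1 1)) (-1) v = Sum_any f"
    unfolding x_def Y_bos_iterate[OF y1 assms] f_def by (simp only: Yy assms(1) bS)
  also have "\<dots> = f 0 + Sum_any (\<lambda>j. f (Suc j))" by (rule Sum_any_Suc[OF f])
  also have "f 0 = x a (y 1 v)" by (simp add: f_def x_def y_def flin_zero[OF flin_bos])
  also have "(\<lambda>j. f (Suc j)) = (\<lambda>j. fock_scale (of_nat ((a + j) choose (j + 1)))
     (x (a + j + 1) (bs t (int j) v) - fock_scale ((-1) ^ a) (y (a + j + 2) (bs s (int (j + 1)) v))))"
  proof
    fix j
    have "- int a - int (Suc j) = - int (a + j + 1)" "-1 + int (Suc j) = int j" "- 1 - int a - int (Suc j) = - int (a + j + 2)"
      "a + Suc j - 1 = a + j" "Suc j = j + 1" by simp_all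
    then show "f (Suc j) = fock_scale (of_nat ((a + j) choose (j + 1)))
     (x (a + j + 1) (bs t (int j) v) - fock_scale ((-1) ^ a) (y (a + j + 2) (bs s (int (j + 1)) v)))"
      unfolding f_def x_def y_def by (simp only:)
  qed
  finally show ?thesis .
qed

lemma xy_St: "v \<in> St \<Longrightarrow> x n v \<in> St" "v \<in> St \<Longrightarrow> y n v \<in> St"
  unfolding x_def y_def by (rule bos_St, assumption)+

text \<open>Each half of the correction contracts with a single letter, at \<open>j = c\<close> and
  at \<open>j = e - 1\<close>.\<close>

lemma Y_q_quad:
  assumes "a \<ge> 1" "c \<ge> 1" "e \<ge> 1"
  shows "Y (x a (y 1 1)) (-1) (x c (y e 1)) = x a (y 1 (x c (y e 1)))
    + fock_scale (of_nat ((a + c) choose (c + 1)) * of_nat c) (x (a + c + 1) (y e 1))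
    - fock_scale ((-1) ^ a * of_nat ((a + e - 1) choose e) * of_nat e) (y (a + e + 1) (x c 1))"
proof -
  have v: "x c (y e 1) \<in> St" by (intro xy_St one_states_on)
  have b1: "bs t (int j) (x c (y e 1)) = (if j = c then fock_scale (of_nat c) (y e 1) else 0)" for j
    using assms by (simp add: bt_x bt_y bos_one)
  have b2: "bs s (int (j + 1)) (x c (y e 1)) = (if j = e - 1 then fock_scale (of_nat e) (x c 1) else 0)" for j
    unfolding bs_x[OF assms(2)] bs_y[OF assms(3)] using assms by (auto simp: bos_one x_scale)
  have e: "a + (e - 1) + 2 = a + e + 1" "a + (e - 1) = a + e - 1" "e - 1 + 1 = e" using assms by auto
  have "Sum_any (\<lambda>j. fock_scale (of_nat ((a + j) choose (j + 1)))
     (x (a + j + 1) (bs t (int j) (x c (y e 1))) - fock_scale ((-1) ^ a) (y (a + j + 2) (bs s (int (j + 1)) (x c (y e 1)))))) =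
    Sum_any (\<lambda>j. (if j = c then fock_scale (of_nat ((a + j) choose (j + 1)) * of_nat c) (x (a + j + 1) (y e 1)) else 0)
      - (if j = e - 1 then fock_scale (of_nat ((a + j) choose (j + 1)) * (-1) ^ a * of_nat e) (y (a + j + 2) (x c 1)) else 0))"
    unfolding b1 b2 by (intro Sum_any.cong) (auto simp: x_scale fs.scale_right_diff_distrib mult_ac)
  also have "\<dots> = fock_scale (of_nat ((a + c) choose (c + 1)) * of_nat c) (x (a + c + 1) (y e 1))
    - fock_scale (of_nat ((a + (e - 1)) choose (e - 1 + 1)) * (-1) ^ a * of_nat e) (y (a + (e - 1) + 2) (x c 1))"
    by (subst Sum_any_diff[OF ev0_delta ev0_delta]) (simp only: Sum_any_delta)
  finally have "Sum_any (\<lambda>j. fock_scale (of_nat ((a + j) choose (j + 1)))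
     (x (a + j + 1) (bs t (int j) (x c (y e 1))) - fock_scale ((-1) ^ a) (y (a + j + 2) (bs s (int (j + 1)) (x c (y e 1)))))) =
    fock_scale (of_nat ((a + c) choose (c + 1)) * of_nat c) (x (a + c + 1) (y e 1))
    - fock_scale ((-1) ^ a * of_nat ((a + e - 1) choose e) * of_nat e) (y (a + e + 1) (x c 1))"
    unfolding e(1) unfolding e(2,3) by (simp only: mult_ac)
  then show ?thesis unfolding Y_q[OF v assms(1)] by (simp only: add_diff_eq)
qed

text \<open>Only \<open>y\<close> finds partners, namely the three letters \<open>x\<close>; the two
  of index 1 together give the factor 2.\<close>

lemma Y_q_cubic:
  assumes "a \<ge> 1" "b \<ge> 1"
  shows "Y (x a (y 1 1)) (-1) (x b (x 1 (x 1 1))) = x a (y 1 (x b (x 1 (x 1 1))))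
    + fock_scale (of_nat ((a + b) choose (b + 1)) * of_nat b) (x (a + b + 1) (x 1 (x 1 1)))
    + fock_scale (2 * of_nat ((a + 1) choose 2)) (x (a + 2) (x b (x 1 1)))"
proof -
  have v: "x b (x 1 (x 1 1)) \<in> St" by (intro xy_St one_states_on)
  have b1: "bs t (int j) (x b (x 1 (x 1 1))) = (if j = b then fock_scale (of_nat b) (x 1 (x 1 1)) else 0)
      + (if j = 1 then fock_scale 2 (x b (x 1 1)) else 0)" for j
  proof -
    have c1: "bs t (int j) (x 1 w) = x 1 (bs t (int j) w) + (if j = 1 then fock_scale (of_nat 1) w else 0)" for w
      by (rule bt_x) simp
    have "bs t (int j) (x 1 (x 1 1)) = (if j = 1 then fock_scale 2 (x 1 1) else 0)"
    proof (cases "j = 1")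
      case True
      have "bs t (int j) (x 1 (x 1 1)) = x 1 1 + x 1 1" unfolding c1 using True by (simp add: bos_one)
      then show ?thesis using True fs.scale_left_distrib[of 1 1 "x 1 1"] by simp
    next
      case False
      show ?thesis unfolding c1 using False by (simp add: bos_one)
    qed
    then show ?thesis unfolding bt_x[OF assms(2)] by (simp add: x_scale)
  qed
  have b2: "bs s (int (j + 1)) (x b (x 1 (x 1 1))) = 0" for j
    using assms by (simp only: bs_x order_refl) (simp add: bos_one)
  have ch: "(a + 1) choose (1 + 1) = (a + 1) choose 2" by (simp only: one_add_one)
  have "Sum_any (\<lambda>j. fock_scale (of_nat ((a + j) choose (j + 1)))
     (x (a + j + 1) (bs t (int j) (x b (x 1 (x 1 1)))) - fock_scale ((-1) ^ a) (y (a + j + 2) (bs s (int (j + 1)) (x b (x 1 (x 1 1))))))) =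
    Sum_any (\<lambda>j. (if j = b then fock_scale (of_nat ((a + j) choose (j + 1)) * of_nat b) (x (a + j + 1) (x 1 (x 1 1))) else 0)
      + (if j = 1 then fock_scale (of_nat ((a + j) choose (j + 1)) * 2) (x (a + j + 1) (x b (x 1 1))) else 0))"
    unfolding b1 b2 by (intro Sum_any.cong) (auto simp: x_scale x_add fs.scale_right_distrib)
  also have "\<dots> = fock_scale (of_nat ((a + b) choose (b + 1)) * of_nat b) (x (a + b + 1) (x 1 (x 1 1)))
    + fock_scale (of_nat ((a + 1) choose (1 + 1)) * 2) (x (a + 1 + 1) (x b (x 1 1)))"
    by (subst Sum_any_add[OF ev0_delta ev0_delta]) (simp only: Sum_any_delta)
  finally show ?thesis unfolding Y_q[OF v assms(1)] ch by (simp add: mult_ac)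
qed

lemma T_x: "n \<ge> 1 \<Longrightarrow> v \<in> St \<Longrightarrow> T (x n v) = x n (T v) + fock_scale (of_nat n) (x (n + 1) v)"
proof -
  assume "v \<in> St"
  moreover have "- int n - 1 = - int (n + 1)" by simp
  ultimately have "bs s (- int n) (T v) = T (bs s (- int n) v) + fock_scale (of_int (- int n)) (bs s (- int (n + 1)) v)"
    using bos_T[of v "cf s" "- int n"] by (simp only:)
  then show ?thesis by (simp only: x_def) simp
qed

lemma T_y: "n \<ge> 1 \<Longrightarrow> v \<in> St \<Longrightarrow> T (y n v) = y n (T v) + fock_scale (of_nat n) (y (n + 1) v)"
proof -
  assume "v \<in> St"
  moreover have "- int n - 1 = - int (n + 1)" by simp
  ultimately have "bs t (- int n) (T v) = T (bs t (- int n) v) + fock_scale (of_int (- int n)) (bs t (- int (n + 1)) v)"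
    using bos_T[of v "cf t" "- int n"] by (simp only:)
  then show ?thesis by (simp only: y_def) simp
qed

lemma quad_Bm: "a \<ge> 1 \<Longrightarrow> b \<ge> 1 \<Longrightarrow> x a (y b 1) = Bm {#(s, a), (t, b)#}"
  by (simp add: Bm_simps bos_neg x_def y_def)

lemma cubic_Bm: "a \<ge> 1 \<Longrightarrow> b \<ge> 1 \<Longrightarrow> c \<ge> 1 \<Longrightarrow> x a (x b (x c 1)) = Bm {#(s, a), (s, b), (s, c)#}"
  by (simp add: Bm_simps bos_neg x_def y_def)

lemma quad_Wd: "a \<ge> 1 \<Longrightarrow> b \<ge> 1 \<Longrightarrow> x a (y b 1) \<in> Wd (a + b)"
  unfolding quad_Bm by (rule Bm_Wd) (use st in \<open>auto simp: Wkeys_def Vkeys_def letters_def numeral_3_eq_3[symmetric]\<close>)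

lemma cubic_Wd: "a \<ge> 1 \<Longrightarrow> b \<ge> 1 \<Longrightarrow> c \<ge> 1 \<Longrightarrow> x a (x b (x c 1)) \<in> Wd (a + b + c)"
proof -
  have "3 dvd s + (s + s)" by presburger
  then show "a \<ge> 1 \<Longrightarrow> b \<ge> 1 \<Longrightarrow> c \<ge> 1 \<Longrightarrow> x a (x b (x c 1)) \<in> Wd (a + b + c)"
    unfolding cubic_Bm by (intro Bm_Wd) (use st in \<open>auto simp: Wkeys_def Vkeys_def letters_def\<close>)
qed

lemma quad_T:
  assumes "a \<ge> 1" "b \<ge> 1"
  shows "fock_scale (of_nat a) (x (a + 1) (y b 1)) + fock_scale (of_nat b) (x a (y (b + 1) 1)) \<in> Dec (a + b + 1)"
proof -
  have "T (x a (y b 1)) = fock_scale (of_nat a) (x (a + 1) (y b 1)) + fock_scale (of_nat b) (x a (y (b + 1) 1))"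
    using assms by (simp only: T_x T_y xy_St one_states_on x_add x_scale T_one x_zero) simp
  then show ?thesis using Dec_T[OF quad_Wd[OF assms]] assms by simp
qed

text \<open>The quadratics with indices (1,1), (2,e) and those with indices (2,1), (1,e) have the
  same product as polynomials, so the difference of the two decomposable vectors consists of quantum
  corrections: a linear relation among quadratics.\<close>

lemma quad_relation:
  assumes e: "e \<ge> 1"
  shows "fock_scale (of_nat e) (x 2 (y (e + 2) 1)) + fock_scale (of_nat (e * (e + 1))) (x 1 (y (e + 3) 1)) - x 4 (y e 1) \<in> Dec (e + 4)"
proof -
  have "Y (x 1 (y 1 1)) (-1) (x 2 (y e 1)) \<in> Dec ((1 + 1) + (2 + e))" "Y (x 2 (y 1 1)) (-1) (x 1 (y e 1)) \<in> Dec ((2 + 1) + (1 + e))"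
    by (rule Dec_prod[OF quad_Wd quad_Wd]; use e in simp)+
  then have "Y (x 1 (y 1 1)) (-1) (x 2 (y e 1)) - Y (x 2 (y 1 1)) (-1) (x 1 (y e 1)) \<in> Dec (e + 4)"
    by (intro fs.subspace_diff[OF subspace_Dec]) (simp_all add: eval_nat_numeral)
  moreover have "Y (x 1 (y 1 1)) (-1) (x 2 (y e 1)) - Y (x 2 (y 1 1)) (-1) (x 1 (y e 1)) =
    fock_scale (of_nat e) (x 2 (y (e + 2) 1)) + fock_scale (of_nat (e * (e + 1))) (x 1 (y (e + 3) 1)) - x 4 (y e 1)"
  proof -
    have L: "x 1 (y 1 (x 2 (y e 1))) = x 2 (y 1 (x 1 (y e 1)))"
      by (simp only: xy_comm order_refl one_le_numeral) (simp only: xx_comm[of 1 2] flip: xy_comm)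
    have a1: "(1 :: nat) + 2 + 1 = 4" "(2 :: nat) + 1 + 1 = 4" "1 + e + 1 = e + 2" "2 + e + 1 = e + 3" "1 + e - 1 = e" "2 + e - 1 = e + 1"
      by simp_all
    have c: "((1 :: nat) + 2) choose (2 + 1) = 1" "((2 :: nat) + 1) choose (1 + 1) = 3" "e choose e = 1" "(e + 1) choose e = e + 1"
      by (simp_all add: eval_nat_numeral)
    have E1: "Y (x 1 (y 1 1)) (-1) (x 2 (y e 1)) = x 1 (y 1 (x 2 (y e 1))) + fock_scale 2 (x 4 (y e 1)) + fock_scale (of_nat e) (x 2 (y (e + 2) 1))"
      using Y_q_quad[OF order_refl _ e, of 2] unfolding a1 c by (simp add: xy_comm)
    have E2: "Y (x 2 (y 1 1)) (-1) (x 1 (y e 1)) = x 2 (y 1 (x 1 (y e 1))) + fock_scale 3 (x 4 (y e 1)) - fock_scale (of_nat (e * (e + 1))) (x 1 (y (e + 3) 1))"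
      using Y_q_quad[OF _ order_refl e, of 2] unfolding a1 c by (simp add: xy_comm algebra_simps)
    show ?thesis unfolding E1 E2 L
      by (rule poly_mapping_eqI) (simp add: lookup_add lookup_minus)
  qed
  ultimately show ?thesis by (simp only:)
qed

lemma Dec_cancel: "fock_scale c v \<in> Dec d \<Longrightarrow> c \<noteq> 0 \<Longrightarrow> v \<in> Dec d"
  using fs.subspace_scale[OF subspace_Dec, of "fock_scale c v" d "1 / c"] by simp

text \<open>Modulo decomposables, translation makes all quadratics of weight \<open>d\<close>
  multiples of the one with indices (1, d-1). Inserted into \<open>quad_relation\<close> this leaves
  the coefficient e (e+1) (e+2) / 6 - e with e = d - 4. It is 0 for e = 1, so weight 5 keeps its
  generator, and nonzero from e = 2 on.\<close>

lemma quad_high: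
  assumes "d \<ge> 6" "p \<ge> 1" "r \<ge> 1" "p + r = d"
  shows "x p (y r 1) \<in> Dec d"
proof -
  have base: "x 1 (y (d - 1) 1) \<in> Dec d"
  proof -
    define e where "e = d - 4"
    have e: "d = e + 4" "e \<ge> 2" using assms(1) by (auto simp: e_def)
    let ?z = "x 1 (y (e + 3) 1)" and ?c = "of_nat e * (of_nat e + 1) * (of_nat e + 2) / 6 - of_nat e :: complex"
    note D = subspace_Dec[of "e + 4"]
    have q1: "x 2 (y (e + 2) 1) + fock_scale (of_nat (e + 2)) ?z \<in> Dec (e + 4)"
      using quad_T[of 1 "e + 2"] by (simp add: eval_nat_numeral)
    have q2: "fock_scale 2 (x 3 (y (e + 1) 1)) + fock_scale (of_nat (e + 1)) (x 2 (y (e + 2) 1)) \<in> Dec (e + 4)"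
      using quad_T[of 2 "e + 1"] by (simp add: eval_nat_numeral)
    have q3: "fock_scale 3 (x 4 (y e 1)) + fock_scale (of_nat e) (x 3 (y (e + 1) 1)) \<in> Dec (e + 4)"
      using quad_T[of 3 e] e by (simp add: eval_nat_numeral)
    have q0: "fock_scale (of_nat e) (x 2 (y (e + 2) 1)) + fock_scale (of_nat (e * (e + 1))) ?z - x 4 (y e 1) \<in> Dec (e + 4)"
      using quad_relation[of e] e by simp
    \<comment> \<open>The multipliers eliminate the quadratics with first index 4, 3 and 2 in
      turn.\<close>
    have "fock_scale ?c ?z =
      (fock_scale (of_nat e) (x 2 (y (e + 2) 1)) + fock_scale (of_nat (e * (e + 1))) ?z - x 4 (y e 1))
      + fock_scale (1/3) (fock_scale 3 (x 4 (y e 1)) + fock_scale (of_nat e) (x 3 (y (e + 1) 1)))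
      + fock_scale (- of_nat e / 6) (fock_scale 2 (x 3 (y (e + 1) 1)) + fock_scale (of_nat (e + 1)) (x 2 (y (e + 2) 1)))
      + fock_scale (of_nat e * (of_nat e + 1) / 6 - of_nat e) (x 2 (y (e + 2) 1) + fock_scale (of_nat (e + 2)) ?z)"
      by (rule poly_mapping_eqI) (simp add: lookup_add lookup_minus, simp add: field_simps)
    also have "\<dots> \<in> Dec (e + 4)"
      by (intro fs.subspace_add[OF D] fs.subspace_scale[OF D] q0 q1 q2 q3)
    finally have z: "fock_scale ?c ?z \<in> Dec (e + 4)" .
    have "?c \<noteq> 0"
    proof -
      have "?c = complex_of_real (real e * ((real e + 1) * (real e + 2) / 6 - 1))" by (simp add: algebra_simps)
      moreover have "(real e + 1) * (real e + 2) \<ge> 3 * 4" using e by (intro mult_mono) auto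
      ultimately show ?thesis using e by (simp del: of_real_mult of_real_diff)
    qed
    then show ?thesis using Dec_cancel[OF z] e by (simp add: numeral_3_eq_3 numeral_eq_Suc)
  qed
  show ?thesis using assms(2-4)
  proof (induction p arbitrary: r rule: nat_induct_at_least)
    case base
    then have "r = d - 1" by simp
    then show ?case using \<open>x 1 (y (d - 1) 1) \<in> Dec d\<close> by simp
  next
    case (Suc p)
    have IH: "x p (y (r + 1) 1) \<in> Dec d" using Suc by (intro Suc.IH) auto
    have d: "p + r + 1 = d" using Suc by simp
    have "(fock_scale (of_nat p) (x (p + 1) (y r 1)) + fock_scale (of_nat r) (x p (y (r + 1) 1))) - fock_scale (of_nat r) (x p (y (r + 1) 1)) \<in> Dec d"
      using quad_T[OF Suc.hyps Suc.prems(1)] IH unfolding d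
      by (intro fs.subspace_diff[OF subspace_Dec] fs.subspace_scale[OF subspace_Dec])
    then have "fock_scale (of_nat p) (x (p + 1) (y r 1)) \<in> Dec d" by (simp only: add_diff_cancel_right')
    then show ?case using Dec_cancel[of "of_nat p"] Suc.hyps by simp
  qed
qed

text \<open>The translation relation alone, solved towards second index 1, the normal form of the
  listed generators.\<close>

lemma quad_low:
  assumes "p \<ge> 1" "r \<ge> 1" "p + r = d"
  shows "x p (y r 1) \<in> fs.span (insert (x (d - 1) (y 1 1)) (Dec d))"
  using assms(2,1,3)
proof (induction r arbitrary: p rule: nat_induct_at_least)
  case base
  then show ?case by (auto intro: fs.span_base)
next
  case (Suc r)
  let ?S = "fs.span (insert (x (d - 1) (y 1 1)) (Dec d))"
  have IH: "x (p + 1) (y r 1) \<in> ?S" using Suc by (intro Suc.IH) auto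
  have d: "p + r + 1 = d" using Suc by simp
  have "fock_scale (of_nat p) (x (p + 1) (y r 1)) + fock_scale (of_nat r) (x p (y (r + 1) 1)) \<in> ?S"
    using quad_T[OF Suc.prems(1) Suc.hyps] unfolding d by (intro fs.span_base) auto
  from fs.span_diff[OF this fs.span_scale[OF IH, of "of_nat p"]]
  have "fock_scale (of_nat r) (x p (y (r + 1) 1)) \<in> ?S" by (simp only: add_diff_cancel_left')
  from fs.span_scale[OF this, of "1 / of_nat r"] show ?case using Suc.hyps by simp
qed

text \<open>
  The factorials turn the translation operator into the derivation raising one index by one.
\<close>

definition c3 :: "nat \<Rightarrow> nat \<Rightarrow> nat \<Rightarrow> fock" where
  "c3 a b c = fock_scale (fact (a - 1) * fact (b - 1) * fact (c - 1)) (x a (x b (x c 1)))"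

lemma c3_sym: "c3 a b c = c3 b a c" "c3 a b c = c3 a c b"
  unfolding c3_def
  by (subst xx_comm[of a b], simp add: mult_ac) (subst xx_comm[of b c], simp add: mult_ac)

lemma fact_step: "n \<ge> 1 \<Longrightarrow> (fact (n - 1) * of_nat n :: complex) = fact n"
  by (cases n) simp_all

lemma c3_T:
  assumes "a \<ge> 1" "b \<ge> 1" "c \<ge> 1"
  shows "c3 (a + 1) b c + c3 a (b + 1) c + c3 a b (c + 1) \<in> Dec (a + b + c + 1)"
proof -
  have "T (x a (x b (x c 1))) = fock_scale (of_nat a) (x (a + 1) (x b (x c 1))) + fock_scale (of_nat b) (x a (x (b + 1) (x c 1)))
     + fock_scale (of_nat c) (x a (x b (x (c + 1) 1)))"
    using assms by (simp only: T_x xy_St one_states_on x_add x_scale T_one x_zero) (simp add: add_ac)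
  then have "fock_scale (fact (a - 1) * fact (b - 1) * fact (c - 1)) (T (x a (x b (x c 1)))) =
    c3 (a + 1) b c + c3 a (b + 1) c + c3 a b (c + 1)"
    unfolding c3_def add_diff_cancel_right' fact_step[OF assms(1), symmetric] fact_step[OF assms(2), symmetric] fact_step[OF assms(3), symmetric]
    by (simp add: fs.scale_right_distrib mult_ac)
  moreover have "1 \<le> a + b + c" using assms by simp
  ultimately show ?thesis using fs.subspace_scale[OF subspace_Dec Dec_T[OF cubic_Wd[OF assms]], of "fact (a - 1) * fact (b - 1) * fact (c - 1)"] by (simp only: simp_thms)
qed

text \<open>With the normalisation of \<open>c3\<close> a binomial correction of
  \<open>Y_q_cubic\<close> becomes a single factorial over \<open>a + 1\<close>, symmetric in the
  two indices up to the denominator.\<close>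

lemma choose_fact_id:
  assumes "a \<ge> 1" "e \<ge> 1"
  shows "(fact (e - 1) * fact (a - 1) * (of_nat ((e + a) choose (a + 1)) * of_nat a) :: complex) = fact (e + a) / (of_nat a + 1)"
proof -
  have "(of_nat ((e + a) choose (a + 1)) :: complex) = fact (e + a) / (fact (a + 1) * fact (e - 1))"
    using assms by (subst binomial_fact) auto
  moreover have "(fact (a + 1) :: complex) = (of_nat a + 1) * (fact (a - 1) * of_nat a)"
    unfolding fact_step[OF assms(1)] by (simp add: add.commute)
  moreover have "(of_nat a + 1 :: complex) \<noteq> 0" by (metis of_nat_Suc of_nat_eq_0_iff nat.distinct(1) add.commute)
  moreover have "(of_nat a :: complex) \<noteq> 0" using assms by simp
  ultimately show ?thesis by (simp only:) (simp add: divide_simps)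
qed

text \<open>The quadratic (e,1) times the cubic (a,1,1) and the quadratic (a,1) times the cubic
  (e,1,1) agree as polynomials; subtracting the decomposable vectors leaves contractions only, and
  these are cubics.\<close>

lemma c3_relation:
  assumes "a \<ge> 1" "e \<ge> 1"
  shows "fock_scale (1 / (of_nat a + 1) - 1 / (of_nat e + 1)) (c3 (a + e + 1) 1 1) + c3 (e + 2) a 1 - c3 (a + 2) e 1 \<in> Dec (a + e + 3)"
proof -
  define P where "P e a = Y (x e (y 1 1)) (-1) (x a (x 1 (x 1 1)))" for e a
  have P: "P e a \<in> Dec (a + e + 3)" if "e \<ge> 1" "a \<ge> 1" for a e
  proof -
    have "P e a \<in> Dec ((e + 1) + (a + 1 + 1))"
      unfolding P_def by (rule Dec_prod[OF quad_Wd cubic_Wd]) (use that in auto)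
    moreover have "(e + 1) + (a + 1 + 1) = a + e + 3" by simp
    ultimately show ?thesis by (simp only:)
  qed
  have F: "fock_scale (fact (e - 1) * fact (a - 1)) (P e a) = fock_scale (fact (e - 1) * fact (a - 1)) (x e (y 1 (x a (x 1 (x 1 1)))))
     + fock_scale (1 / (of_nat a + 1)) (c3 (a + e + 1) 1 1) + c3 (e + 2) a 1" if "e \<ge> 1" "a \<ge> 1" for a e
  proof -
    have "(2 * of_nat ((e + 1) choose 2) :: complex) = of_nat ((e + 1) * e)"
    proof -
      have "2 * ((e + 1) choose 2) = (e + 1) * e" by (induction e) (simp_all add: numeral_2_eq_2)
      then show ?thesis by (metis of_nat_mult of_nat_numeral)
    qed
    then have c2: "fact (e - 1) * fact (a - 1) * (2 * of_nat ((e + 1) choose 2)) = (fact (e + 1) * fact (a - 1) :: complex)"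
      by (simp add: algebra_simps flip: fact_step[OF that(1)])
    have "fock_scale (fact (e - 1) * fact (a - 1)) (P e a) = fock_scale (fact (e - 1) * fact (a - 1)) (x e (y 1 (x a (x 1 (x 1 1)))))
      + fock_scale (fact (e - 1) * fact (a - 1) * (of_nat ((e + a) choose (a + 1)) * of_nat a)) (x (e + a + 1) (x 1 (x 1 1)))
      + fock_scale (fact (e - 1) * fact (a - 1) * (2 * of_nat ((e + 1) choose 2))) (x (e + 2) (x a (x 1 1)))"
      unfolding P_def Y_q_cubic[OF that] by (simp only: fs.scale_right_distrib fs.scale_scale)
    then show ?thesis
      unfolding choose_fact_id[OF that(2,1)] c2 c3_def by (simp add: add.commute)
  qed
  have "x e (y 1 (x a (x 1 (x 1 1)))) = x a (y 1 (x e (x 1 (x 1 1))))"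
    using assms by (simp only: xy_comm) (simp only: xx_comm[of e a])
  then have "fock_scale (fact (e - 1) * fact (a - 1)) (P e a) - fock_scale (fact (a - 1) * fact (e - 1)) (P a e) =
    fock_scale (1 / (of_nat a + 1) - 1 / (of_nat e + 1)) (c3 (a + e + 1) 1 1) + c3 (e + 2) a 1 - c3 (a + 2) e 1"
    unfolding F[OF assms(2,1)] F[OF assms] by (simp add: fs.scale_left_diff_distrib mult.commute add.commute)
  moreover have "e + a + 3 = a + e + 3" by simp
  ultimately show ?thesis
    using fs.subspace_diff[OF subspace_Dec fs.subspace_scale[OF subspace_Dec P[OF assms(2,1)]] fs.subspace_scale[OF subspace_Dec P[OF assms, unfolded \<open>e + a + 3 = a + e + 3\<close>]]]
    by metis
qed

text \<open>Combined with the exchange of the first two indices, \<open>c3_relation\<close> lowers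
  the first index by 2; index 2 is handled by translating the cubic (1,1,m).\<close>

lemma c3_span_1:
  assumes "n \<ge> 1" "m \<ge> 1" "n + m + 1 = d"
  shows "c3 n m 1 \<in> fs.span (insert (c3 (d - 2) 1 1) (Dec d))"
  using assms
proof (induction n arbitrary: m rule: less_induct)
  case (less n)
  let ?S = "fs.span (insert (c3 (d - 2) 1 1) (Dec d))"
  have g1: "c3 (d - 2) 1 1 \<in> ?S" by (simp add: fs.span_base)
  have D: "v \<in> ?S" if "v \<in> Dec d" for v using that by (simp add: fs.span_base)
  consider "n = 1" | "n = 2" | "n \<ge> 3" using less.prems by linarith
  then show ?case
  proof cases
    case 1
    then have "c3 n m 1 = c3 (d - 2) 1 1" using less.prems c3_sym by auto
    then show ?thesis using g1 by simp
  next
    case 2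
    have "c3 (1 + 1) 1 m + c3 1 (1 + 1) m + c3 1 1 (m + 1) \<in> Dec (1 + 1 + m + 1)"
      by (rule c3_T) (use less.prems in auto)
    moreover have "1 + 1 + m + 1 = d" "m + 1 = d - 2" using less.prems 2 by auto
    moreover have "c3 (1 + 1) 1 m = c3 2 m 1" "c3 1 (1 + 1) m = c3 2 m 1" "c3 1 1 (d - 2) = c3 (d - 2) 1 1"
      using c3_sym by (metis one_add_one)+
    ultimately have "c3 2 m 1 + c3 2 m 1 + c3 (d - 2) 1 1 \<in> ?S" using D by simp
    from fs.span_diff[OF this g1] have "fock_scale (1/2) (c3 2 m 1 + c3 2 m 1) \<in> ?S" by (intro fs.span_scale) simp
    moreover have "fock_scale (1/2) (c3 2 m 1 + c3 2 m 1) = c3 2 m 1"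
      by (rule poly_mapping_eqI) (simp only: lookup_fock_scale lookup_add, simp)
    ultimately show ?thesis using 2 by simp
  next
    case 3
    define e where "e = n - 2"
    have e: "n = e + 2" "e \<ge> 1" using 3 by (auto simp: e_def)
    have d: "m + e + 3 = d" "m + e + 1 = d - 2" using less.prems e by auto
    have "fock_scale (1 / (of_nat m + 1) - 1 / (of_nat e + 1)) (c3 (d - 2) 1 1) + c3 (e + 2) m 1 - c3 (m + 2) e 1 \<in> ?S"
      using D[OF c3_relation[OF less.prems(2) e(2), unfolded d]] .
    moreover have "c3 (m + 2) e 1 \<in> ?S"
      using less.IH[of e "m + 2"] e d c3_sym(1)[of e "m + 2" 1] by simp
    ultimately have "fock_scale (1 / (of_nat m + 1) - 1 / (of_nat e + 1)) (c3 (d - 2) 1 1) + c3 (e + 2) m 1 - c3 (m + 2) e 1 + c3 (m + 2) e 1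
       - fock_scale (1 / (of_nat m + 1) - 1 / (of_nat e + 1)) (c3 (d - 2) 1 1) \<in> ?S"
      using g1 by (intro fs.span_diff[OF fs.span_add fs.span_scale])
    then show ?thesis by (simp add: e)
  qed
qed

lemma c3_span:
  assumes "a \<ge> 1" "b \<ge> 1" "c \<ge> 1" "a + b + c = d"
  shows "c3 a b c \<in> fs.span (insert (c3 (d - 2) 1 1) (Dec d))"
  using assms(3,1,2,4)
proof (induction c arbitrary: a b rule: nat_induct_at_least)
  case base
  then show ?case by (intro c3_span_1) auto
next
  case (Suc c)
  let ?S = "fs.span (insert (c3 (d - 2) 1 1) (Dec d))"
  have d: "a + b + c + 1 = d" using Suc by simp
  have "c3 (a + 1) b c + c3 a (b + 1) c + c3 a b (c + 1) \<in> ?S"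
    using c3_T[OF Suc.prems(1,2) Suc.hyps] unfolding d by (simp add: fs.span_base)
  moreover have "c3 (a + 1) b c \<in> ?S" "c3 a (b + 1) c \<in> ?S" by (rule Suc.IH; use Suc.prems in simp)+
  ultimately have "c3 (a + 1) b c + c3 a (b + 1) c + c3 a b (c + 1) - (c3 (a + 1) b c + c3 a (b + 1) c) \<in> ?S"
    by (rule fs.span_diff[OF _ fs.span_add])
  then show ?case unfolding add_diff_cancel_left' Suc_eq_plus1 .
qed

text \<open>Four translation relations and two instances of \<open>c3_relation\<close> among six
  cubics. Elimination leaves 11/6 - (3/2) u - w times the cubic (k+4,1,1), a positive factor because
  u \<le> 1/3 and w \<le> 1/2. The index k + 1 has to be at least 1, so weight 6 is the first one
  covered.\<close>

lemma c3_high: "c3 (k + 4) 1 1 \<in> Dec (k + 6)"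
proof -
  note D = subspace_Dec[of "k + 6"]
  let ?g1 = "c3 (k + 4) 1 1" and ?g2 = "c3 (k + 3) 2 1" and ?g3 = "c3 (k + 2) 3 1" and ?g4 = "c3 (k + 1) 4 1"
  let ?h = "c3 2 2 (k + 2)" and ?j = "c3 3 2 (k + 1)"
  have s: "c3 2 1 (k + 3) = ?g2" "c3 1 2 (k + 3) = ?g2" "c3 1 1 (k + 4) = ?g1" "c3 3 1 (k + 2) = ?g3" "c3 2 1 (k + 3) = ?g2"
    "c3 2 3 (k + 1) = ?j" "c3 4 1 (k + 1) = ?g4" "c3 3 (k + 2) 1 = ?g3" "c3 4 (k + 1) 1 = ?g4" 
    by (metis c3_sym)+
  have A: "?g2 + ?g2 + ?g1 \<in> Dec (k + 6)"
    using c3_T[of 1 1 "k + 3"] s by (simp add: eval_nat_numeral)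
  have B: "?g3 + ?h + ?g2 \<in> Dec (k + 6)"
    using c3_T[of 2 1 "k + 2"] s by (simp add: eval_nat_numeral)
  have C: "?j + ?j + ?h \<in> Dec (k + 6)"
    using c3_T[of 2 2 "k + 1"] s by (simp add: eval_nat_numeral)
  have E: "?g4 + ?j + ?g3 \<in> Dec (k + 6)"
    using c3_T[of 3 1 "k + 1"] s by (simp add: eval_nat_numeral)
  define u w :: complex where "u = 1 / (of_nat k + 3)" and "w = 1 / (of_nat k + 2)"
  have R1: "fock_scale (u - 1 / 2) ?g1 + ?g3 - ?g1 \<in> Dec (k + 6)"
    using c3_relation[of "k + 2" 1] s by (simp add: eval_nat_numeral add_ac u_def)
  have R2: "fock_scale (w - 1 / 3) ?g1 + ?g4 - ?g2 \<in> Dec (k + 6)"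
    using c3_relation[of "k + 1" 2] s by (simp add: eval_nat_numeral add_ac w_def)
  define c where "c = (11 / 6 - 3 / 2 * u - w :: complex)"
  \<comment> \<open>The combination removes \<open>?j\<close>, \<open>?h\<close>,
    \<open>?g4\<close>, \<open>?g3\<close> and \<open>?g2\<close>, in this order.\<close>
  have "fock_scale c ?g1 = (?g4 + ?j + ?g3) - fock_scale (1/2) (?j + ?j + ?h) + fock_scale (1/2) (?g3 + ?h + ?g2)
    - (fock_scale (w - 1 / 3) ?g1 + ?g4 - ?g2)
    - fock_scale (3/2) (fock_scale (u - 1 / 2) ?g1 + ?g3 - ?g1)
    - fock_scale (3/4) (?g2 + ?g2 + ?g1)"
    by (rule poly_mapping_eqI) (simp only: lookup_add lookup_minus lookup_fock_scale c_def, simp add: algebra_simps)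
  also have "\<dots> \<in> Dec (k + 6)"
    by (intro fs.subspace_diff[OF D] fs.subspace_add[OF D] fs.subspace_scale[OF D] A B C E R1 R2)
  finally have z: "fock_scale c ?g1 \<in> Dec (k + 6)" .
  have "c = complex_of_real (11 / 6 - 3 / 2 * (1 / (real k + 3)) - 1 / (real k + 2))" by (simp add: c_def u_def w_def)
  moreover have "1 / (real k + 3) \<le> 1 / 3" "1 / (real k + 2) \<le> 1 / 2" by (simp_all add: field_simps)
  then have "11 / 6 - 3 / 2 * (1 / (real k + 3)) - 1 / (real k + 2) > 0" by linarith
  ultimately have "c \<noteq> 0" by (simp only: of_real_eq_0_iff)
  then show ?thesis using Dec_cancel[OF z] by simp
qed

text \<open>Three times this cubic is the translate of the cubic (1,1,1).\<close>

lemma c3_4: "c3 2 1 1 \<in> Dec 4"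
proof -
  have "c3 (1 + 1) 1 1 + c3 1 (1 + 1) 1 + c3 1 1 (1 + 1) \<in> Dec (1 + 1 + 1 + 1)" by (rule c3_T) auto
  moreover have "c3 1 2 1 = c3 2 1 1" "c3 1 1 2 = c3 2 1 1" by (metis c3_sym)+
  ultimately have "c3 2 1 1 + c3 2 1 1 + c3 2 1 1 \<in> Dec 4" by (simp add: eval_nat_numeral)
  moreover have "fock_scale 3 (c3 2 1 1) = c3 2 1 1 + c3 2 1 1 + c3 2 1 1"
    by (rule poly_mapping_eqI) (simp only: lookup_fock_scale lookup_add, simp)
  ultimately show ?thesis using Dec_cancel[of 3 "c3 2 1 1" 4] by simp
qed

lemma c3_low: "c3 (d - 2) 1 1 \<in> Dec d" if "d \<ge> 3" "d \<noteq> 3" "d \<noteq> 5"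
proof (cases "d = 4")
  case True
  have "(4 :: nat) - 2 = 2" by simp
  then show ?thesis unfolding True using c3_4 by (simp only:)
next
  case False
  then have "d - 6 + 4 = d - 2" "d - 6 + 6 = d" using that by simp_all
  then show ?thesis using c3_high[of "d - 6"] by (simp only:)
qed

lemma cubic_span:
  assumes "a \<ge> 1" "b \<ge> 1" "c \<ge> 1" "a + b + c = d"
  shows "x a (x b (x c 1)) \<in> fs.span (Dec d \<union> (if d = 3 \<or> d = 5 then {x (d - 2) (x 1 (x 1 1))} else {}))"
proof -
  define G where "G = Dec d \<union> (if d = 3 \<or> d = 5 then {x (d - 2) (x 1 (x 1 1))} else {})"
  have DG: "v \<in> fs.span G" if "v \<in> Dec d" for v
    by (rule fs.span_base) (simp add: G_def that)
  have g1: "c3 (d - 2) 1 1 \<in> fs.span G"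
  proof (cases "d = 3 \<or> d = 5")
    case True
    have "x (d - 2) (x 1 (x 1 1)) \<in> G" unfolding G_def if_P[OF True] by (rule UnI2) (rule singletonI)
    then show ?thesis unfolding c3_def by (intro fs.span_scale fs.span_base)
  next
    case False
    show ?thesis by (rule DG, rule c3_low) (use False assms in linarith)+
  qed
  have "v \<in> fs.span G" if "v \<in> insert (c3 (d - 2) 1 1) (Dec d)" for v
    using that by (rule insertE) (simp only: g1, rule DG)
  then have "fs.span (insert (c3 (d - 2) 1 1) (Dec d)) \<subseteq> fs.span G"
    by (intro fs.span_minimal fs.subspace_span subsetI)
  then have c: "c3 a b c \<in> fs.span G" using c3_span[OF assms] by (rule subsetD)
  have sc: "fock_scale (1 / k) (fock_scale k v) = v" if "k \<noteq> 0" for k v using that by simp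
  have nz: "fact (a - 1) * fact (b - 1) * fact (c - 1) \<noteq> (0 :: complex)"
    by (intro no_zero_divisors fact_nonzero)
  show ?thesis
    using fs.span_scale[OF c, of "1 / (fact (a - 1) * fact (b - 1) * fact (c - 1))"] unfolding c3_def sc[OF nz] G_def .
qed

end

section \<open>Eight generators of the commutant and nine of the orbifold\<close>

section \<open>Strong generation\<close>

interpretation A: dual_pair 1 2 by unfold_locales simp
interpretation B: dual_pair 2 1 by unfold_locales simp

text \<open>Representatives matching the normal forms of \<open>quad_low\<close> and
  \<open>c3_span\<close>: only the first index may differ from 1.\<close>

definition glistW :: "(nat \<times> nat) multiset list" where
  "glistW = [{#(1, 1), (2, 1)#}, {#(1, 2), (2, 1)#}, {#(1, 1), (1, 1), (1, 1)#}, {#(2, 1), (2, 1), (2, 1)#},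
     {#(1, 3), (2, 1)#}, {#(1, 4), (2, 1)#}, {#(1, 3), (1, 1), (1, 1)#}, {#(2, 3), (2, 1), (2, 1)#}]"

definition glistV :: "(nat \<times> nat) multiset list" where
  "glistV = {#(0, 1)#} # glistW"

definition SW :: "fock set" where "SW = Bm ` set glistW"
definition SV :: "fock set" where "SV = Bm ` set glistV"

lemma distinct_glistV: "distinct glistV"
proof -
  \<comment> \<open>Size, charge and weight already tell the nine multisets apart.\<close>
  have "distinct (map (\<lambda>M. (size M, charge M, wt M)) glistV)"
    by (simp add: glistV_def glistW_def)
  then show ?thesis by (simp only: distinct_map)
qed

lemma three_dvd: "(3 :: nat) dvd Suc (Suc (Suc 0))" "(3 :: nat) dvd 6"
  by (simp_all flip: numeral_3_eq_3)

lemma glistW_Wkeys: "set glistW \<subseteq> Wkeys"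
  by (auto simp: glistW_def Wkeys_def Vkeys_def letters_def three_dvd)

lemma glistV_Vkeys: "set glistV \<subseteq> Vkeys"
proof -
  have "{#(0, 1)#} \<in> Vkeys" by (auto simp: Vkeys_def letters_def)
  then show ?thesis using glistW_Wkeys by (auto simp: glistV_def Wkeys_def)
qed

lemma Wkeys_add: "M \<in> Wkeys \<Longrightarrow> N \<in> Wkeys \<Longrightarrow> M + N \<in> Wkeys"
  by (auto simp: Wkeys_def Vkeys_def letters_def)

lemma Wkeys_wt: "M \<in> Wkeys \<Longrightarrow> M \<noteq> {#} \<Longrightarrow> wt M \<ge> 1 \<and> size M \<ge> 1"
  by (cases M) (auto simp: Wkeys_def Vkeys_def letters_def)

text \<open>By \<open>Y_Bm_leading\<close> the product of polynomials differs from a decomposable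
  vector by terms of smaller polynomial degree; these stay in the commutant, hence are combinations
  of its eigenmonomials.\<close>

lemma Bm_split:
  assumes "A \<in> Wkeys" "B \<in> Wkeys" "A \<noteq> {#}" "B \<noteq> {#}" "wt A + wt B = d"
  shows "Bm (A + B) \<in> fs.span (Dec d \<union> Bm ` {M \<in> Wkeys. wt M = d \<and> size M < size (A + B)})"
proof -
  have W: "Bm A \<in> Wd (wt A)" "Bm B \<in> Wd (wt B)" "Bm (A + B) \<in> Wd d"
    using assms by (auto intro!: Bm_Wd Wkeys_add)
  have wts: "wt A \<ge> 1" "wt B \<ge> 1" "size A \<ge> 1" "size B \<ge> 1" using assms Wkeys_wt by auto
  define E where "E = Y (Bm A) (-1) (Bm B) - Bm A * Bm B"
  have P: "Y (Bm A) (-1) (Bm B) \<in> Dec d" using Dec_prod[OF W(1,2) wts(1,2)] assms(5) by simp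
  have l: "A \<in> letters" "B \<in> letters" "Wkeys \<subseteq> letters" using assms by (auto simp: Wkeys_def Vkeys_def)
  have YW: "Y (Bm A) (-1) (Bm B) \<in> Wd d"
    by (rule Y_Wd[OF W(1,2)]) (use assms(5) in simp)
  have "E \<in> Wd d" unfolding E_def using YW W(3)
    by (intro fs.subspace_diff[OF subspace_Wd]) (simp_all add: Bm_simps)
  moreover have "E \<in> degs {..int (size B) + int (size A) - 2}"
    unfolding E_def
    by (intro Y_Bm_leading(3) l Wd_St[OF W(2)] degs_mono[OF _ Bm_degs[OF l(2)]]) auto
  moreover have "int (size B) + int (size A) - 2 = int (size A + size B - 2)" using wts by simp
  ultimately have "E \<in> fs.span (Bm ` {M \<in> Wkeys. wt M = d \<and> size M \<le> size A + size B - 2})"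
    using Wd_WW[of E d] Wd_graded[of E d] by (intro graded_deg_piece_span[OF l(3)]) (auto simp: WW_span)
  moreover have "{M \<in> Wkeys. wt M = d \<and> size M \<le> size A + size B - 2} \<subseteq> {M \<in> Wkeys. wt M = d \<and> size M < size (A + B)}"
    using wts by auto
  then have "fs.span (Bm ` {M \<in> Wkeys. wt M = d \<and> size M \<le> size A + size B - 2}) \<subseteq>
     fs.span (Dec d \<union> Bm ` {M \<in> Wkeys. wt M = d \<and> size M < size (A + B)})"
    by (intro fs.span_mono) blast
  ultimately have "Y (Bm A) (-1) (Bm B) - E \<in> fs.span (Dec d \<union> Bm ` {M \<in> Wkeys. wt M = d \<and> size M < size (A + B)})"
    using P by (intro fs.span_diff) (auto intro: fs.span_base)
  then show ?thesis by (simp add: E_def Bm_simps)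
qed

lemma glistW_SW: "M \<in> set glistW \<Longrightarrow> Bm M \<in> SW \<inter> Wd (wt M)"
  using glistW_Wkeys Bm_Wd by (auto simp: SW_def)

lemma quad_reduce:
  assumes "p \<ge> 1" "r \<ge> 1" "p + r = d"
  shows "Bm {#(1, p), (2, r)#} \<in> fs.span (Dec d \<union> (SW \<inter> Wd d))"
proof (cases "d \<ge> 6")
  case True
  have "Bm {#(1, p), (2, r)#} \<in> Dec d"
    using A.quad_high[OF True assms] unfolding A.quad_Bm[OF assms(1,2)] .
  then show ?thesis by (intro fs.span_base) simp
next
  case False
  have "d = 2 \<or> d = 3 \<or> d = 4 \<or> d = 5" using assms False by linarith
  then have "{#(1, d - 1), (2, 1)#} \<in> set glistW" "wt {#(1, d - 1), (2, 1)#} = d"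
    by (auto simp: glistW_def)
  then have g: "Bm {#(1, d - 1), (2, 1)#} \<in> SW \<inter> Wd d" using glistW_SW by metis
  have "fs.span (insert (Bm {#(1, d - 1), (2, 1)#}) (Dec d)) \<subseteq> fs.span (Dec d \<union> (SW \<inter> Wd d))"
    by (intro fs.span_mono) (use g in auto)
  moreover have "d - 1 \<ge> 1" using assms by simp
  ultimately show ?thesis
    using A.quad_low[OF assms] unfolding A.quad_Bm[OF assms(1,2)] A.quad_Bm[OF \<open>d - 1 \<ge> 1\<close> order_refl] by blast
qed

lemma cubic_reduce:
  assumes "a \<ge> 1" "b \<ge> 1" "c \<ge> 1" "a + b + c = d" "s = 1 \<or> s = 2"
  shows "Bm {#(s, a), (s, b), (s, c)#} \<in> fs.span (Dec d \<union> (SW \<inter> Wd d))"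
proof -
  interpret C: dual_pair s "3 - s" by unfold_locales (use assms(5) in auto)
  have d: "d - 2 \<ge> 1" using assms by simp
  have "Dec d \<union> (if d = 3 \<or> d = 5 then {Bm {#(s, d - 2), (s, 1), (s, 1)#}} else {}) \<subseteq> Dec d \<union> (SW \<inter> Wd d)"
  proof (cases "d = 3 \<or> d = 5")
    case True
    then have "{#(s, d - 2), (s, 1), (s, 1)#} \<in> set glistW" "wt {#(s, d - 2), (s, 1), (s, 1)#} = d"
      using assms(5) by (auto simp: glistW_def)
    then have "Bm {#(s, d - 2), (s, 1), (s, 1)#} \<in> SW \<inter> Wd d" using glistW_SW by metis
    then show ?thesis using True by auto
  qed auto
  from fs.span_mono[OF this] C.cubic_span[OF assms(1-4)] show ?thesis
    unfolding C.cubic_Bm[OF assms(1-3)] C.cubic_Bm[OF d order_refl order_refl] by blast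
qed

text \<open>Induction on polynomial degree. A nonempty word in charges 1 and 2 of total charge
  divisible by 3 contains a pair of both charges or, if only one occurs, a triple of it; splitting
  this off leaves a product, unless the word is itself such a quadratic or cubic.\<close>

lemma Wd_generated: "d \<ge> 1 \<Longrightarrow> Wd d \<subseteq> fs.span (Dec d \<union> (SW \<inter> Wd d))"
proof -
  assume d: "d \<ge> 1"
  let ?S = "fs.span (Dec d \<union> (SW \<inter> Wd d))"
  have "M \<in> Wkeys \<Longrightarrow> wt M = d \<Longrightarrow> Bm M \<in> ?S" for M
  proof (induction "size M" arbitrary: M rule: less_induct)
    case less
    have M: "set_mset M \<subseteq> {1, 2} \<times> {1..}" "3 dvd charge M"
    proof -
      have "set_mset M \<subseteq> {..<3} \<times> {1..}" "0 \<notin> fst ` set_mset M" "3 dvd charge M"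
        using less.prems by (auto simp: Wkeys_def Vkeys_def letters_def)
      moreover have "fst z = 1 \<or> fst z = 2" if "z \<in># M" for z
      proof -
        have "fst z < 3" "fst z \<noteq> 0" using calculation that by force+
        then show ?thesis by auto
      qed
      ultimately show "set_mset M \<subseteq> {1, 2} \<times> {1..}" "3 dvd charge M" by fastforce+
    qed
    have split: "Bm M \<in> ?S" if "M = A + B" "A \<in> Wkeys" "B \<in> Wkeys" "A \<noteq> {#}" "B \<noteq> {#}" for A B
    proof -
      have "fs.span (Dec d \<union> Bm ` {K \<in> Wkeys. wt K = d \<and> size K < size (A + B)}) \<subseteq> ?S"
      proof (intro fs.span_minimal fs.subspace_span Un_least image_subsetI)
        show "Dec d \<subseteq> ?S" by (auto intro: fs.span_base)
        show "Bm K \<in> ?S" if "K \<in> {K \<in> Wkeys. wt K = d \<and> size K < size (A + B)}" for K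
          using that less.hyps \<open>M = A + B\<close> by auto
      qed
      moreover have "wt A + wt B = d" using that(1) less.prems by simp
      ultimately show ?thesis using Bm_split[OF that(2-5)] that(1) by blast
    qed
    have sub: "B \<in> Wkeys" if "M = A + B" "3 dvd charge A" for A B
    proof -
      have "3 dvd charge B" using that M(2) by (simp add: dvd_add_right_iff)
      moreover have "set_mset B \<subseteq> set_mset M" using that by simp
      moreover have "0 \<notin> fst ` set_mset M" "set_mset M \<subseteq> {..<3} \<times> {1..}"
        using less.prems by (auto simp: Wkeys_def Vkeys_def letters_def)
      ultimately show ?thesis by (auto simp: Wkeys_def Vkeys_def letters_def)
    qed
    show ?case
    proof (cases "(\<exists>a. (1, a) \<in># M) \<and> (\<exists>b. (2, b) \<in># M)")
      case True
      then obtain a b where ab: "(1, a) \<in># M" "(2, b) \<in># M" by blast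
      then obtain N where N: "M = add_mset (1, a) N" by (metis insert_DiffM)
      then have "(2, b) \<in># N" using ab by auto
      then obtain B where "N = add_mset (2, b) B" by (metis insert_DiffM)
      then have MB: "M = {#(1, a), (2, b)#} + B" using N by simp
      have ab1: "a \<ge> 1" "b \<ge> 1" using ab M(1) by auto
      have A: "{#(1, a), (2, b)#} \<in> Wkeys" using ab1 by (auto simp: Wkeys_def Vkeys_def letters_def three_dvd)
      have B: "B \<in> Wkeys" by (rule sub[OF MB]) (simp add: three_dvd)
      show ?thesis
      proof (cases "B = {#}")
        case True
        then show ?thesis using quad_reduce[OF ab1, of d] less.prems(2) MB by simp
      next
        case False
        show ?thesis by (rule split[OF MB A B _ False]) simp
      qed
    next
      case False
      have "\<exists>s. (s = 1 \<or> s = 2) \<and> (\<forall>z \<in># M. fst z = s)"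
      proof (cases "\<exists>a. (1, a) \<in># M")
        case True
        then have "\<forall>z \<in># M. fst z = 1" using False M(1) by fastforce
        then show ?thesis by blast
      next
        case F: False
        then have "\<forall>z \<in># M. fst z = 2" using M(1) by fastforce
        then show ?thesis by blast
      qed
      then obtain s where s: "s = 1 \<or> s = 2" "\<And>z. z \<in># M \<Longrightarrow> fst z = s" by blast
      \<comment> \<open>A single charge prime to 3 makes the number of letters divisible by 3, so
        there are at least three.\<close>
      have "charge M = s * size M" using s(2) by (induction M) auto
      then have "3 dvd s * size M" using M(2) by simp
      then have d3: "3 dvd size M" using s(1) by auto presburger
      have "size M \<noteq> 0" using less.prems(2) d by auto
      have "size M \<ge> 3" by (rule dvd_imp_le[OF d3]) (use \<open>size M \<noteq> 0\<close> in linarith)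
      then have n: "size M = Suc (Suc (Suc (size M - 3)))" by linarith
      then obtain z1 M1 where z1: "M = add_mset z1 M1" by (blast dest: size_eq_Suc_imp_eq_union)
      then have "size M1 = Suc (Suc (size M - 3))" using n by simp
      then obtain z2 M2 where z2: "M1 = add_mset z2 M2" by (blast dest: size_eq_Suc_imp_eq_union)
      then have "size M2 = Suc (size M - 3)" using n z1 by simp
      then obtain z3 B where z3: "M2 = add_mset z3 B" by (blast dest: size_eq_Suc_imp_eq_union)
      have z: "M = add_mset z1 (add_mset z2 (add_mset z3 B))" by (simp only: z1 z2 z3)
      have "fst z1 = s" "fst z2 = s" "fst z3 = s" by (rule s(2), simp add: z)+
      then obtain a b c where abc: "z1 = (s, a)" "z2 = (s, b)" "z3 = (s, c)" by (metis prod.collapse)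
      have abc1: "a \<ge> 1" "b \<ge> 1" "c \<ge> 1" using M(1) z abc by auto
      have MB: "M = {#(s, a), (s, b), (s, c)#} + B" using z abc by simp
      have c3: "3 dvd charge {#(s, a), (s, b), (s, c)#}" by (simp, presburger)
      have B: "B \<in> Wkeys" by (rule sub[OF MB c3])
      have A: "{#(s, a), (s, b), (s, c)#} \<in> Wkeys" using abc1 s(1) c3 by (auto simp: Wkeys_def Vkeys_def letters_def)
      show ?thesis
      proof (cases "B = {#}")
        case True
        then show ?thesis using cubic_reduce[OF abc1 _ s(1), of d] less.prems(2) MB by simp
      next
        case False
        show ?thesis by (rule split[OF MB A B _ False]) simp
      qed
    qed
  qed
  then show ?thesis unfolding Wd_span[of d] by (intro fs.span_minimal fs.subspace_span) auto
qed

lemma monomial_Cons: "monomial (sub_voa U \<omega>) ((a, n) # xs) = Y a (- int n) (monomial (sub_voa U \<omega>) xs)"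
  by (simp add: monomial_def)

lemma monomial_Nil: "monomial (sub_voa U \<omega>) [] = 1"
  by (simp add: monomial_def)

lemma monomial_in:
  assumes "1 \<in> U'" "\<And>a n b. a \<in> U' \<Longrightarrow> b \<in> U' \<Longrightarrow> Y a n b \<in> U'" "S \<subseteq> U'"
  shows "xs \<in> lists (S \<times> {1..}) \<Longrightarrow> monomial (sub_voa U \<omega>) xs \<in> U'"
proof (induction xs)
  case Nil
  then show ?case using assms(1) by (simp add: monomial_Nil)
next
  case (Cons x xs)
  then show ?case using assms(2,3) by (cases x) (auto simp: monomial_Cons)
qed

text \<open>Monomials depend on the products only, so the lemma applies to the commutant itself and
  also inside the orbifold.\<close>

lemma WW_subset_monomials: "WW \<subseteq> fs.span (monomial (sub_voa U \<omega>) ` lists (SW \<times> {1..}))"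
proof -
  have "WW \<subseteq> fs.span (\<Union>d. Wd d)" using W.U_homogeneous by (simp add: Wd_def)
  also have "\<dots> \<subseteq> fs.span (monomial (sub_voa U \<omega>) ` lists (SW \<times> {1..}))"
  proof (intro fs.span_minimal fs.subspace_span UN_least)
    fix d
    have "Wd d \<subseteq> fs.span {u. mons SW d u}" by (rule strong_generation_criterion[OF Wd_generated])
    also have "\<dots> \<subseteq> fs.span (monomial (sub_voa U \<omega>) ` lists (SW \<times> {1..}))"
      by (intro fs.span_mono subsetI) (use mons_monomial in blast)
    finally show "Wd d \<subseteq> fs.span (monomial (sub_voa U \<omega>) ` lists (SW \<times> {1..}))" .
  qed
  finally show ?thesis .
qed

lemma SW_WW: "SW \<subseteq> WW"
  using glistW_Wkeys by (auto simp: SW_def WW_span intro: fs.span_base)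

lemma SV_VV: "SV \<subseteq> VV"
  using glistV_Vkeys by (auto simp: SV_def VV_span intro: fs.span_base)

lemma SW_strong: "strongly_generates (sub_voa WW omegaW) SW"
  unfolding strongly_generates_def
proof
  have "Bm M \<in> weight_space (sub_voa WW omegaW) (int (wt M))" if "M \<in> set glistW" for M
    using glistW_SW[OF that] by (simp add: W.weight_space_eq Wd_def)
  then show "SW \<subseteq> (\<Union>d. weight_space (sub_voa WW omegaW) d)" by (auto simp: SW_def)
  have "monomial (sub_voa WW omegaW) ` lists (SW \<times> {1..}) \<subseteq> WW"
    using monomial_in[of WW SW] WW_closed SW_WW by auto
  then show "states (sub_voa WW omegaW) = module.span (vscale (sub_voa WW omegaW)) (monomial (sub_voa WW omegaW) ` lists (SW \<times> {1..}))"
    using WW_subset_monomials fs.span_minimal[OF _ subspace_WW] by (simp add: subset_antisym)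
qed

text \<open>The orbifold arises from the commutant by creation operators of boson 0, and these are
  modes of the additional generator.\<close>

lemma SV_strong: "strongly_generates heisenberg3_Z3 SV"
  unfolding strongly_generates_def heisenberg3_Z3_eq
proof
  have "Bm M \<in> weight_space (sub_voa VV omega3) (int (wt M))" if "M \<in> set glistV" for M
  proof -
    have "M \<in> Vkeys" using that glistV_Vkeys by blast
    then have "Bm M \<in> VV" "M \<in> letters" by (auto simp: VV_span Vkeys_def intro: fs.span_base)
    then show ?thesis using Bm_graded[of M] by (simp add: V.weight_space_eq)
  qed
  then show "SV \<subseteq> (\<Union>d. weight_space (sub_voa VV omega3) d)" by (auto simp: SV_def)
  let ?m = "monomial (sub_voa VV omega3)"
  let ?G = "fs.span (?m ` lists (SV \<times> {1..}))"
  have "?m ` lists (SV \<times> {1..}) \<subseteq> VV"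
    using monomial_in[of VV SV] VV_closed SV_VV by auto
  then have "?G \<subseteq> VV" by (intro fs.span_minimal subspace_VV)
  have "lists (SW \<times> {1 :: nat ..}) \<subseteq> lists (SV \<times> {1..})" by (intro lists_mono) (auto simp: SV_def SW_def glistV_def)
  then have W: "WW \<subseteq> ?G" using WW_subset_monomials[of VV omega3] fs.span_mono[OF image_mono, of _ _ ?m] by blast
  have b0: "Bm {#(0, 1)#} = bs 0 (-1) 1" using bos_neg[of 1 "cf 0" 1] by (simp add: Bm_simps)
  have step: "bs 0 (- int n) v \<in> ?G" if "n \<ge> 1" "v \<in> ?G" for n v
  proof -
    have "?G \<subseteq> {v. bs 0 (- int n) v \<in> ?G}"
    proof (intro fs.span_minimal module_hom.subspace_linear_preimage[OF flin_bos] fs.subspace_span subsetI CollectI)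
      fix u assume "u \<in> ?m ` lists (SV \<times> {1..})"
      then obtain xs where xs: "u = ?m xs" "xs \<in> lists (SV \<times> {1..})" by blast
      have "u \<in> St" using xs \<open>?m ` lists (SV \<times> {1..}) \<subseteq> VV\<close> VV_St by blast
      then have "bs 0 (- int n) u = ?m ((Bm {#(0, 1)#}, n) # xs)"
        unfolding monomial_Cons b0 xs(1) by (simp add: Y_bos_1)
      moreover have "(Bm {#(0, 1)#}, n) # xs \<in> lists (SV \<times> {1..})" using xs(2) that(1) by (auto simp: SV_def glistV_def)
      ultimately show "bs 0 (- int n) u \<in> ?G" by (metis fs.span_base image_eqI)
    qed
    then show ?thesis using that(2) by blast
  qed
  have "M \<in> Vkeys \<Longrightarrow> Bm M \<in> ?G" for M
  proof (induction "size M" arbitrary: M rule: less_induct)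
    case less
    show ?case
    proof (cases "0 \<in> fst ` set_mset M")
      case True
      then obtain n where "(0, n) \<in># M" by auto
      then obtain N where N: "M = add_mset (0, n) N" by (metis insert_DiffM)
      have n: "n \<ge> 1" "N \<in> Vkeys" using less.prems by (auto simp: N Vkeys_def letters_def)
      have "Bm M = bs 0 (- int n) (Bm N)" using n by (simp add: N Bm_simps bos_neg)
      then show ?thesis using step[OF n(1) less.hyps[OF _ n(2)]] N by simp
    next
      case False
      then have "Bm M \<in> WW" using less.prems by (auto simp: WW_span Wkeys_def intro: fs.span_base)
      then show ?thesis using W by blast
    qed
  qed
  then have "VV \<subseteq> ?G" unfolding VV_span by (intro fs.span_minimal fs.subspace_span) auto
  then show "states (sub_voa VV omega3) = module.span (vscale (sub_voa VV omega3)) (?m ` lists (SV \<times> {1..}))"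
    using \<open>?G \<subseteq> VV\<close> by (simp add: subset_antisym)
qed

lemma Bm_inj: "inj_on Bm letters"
  by (rule inj_on_inverseI[of _ "\<lambda>p. the_elem (Poly_Mapping.keys (theta_inv p))"]) (simp add: theta_inv_Bm)

lemma Bm_nonzero: "M \<in> letters \<Longrightarrow> Bm M \<noteq> 0"
proof
  assume "M \<in> letters" "Bm M = 0"
  then have "mon M = 0" using theta_inv_Bm[of M] by (simp add: flin_zero[OF flin_theta_inv])
  then have "Poly_Mapping.lookup (mon M) M = 0" by simp
  then show False by simp
qed

lemma has_weights_Bm:
  assumes "set xs \<subseteq> letters" "distinct xs" "\<And>M. M \<in> set xs \<Longrightarrow> Bm M \<in> weight_space V (int (wt M))"
  shows "has_weights V (Bm ` set xs) (mset (map (\<lambda>M. int (wt M)) xs))"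
  unfolding has_weights_def
proof (intro conjI exI ballI)
  let ?wt = "\<lambda>a. int (wt (inv_into letters Bm a))"
  have inv: "inv_into letters Bm (Bm M) = M" if "M \<in> set xs" for M
    using that assms(1) by (auto intro: inv_into_f_f[OF Bm_inj])
  show "finite (Bm ` set xs)" by simp
  show "a \<in> weight_space V (?wt a) - {0}" if "a \<in> Bm ` set xs" for a
    using that assms(1,3) Bm_nonzero by (auto simp: inv)
  have "mset_set (Bm ` set xs) = image_mset Bm (mset xs)"
    using image_mset_mset_set[OF inj_on_subset[OF Bm_inj assms(1)]] mset_set_set[OF assms(2)] by simp
  then have "image_mset ?wt (mset_set (Bm ` set xs)) = image_mset (\<lambda>M. ?wt (Bm M)) (mset xs)"
    by (simp add: image_mset.compositionality o_def)
  also have "\<dots> = image_mset (\<lambda>M. int (wt M)) (mset xs)"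
    by (rule image_mset_cong) (simp add: inv)
  finally show "image_mset ?wt (mset_set (Bm ` set xs)) = mset (map (\<lambda>M. int (wt M)) xs)" by simp
qed

lemma SW_weights: "has_weights (sub_voa WW omegaW) SW {#2, 3, 3, 3, 4, 5, 5, 5#}"
proof -
  have "has_weights (sub_voa WW omegaW) (Bm ` set glistW) (mset (map (\<lambda>M. int (wt M)) glistW))"
  proof (rule has_weights_Bm)
    show "set glistW \<subseteq> letters" using glistW_Wkeys by (auto simp: Wkeys_def Vkeys_def)
    show "distinct glistW" using distinct_glistV by (simp add: glistV_def)
    show "Bm M \<in> weight_space (sub_voa WW omegaW) (int (wt M))" if "M \<in> set glistW" for M
      using glistW_SW[OF that] by (simp add: W.weight_space_eq Wd_def)
  qed
  moreover have "mset (map (\<lambda>M. int (wt M)) glistW) = {#2, 3, 3, 3, 4, 5, 5, 5#}"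
    by (simp add: glistW_def)
  ultimately show ?thesis by (simp add: SW_def)
qed

lemma SV_weights: "has_weights heisenberg3_Z3 SV {#1, 2, 3, 3, 3, 4, 5, 5, 5#}"
proof -
  have "has_weights heisenberg3_Z3 (Bm ` set glistV) (mset (map (\<lambda>M. int (wt M)) glistV))"
  proof (rule has_weights_Bm)
    show "set glistV \<subseteq> letters" using glistV_Vkeys by (auto simp: Vkeys_def)
    show "distinct glistV" by (rule distinct_glistV)
    show "Bm M \<in> weight_space heisenberg3_Z3 (int (wt M))" if "M \<in> set glistV" for M
    proof -
      have "M \<in> Vkeys" using that glistV_Vkeys by blast
      then have "Bm M \<in> VV" "M \<in> letters" by (auto simp: VV_span Vkeys_def intro: fs.span_base)
      then show ?thesis using Bm_graded[of M] by (simp add: heisenberg3_Z3_eq V.weight_space_eq)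
    qed
  qed
  moreover have "mset (map (\<lambda>M. int (wt M)) glistV) = {#1, 2, 3, 3, 3, 4, 5, 5, 5#}"
    by (simp add: glistV_def glistW_def)
  ultimately show ?thesis by (simp add: SV_def)
qed

section \<open>Counting multisets by weight and charge\<close>

section \<open>Graded dimensions\<close>

text \<open>
  Counts the multisets of total weight \<open>d\<close> whose total charge is \<open>- c\<close> modulo 3, where the
  list gives weight and charge of each letter.
\<close>

fun cnt :: "(nat \<times> nat) list \<Rightarrow> nat \<Rightarrow> nat \<Rightarrow> nat" where
  "cnt [] d c = (if d = 0 \<and> 3 dvd c then 1 else 0)"
| "cnt ((k, e) # ls) d c =
     cnt ls d c + (if 1 \<le> k \<and> k \<le> d then cnt ((k, e) # ls) (d - k) (c + e) else 0)"

declare cnt.simps(2) [simp del]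

text \<open>Either the first letter does not occur or one copy of it is removed; positive letter
  weights make the total weight decrease in the second case.\<close>

lemma card_cnt:
  assumes "distinct xs" "\<And>x. x \<in> set xs \<Longrightarrow> w x \<ge> 1"
  shows "finite {M. set_mset M \<subseteq> set xs \<and> (\<Sum>x\<in>#M. w x) = d \<and> 3 dvd c + (\<Sum>x\<in>#M. e x)} \<and>
    card {M. set_mset M \<subseteq> set xs \<and> (\<Sum>x\<in>#M. w x) = d \<and> 3 dvd c + (\<Sum>x\<in>#M. e x)} =
    cnt (map (\<lambda>x. (w x, e x)) xs) d c"
  using assms
proof (induction xs arbitrary: d c)
  case Nil
  have "{M. set_mset M \<subseteq> set [] \<and> (\<Sum>x\<in>#M. w x) = d \<and> 3 dvd c + (\<Sum>x\<in>#M. e x)} = (if d = 0 \<and> 3 dvd c then {{#}} else {})"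
    by auto
  then show ?case by simp
next
  case (Cons x xs)
  define A where "A d c ys = {M. set_mset M \<subseteq> set ys \<and> (\<Sum>x\<in>#M. w x) = d \<and> 3 dvd c + (\<Sum>x\<in>#M. e x)}" for d c ys
  have x: "x \<notin> set xs" "w x \<ge> 1" using Cons.prems by auto
  have A_xs: "finite (A d c xs)" "card (A d c xs) = cnt (map (\<lambda>x. (w x, e x)) xs) d c" for d c
    unfolding A_def using Cons.IH Cons.prems by auto
  have A_Cons: "A d c (x # xs) = A d c xs \<union> (if w x \<le> d then add_mset x ` A (d - w x) (c + e x) (x # xs) else {})"
    (is "_ = ?r") for d c
  proof (intro equalityI subsetI)
    fix M assume M: "M \<in> A d c (x # xs)"
    show "M \<in> ?r"
    proof (cases "x \<in># M")
      case True
      then obtain N where N: "M = add_mset x N" by (metis insert_DiffM)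
      then have "N \<in> A (d - w x) (c + e x) (x # xs)" "w x \<le> d" using M by (auto simp: A_def add.assoc)
      then show ?thesis using N by auto
    next
      case False
      then show ?thesis using M by (auto simp: A_def)
    qed
  next
    fix M assume "M \<in> ?r"
    then show "M \<in> A d c (x # xs)" by (auto simp: A_def add.assoc split: if_splits)
  qed
  let ?m = "map (\<lambda>x. (w x, e x))"
  have cnt_Cons: "cnt (?m (x # xs)) d c = cnt (?m xs) d c + (if w x \<le> d then cnt (?m (x # xs)) (d - w x) (c + e x) else 0)" for d c
    using cnt.simps(2)[of "w x" "e x" "?m xs" d c] x(2) unfolding list.map by (simp only: simp_thms)
  have "finite (A d c (x # xs)) \<and> card (A d c (x # xs)) = cnt (?m (x # xs)) d c" for d c
  proof (induction d arbitrary: c rule: less_induct)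
    case (less d)
    show ?case
    proof (cases "w x \<le> d")
      case True
      let ?I = "add_mset x ` A (d - w x) (c + e x) (x # xs)"
      have "d - w x < d" using True x(2) by linarith
      note IH = less.IH[OF this, of "c + e x"]
      have eq: "A d c (x # xs) = A d c xs \<union> ?I" unfolding A_Cons[of d c] if_P[OF True] by (rule refl)
      have fI: "finite ?I" by (rule finite_imageI[OF conjunct1[OF IH]])
      have cI: "card ?I = card (A (d - w x) (c + e x) (x # xs))"
        by (rule card_image) (simp add: inj_on_def)
      have dis: "A d c xs \<inter> ?I = {}"
      proof (rule equals0I)
        fix M assume "M \<in> A d c xs \<inter> ?I"
        then obtain N where N: "M = add_mset x N" "M \<in> A d c xs" by blast
        then have "x \<in> set xs" by (auto simp: A_def)
        then show False using x(1) by contradiction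
      qed
      have "card (A d c xs \<union> ?I) = card (A d c xs) + card ?I" by (rule card_Un_disjoint[OF A_xs(1) fI dis])
      also have "\<dots> = cnt (?m xs) d c + cnt (?m (x # xs)) (d - w x) (c + e x)"
        by (simp only: cI A_xs(2) conjunct2[OF IH])
      also have "\<dots> = cnt (?m (x # xs)) d c" using cnt_Cons[of d c] unfolding if_P[OF True] by (rule sym)
      finally show ?thesis unfolding eq by (rule conjI[OF finite_UnI[OF A_xs(1) fI]])
    next
      case False
      have eq: "A d c (x # xs) = A d c xs" unfolding A_Cons[of d c] if_not_P[OF False] by (rule Un_empty_right)
      have "cnt (?m (x # xs)) d c = cnt (?m xs) d c" using cnt_Cons[of d c] unfolding if_not_P[OF False] add_0_right .
      then show ?thesis unfolding eq using A_xs[of d c] by (simp only: simp_thms)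
    qed
  qed
  then show ?case unfolding A_def .
qed

text \<open>Only the weights of the unknown letters enter the counts, so the letters themselves are
  quantified away. The existence of the list includes finiteness.\<close>

definition letters_below :: "'a set \<Rightarrow> ('a \<Rightarrow> nat) \<Rightarrow> nat \<Rightarrow> nat list \<Rightarrow> bool" where
  "letters_below L w k ws \<longleftrightarrow> (\<exists>xs. distinct xs \<and> set xs = {l \<in> L. w l < k} \<and> map w xs = ws)"

lemma sum_mset_mono_mem: "x \<in># M \<Longrightarrow> (f x :: nat) \<le> (\<Sum>x\<in>#M. f x)"
  by (auto dest!: multi_member_split)

lemma sum_mset_mset: "(\<Sum>x\<in>#mset xs. f x :: nat) = (\<Sum>x\<leftarrow>xs. f x)"
  by (induction xs) simp_all

text \<open>A multiset of weight \<open>k\<close> either consists of letters of smaller weight or is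
  a single letter, so the total number \<open>D\<close> determines how many letters of weight
  \<open>k\<close> there are.\<close>

lemma letters_below_step:
  assumes w: "\<And>l. l \<in> L \<Longrightarrow> w l \<ge> 1" and E: "letters_below L w k ws" and k: "k \<ge> 1"
    and D: "card {M. set_mset M \<subseteq> L \<and> (\<Sum>x\<in>#M. w x) = k} = D" "D > 0"
  shows "letters_below L w (Suc k) (replicate (D - cnt (map (\<lambda>k. (k, 0)) ws) k 0) k @ ws)"
    and "finite {l \<in> L. w l = k} \<and> card {l \<in> L. w l = k} = D - cnt (map (\<lambda>k. (k, 0)) ws) k 0"
proof -
  obtain xs where xs: "distinct xs" "set xs = {l \<in> L. w l < k}" "map w xs = ws"
    using E unfolding letters_below_def by blast
  let ?A = "{M. set_mset M \<subseteq> L \<and> (\<Sum>x\<in>#M. w x) = k}"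
  let ?B = "{M. set_mset M \<subseteq> set xs \<and> (\<Sum>x\<in>#M. w x) = k}"
  let ?C = "{l \<in> L. w l = k}"
  \<comment> \<open>Infinite sets have cardinality 0, so \<open>D > 0\<close> yields
    finiteness.\<close>
  have fA: "finite ?A" by (rule card_ge_0_finite) (simp only: D)
  have split: "?A = ?B \<union> (\<lambda>l. {#l#}) ` ?C"
  proof (intro equalityI subsetI)
    fix M assume M: "M \<in> ?A"
    show "M \<in> ?B \<union> (\<lambda>l. {#l#}) ` ?C"
    proof (cases "\<forall>l \<in># M. w l < k")
      case True
      then show ?thesis using M xs(2) by auto
    next
      case False
      then obtain l N where l: "w l \<ge> k" "M = add_mset l N" by (metis insert_DiffM linorder_not_less)
      have "N = {#}"
      proof (rule ccontr)
        assume "N \<noteq> {#}"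
        then obtain n where n: "n \<in># N" by blast
        then have "n \<in> L" using M l by auto
        then have "w n \<ge> 1" by (rule w)
        moreover have "w n \<le> (\<Sum>x\<in>#N. w x)" by (rule sum_mset_mono_mem[OF n])
        ultimately have "(\<Sum>x\<in>#N. w x) \<ge> 1" by linarith
        then show False using M l by simp
      qed
      then show ?thesis using M l by auto
    qed
  qed (auto simp: xs(2))
  have dis: "?B \<inter> (\<lambda>l. {#l#}) ` ?C = {}"
  proof (rule equals0I)
    fix M assume "M \<in> ?B \<inter> (\<lambda>l. {#l#}) ` ?C"
    then obtain l where l: "M = {#l#}" "w l = k" "set_mset M \<subseteq> set xs" by blast
    then have "l \<in> set xs" by simp
    then have "l \<in> {l \<in> L. w l < k}" unfolding xs(2) .
    then show False using l(2) by simp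
  qed
  have fC: "finite ?C" using fA unfolding split by (auto dest!: finite_imageD simp: inj_on_def)
  have cC: "card ((\<lambda>l. {#l#}) ` ?C) = card ?C" by (rule card_image) (simp add: inj_on_def)
  have "?B = {M. set_mset M \<subseteq> set xs \<and> (\<Sum>x\<in>#M. w x) = k \<and> 3 dvd 0 + (\<Sum>x\<in>#M. 0 :: nat)}" by simp
  also have "card \<dots> = cnt (map (\<lambda>x. (w x, 0)) xs) k 0"
    using card_cnt[OF xs(1), of w k 0 "\<lambda>_. 0"] w xs(2) by blast
  also have "map (\<lambda>x. (w x, 0 :: nat)) xs = map (\<lambda>k. (k, 0)) ws" by (simp flip: xs(3))
  finally have cB: "card ?B = cnt (map (\<lambda>k. (k, 0)) ws) k 0" .
  have "finite (?B \<union> (\<lambda>l. {#l#}) ` ?C)" using fA unfolding split .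
  then have "finite ?B" by (rule conjunct1[OF iffD1[OF finite_Un]])
  then have "D = card ?B + card ?C"
    unfolding D(1)[symmetric] split using dis fC by (subst card_Un_disjoint) (auto simp: cC)
  then have c: "card ?C = D - cnt (map (\<lambda>k. (k, 0)) ws) k 0" using cB by simp
  then show "finite ?C \<and> card ?C = D - cnt (map (\<lambda>k. (k, 0)) ws) k 0" using fC by blast
  obtain ys where ys: "set ys = ?C" "distinct ys" using fC finite_distinct_list by blast
  have "length ys = D - cnt (map (\<lambda>k. (k, 0)) ws) k 0" using ys c distinct_card by metis
  moreover have "map w ys = map (\<lambda>_. k) ys" using ys(1) by (intro map_cong) auto
  then have "map w ys = replicate (length ys) k" by (simp only: map_replicate_const)
  ultimately have "map w (ys @ xs) = replicate (D - cnt (map (\<lambda>k. (k, 0)) ws) k 0) k @ ws" using xs by simp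
  moreover have "distinct (ys @ xs)" "set (ys @ xs) = {l \<in> L. w l < Suc k}" using ys xs by auto
  ultimately show "letters_below L w (Suc k) (replicate (D - cnt (map (\<lambda>k. (k, 0)) ws) k 0) k @ ws)"
    unfolding letters_below_def by blast
qed

lemma replicate_numeral_Cons: "replicate (numeral k) x = x # replicate (pred_numeral k) x"
  by (simp only: numeral_eq_Suc replicate_Suc)

text \<open>
  The graded dimensions 1, 3, 8, 17, 36, 75 force 9 free letters of weight 5 but only 8 of weight 6,
  although \<open>t\<close> (the translation operator) embeds the former into the latter.
\<close>

lemma no_free_letters:
  fixes L :: "'a set"
  assumes w: "\<And>l. l \<in> L \<Longrightarrow> w l \<ge> 1"
    and D: "\<And>d. 1 \<le> d \<Longrightarrow> d \<le> 6 \<Longrightarrow> card {M. set_mset M \<subseteq> L \<and> (\<Sum>x\<in>#M. w x) = d} = [1, 1, 3, 8, 17, 36, 75] ! d"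
    and t: "inj_on t L" "\<And>l. l \<in> L \<Longrightarrow> t l \<in> L \<and> w (t l) = Suc (w l)"
  shows False
proof -
  have "{l \<in> L. w l < 1} = {}" using w by fastforce
  then have E1: "letters_below L w 1 []" by (auto simp: letters_below_def)
  have E2: "letters_below L w 2 [1]"
    using letters_below_step(1)[OF w E1 _ D[of 1]] by (simp add: numeral_2_eq_2 cnt.simps)
  have E3: "letters_below L w 3 [2, 2, 1]"
    using letters_below_step(1)[OF w E2 _ D[of 2]] by (simp add: replicate_numeral_Cons cnt.simps)
  have E4: "letters_below L w 4 [3, 3, 3, 3, 3, 2, 2, 1]"
    using letters_below_step(1)[OF w E3 _ D[of 3]] by (simp add: replicate_numeral_Cons cnt.simps)
  have E5: "letters_below L w 5 [4, 4, 4, 4, 4, 4, 3, 3, 3, 3, 3, 2, 2, 1]"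
    using letters_below_step(1)[OF w E4 _ D[of 4]] by (simp add: replicate_numeral_Cons cnt.simps)
  have c5: "finite {l \<in> L. w l = 5} \<and> card {l \<in> L. w l = 5} = 9"
    and E6: "letters_below L w 6 [5, 5, 5, 5, 5, 5, 5, 5, 5, 4, 4, 4, 4, 4, 4, 3, 3, 3, 3, 3, 2, 2, 1]"
    using letters_below_step[OF w E5 _ D[of 5]] by (simp_all add: replicate_numeral_Cons cnt.simps)
  have c6: "finite {l \<in> L. w l = 6} \<and> card {l \<in> L. w l = 6} = 8"
    using letters_below_step(2)[OF w E6 _ D[of 6]] by (simp add: cnt.simps)
  have "card {l \<in> L. w l = 5} \<le> card {l \<in> L. w l = 6}"
    by (rule card_inj_on_le[of t]) (use t c6 in \<open>auto intro: inj_on_subset\<close>)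
  then show False using c5 c6 by simp
qed

lemma card_Vkeys:
  assumes "d \<le> 6"
  shows "finite {M \<in> Vkeys. wt M = d} \<and> card {M \<in> Vkeys. wt M = d} = [1, 1, 3, 8, 17, 36, 75] ! d"
proof -
  \<comment> \<open>Letters of weight above 6 cannot occur here, so eighteen letters suffice for the
    count.\<close>
  define xs where "xs = List.product [0 :: nat, 1, 2] [1 :: nat, 2, 3, 4, 5, 6]"
  have a: "set_mset M \<subseteq> set xs" if "M \<in> letters" "wt M = d" for M
  proof
    fix x assume x: "x \<in># M"
    then have "snd x \<le> 6" using sum_mset_mono_mem[OF x, of snd] that assms by (simp add: wt_def)
    moreover have "fst x < 3" "snd x \<ge> 1" using x that by (auto simp: letters_def)
    ultimately have "(fst x = 0 \<or> fst x = 1 \<or> fst x = 2) \<and> (snd x = 1 \<or> snd x = 2 \<or> snd x = 3 \<or> snd x = 4 \<or> snd x = 5 \<or> snd x = 6)"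
      by linarith
    then have "x \<in> {0, 1, 2} \<times> {1, 2, 3, 4, 5, 6}" by (cases x) auto
    then show "x \<in> set xs" by (simp add: xs_def)
  qed
  have "set xs \<subseteq> {..<3} \<times> {1..}" by (auto simp: xs_def)
  then have b: "set_mset M \<subseteq> set xs \<Longrightarrow> M \<in> letters" for M unfolding letters_def by blast
  have eq: "{M \<in> Vkeys. wt M = d} = {M. set_mset M \<subseteq> set xs \<and> (\<Sum>x\<in>#M. snd x) = d \<and> 3 dvd 0 + (\<Sum>x\<in>#M. fst x)}"
    unfolding Vkeys_def add_0_left wt_def[symmetric] charge_def[symmetric] using a b by blast
  have "d = 0 \<or> d = 1 \<or> d = 2 \<or> d = 3 \<or> d = 4 \<or> d = 5 \<or> d = 6" using assms by linarith
  then have cv: "cnt (map (\<lambda>x. (snd x, fst x)) xs) d 0 = [1, 1, 3, 8, 17, 36, 75] ! d"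
    unfolding xs_def by (elim disjE; hypsubst; code_simp)
  have dx: "distinct xs" by (simp add: xs_def)
  have sx: "\<And>x. x \<in> set xs \<Longrightarrow> snd x \<ge> 1" by (auto simp: xs_def)
  show ?thesis using card_cnt[where w = snd and e = fst and d = d and c = 0, OF dx sx] unfolding eq cv .
qed

lemma Bm_independent: "fs.independent (Bm ` letters)"
  unfolding fs.independent_explicit_module
proof (intro allI impI)
  fix t and u :: "fock \<Rightarrow> complex" and v
  assume t: "finite t" "t \<subseteq> Bm ` letters" "(\<Sum>v\<in>t. fock_scale (u v) v) = 0" "v \<in> t"
  obtain M where M: "v = Bm M" "M \<in> letters" using t by blast
  have "(\<Sum>x\<in>t. fock_scale (u x) (theta_inv x)) = 0"
    using arg_cong[OF t(3), of theta_inv] by (simp add: flin_sum[OF flin_theta_inv] flin_scale[OF flin_theta_inv] flin_zero[OF flin_theta_inv])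
  then have "(\<Sum>x\<in>t. u x * Poly_Mapping.lookup (theta_inv x) M) = 0"
    by (metis (no_types, lifting) lookup_fock_scale lookup_sum lookup_zero sum.cong)
  moreover have "u x * Poly_Mapping.lookup (theta_inv x) M = (if x = v then u v else 0)" if x: "x \<in> t" for x
  proof -
    obtain N where N: "x = Bm N" "N \<in> letters" using x t(2) by blast
    then have "x = v \<longleftrightarrow> N = M" using M Bm_inj by (auto simp: inj_on_def)
    then show ?thesis using N M(1) by (auto simp: theta_inv_Bm lookup_single when_def)
  qed
  ultimately have "(\<Sum>x\<in>t. if x = v then u v else 0) = 0" by simp
  then show "u v = 0" using t(1,4) by simp
qed

text \<open>Projection to weight \<open>d\<close> fixes the vector and kills all spanning vectors of
  other weights.\<close>

lemma graded_span_piece: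
  assumes v: "\<And>i. i \<in> I \<Longrightarrow> v i \<in> graded {int (g i)}"
    and x: "x \<in> fs.span (v ` I)" "x \<in> graded {int d}"
  shows "x \<in> fs.span (v ` {i \<in> I. g i = d})"
proof -
  define P where "P = lin (\<lambda>M. if wt M = d then mon M else 0)"
  have P: "flin P" unfolding P_def by (rule flin_lin)
  have Pd: "P p = p" if "p \<in> graded {int d}" for p
    by (rule supp_in_eqI[OF P flin_ident that]) (simp add: P_def)
  have Pe: "P p = 0" if "p \<in> graded {int e}" "e \<noteq> d" for p e
    using that supp_in_eqI[OF P fp.module_hom_zero that(1)] by (simp add: P_def)
  have "fs.span (v ` I) \<subseteq> {p. P p \<in> fs.span (v ` {i \<in> I. g i = d})}"
  proof (intro fs.span_minimal module_hom.subspace_linear_preimage[OF P] fs.subspace_span subsetI CollectI)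
    fix p assume "p \<in> v ` I"
    then obtain i where i: "p = v i" "i \<in> I" by blast
    show "P p \<in> fs.span (v ` {i \<in> I. g i = d})"
    proof (cases "g i = d")
      case True
      have "P p = v i" using v[OF i(2)] True i(1) by (simp add: Pd)
      moreover have "v i \<in> v ` {i \<in> I. g i = d}" using True i(2) by blast
      ultimately show ?thesis by (simp add: fs.span_base)
    next
      case False
      then show ?thesis using Pe[OF v[OF i(2)] False] i(1) by (simp add: fs.span_zero)
    qed
  qed
  then show ?thesis using x Pd by fastforce
qed

lemma VV_piece:
  shows "VV \<inter> graded {int d} \<subseteq> fs.span (Bm ` {M \<in> Vkeys. wt M = d})"
    and "Bm ` {M \<in> Vkeys. wt M = d} \<subseteq> VV \<inter> graded {int d}"
    and "fs.independent (Bm ` {M \<in> Vkeys. wt M = d})"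
    and "card (Bm ` {M \<in> Vkeys. wt M = d}) = card {M \<in> Vkeys. wt M = d}"
proof -
  have l: "Vkeys \<subseteq> letters" by (auto simp: Vkeys_def)
  show "VV \<inter> graded {int d} \<subseteq> fs.span (Bm ` {M \<in> Vkeys. wt M = d})"
    using graded_piece_span[OF l, of _ d] by (auto simp: VV_span)
  show "Bm ` {M \<in> Vkeys. wt M = d} \<subseteq> VV \<inter> graded {int d}"
  proof
    fix v assume "v \<in> Bm ` {M \<in> Vkeys. wt M = d}"
    then obtain M where M: "v = Bm M" "M \<in> Vkeys" "wt M = d" by blast
    then have "v \<in> VV" unfolding VV_span by (auto intro: fs.span_base)
    then show "v \<in> VV \<inter> graded {int d}" using Bm_graded[of M] l M by blast
  qed
  show "fs.independent (Bm ` {M \<in> Vkeys. wt M = d})"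
    by (rule fs.independent_mono[OF Bm_independent]) (use l in auto)
  show "card (Bm ` {M \<in> Vkeys. wt M = d}) = card {M \<in> Vkeys. wt M = d}"
    by (rule card_image, rule inj_on_subset[OF Bm_inj]) (use l in auto)
qed

abbreviation mo :: "(fock \<times> nat) list \<Rightarrow> fock" where
  "mo \<equiv> monomial (sub_voa VV omega3)"

abbreviation lwt :: "(fock \<Rightarrow> nat) \<Rightarrow> fock \<times> nat \<Rightarrow> nat" where
  "lwt gw l \<equiv> gw (fst l) + snd l - 1"

lemma mo_graded:
  fixes gw :: "fock \<Rightarrow> nat"
  assumes "\<And>a. a \<in> S \<Longrightarrow> a \<in> graded {int (gw a)}" "xs \<in> lists (S \<times> {1..})"
  shows "mo xs \<in> graded {int (\<Sum>l\<leftarrow>xs. lwt gw l)}"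
  using assms(2)
proof (induction xs)
  case Nil
  then show ?case using one_supp_in[of "{M. int (wt M) \<in> {0}}"] by (simp add: monomial_Nil)
next
  case (Cons x xs)
  obtain a n where x: "x = (a, n)" "a \<in> S" "n \<ge> 1" using Cons.hyps by (cases x) auto
  have "mo (x # xs) \<in> graded {int (gw a) + int (\<Sum>l\<leftarrow>xs. lwt gw l) - (- int n) - 1}"
    unfolding x(1) monomial_Cons by (rule Y_graded1[OF assms(1)[OF x(2)] Cons.IH])
  moreover have "int (gw a) + int (\<Sum>l\<leftarrow>xs. lwt gw l) - (- int n) - 1 = int (\<Sum>l\<leftarrow>x # xs. lwt gw l)"
    using x by simp
  ultimately show ?case by (simp only:)
qed

section \<open>Ordered monomials counted as multisets, and the contradiction in weight 6\<close>

section \<open>Non-freeness\<close>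

lemma sorted_wrt_unique:
  assumes "antisym R" "trans R"
  shows "sorted_wrt (\<lambda>p q. (p, q) \<in> R) xs \<Longrightarrow> sorted_wrt (\<lambda>p q. (p, q) \<in> R) ys \<Longrightarrow> mset xs = mset ys \<Longrightarrow> xs = ys"
proof (induction xs arbitrary: ys)
  case (Cons x xs)
  then obtain y ys' where ys: "ys = y # ys'" by (cases ys) auto
  have "x = y"
  proof (rule ccontr)
    assume "x \<noteq> y"
    have s: "set (x # xs) = set ys" by (rule mset_eq_setD[OF Cons.prems(3)])
    have "x \<in> set ys" unfolding s[symmetric] by simp
    then have x: "x \<in> set ys'" using \<open>x \<noteq> y\<close> unfolding ys by simp
    have "y \<in> set (x # xs)" unfolding s ys by simp
    then have "y \<in> set xs" using \<open>x \<noteq> y\<close> by auto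
    with x have "(x, y) \<in> R" "(y, x) \<in> R" using Cons.prems(1,2) ys by auto
    then show False using assms(1) \<open>x \<noteq> y\<close> by (auto dest: antisymD)
  qed
  then show ?case using Cons ys by simp
qed simp

lemma sorted_wrt_insert:
  assumes R: "linear_order_on A R"
  shows "x \<in> A \<Longrightarrow> set ys \<subseteq> A \<Longrightarrow> sorted_wrt (\<lambda>p q. (p, q) \<in> R) ys \<Longrightarrow>
    \<exists>zs. mset zs = add_mset x (mset ys) \<and> sorted_wrt (\<lambda>p q. (p, q) \<in> R) zs"
proof (induction ys)
  case Nil
  then show ?case by (intro exI[of _ "[x]"]) simp
next
  case (Cons y ys)
  have tr: "trans R" using R by (auto simp: linear_order_on_def partial_order_on_def preorder_on_def)
  have tot: "(x, y) \<in> R \<or> (y, x) \<in> R"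
    using R Cons.prems
    by (cases "x = y") (auto simp: linear_order_on_def partial_order_on_def preorder_on_def total_on_def refl_on_def)
  show ?case
  proof (cases "(x, y) \<in> R")
    case True
    then have "sorted_wrt (\<lambda>p q. (p, q) \<in> R) (x # y # ys)"
      using Cons.prems(3) tr by (auto dest: transD)
    then show ?thesis by (intro exI[of _ "x # y # ys"]) simp
  next
    case False
    obtain zs where zs: "mset zs = add_mset x (mset ys)" "sorted_wrt (\<lambda>p q. (p, q) \<in> R) zs"
      using Cons by auto
    have "set zs = insert x (set ys)" using zs(1) by (metis set_mset_add_mset_insert set_mset_mset)
    then have "sorted_wrt (\<lambda>p q. (p, q) \<in> R) (y # zs)" using zs Cons.prems(3) tot False by auto
    then show ?thesis using zs(1) by (intro exI[of _ "y # zs"]) simp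
  qed
qed

text \<open>Existence is insertion sort, uniqueness is antisymmetry; so ordered monomials may be
  counted as multisets, whatever the total order.\<close>

lemma sorted_bij:
  assumes R: "linear_order_on A R"
  shows "bij_betw mset {xs \<in> lists A. sorted_wrt (\<lambda>p q. (p, q) \<in> R) xs} {M. set_mset M \<subseteq> A}"
proof -
  have "antisym R" "trans R" using R by (auto simp: linear_order_on_def partial_order_on_def preorder_on_def)
  then have "inj_on mset {xs \<in> lists A. sorted_wrt (\<lambda>p q. (p, q) \<in> R) xs}"
    by (auto simp: inj_on_def intro: sorted_wrt_unique)
  moreover have "set_mset M \<subseteq> A \<Longrightarrow> \<exists>xs. mset xs = M \<and> sorted_wrt (\<lambda>p q. (p, q) \<in> R) xs" for M
  proof (induction M)
    case empty
    then show ?case by (intro exI[of _ "[]"]) simp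
  next
    case (add x M)
    then obtain xs where xs: "mset xs = M" "sorted_wrt (\<lambda>p q. (p, q) \<in> R) xs" by auto
    have "x \<in> A" "set xs \<subseteq> A" using add.prems xs(1) by auto
    from sorted_wrt_insert[OF R this xs(2)] show ?case using xs(1) by simp
  qed
  then have "M \<in> mset ` {xs \<in> lists A. sorted_wrt (\<lambda>p q. (p, q) \<in> R) xs}" if M: "set_mset M \<subseteq> A" for M
  proof -
    obtain xs where "mset xs = M" "sorted_wrt (\<lambda>p q. (p, q) \<in> R) xs" using \<open>\<And>M. set_mset M \<subseteq> A \<Longrightarrow> _\<close> M by blast
    then show ?thesis using M by (intro image_eqI[of _ _ xs]) auto
  qed
  moreover have "mset ` {xs \<in> lists A. sorted_wrt (\<lambda>p q. (p, q) \<in> R) xs} \<subseteq> {M. set_mset M \<subseteq> A}" by auto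
  ultimately show ?thesis unfolding bij_betw_def by blast
qed

text \<open>A free generating set would make the ordered monomials a graded basis and so turn
  dimensions into counts of multisets of letters \<open>(a, n)\<close> of weight
  \<open>gw a + n - 1\<close>; raising \<open>n\<close> by one is the injection required by
  \<open>no_free_letters\<close>.\<close>

lemma not_freely_generated: "\<not> freely_generates heisenberg3_Z3 S"
proof
  assume "freely_generates heisenberg3_Z3 S"
  then obtain R where sg: "strongly_generates (sub_voa VV omega3) S" and R: "linear_order_on (S \<times> {1..}) R"
    and inj: "inj_on mo {xs \<in> lists (S \<times> {1..}). sorted_wrt (\<lambda>p q. (p, q) \<in> R) xs}" 
    and ind: "fs.independent (mo ` {xs \<in> lists (S \<times> {1..}). sorted_wrt (\<lambda>p q. (p, q) \<in> R) xs})" and sp: "fs.span (mo ` {xs \<in> lists (S \<times> {1..}). sorted_wrt (\<lambda>p q. (p, q) \<in> R) xs}) = VV"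
    unfolding freely_generates_def Let_def heisenberg3_Z3_eq by auto
  let ?M = "{xs \<in> lists (S \<times> {1..}). sorted_wrt (\<lambda>p q. (p, q) \<in> R) xs}"
  have one: "1 \<in> mo ` ?M" by (rule image_eqI[of _ _ "[]"]) (simp_all add: monomial_Nil)
  \<comment> \<open>Independence excludes weights below 1: negative weight gives the zero vector,
    and weight 0 a multiple of the vacuum, which already is the empty monomial.\<close>
  have gw_ex: "\<exists>d :: nat. d \<ge> 1 \<and> a \<in> VV \<and> a \<in> graded {int d}" if a: "a \<in> S" for a
  proof -
    obtain e where e: "a \<in> VV" "a \<in> graded {e}"
      using sg a unfolding strongly_generates_def V.weight_space_eq by blast
    have aM: "[(a, 1)] \<in> ?M" "[] \<in> ?M" using a by auto
    have mo_a: "mo [(a, 1)] = a" using Y_vac(2)[OF VV_St[OF e(1)]] by (simp add: monomial_Cons monomial_Nil)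
    have "mo [(a, 1)] \<in> mo ` ?M" using aM(1) by (rule imageI)
    then have am: "a \<in> mo ` ?M" unfolding mo_a .
    have "a \<noteq> 0"
    proof
      assume "a = 0"
      then have "0 \<in> mo ` ?M" using am by (simp only:)
      then have "fs.dependent (mo ` ?M)" by (rule fs.dependent_zero)
      then show False using ind by contradiction
    qed
    then have "\<not> e < 0" using graded_neg[of "{e}" a] e(2) by auto
    moreover have "e \<noteq> 0"
    proof
      assume "e = 0"
      then have "a \<in> fs.span (Bm ` {M \<in> Vkeys. wt M = 0})" using VV_piece(1)[of 0] e by auto
      moreover have "{M \<in> Vkeys. wt M = 0} \<subseteq> {{#}}"
      proof
        fix M assume M: "M \<in> {M \<in> Vkeys. wt M = 0}"
        have "x \<notin># M" for x
        proof
          assume x: "x \<in># M"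
          then have "snd x \<ge> 1" using M by (auto simp: Vkeys_def letters_def)
          then show False using M x by (auto simp: wt_def)
        qed
        then have "set_mset M = {}" by blast
        then show "M \<in> {{#}}" by simp
      qed
      then have "Bm ` {M \<in> Vkeys. wt M = 0} \<subseteq> {1}" by (auto simp: Bm_simps)
      ultimately have a1: "a \<in> fs.span {1}" using fs.span_mono by blast
      \<comment> \<open>Injectivity on lists separates \<open>a\<close> from the vacuum, so
        \<open>1\<close> is still available after removing \<open>a\<close>.\<close>
      have "mo [] \<noteq> mo [(a, 1)]" using inj_onD[OF inj _ aM(2) aM(1)] by auto
      then have "1 \<in> mo ` ?M - {a}" using one unfolding mo_a by (auto simp: monomial_Nil)
      then have "a \<in> fs.span (mo ` ?M - {a})" using a1 fs.span_mono[of "{1}" "mo ` ?M - {a}"] by blast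
      then show False using ind am unfolding fs.dependent_def by blast
    qed
    ultimately have "nat e \<ge> 1" "int (nat e) = e" by auto
    then show ?thesis using e by (intro exI[of _ "nat e"]) simp
  qed
  then obtain gw where gw: "\<And>a. a \<in> S \<Longrightarrow> gw a \<ge> 1 \<and> a \<in> VV \<and> a \<in> graded {int (gw a)}" by metis
  show False
  proof (rule no_free_letters[of "S \<times> {1..}" "lwt gw" "\<lambda>(a, n). (a, Suc n)"])
    show "lwt gw l \<ge> 1" if "l \<in> S \<times> {1..}" for l using that gw[of "fst l"] by auto
    show "inj_on (\<lambda>(a, n). (a, Suc n)) (S \<times> {1..})" by (auto simp: inj_on_def)
    show "(case l of (a, n) \<Rightarrow> (a, Suc n)) \<in> S \<times> {1..} \<and> lwt gw (case l of (a, n) \<Rightarrow> (a, Suc n)) = Suc (lwt gw l)"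
      if "l \<in> S \<times> {1..}" for l using that by auto
    fix d :: nat assume d: "1 \<le> d" "d \<le> 6"
    let ?Md = "{xs \<in> ?M. (\<Sum>l\<leftarrow>xs. lwt gw l) = d}"
    have mg: "mo xs \<in> graded {int (\<Sum>l\<leftarrow>xs. lwt gw l)}" if "xs \<in> ?M" for xs
      by (rule mo_graded[of S]) (use gw that in auto)
    have sub: "mo ` ?Md \<subseteq> VV \<inter> graded {int d}"
    proof
      fix x assume "x \<in> mo ` ?Md"
      then obtain xs where xs: "x = mo xs" "xs \<in> ?M" "(\<Sum>l\<leftarrow>xs. lwt gw l) = d" by auto
      have "x \<in> fs.span (mo ` ?M)" unfolding xs(1) by (rule fs.span_base) (rule imageI[OF xs(2)])
      then show "x \<in> VV \<inter> graded {int d}" using mg[OF xs(2)] xs sp by auto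
    qed
    have span: "VV \<inter> graded {int d} \<subseteq> fs.span (mo ` ?Md)"
    proof
      fix x assume "x \<in> VV \<inter> graded {int d}"
      then have x: "x \<in> fs.span (mo ` ?M)" "x \<in> graded {int d}" unfolding sp by blast+
      show "x \<in> fs.span (mo ` ?Md)"
        by (rule graded_span_piece[where v = mo and I = ?M and g = "\<lambda>xs. \<Sum>l\<leftarrow>xs. lwt gw l"])
          (rule mg, assumption, rule x(1), rule x(2))
    qed
    have ind': "fs.independent (mo ` ?Md)" by (rule fs.independent_mono[OF ind]) auto
    note K = VV_piece[of d]
    have fin: "finite (Bm ` {M \<in> Vkeys. wt M = d})" using card_Vkeys[OF d(2)] by simp
    have A: "finite (mo ` ?Md) \<and> card (mo ` ?Md) \<le> card (Bm ` {M \<in> Vkeys. wt M = d})"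
      by (rule fs.independent_span_bound[OF fin ind']) (use sub K(1) in blast)
    moreover have "card (Bm ` {M \<in> Vkeys. wt M = d}) \<le> card (mo ` ?Md)"
      using fs.independent_span_bound[OF _ K(3), of "mo ` ?Md"] A K(2) span by blast
    ultimately have "card (mo ` ?Md) = [1, 1, 3, 8, 17, 36, 75] ! d"
      using K(4) card_Vkeys[OF d(2)] by simp
    moreover have "inj_on mo ?Md" by (rule inj_on_subset[OF inj]) auto
    ultimately have c: "card ?Md = [1, 1, 3, 8, 17, 36, 75] ! d" by (simp add: card_image)
    note s = sum_mset_mset[of "lwt gw"]
    have bij: "bij_betw mset ?M {M. set_mset M \<subseteq> S \<times> {1..}}" by (rule sorted_bij[OF R])
    have im: "mset ` ?M = {M. set_mset M \<subseteq> S \<times> {1..}}" by (rule bij_betw_imp_surj_on[OF bij])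
    have bij': "bij_betw mset ?Md {M. set_mset M \<subseteq> S \<times> {1..} \<and> (\<Sum>x\<in>#M. lwt gw x) = d}"
    proof (rule bij_betw_imageI)
      show "inj_on mset ?Md" by (rule inj_on_subset[OF bij_betw_imp_inj_on[OF bij]]) blast
      show "mset ` ?Md = {M. set_mset M \<subseteq> S \<times> {1..} \<and> (\<Sum>x\<in>#M. lwt gw x) = d}"
      proof (intro equalityI subsetI)
        fix M assume "M \<in> mset ` ?Md"
        then obtain xs where xs: "M = mset xs" "xs \<in> ?M" "(\<Sum>l\<leftarrow>xs. lwt gw l) = d" by blast
        have "M \<in> {M. set_mset M \<subseteq> S \<times> {1..}}" unfolding im[symmetric] xs(1) by (rule imageI[OF xs(2)])
        moreover have "(\<Sum>x\<in>#M. lwt gw x) = d" unfolding xs(1) s by (rule xs(3))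
        ultimately show "M \<in> {M. set_mset M \<subseteq> S \<times> {1..} \<and> (\<Sum>x\<in>#M. lwt gw x) = d}" by blast
      next
        fix M assume M: "M \<in> {M. set_mset M \<subseteq> S \<times> {1..} \<and> (\<Sum>x\<in>#M. lwt gw x) = d}"
        then have "M \<in> {M. set_mset M \<subseteq> S \<times> {1..}}" by blast
        then have "M \<in> mset ` ?M" unfolding im .
        then obtain xs where xs: "M = mset xs" "xs \<in> ?M" by (rule imageE)
        have "(\<Sum>x\<in>#M. lwt gw x) = d" using M by blast
        then have "(\<Sum>l\<leftarrow>xs. lwt gw l) = d" unfolding xs(1) s .
        then show "M \<in> mset ` ?Md" unfolding xs(1) using xs(2) by (intro imageI) blast
      qed
    qed
    show "card {M. set_mset M \<subseteq> S \<times> {1..} \<and> (\<Sum>x\<in>#M. lwt gw x) = d} = [1, 1, 3, 8, 17, 36, 75] ! d"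
      using c unfolding bij_betw_same_card[OF bij'] .
  qed
qed

section \<open>The filtration by generator weight, and spanning by one monomial per multiset\<close>

section \<open>A Poincare-Birkhoff-Witt argument and minimality\<close>

text \<open>Formulated for any homogeneous generating set of positive weights, since minimality
  applies it to a hypothetical smaller set.\<close>

locale pbw =
  fixes S :: "fock set" and gw :: "fock \<Rightarrow> nat"
  assumes S_VV: "S \<subseteq> VV" and gw: "\<And>a. a \<in> S \<Longrightarrow> a \<in> graded {int (gw a)} \<and> gw a \<ge> 1"
    and S_gen: "VV = fs.span (mo ` lists (S \<times> {1..}))"
begin

definition hgt :: "(fock \<times> nat) list \<Rightarrow> nat" where
  "hgt xs = (\<Sum>l\<leftarrow>xs. gw (fst l))"

lemma hgt_simps [simp]: "hgt [] = 0" "hgt (x # xs) = gw (fst x) + hgt xs" "hgt (xs @ ys) = hgt xs + hgt ys"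
  by (simp_all add: hgt_def)

text \<open>
  The filtration by the total weight of the generators involved: with respect to it the modes of the
  generators commute up to lower order.
\<close>

definition F :: "int \<Rightarrow> fock set" where
  "F p = fs.span (mo ` {xs \<in> lists (S \<times> {1..}). int (hgt xs) \<le> p})"

lemma subspace_F: "fs.subspace (F p)"
  by (simp add: F_def)

lemma F_mono: "p \<le> q \<Longrightarrow> F p \<subseteq> F q"
  unfolding F_def by (intro fs.span_mono image_mono) auto

lemma mo_F: "xs \<in> lists (S \<times> {1..}) \<Longrightarrow> int (hgt xs) \<le> p \<Longrightarrow> mo xs \<in> F p"
  unfolding F_def by (intro fs.span_base imageI) auto

lemma F_induct:
  assumes "v \<in> F p" "flin f" "fs.subspace A"
    "\<And>xs. xs \<in> lists (S \<times> {1..}) \<Longrightarrow> int (hgt xs) \<le> p \<Longrightarrow> f (mo xs) \<in> A"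
  shows "f v \<in> A"
proof -
  have "F p \<subseteq> {v. f v \<in> A}" unfolding F_def
    by (intro fs.span_minimal module_hom.subspace_linear_preimage[OF assms(2)] assms(3)) (use assms(4) in auto)
  then show ?thesis using assms(1) by blast
qed

lemma act_F:
  assumes "a \<in> S" "n \<ge> 1" "v \<in> F p"
  shows "Y a (- int n) v \<in> F (int (gw a) + p)"
proof (rule F_induct[OF assms(3) flin_Y subspace_F])
  fix xs assume "xs \<in> lists (S \<times> {1..})" "int (hgt xs) \<le> p"
  then have "mo ((a, n) # xs) \<in> F (int (gw a) + p)" using assms(1,2) by (intro mo_F) auto
  then show "Y a (- int n) (mo xs) \<in> F (int (gw a) + p)" by (simp only: monomial_Cons)
qed

lemma S_F: "a \<in> S \<Longrightarrow> a \<in> F (int (gw a))"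
proof -
  assume a: "a \<in> S"
  have "mo [(a, 1)] \<in> F (int (gw a))" using a by (intro mo_F) auto
  moreover have "mo [(a, 1)] = a" using Y_vac(2)[of a] VV_St S_VV a by (auto simp: monomial_Cons monomial_Nil)
  ultimately show ?thesis by simp
qed

lemma hgt_mset: "hgt xs = (\<Sum>l\<in>#mset xs. gw (fst l))"
  by (induction xs) simp_all

lemma hgt_le: "xs \<in> lists (S \<times> {1..}) \<Longrightarrow> hgt xs \<le> (\<Sum>l\<leftarrow>xs. lwt gw l)"
  by (induction xs) auto

lemma VV_span_weight: "v \<in> VV \<Longrightarrow> v \<in> graded {int d} \<Longrightarrow> v \<in> fs.span (mo ` {xs \<in> lists (S \<times> {1..}). (\<Sum>l\<leftarrow>xs. lwt gw l) = d})"
  using S_gen gw by (intro graded_span_piece mo_graded[of S]) auto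

text \<open>A letter \<open>(a, n)\<close> with \<open>n >= 1\<close> weighs at least
  \<open>gw a\<close>, so the height of a monomial is bounded by its weight.\<close>

lemma VV_F: "v \<in> VV \<Longrightarrow> v \<in> graded {e} \<Longrightarrow> v \<in> F e"
proof (cases "e < 0")
  case True
  assume "v \<in> graded {e}"
  then have "v = 0" using True graded_neg[of "{e}" v] by auto
  then show ?thesis by (simp add: F_def fs.span_zero)
next
  case False
  assume v: "v \<in> VV" "v \<in> graded {e}"
  then have "v \<in> fs.span (mo ` {xs \<in> lists (S \<times> {1..}). (\<Sum>l\<leftarrow>xs. lwt gw l) = nat e})"
    using VV_span_weight[of v "nat e"] False by simp
  also have "\<dots> \<subseteq> F e" unfolding F_def
    by (intro fs.span_mono image_mono) (use hgt_le False in fastforce)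
  finally show ?thesis .
qed

lemma mo_VV: "xs \<in> lists (S \<times> {1..}) \<Longrightarrow> mo xs \<in> VV"
  by (subst S_gen) (auto intro: fs.span_base)

text \<open>Everything rests on products \<open>Y a i b\<close> of generators with
  \<open>i >= 0\<close>: their weight, and by \<open>VV_F\<close> their filtration degree, is below
  \<open>gw a + gw b\<close>. Induction on the total height does the rest, peeling off letters of
  \<open>xs\<close> by the iterate and of \<open>ys\<close> by the commutator formula.\<close>

lemma Y_F_mo:
  assumes "xs \<in> lists (S \<times> {1..})" "ys \<in> lists (S \<times> {1..})"
  shows "Y (mo xs) n (mo ys) \<in> F (int (hgt xs + hgt ys)) \<and>
    (n \<ge> 0 \<longrightarrow> Y (mo xs) n (mo ys) \<in> F (int (hgt xs + hgt ys) - 1))"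
  using assms
proof (induction "hgt xs + hgt ys" arbitrary: xs ys n rule: less_induct)
  case less
  define s where "s = hgt xs + hgt ys"
  have IH: "Y u n v \<in> F (p + q) \<and> (n \<ge> 0 \<longrightarrow> Y u n v \<in> F (p + q - 1))"
    if pq: "u \<in> F p" "v \<in> F q" "p + q < int s" for u v p q n
  proof -
    have *: "Y (mo us) n (mo vs) \<in> F (p + q) \<and> (n \<ge> 0 \<longrightarrow> Y (mo us) n (mo vs) \<in> F (p + q - 1))"
      if uv: "us \<in> lists (S \<times> {1..})" "int (hgt us) \<le> p" "vs \<in> lists (S \<times> {1..})" "int (hgt vs) \<le> q" for us vs
    proof -
      have "hgt us + hgt vs < hgt xs + hgt ys" using uv(2,4) pq(3) by (simp add: s_def)
      from less.hyps[OF this uv(1,3), of n]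
      show ?thesis using F_mono[of "int (hgt us + hgt vs)" "p + q"] F_mono[of "int (hgt us + hgt vs) - 1" "p + q - 1"] uv by auto
    qed
    have "Y u n v \<in> F r" if r: "\<And>us vs. us \<in> lists (S \<times> {1..}) \<Longrightarrow> int (hgt us) \<le> p \<Longrightarrow> vs \<in> lists (S \<times> {1..}) \<Longrightarrow> int (hgt vs) \<le> q \<Longrightarrow> Y (mo us) n (mo vs) \<in> F r" for r
      by (rule F_induct[OF pq(1) flin_Y_left subspace_F], rule F_induct[OF pq(2) flin_Y subspace_F], rule r)
    then show ?thesis using * by blast
  qed
  \<comment> \<open>A single generator in a nonnegative mode. The bound admits total height
    \<open>s\<close> itself, which the induction hypothesis does not reach.\<close>
  have gen: "Y a n (mo zs) \<in> F (int (gw a + hgt zs) - 1)"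
    if g: "a \<in> S" "zs \<in> lists (S \<times> {1..})" "gw a + hgt zs \<le> s" "n \<ge> 0" for a zs n
  proof (cases zs)
    case Nil
    then show ?thesis using Y_vac(1)[OF g(4)] by (simp add: monomial_Nil F_def fs.span_zero)
  next
    case (Cons z zs')
    then obtain b m where z: "z = (b, m)" "b \<in> S" "m \<ge> 1" "zs' \<in> lists (S \<times> {1..})" using g(2) by (cases z) auto
    have St: "a \<in> St" "b \<in> St" "mo zs' \<in> St" using VV_St S_VV mo_VV z g(1) by auto
    have wb: "gw b \<ge> 1" using gw z by blast
    have w': "mo zs' \<in> F (int (hgt zs'))" using z(4) by (intro mo_F) auto
    have "Y a n (mo zs) = Y b (- int m) (Y a n (mo zs')) +
      Sum_any (\<lambda>i. fock_scale (of_int n gchoose i) (Y (Y a (int i) b) (n + - int m - int i) (mo zs')))"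
      using Y_commutator[OF St, of n "- int m"] unfolding Cons z(1) monomial_Cons by (simp add: algebra_simps)
    moreover have "Y b (- int m) (Y a n (mo zs')) \<in> F (int (gw a + hgt zs) - 1)"
    proof -
      have "Y a n (mo zs') \<in> F (int (gw a) + int (hgt zs') - 1)"
        using IH[OF S_F[OF g(1)] w', of n] g(3,4) wb Cons z(1) by simp
      from act_F[OF z(2,3) this] show ?thesis using Cons z(1) by (simp add: algebra_simps)
    qed
    moreover have "Y (Y a (int i) b) r (mo zs') \<in> F (int (gw a + hgt zs) - 1)" for i r
    proof -
      have "Y a (int i) b \<in> F (int (gw a) + int (gw b) - int i - 1)"
        using gw g(1) z(2) S_VV by (intro VV_F VV_closed Y_graded1) auto
      from IH[OF this w', of r]
      have "Y (Y a (int i) b) r (mo zs') \<in> F (int (gw a) + int (gw b) - int i - 1 + int (hgt zs'))"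
        using g(3) Cons z(1) by simp
      moreover have "F (int (gw a) + int (gw b) - int i - 1 + int (hgt zs')) \<subseteq> F (int (gw a + hgt zs) - 1)"
        by (rule F_mono) (simp add: Cons z(1))
      ultimately show ?thesis by blast
    qed
    then have "Sum_any (\<lambda>i. fock_scale (of_int n gchoose i) (Y (Y a (int i) b) (n + - int m - int i) (mo zs'))) \<in> F (int (gw a + hgt zs) - 1)"
      by (intro Sum_any_mem subspace_F fs.subspace_scale[OF subspace_F])
    ultimately show ?thesis by (simp only: fs.subspace_add[OF subspace_F])
  qed
  show ?case
  proof (cases xs)
    case Nil
    have "mo ys \<in> F (int (hgt ys))" using less.prems(2) by (intro mo_F) auto
    then show ?thesis unfolding Nil monomial_Nil Y_one by (simp add: F_def fs.span_zero)
  next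
    case (Cons x xs')
    then obtain a m where x: "x = (a, m)" "a \<in> S" "m \<ge> 1" "xs' \<in> lists (S \<times> {1..})" using less.prems by (cases x) auto
    let ?u = "mo xs'" and ?w = "mo ys"
    have St: "a \<in> St" "?u \<in> St" "?w \<in> St" using VV_St S_VV mo_VV x less.prems by auto
    have wa: "gw a \<ge> 1" using gw x by blast
    have u: "?u \<in> F (int (hgt xs'))" and w: "?w \<in> F (int (hgt ys))" by (rule mo_F, rule x(4), rule order_refl) (rule mo_F, rule less.prems(2), rule order_refl)
    have s: "int s = int (gw a) + int (hgt xs') + int (hgt ys)" by (simp add: s_def Cons x(1))
    have "Y (mo xs) n ?w = B_lhs (- int m) 0 n a ?u ?w"
    proof -
      have "(\<lambda>i. fock_scale (of_int 0 gchoose i) (Y (Y a (- int m + int i) ?u) (0 + n - int i) ?w)) =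
        (\<lambda>i. if i = 0 then Y (Y a (- int m) ?u) n ?w else 0)"
        by (rule ext) (auto simp: gbinomial_0_left)
      then show ?thesis unfolding B_lhs_def Cons x(1) monomial_Cons by (simp only: Sum_any_delta)
    qed
    then have it: "Y (mo xs) n ?w = B_rhs (- int m) 0 n a ?u ?w" using borcherds[OF St] by simp
    \<comment> \<open>The reversed summands always gain one step of the filtration, so the summands
      with \<open>a\<close> in front decide between \<open>s\<close> and
      \<open>s - 1\<close>.\<close>
    have fin: "Y (mo xs) n ?w \<in> F r"
      if 1: "\<And>i. Y a (- int m - int i) (Y ?u (n + int i) ?w) \<in> F r" and r: "r \<ge> int s - 1" for r
    proof -
      have 2: "Y ?u k (Y a (int i) ?w) \<in> F r" for i k
      proof -
        have "Y a (int i) ?w \<in> F (int (gw a + hgt ys) - 1)"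
          by (rule gen) (use x less.prems s in auto)
        from IH[OF u this, of k] have "Y ?u k (Y a (int i) ?w) \<in> F (int s - 1)" using s by (simp add: algebra_simps)
        then show ?thesis using F_mono[OF r] by blast
      qed
      show ?thesis unfolding it B_rhs_def
        by (intro Sum_any_mem subspace_F fs.subspace_scale[OF subspace_F] fs.subspace_diff[OF subspace_F]) (use 1 2 in auto)
    qed
    have k: "Y a (- int m - int i) v \<in> F (int (gw a) + p)" if "v \<in> F p" for i v p
    proof -
      have "Y a (- int (m + i)) v \<in> F (int (gw a) + p)" by (rule act_F[OF x(2) _ that]) (use x in simp)
      moreover have "- int (m + i) = - int m - int i" by simp
      ultimately show ?thesis by (simp only:)
    qed
    have lt: "int (hgt xs') + int (hgt ys) < int s" using s wa by simp
    have "Y (mo xs) n ?w \<in> F (int s)"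
    proof (rule fin)
      fix i
      have "Y ?u (n + int i) ?w \<in> F (int (hgt xs') + int (hgt ys))" using IH[OF u w lt] by blast
      from k[OF this, of i] show "Y a (- int m - int i) (Y ?u (n + int i) ?w) \<in> F (int s)" using s by (simp add: add.assoc)
    qed simp
    moreover have "Y (mo xs) n ?w \<in> F (int s - 1)" if n: "n \<ge> 0"
    proof (rule fin)
      fix i
      have "n + int i \<ge> 0" using n by simp
      then have "Y ?u (n + int i) ?w \<in> F (int (hgt xs') + int (hgt ys) - 1)" using IH[OF u w lt] by blast
      from k[OF this, of i] show "Y a (- int m - int i) (Y ?u (n + int i) ?w) \<in> F (int s - 1)" using s by (simp add: add_ac add_diff_eq)
    qed simp
    ultimately show ?thesis by (simp add: s_def)
  qed
qed

text \<open>The commutator is made of nonnegative products of the two generators, which have lower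
  height.\<close>

lemma swap_F:
  assumes "a \<in> S" "b \<in> S" "xs \<in> lists (S \<times> {1..})"
  shows "Y a p (Y b q (mo xs)) - Y b q (Y a p (mo xs)) \<in> F (int (gw a + gw b + hgt xs) - 1)"
proof -
  have St: "a \<in> St" "b \<in> St" "mo xs \<in> St" using VV_St S_VV mo_VV assms by auto
  have "Y (Y a (int i) b) r (mo xs) \<in> F (int (gw a + gw b + hgt xs) - 1)" for i r
  proof -
    have ab: "Y a (int i) b \<in> F (int (gw a) + int (gw b) - int i - 1)"
      using gw assms S_VV by (intro VV_F VV_closed Y_graded1) auto
    show ?thesis
    proof (rule F_induct[OF ab flin_Y_left subspace_F])
      fix zs assume zs: "zs \<in> lists (S \<times> {1..})" "int (hgt zs) \<le> int (gw a) + int (gw b) - int i - 1"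
      have "Y (mo zs) r (mo xs) \<in> F (int (hgt zs + hgt xs))" using Y_F_mo[OF zs(1) assms(3)] by blast
      moreover have "F (int (hgt zs + hgt xs)) \<subseteq> F (int (gw a + gw b + hgt xs) - 1)" by (rule F_mono) (use zs in simp)
      ultimately show "Y (mo zs) r (mo xs) \<in> F (int (gw a + gw b + hgt xs) - 1)" by blast
    qed
  qed
  then show ?thesis unfolding Y_commutator[OF St]
    by (intro Sum_any_mem subspace_F fs.subspace_scale[OF subspace_F])
qed

lemma front_F:
  assumes "xs \<in> lists (S \<times> {1..})" "ys \<in> lists (S \<times> {1..})" "x \<in> S \<times> {1..}"
  shows "mo (xs @ x # ys) - mo (x # xs @ ys) \<in> F (int (hgt (x # xs @ ys)) - 1)"
  using assms(1)
proof (induction xs)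
  case Nil
  then show ?case by (simp add: F_def fs.span_zero)
next
  case (Cons z xs)
  obtain a m where x: "x = (a, m)" "a \<in> S" "m \<ge> 1" using assms(3) by (cases x) auto
  obtain b n where z: "z = (b, n)" "b \<in> S" "n \<ge> 1" using Cons.hyps by (cases z) auto
  have l: "xs @ ys \<in> lists (S \<times> {1..})" using Cons.hyps assms(2) by auto
  have "Y b (- int n) (mo (xs @ x # ys) - mo (x # xs @ ys)) \<in> F (int (gw b) + (int (hgt (x # xs @ ys)) - 1))"
    by (rule act_F[OF z(2,3) Cons.IH])
  moreover have "Y b (- int n) (mo (x # xs @ ys)) - Y a (- int m) (Y b (- int n) (mo (xs @ ys))) \<in> F (int (gw b + gw a + hgt (xs @ ys)) - 1)"
    unfolding x(1) monomial_Cons by (rule swap_F[OF z(2) x(2) l])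
  moreover have "int (gw b) + (int (hgt (x # xs @ ys)) - 1) = int (hgt (x # (z # xs) @ ys)) - 1"
    "int (gw b + gw a + hgt (xs @ ys)) - 1 = int (hgt (x # (z # xs) @ ys)) - 1" by (simp_all add: x z)
  ultimately have "Y b (- int n) (mo (xs @ x # ys) - mo (x # xs @ ys)) + (Y b (- int n) (mo (x # xs @ ys)) - Y a (- int m) (Y b (- int n) (mo (xs @ ys))))
     \<in> F (int (hgt (x # (z # xs) @ ys)) - 1)" by (simp only: fs.subspace_add[OF subspace_F])
  then show ?case by (simp add: x(1) z(1) monomial_Cons flin_diff[OF flin_Y])
qed

lemma perm_F:
  assumes "xs \<in> lists (S \<times> {1..})" "mset xs = mset ys"
  shows "mo xs - mo ys \<in> F (int (hgt xs) - 1)"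
  using assms
proof (induction xs arbitrary: ys)
  case Nil
  then show ?case by (simp add: F_def fs.span_zero)
next
  case (Cons x xs)
  then have "x \<in> set ys" by (metis list.set_intros(1) set_mset_mset)
  then obtain us vs where ys: "ys = us @ x # vs" by (meson split_list)
  have m: "mset xs = mset (us @ vs)" using Cons.prems ys by simp
  have sy: "set ys = set (x # xs)" using Cons.prems(1) by (metis set_mset_mset)
  have l: "us \<in> lists (S \<times> {1..})" "vs \<in> lists (S \<times> {1..})" "x \<in> S \<times> {1..}"
  proof -
    have "set ys \<subseteq> S \<times> {1..}" unfolding sy using Cons.hyps by (simp add: subset_eq in_lists_conv_set)
    then show "us \<in> lists (S \<times> {1..})" "vs \<in> lists (S \<times> {1..})" "x \<in> S \<times> {1..}"
      unfolding ys set_append list.set in_lists_conv_set by blast+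
  qed
  have h: "hgt (us @ vs) = hgt xs" by (simp only: hgt_mset m)
  obtain a n where x: "x = (a, n)" "a \<in> S" "n \<ge> 1" using l(3) by (cases x) auto
  have "Y a (- int n) (mo xs - mo (us @ vs)) \<in> F (int (gw a) + (int (hgt xs) - 1))"
    by (rule act_F[OF x(2,3) Cons.IH[OF m]])
  moreover have "mo ys - mo (x # us @ vs) \<in> F (int (hgt (x # us @ vs)) - 1)"
    unfolding ys by (rule front_F[OF l])
  moreover have "int (gw a) + (int (hgt xs) - 1) = int (hgt (x # xs)) - 1"
    "int (hgt (x # us @ vs)) - 1 = int (hgt (x # xs)) - 1" using h by (simp_all add: x(1))
  ultimately have "Y a (- int n) (mo xs - mo (us @ vs)) - (mo ys - mo (x # us @ vs)) \<in> F (int (hgt (x # xs)) - 1)"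
    by (simp only: fs.subspace_diff[OF subspace_F])
  then show ?case by (simp add: x(1) monomial_Cons flin_diff[OF flin_Y])
qed

definition rep :: "(fock \<times> nat) multiset \<Rightarrow> (fock \<times> nat) list" where
  "rep M = (SOME xs. mset xs = M)"

lemma mset_rep [simp]: "mset (rep M) = M"
  unfolding rep_def by (rule someI_ex) (rule ex_mset)

text \<open>Reordering letters costs only terms of smaller height, so by induction on the height one
  representative per multiset spans.\<close>

lemma VV_pbw: "VV \<subseteq> fs.span ((\<lambda>M. mo (rep M)) ` {M. set_mset M \<subseteq> S \<times> {1..}})" (is "_ \<subseteq> ?P")
proof -
  have "mo xs \<in> ?P" if "xs \<in> lists (S \<times> {1..})" for xs
    using that
  proof (induction "hgt xs" arbitrary: xs rule: less_induct)
    case less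
    have "mo xs - mo (rep (mset xs)) \<in> F (int (hgt xs) - 1)" by (rule perm_F[OF less.prems]) simp
    also have "F (int (hgt xs) - 1) \<subseteq> ?P"
      unfolding F_def
    proof (rule fs.span_minimal[OF _ fs.subspace_span], rule image_subsetI)
      fix zs assume "zs \<in> {zs \<in> lists (S \<times> {1..}). int (hgt zs) \<le> int (hgt xs) - 1}"
      then have z: "zs \<in> lists (S \<times> {1..})" "int (hgt zs) \<le> int (hgt xs) - 1" by blast+
      then have "hgt zs < hgt xs" by linarith
      then show "mo zs \<in> ?P" using z(1) by (rule less.hyps)
    qed
    finally have "mo xs - mo (rep (mset xs)) \<in> ?P" .
    moreover have "mo (rep (mset xs)) \<in> ?P"
      using less.prems by (intro fs.span_base image_eqI[of _ _ "mset xs"]) auto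
    ultimately have "mo xs - mo (rep (mset xs)) + mo (rep (mset xs)) \<in> ?P" by (rule fs.span_add)
    then show ?case by simp
  qed
  then show ?thesis by (subst S_gen) (intro fs.span_minimal fs.subspace_span, auto)
qed

lemma dim_bound:
  assumes "finite {M. set_mset M \<subseteq> S \<times> {1..} \<and> (\<Sum>l\<in>#M. lwt gw l) = d}" (is "finite ?M")
  shows "card {M \<in> Vkeys. wt M = d} \<le> card {M. set_mset M \<subseteq> S \<times> {1..} \<and> (\<Sum>l\<in>#M. lwt gw l) = d}"
proof -
  have gr: "mo (rep M) \<in> graded {int (\<Sum>l\<in>#M. lwt gw l)}" if "M \<in> {M. set_mset M \<subseteq> S \<times> {1..}}" for M
  proof -
    have "set (rep M) = set_mset M" by (metis mset_rep set_mset_mset)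
    then have "mo (rep M) \<in> graded {int (\<Sum>l\<leftarrow>rep M. lwt gw l)}" using that gw by (intro mo_graded[of S]) (auto simp: in_lists_conv_set)
    moreover have "(\<Sum>l\<leftarrow>rep M. lwt gw l) = (\<Sum>l\<in>#M. lwt gw l)" 
      using sum_mset_mset[of "lwt gw" "rep M"] unfolding mset_rep by (rule sym)
    ultimately show ?thesis by (simp only:)
  qed
  have eq: "{M \<in> {M. set_mset M \<subseteq> S \<times> {1..}}. (\<Sum>l\<in>#M. lwt gw l) = d} = ?M" by blast
  have "VV \<inter> graded {int d} \<subseteq> fs.span ((\<lambda>M. mo (rep M)) ` ?M)"
  proof
    fix x assume x: "x \<in> VV \<inter> graded {int d}"
    have "x \<in> fs.span ((\<lambda>M. mo (rep M)) ` {M \<in> {M. set_mset M \<subseteq> S \<times> {1..}}. (\<Sum>l\<in>#M. lwt gw l) = d})"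
      by (rule graded_span_piece[where v = "\<lambda>M. mo (rep M)" and I = "{M. set_mset M \<subseteq> S \<times> {1..}}" and g = "\<lambda>M. \<Sum>l\<in>#M. lwt gw l"])
        (rule gr, assumption, rule subsetD[OF VV_pbw IntD1[OF x]], rule IntD2[OF x])
    then show "x \<in> fs.span ((\<lambda>M. mo (rep M)) ` ?M)" unfolding eq .
  qed
  then have "card (Bm ` {M \<in> Vkeys. wt M = d}) \<le> card ((\<lambda>M. mo (rep M)) ` ?M)"
    using fs.independent_span_bound[OF finite_imageI[OF assms] VV_piece(3)[of d]] VV_piece(2) by blast
  also have "\<dots> \<le> card ?M" by (rule card_image_le[OF assms])
  finally show ?thesis by (simp add: VV_piece(4))
qed

end

section \<open>Minimality by comparing dimensions with numbers of multisets\<close>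

definition gwt :: "fock \<Rightarrow> nat" where
  "gwt a = wt (the_elem (Poly_Mapping.keys (theta_inv a)))"

lemma gwt_Bm: "M \<in> letters \<Longrightarrow> gwt (Bm M) = wt M"
  by (simp add: gwt_def theta_inv_Bm)

text \<open>Equality with the dimensions in \<open>card_Vkeys\<close> leaves no room for relations
  between the nine generators up to weight 5; this is what makes each of them indispensable.\<close>

lemma card_SV_multisets:
  assumes "1 \<le> d" "d \<le> 5"
  shows "finite {M. set_mset M \<subseteq> SV \<times> {1..} \<and> (\<Sum>l\<in>#M. lwt gwt l) = d} \<and>
    card {M. set_mset M \<subseteq> SV \<times> {1..} \<and> (\<Sum>l\<in>#M. lwt gwt l) = d} = [1, 1, 3, 8, 17, 36, 75] ! d"
proof -
  have gl: "set glistV \<subseteq> letters" using glistV_Vkeys by (auto simp: Vkeys_def)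
  have pos: "wt K \<ge> 1" if "K \<in> set glistV" for K using that by (auto simp: glistV_def glistW_def)
  \<comment> \<open>A letter weighs at least its second entry, so entries up to 5 suffice.\<close>
  define ps where "ps = List.product glistV [1 :: nat, 2, 3, 4, 5]"
  define xs where "xs = map (\<lambda>(K, n). (Bm K, n)) ps"
  have "inj_on (\<lambda>(K, n). (Bm K, n)) (set ps)" using gl Bm_inj by (auto simp: inj_on_def ps_def)
  then have dxs: "distinct xs" using distinct_glistV by (simp add: xs_def ps_def distinct_map distinct_product)
  have lw: "lwt gwt (Bm K, n) = wt K + n - 1" if "K \<in> set glistV" for K n using that gl by (simp add: gwt_Bm subset_eq)
  have gb: "gwt (Bm K) = wt K" if "K \<in> set glistV" for K using gwt_Bm[of K] gl that by blast
  have sub: "set xs \<subseteq> SV \<times> {1..}" by (auto simp: xs_def ps_def SV_def)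
  have w1: "lwt gwt x \<ge> 1" if x: "x \<in> set xs" for x
  proof -
    obtain q where q: "q \<in> set ps" "x = (case q of (K, n) \<Rightarrow> (Bm K, n))" using x unfolding xs_def set_map by blast
    obtain K n where Kn: "q = (K, n)" by (cases q)
    have K: "K \<in> set glistV" and "n \<in> set [1 :: nat, 2, 3, 4, 5]" using q(1) unfolding ps_def Kn set_product by blast+
    then have "n \<ge> 1" by auto
    then show ?thesis unfolding q(2) Kn prod.case lw[OF K] using pos[OF K] by linarith
  qed
  have "set_mset M \<subseteq> set xs" if M: "set_mset M \<subseteq> SV \<times> {1..}" "(\<Sum>l\<in>#M. lwt gwt l) = d" for M
  proof
    fix x assume x: "x \<in># M"
    then have "lwt gwt x \<le> 5" using sum_mset_mono_mem[OF x, of "lwt gwt"] M(2) assms by simp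
    moreover obtain K n where K: "x = (Bm K, n)" "K \<in> set glistV" "n \<ge> 1" using M(1) x by (cases x) (auto simp: SV_def)
    ultimately have "n \<le> 5" using lw[of K n] pos[of K] by simp
    then have "n = 1 \<or> n = 2 \<or> n = 3 \<or> n = 4 \<or> n = 5" using K(3) by linarith
    then have "(K, n) \<in> set ps" using K(2) by (auto simp: ps_def)
    then show "x \<in> set xs" unfolding xs_def K(1) by force
  qed
  then have eq: "{M. set_mset M \<subseteq> SV \<times> {1..} \<and> (\<Sum>l\<in>#M. lwt gwt l) = d} =
    {M. set_mset M \<subseteq> set xs \<and> (\<Sum>l\<in>#M. lwt gwt l) = d \<and> 3 dvd 0 + (\<Sum>l\<in>#M. 0 :: nat)}"
    using sub by auto
  have "map (\<lambda>x. (lwt gwt x, 0 :: nat)) xs = map (\<lambda>(K, n). (wt K + n - 1, 0)) ps"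
    unfolding xs_def map_map by (rule map_cong) (auto simp: ps_def gb)
  also have "\<dots> = map (\<lambda>(k, n). (k + n - 1, 0)) (List.product [1, 2, 3, 3, 3, 4, 5, 5, 5] [1, 2, 3, 4, 5])"
    by (simp add: ps_def glistV_def glistW_def)
  finally have ws: "map (\<lambda>x. (lwt gwt x, 0 :: nat)) xs = map (\<lambda>(k, n). (k + n - 1, 0)) (List.product [1, 2, 3, 3, 3, 4, 5, 5, 5] [1, 2, 3, 4, 5])" .
  have "d = 1 \<or> d = 2 \<or> d = 3 \<or> d = 4 \<or> d = 5" using assms by linarith
  then have cv: "cnt (map (\<lambda>(k, n). (k + n - 1, 0)) (List.product [1, 2, 3, 3, 3, 4, 5, 5, 5] [1, 2, 3, 4, 5])) d 0 = [1, 1, 3, 8, 17, 36, 75] ! d"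
    by (elim disjE; hypsubst; code_simp)
  show ?thesis
    using card_cnt[where w = "\<lambda>x. lwt gwt x" and e = "\<lambda>_. 0" and d = d and c = 0, OF dxs w1] unfolding eq ws cv .
qed

text \<open>Without the generator \<open>Bm K\<close> the multiset with the single letter
  \<open>(Bm K, 1)\<close> is lost in weight \<open>wt K\<close>, which leaves fewer multisets than
  the dimension there.\<close>

lemma SV_minimal: "minimally_strongly_generates heisenberg3_Z3 SV"
  unfolding minimally_strongly_generates_def
proof (intro conjI allI impI notI)
  show "strongly_generates heisenberg3_Z3 SV" by (rule SV_strong)
  fix S assume S: "S \<subset> SV" "strongly_generates heisenberg3_Z3 S"
  obtain K where K: "K \<in> set glistV" "Bm K \<notin> S" using S(1) by (auto simp: SV_def)
  have gl: "set glistV \<subseteq> letters" using glistV_Vkeys by (auto simp: Vkeys_def)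
  have k: "1 \<le> wt K" "wt K \<le> 5" using K by (auto simp: glistV_def glistW_def)
  interpret pbw S gwt
  proof
    show "S \<subseteq> VV" using S(1) SV_VV by blast
    show "VV = fs.span (mo ` lists (S \<times> {1..}))"
      using S(2) by (simp add: strongly_generates_def heisenberg3_Z3_eq)
    fix a assume "a \<in> S"
    then obtain M where M: "a = Bm M" "M \<in> set glistV" using S(1) by (auto simp: SV_def)
    then have "wt M \<ge> 1" by (auto simp: glistV_def glistW_def)
    then show "a \<in> graded {int (gwt a)} \<and> gwt a \<ge> 1" using M gl gwt_Bm[of M] Bm_graded[of M] by auto
  qed
  let ?A = "{M. set_mset M \<subseteq> S \<times> {1..} \<and> (\<Sum>l\<in>#M. lwt gwt l) = wt K}"
  let ?B = "{M. set_mset M \<subseteq> SV \<times> {1..} \<and> (\<Sum>l\<in>#M. lwt gwt l) = wt K}"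
  have B: "finite ?B" "card ?B = [1, 1, 3, 8, 17, 36, 75] ! wt K" using card_SV_multisets[OF k] by blast+
  have "S \<times> {1 :: nat ..} \<subseteq> SV \<times> {1..}" using S(1) by auto
  then have sub: "?A \<subseteq> ?B" by blast
  have "{#(Bm K, 1)#} \<in> ?B" using K(1) gl gwt_Bm[of K] by (auto simp: SV_def)
  moreover have "{#(Bm K, 1)#} \<notin> ?A" using K(2) by auto
  ultimately have "?A \<subset> ?B" using sub by blast
  then have "card ?A < card ?B" by (rule psubset_card_mono[OF B(1)])
  moreover have "card {M \<in> Vkeys. wt M = wt K} \<le> card ?A" by (rule dim_bound) (rule finite_subset[OF sub B(1)])
  ultimately show False using card_Vkeys[of "wt K"] k B by simp
qed

section \<open>The orbifold as a tensor product of the invariant boson and its commutant\<close>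

section \<open>Splitting off the Heisenberg factor\<close>

text \<open>Substitutes the normalised diagonal boson for the generator of the rank one Heisenberg algebra.\<close>

definition Phi :: "fock \<Rightarrow> fock" where
  "Phi = subst_hom (\<lambda>x. bv 0 (snd x))"

lemma flin_Phi: "flin Phi"
  by (simp add: Phi_def flin_subst_hom)

lemma Phi_one [simp]: "Phi 1 = 1"
  by (simp add: Phi_def)

lemma Phi_mult: "Phi (p * q) = Phi p * Phi q"
  by (simp add: Phi_def subst_hom_mult)

lemma Phi_mon: "Phi (mon A) = Bm (image_mset (\<lambda>x. (0, snd x)) A)"
  by (simp add: Phi_def subst_hom_mon Bm_def image_mset.compositionality comp_def)

lemma Phi_var: "Phi (var i m) = bv 0 m"
  by (simp add: Phi_def subst_hom_mon)

lemma flin_Phi_mult: "flin (\<lambda>u. Phi u * w)"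
  using flin_comp[OF flin_mult[of w] flin_Phi] by (simp only: mult.commute[of w])

lemma Phi_tensor:
  "Phi (a - b) * w = Phi a * w - Phi b * w" "Phi (fock_scale c a) * w = fock_scale c (Phi a * w)"
  by (simp add: flin_diff[OF flin_Phi] left_diff_distrib) (simp only: flin_scale[OF flin_Phi], simp add: fock_scale_def mult.assoc)

lemma Phi_neg: "m \<ge> 1 \<Longrightarrow> Phi (alpha 1 (- int m) p) = bs 0 (- int m) (Phi p)"
  by (simp add: alpha_neg Phi_mult Phi_var bos_neg)

lemma mon_H1_step:
  assumes "set_mset (add_mset x A) \<subseteq> {1} \<times> {1..}"
  obtains m where "m \<ge> 1" "mon (add_mset x A) = alpha 1 (- int m) (mon A)" "set_mset A \<subseteq> {1} \<times> {1..}"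
proof -
  obtain m where x: "x = (1, m)" "m \<ge> 1" using assms by (cases x) auto
  have "mon (add_mset x A) = alpha 1 (- int m) (mon A)" using x by (simp add: alpha_mon_neg)
  moreover have "set_mset A \<subseteq> {1} \<times> {1..}" using assms by simp
  ultimately show thesis using that x(2) by blast
qed

text \<open>The normalised boson 0 pairs to 1 with itself, so it has the commutators of the rank one
  boson and \<open>Phi\<close> intertwines annihilation as well as creation.\<close>

lemma Phi_pos:
  assumes "u \<in> states_on {1}" "n \<ge> 0"
  shows "bs 0 n (Phi u) = Phi (alpha 1 n u)"
proof (rule supp_in_eqI[OF flin_comp[OF flin_bos flin_Phi] flin_comp[OF flin_Phi flin_alpha] assms(1)[unfolded states_on_def]])
  fix A :: "(nat \<times> nat) multiset" assume "A \<in> {M. set_mset M \<subseteq> {1} \<times> {1..}}"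
  then have "set_mset A \<subseteq> {1} \<times> {1..}" by simp
  then show "bs 0 n (Phi (mon A)) = Phi (alpha 1 n (mon A))"
  proof (induction A)
    case empty
    show ?case using assms(2) by (simp add: bos_one alpha_one flin_zero[OF flin_Phi])
  next
    case (add x A)
    obtain m where m: "m \<ge> 1" "mon (add_mset x A) = alpha 1 (- int m) (mon A)" "set_mset A \<subseteq> {1} \<times> {1..}"
      using add.prems by (rule mon_H1_step)
    have p1: "pair (cf 0) (cf 0) = 1" by (simp add: pair_cf dual_def)
    have "bs 0 n (Phi (mon (add_mset x A))) = bs 0 (- int m) (bs 0 n (Phi (mon A)))
        + (if n + - int m = 0 then fock_scale (of_int n * 1) (Phi (mon A)) else 0)"
      by (simp only: m(2) Phi_neg[OF m(1)] bos_commutator[of "cf 0" n "cf 0" "- int m"] p1)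
    also have "\<dots> = Phi (alpha 1 (- int m) (alpha 1 n (mon A))) + Phi (if n + - int m = 0 then fock_scale (of_int n) (mon A) else 0)"
      unfolding Phi_neg[OF m(1)] add.IH[OF m(3)] by (simp add: flin_scale[OF flin_Phi] flin_zero[OF flin_Phi])
    also have "\<dots> = Phi (alpha 1 n (mon (add_mset x A)))"
      unfolding m(2) alpha_commutator[of 1 n 1 "- int m"] flin_add[OF flin_Phi] by simp
    finally show ?case .
  qed
qed

lemma Phi_alpha:
  assumes "u \<in> states_on {1}" "w \<in> WW"
  shows "bs 0 n (Phi u * w) = Phi (alpha 1 n u) * w"
proof (cases "n < 0")
  case True
  define m where "m = nat (- n)"
  have m: "n = - int m" "m \<ge> 1" using True by (auto simp: m_def)
  show ?thesis unfolding m(1) Phi_neg[OF m(2)] bos_neg[OF m(2)] by (simp add: mult.assoc)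
next
  case False
  then show ?thesis using bos_derivation[of n "cf 0" "Phi u" w] Phi_pos[OF assms(1)] bs0_WW[OF assms(2)] by simp
qed

lemma Vkeys_tensor: "set_mset A \<subseteq> {1} \<times> {1..} \<Longrightarrow> N \<in> Wkeys \<Longrightarrow> image_mset (\<lambda>x. (0, snd x)) A + N \<in> Vkeys"
  by (auto simp: Wkeys_def Vkeys_def letters_def charge_def image_mset.compositionality comp_def)

lemma Phi_VV:
  assumes "u \<in> states_on {1}" "w \<in> WW"
  shows "Phi u * w \<in> VV"
proof (rule flin_supp_inI[OF flin_Phi_mult assms(1)[unfolded states_on_def] subspace_VV])
  fix A :: "(nat \<times> nat) multiset" assume "A \<in> {M. set_mset M \<subseteq> {1} \<times> {1..}}"
  then have A: "set_mset A \<subseteq> {1} \<times> {1..}" by simp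
  have "Phi (mon A) * Bm N \<in> VV" if "N \<in> Wkeys" for N
    unfolding Phi_mon VV_span Bm_simps(3)[symmetric] using Vkeys_tensor[OF A that] by (intro fs.span_base imageI)
  then have "WW \<subseteq> {w. Phi (mon A) * w \<in> VV}"
    unfolding WW_span by (intro fs.span_minimal module_hom.subspace_linear_preimage[OF flin_mult] subspace_VV) auto
  then show "Phi (mon A) * w \<in> VV" using assms(2) by blast
qed

lemma Phi_St: "u \<in> states_on {1} \<Longrightarrow> w \<in> WW \<Longrightarrow> Phi u * w \<in> St"
  by (rule VV_St) (rule Phi_VV)

text \<open>Vectors of the commutant have no contraction with boson 0, so their modes commute with
  its creation operators, which build \<open>Phi u\<close>.\<close>

lemma W_mode_Phi:
  assumes "u \<in> states_on {1}" "w \<in> WW" "w' \<in> WW"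
  shows "Y w q (Phi u * w') = Phi u * Y w q w'"
proof (rule supp_in_eqI[OF flin_comp[OF flin_Y flin_Phi_mult] flin_Phi_mult assms(1)[unfolded states_on_def]])
  fix A :: "(nat \<times> nat) multiset" assume "A \<in> {M. set_mset M \<subseteq> {1} \<times> {1..}}"
  then have "set_mset A \<subseteq> {1} \<times> {1..}" by simp
  then show "Y w q (Phi (mon A) * w') = Phi (mon A) * Y w q w'"
  proof (induction A)
    case empty
    show ?case by simp
  next
    case (add x A)
    obtain m where m: "m \<ge> 1" "mon (add_mset x A) = alpha 1 (- int m) (mon A)" "set_mset A \<subseteq> {1} \<times> {1..}"
      using add.prems by (rule mon_H1_step)
    have A: "mon A \<in> states_on {1}" using m(3) by simp
    have wS: "w \<in> St" using assms(2) VV_St WW_VV by blast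
    have z: "bs 0 (int j) w = 0" for j using bs0_WW[OF assms(2)] by simp
    have "bs 0 (- int m) (Y w q (Phi (mon A) * w')) = Y w q (bs 0 (- int m) (Phi (mon A) * w'))"
      unfolding Y_bos_comm[OF wS Phi_St[OF A assms(3)]] z by (simp add: flin_zero[OF flin_Y_left])
    then have "Y w q (Phi (alpha 1 (- int m) (mon A)) * w') = bs 0 (- int m) (Phi (mon A) * Y w q w')"
      unfolding Phi_alpha[OF A assms(3)] add.IH[OF m(3)] by (rule sym)
    then show ?case unfolding m(2) Phi_alpha[OF A WW_closed[OF assms(2,3)]] .
  qed
qed

text \<open>The iterate formula over the letters of \<open>u\<close> involves boson 0 only, and by
  \<open>Phi_alpha\<close> this boson acts on a product through the first factor.\<close>

lemma Phi_mode:
  assumes "u \<in> states_on {1}" "u' \<in> states_on {1}" "w \<in> WW"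
  shows "Y (Phi u) p (Phi u' * w) = Phi (Y u p u') * w"
proof (rule supp_in_eqI[OF flin_comp[OF flin_Y_left flin_Phi] flin_comp[OF flin_Phi_mult flin_Y_left] assms(1)[unfolded states_on_def]])
  fix A :: "(nat \<times> nat) multiset" assume "A \<in> {M. set_mset M \<subseteq> {1} \<times> {1..}}"
  then have "set_mset A \<subseteq> {1} \<times> {1..}" by simp
  then show "Y (Phi (mon A)) p (Phi u' * w) = Phi (Y (mon A) p u') * w"
    using assms(2)
  proof (induction A arbitrary: p u')
    case empty
    show ?case by (simp add: Y_one flin_zero[OF flin_Phi])
  next
    case (add x A)
    obtain m where m: "m \<ge> 1" "mon (add_mset x A) = alpha 1 (- int m) (mon A)" "set_mset A \<subseteq> {1} \<times> {1..}"
      using add.prems(1) by (rule mon_H1_step)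
    have A: "mon A \<in> states_on {1}" using m(3) by simp
    have AS: "mon A \<in> St" "u' \<in> St" using A add.prems(2) states_on_St by blast+
    have PS: "Phi (mon A) \<in> St" using Phi_St[OF A one_WW] by simp
    have YA: "Y (mon A) k u' \<in> states_on {1}" for k by (rule Y_states_on[OF A add.prems(2)])
    have au: "alpha 1 (int j) u' \<in> states_on {1}" for j by (rule alpha_states_on[OF add.prems(2)]) simp
    have t: "fock_scale c (bs 0 (- int m - int j) (Y (Phi (mon A)) (p + int j) (Phi u' * w))
        - fock_scale s (Y (Phi (mon A)) (p - int m - int j) (bs 0 (int j) (Phi u' * w)))) =
      Phi (fock_scale c (alpha 1 (- int m - int j) (Y (mon A) (p + int j) u')
        - fock_scale s (Y (mon A) (p - int m - int j) (alpha 1 (int j) u')))) * w" for c s j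
      unfolding Phi_alpha[OF add.prems(2) assms(3)] add.IH[OF m(3) add.prems(2)] add.IH[OF m(3) au]
        Phi_alpha[OF YA assms(3)] Phi_tensor ..
    have "Y (Phi (mon (add_mset x A))) p (Phi u' * w) = Sum_any (\<lambda>j. Phi (fock_scale (of_nat ((m + j - 1) choose j)) (alpha 1 (- int m - int j) (Y (mon A) (p + int j) u')
        - fock_scale ((-1) ^ m) (Y (mon A) (p - int m - int j) (alpha 1 (int j) u')))) * w)"
      unfolding m(2) Phi_neg[OF m(1)] Y_bos_iterate[OF PS Phi_St[OF add.prems(2) assms(3)] m(1)] t ..
    also have "\<dots> = Phi (Y (mon (add_mset x A)) p u') * w"
      unfolding m(2) Y_iterate[OF AS m(1)] by (rule Sum_any_flin[OF flin_Phi_mult ev0_Y_iterate, symmetric])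
    finally show ?case .
  qed
qed

lemma Y_minus_one:
  assumes "a \<in> St" "b \<in> St" "v \<in> St"
  shows "Y (Y a (-1) b) n v = Sum_any (\<lambda>i. Y a (-1 - int i) (Y b (n + int i) v) + Y b (n - 1 - int i) (Y a (int i) v))"
proof -
  have "(\<lambda>i. fock_scale (of_int 0 gchoose i) (Y (Y a (-1 + int i) b) (0 + n - int i) v)) =
    (\<lambda>i. if i = 0 then Y (Y a (-1) b) n v else 0)"
    by (rule ext) (auto simp: gbinomial_0_left)
  then have "Y (Y a (-1) b) n v = B_lhs (-1) 0 n a b v" unfolding B_lhs_def by (simp only: Sum_any_delta)
  also have "\<dots> = B_rhs (-1) 0 n a b v" by (rule borcherds[OF assms])
  also have "\<dots> = Sum_any (\<lambda>i. Y a (-1 - int i) (Y b (n + int i) v) + Y b (n - 1 - int i) (Y a (int i) v))"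
  proof -
    have c: "(-1) ^ i * (of_int (-1) gchoose i) = (1 :: complex)" for i
    proof -
      have "(of_int (- int 1) gchoose i :: complex) = (-1) ^ i * of_nat ((1 + i - 1) choose i)" by (rule gchoose_neg_nat) simp
      then have "(of_int (-1) gchoose i :: complex) = (-1) ^ i" by simp
      then show ?thesis by (metis power_mult_distrib mult_minus1 minus_minus power_one minus_mult_minus)
    qed
    have e: "-1 + 0 - int i = -1 - int i" "-1 + n - int i = n - 1 - int i" "0 + int i = int i" for i by simp_all
    show ?thesis unfolding B_rhs_def c e by simp
  qed
  finally show ?thesis .
qed

lemma sum_symmetric_int: "(\<Sum>i<K. G (-1 - int i) + G (int i)) = (\<Sum>p\<in>{- int K..<int K}. G p :: 'a :: comm_monoid_add)"
proof (induction K)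
  case (Suc K)
  have "{- int (Suc K)..<int (Suc K)} = insert (-1 - int K) (insert (int K) {- int K..<int K})" by auto
  then have "(\<Sum>p\<in>{- int (Suc K)..<int (Suc K)}. G p) = G (-1 - int K) + (G (int K) + (\<Sum>p\<in>{- int K..<int K}. G p))"
    by simp
  then show ?case using Suc by (simp add: add_ac)
qed simp

text \<open>The product of \<open>Phi u\<close> and \<open>w\<close> is
  \<open>Y (Phi u) (-1) w\<close>, and the iterate formula gives two half-lines of summands, p = -1
  - i and p = i, which together run over all integers. The finite set \<open>P\<close> is kept
  explicit because \<open>tensor_nprod\<close> sums over all \<open>p\<close>.\<close>

lemma Y_tensor:
  assumes "u \<in> states_on {1}" "u' \<in> states_on {1}" "w \<in> WW" "w' \<in> WW"
  shows "\<exists>P :: int set. finite P \<and> (\<forall>p. p \<notin> P \<longrightarrow> Y u p u' = 0 \<or> Y w (n - 1 - p) w' = 0) \<and>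
    Y (Phi u * w) n (Phi u' * w') = (\<Sum>p\<in>P. Phi (Y u p u') * Y w (n - 1 - p) w')"
proof -
  obtain N1 where N1: "\<forall>p\<ge>N1. Y u p u' = 0" using Y_trunc by blast
  obtain N2 where N2: "\<forall>p\<ge>N2. Y w p w' = 0" using Y_trunc by blast
  \<comment> \<open>From \<open>K\<close> on the first factor is truncated, below \<open>- K\<close>
    the second.\<close>
  define K where "K = nat (max N1 (N2 - n + 1))"
  define G where "G p = Phi (Y u p u') * Y w (n - 1 - p) w'" for p
  have K: "int K \<ge> N1" "int K \<ge> N2 - n + 1" by (auto simp: K_def)
  have hi: "Y u p u' = 0" if "p \<ge> int K" for p using N1 K that by auto
  have lo: "Y w (n - 1 - p) w' = 0" if "p < - int K" for p using N2 K that by auto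
  have G0: "G (-1 - int i) + G (int i) = 0" if "i \<ge> K" for i
    using hi[of "int i"] lo[of "-1 - int i"] that by (simp add: G_def flin_zero[OF flin_Phi])
  have St: "Phi u \<in> St" "w \<in> St" "Phi u' * w' \<in> St"
    using Phi_St[OF assms(1) one_WW] Phi_St[OF assms(2,4)] assms(3) VV_St WW_VV by auto
  have Yw: "Y w q (Phi z * w') = Phi z * Y w q w'" "Y w q w' \<in> WW" if "z \<in> states_on {1}" for z q
    using W_mode_Phi[OF that assms(3,4)] WW_closed[OF assms(3,4)] by auto
  have "Phi u * w = Y (Phi u) (-1) w"
    using Phi_mode[OF assms(1) one_states_on assms(3), of "-1"] Y_vac(2)[OF states_on_St[OF assms(1)]] by simp
  then have "Y (Phi u * w) n (Phi u' * w') = Sum_any (\<lambda>i. Y (Phi u) (-1 - int i) (Y w (n + int i) (Phi u' * w')) + Y w (n - 1 - int i) (Y (Phi u) (int i) (Phi u' * w')))"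
    using Y_minus_one[OF St] by simp
  also have "\<dots> = Sum_any (\<lambda>i. G (-1 - int i) + G (int i))"
  proof (rule Sum_any.cong)
    fix i
    have "Y (Phi u) (-1 - int i) (Y w (n + int i) (Phi u' * w')) = G (-1 - int i)"
      unfolding Yw(1)[OF assms(2)] Phi_mode[OF assms(1,2) Yw(2)[OF assms(2)]] by (simp add: G_def)
    moreover have "Y w (n - 1 - int i) (Y (Phi u) (int i) (Phi u' * w')) = G (int i)"
      unfolding Phi_mode[OF assms(1,2,4)] Yw(1)[OF Y_states_on[OF assms(1,2)]] by (simp add: G_def)
    ultimately show "Y (Phi u) (-1 - int i) (Y w (n + int i) (Phi u' * w')) + Y w (n - 1 - int i) (Y (Phi u) (int i) (Phi u' * w')) = G (-1 - int i) + G (int i)"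
      by simp
  qed
  also have "\<dots> = (\<Sum>i<K. G (-1 - int i) + G (int i))" by (rule Sum_any_upto) (rule G0)
  also have "\<dots> = (\<Sum>p\<in>{- int K..<int K}. G p)" by (rule sum_symmetric_int)
  finally have "Y (Phi u * w) n (Phi u' * w') = (\<Sum>p\<in>{- int K..<int K}. Phi (Y u p u') * Y w (n - 1 - p) w')" by (simp only: G_def)
  moreover have "Y u p u' = 0 \<or> Y w (n - 1 - p) w' = 0" if "p \<notin> {- int K..<int K}" for p using that hi[of p] lo[of p] by auto
  ultimately show ?thesis by (intro exI[of _ "{- int K..<int K}"]) simp
qed

text \<open>First factor of an eigenmonomial; boson 0 is renamed to 1, the index of the only boson
  of \<open>heisenberg 1\<close>.\<close>

definition up :: "(nat \<times> nat) multiset \<Rightarrow> fock" where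
  "up M = mon (image_mset (\<lambda>x. (1, snd x)) (filter_mset (\<lambda>x. fst x = 0) M))"

definition wp :: "(nat \<times> nat) multiset \<Rightarrow> fock" where
  "wp M = Bm (filter_mset (\<lambda>x. fst x \<noteq> 0) M)"

lemma up_H1: "M \<in> letters \<Longrightarrow> up M \<in> states_on {1}"
  by (auto simp: up_def letters_def)

lemma charge_filter: "charge (filter_mset (\<lambda>x. fst x \<noteq> 0) M) = charge M"
  by (induction M) (auto simp: charge_def)

lemma wp_WW:
  assumes "M \<in> Vkeys"
  shows "wp M \<in> WW"
proof -
  let ?N = "filter_mset (\<lambda>x. fst x \<noteq> 0) M"
  have "3 dvd charge ?N" unfolding charge_filter using assms by (simp add: Vkeys_def)
  moreover have "set_mset ?N \<subseteq> {..<3} \<times> {1..}" using assms by (auto simp: Vkeys_def letters_def)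
  moreover have "0 \<notin> fst ` set_mset ?N" by auto
  ultimately have "?N \<in> Wkeys" by (simp only: Wkeys_def Vkeys_def letters_def mem_Collect_eq simp_thms)
  then show ?thesis unfolding wp_def WW_span by (intro fs.span_base imageI)
qed

lemma filter_mset_trivial:
  "(\<And>x. x \<in># M \<Longrightarrow> P x) \<Longrightarrow> filter_mset P M = M"
  "(\<And>x. x \<in># M \<Longrightarrow> \<not> P x) \<Longrightarrow> filter_mset P M = {#}"
  by (induction M) auto

lemma Bm_up_wp: "Bm M = Phi (up M) * wp M"
proof -
  have "image_mset (\<lambda>x. (0 :: nat, snd x)) (image_mset (\<lambda>x. (1 :: nat, snd x)) (filter_mset (\<lambda>x. fst x = 0) M)) = filter_mset (\<lambda>x. fst x = 0) M"
    by (induction M) auto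
  then have "Phi (up M) * wp M = Bm (filter_mset (\<lambda>x. fst x = 0) M + filter_mset (\<lambda>x. fst x \<noteq> 0) M)"
    unfolding up_def wp_def Phi_mon Bm_simps(3) by simp
  then show ?thesis by (simp flip: multiset_partition)
qed

abbreviation bil :: "(fock \<Rightarrow> fock \<Rightarrow> complex) \<Rightarrow> bool" where
  "bil \<equiv> bilinear_form (heisenberg 1) (sub_voa WW omegaW)"

lemma states_H1: "states (heisenberg 1) = states_on {1}"
  by (simp add: states_heisenberg)

lemma bilD:
  assumes "bil B"
  shows "u \<in> states_on {1} \<Longrightarrow> u' \<in> states_on {1} \<Longrightarrow> w \<in> WW \<Longrightarrow> B (u + u') w = B u w + B u' w"
    "u \<in> states_on {1} \<Longrightarrow> w \<in> WW \<Longrightarrow> w' \<in> WW \<Longrightarrow> B u (w + w') = B u w + B u w'"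
    "u \<in> states_on {1} \<Longrightarrow> w \<in> WW \<Longrightarrow> B (fock_scale c u) w = c * B u w"
    "u \<in> states_on {1} \<Longrightarrow> w \<in> WW \<Longrightarrow> B u (fock_scale c w) = c * B u w"
  using assms unfolding bilinear_form_def states_H1 by simp_all

lemma bilI:
  assumes "\<And>u u' w. u \<in> states_on {1} \<Longrightarrow> u' \<in> states_on {1} \<Longrightarrow> w \<in> WW \<Longrightarrow> B (u + u') w = B u w + B u' w"
    "\<And>u w w'. u \<in> states_on {1} \<Longrightarrow> w \<in> WW \<Longrightarrow> w' \<in> WW \<Longrightarrow> B u (w + w') = B u w + B u w'"
    "\<And>c u w. u \<in> states_on {1} \<Longrightarrow> w \<in> WW \<Longrightarrow> B (fock_scale c u) w = c * B u w"
    "\<And>c u w. u \<in> states_on {1} \<Longrightarrow> w \<in> WW \<Longrightarrow> B u (fock_scale c w) = c * B u w"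
  shows "bil B"
  unfolding bilinear_form_def states_H1 using assms by simp

lemma bil_zero:
  assumes "bil B"
  shows "w \<in> WW \<Longrightarrow> B 0 w = 0" "u \<in> states_on {1} \<Longrightarrow> B u 0 = 0"
  using bilD(3)[OF assms one_states_on, of w 0] bilD(4)[OF assms _ one_WW, of u 0] by simp_all

definition L :: "(fock \<Rightarrow> fock \<Rightarrow> complex) \<Rightarrow> fock \<Rightarrow> complex" where
  "L g x = (\<Sum>M\<in>Poly_Mapping.keys (theta_inv x). Poly_Mapping.lookup (theta_inv x) M * g (up M) (wp M))"

lemma L_lin: "L g x = Poly_Mapping.lookup (lin (\<lambda>M. fock_scale (g (up M) (wp M)) 1) (theta_inv x)) {#}"
  by (simp add: L_def lin_def lookup_sum lookup_fock_scale)

lemma L_add: "L g (x + y) = L g x + L g y"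
  by (simp add: L_lin flin_add[OF flin_theta_inv] flin_add[OF flin_lin] lookup_add)

lemma L_scale: "L g (fock_scale c x) = c * L g x"
  by (simp add: L_lin flin_scale[OF flin_theta_inv] flin_scale[OF flin_lin] lookup_fock_scale)

lemma L_sum: "L g (\<Sum>i\<in>A. f i) = (\<Sum>i\<in>A. L g (f i))"
proof -
  have "L g 0 = 0" by (simp add: L_def flin_zero[OF flin_theta_inv])
  then show ?thesis by (induction A rule: infinite_finite_induct) (simp_all add: L_add)
qed

lemma L_Bm: "M \<in> letters \<Longrightarrow> L g (Bm M) = g (up M) (wp M)"
  by (simp add: L_lin theta_inv_Bm lookup_fock_scale)

lemma span_functional_eq:
  fixes g h :: "fock \<Rightarrow> complex"
  assumes x: "x \<in> fs.span S"
    and g: "\<And>x y. x \<in> fs.span S \<Longrightarrow> y \<in> fs.span S \<Longrightarrow> g (x + y) = g x + g y" "\<And>c x. x \<in> fs.span S \<Longrightarrow> g (fock_scale c x) = c * g x"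
    and h: "\<And>x y. x \<in> fs.span S \<Longrightarrow> y \<in> fs.span S \<Longrightarrow> h (x + y) = h x + h y" "\<And>c x. x \<in> fs.span S \<Longrightarrow> h (fock_scale c x) = c * h x"
    and eq: "\<And>x. x \<in> S \<Longrightarrow> g x = h x"
  shows "g x = h x"
proof -
  have z: "g 0 = 0" "h 0 = 0" using g(2)[OF fs.span_zero, of 0] h(2)[OF fs.span_zero, of 0] by simp_all
  have "fs.subspace {x \<in> fs.span S. g x = h x}"
    by (rule fs.subspaceI) (auto simp: z g h fs.span_zero fs.span_add fs.span_scale)
  then have "fs.span S \<subseteq> {x \<in> fs.span S. g x = h x}"
    by (intro fs.span_minimal) (auto simp: eq fs.span_base)
  then show ?thesis using x by blast
qed

text \<open>Both sides are bilinear, and on an eigenmonomial the factorisation recovers the pair it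
  was made from.\<close>

lemma L_Phi:
  assumes B: "bil B" and u: "u \<in> states_on {1}" and w: "w \<in> WW"
  shows "L B (Phi u * w) = B u w"
proof -
  have H: "states_on {1} = fs.span (mon ` {M. set_mset M \<subseteq> {1} \<times> {1..}})" by (simp only: states_on_def supp_in_span)
  have base: "L B (Phi (mon A) * Bm N) = B (mon A) (Bm N)" if A: "set_mset A \<subseteq> {1} \<times> {1..}" and N: "N \<in> Wkeys" for A N
  proof -
    let ?K = "image_mset (\<lambda>x. (0 :: nat, snd x)) A + N"
    have N0: "fst x \<noteq> 0" if "x \<in># N" for x
    proof
      assume "fst x = 0"
      then have "0 \<in> fst ` set_mset N" using that by force
      then show False using N by (simp add: Wkeys_def)
    qed
    have A0: "filter_mset (\<lambda>x. fst x = 0) (image_mset (\<lambda>x. (0 :: nat, snd x)) A) = image_mset (\<lambda>x. (0, snd x)) A"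
      "filter_mset (\<lambda>x. fst x \<noteq> 0) (image_mset (\<lambda>x. (0 :: nat, snd x)) A) = {#}" by (induction A) auto
    have N1: "filter_mset (\<lambda>x. fst x = 0) N = {#}" by (rule filter_mset_trivial(2)) (rule N0)
    have N2: "filter_mset (\<lambda>x. fst x \<noteq> 0) N = N" by (rule filter_mset_trivial(1)) (rule N0)
    have f1: "filter_mset (\<lambda>x. fst x = 0) ?K = image_mset (\<lambda>x. (0, snd x)) A"
      unfolding filter_union_mset A0 N1 by (rule add_0_right)
    have f2: "filter_mset (\<lambda>x. fst x \<noteq> 0) ?K = N"
      unfolding filter_union_mset A0 N2 by (rule add_0_left)
    have "image_mset (\<lambda>x. (1 :: nat, snd x)) (image_mset (\<lambda>x. (0 :: nat, snd x)) A) = A"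
      using A by (induction A) auto
    then have "up ?K = mon A" "wp ?K = Bm N" unfolding up_def wp_def f1 f2 by simp_all
    moreover have "?K \<in> letters" using Vkeys_tensor[OF A N] by (simp add: Vkeys_def)
    ultimately show ?thesis unfolding Phi_mon Bm_simps(3)[symmetric] by (simp add: L_Bm)
  qed
  have 1: "L B (Phi (mon A) * w) = B (mon A) w" if A: "set_mset A \<subseteq> {1} \<times> {1..}" for A
  proof (rule span_functional_eq[of w "Bm ` Wkeys" "\<lambda>w. L B (Phi (mon A) * w)" "B (mon A)"])
    have mA: "mon A \<in> states_on {1}" using A by simp
    show "w \<in> fs.span (Bm ` Wkeys)" using w by (simp add: WW_span)
    show "L B (Phi (mon A) * (x + y)) = L B (Phi (mon A) * x) + L B (Phi (mon A) * y)" for x y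
      by (simp add: distrib_left L_add)
    show "L B (Phi (mon A) * fock_scale c x) = c * L B (Phi (mon A) * x)" for c x
      by (simp add: flin_scale[OF flin_mult] L_scale)
    show "B (mon A) (x + y) = B (mon A) x + B (mon A) y" if "x \<in> fs.span (Bm ` Wkeys)" "y \<in> fs.span (Bm ` Wkeys)" for x y
      using bilD(2)[OF B mA] that by (simp add: WW_span)
    show "B (mon A) (fock_scale c x) = c * B (mon A) x" if "x \<in> fs.span (Bm ` Wkeys)" for c x
      using bilD(4)[OF B mA] that by (simp add: WW_span)
    show "L B (Phi (mon A) * x) = B (mon A) x" if "x \<in> Bm ` Wkeys" for x using base[OF A] that by blast
  qed
  show ?thesis
  proof (rule span_functional_eq[of u "mon ` {M. set_mset M \<subseteq> {1} \<times> {1..}}" "\<lambda>u. L B (Phi u * w)" "\<lambda>u. B u w"])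
    show "u \<in> fs.span (mon ` {M. set_mset M \<subseteq> {1} \<times> {1..}})" using u by (simp only: H)
    show "L B (Phi (x + y) * w) = L B (Phi x * w) + L B (Phi y * w)" for x y
      by (simp add: flin_add[OF flin_Phi] distrib_right L_add)
    show "L B (Phi (fock_scale c x) * w) = c * L B (Phi x * w)" for c x
      by (simp add: Phi_tensor L_scale)
    show "B (x + y) w = B x w + B y w" if "x \<in> fs.span (mon ` {M. set_mset M \<subseteq> {1} \<times> {1..}})" "y \<in> fs.span (mon ` {M. set_mset M \<subseteq> {1} \<times> {1..}})" for x y
      by (rule bilD(1)[OF B _ _ w]) (use that in \<open>simp_all only: H\<close>)
    show "B (fock_scale c x) w = c * B x w" if "x \<in> fs.span (mon ` {M. set_mset M \<subseteq> {1} \<times> {1..}})" for c x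
      by (rule bilD(3)[OF B _ w]) (use that in \<open>simp only: H\<close>)
    show "L B (Phi x * w) = B x w" if "x \<in> mon ` {M. set_mset M \<subseteq> {1} \<times> {1..}}" for x using 1 that by blast
  qed
qed

text \<open>A tensor is a function of forms with value 0 on functions that are not bilinear; the
  guard mirrors \<open>pure_tensor\<close>.\<close>

definition split_iso :: "fock \<Rightarrow> (fock, fock) tensor" where
  "split_iso x = (\<lambda>B. if bil B then L B x else 0)"

interpretation ts: vector_space tensor_scale
  by unfold_locales (auto simp: tensor_scale_def fun_eq_iff algebra_simps)

lemma split_iso_add: "split_iso (x + y) = split_iso x + split_iso y"
  by (simp add: split_iso_def fun_eq_iff L_add)

lemma split_iso_scale: "split_iso (fock_scale c x) = tensor_scale c (split_iso x)"
  by (simp add: split_iso_def tensor_scale_def fun_eq_iff L_scale)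

lemma split_iso_pure: "u \<in> states_on {1} \<Longrightarrow> w \<in> WW \<Longrightarrow> split_iso (Phi u * w) = pure_tensor (heisenberg 1) (sub_voa WW omegaW) u w"
  by (simp add: split_iso_def pure_tensor_def fun_eq_iff L_Phi)

lemma VV_letters: "x \<in> VV \<Longrightarrow> Poly_Mapping.keys (theta_inv x) \<subseteq> Vkeys"
  using VV_iff by (auto simp: supp_in_def)

lemma split_iso_inj: "inj_on split_iso VV"
proof (rule inj_onI)
  fix x y assume xy: "x \<in> VV" "y \<in> VV" "split_iso x = split_iso y"
  \<comment> \<open>The forms taking the coefficient of \<open>M\<close> in the product of
    \<open>Phi u\<close> and \<open>w\<close> separate points: evaluating the image of
    \<open>z\<close> on them returns the coordinates of \<open>z\<close>.\<close>
  have key: "split_iso z (\<lambda>u w. Poly_Mapping.lookup (theta_inv (Phi u * w)) M) = Poly_Mapping.lookup (theta_inv z) M" if z: "z \<in> VV" for z M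
  proof -
    let ?B = "\<lambda>u w. Poly_Mapping.lookup (theta_inv (Phi u * w)) M"
    have "bil ?B"
      by (rule bilI) (simp_all add: flin_add[OF flin_Phi] distrib_left distrib_right flin_add[OF flin_theta_inv] lookup_add
          Phi_tensor flin_scale[OF flin_mult] flin_scale[OF flin_theta_inv] lookup_fock_scale)
    moreover have "?B (up N) (wp N) = (if N = M then 1 else 0)" if "N \<in> Poly_Mapping.keys (theta_inv z)" for N
    proof -
      have "N \<in> letters" using that VV_letters[OF z] by (auto simp: Vkeys_def)
      then show ?thesis by (simp add: Bm_up_wp[symmetric] theta_inv_Bm lookup_single when_def)
    qed
    then have "L ?B z = (\<Sum>N\<in>Poly_Mapping.keys (theta_inv z). Poly_Mapping.lookup (theta_inv z) N * (if N = M then 1 else 0))"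
      unfolding L_def by (intro sum.cong) simp_all
    moreover have "\<dots> = Poly_Mapping.lookup (theta_inv z) M"
      by (simp add: in_keys_iff if_distrib cong: if_cong)
    ultimately show ?thesis by (simp add: split_iso_def)
  qed
  have "theta_inv x = theta_inv y" by (rule poly_mapping_eqI) (simp only: xy(3) flip: key[OF xy(1)] key[OF xy(2)])
  then show "x = y" using theta_theta_inv[of x] theta_theta_inv[of y] VV_states xy by metis
qed

lemma split_iso_image:
  "split_iso ` VV = ts.span {pure_tensor (heisenberg 1) (sub_voa WW omegaW) u w | u w. u \<in> states_on {1} \<and> w \<in> WW}" (is "_ = ts.span ?P")
proof (intro equalityI subsetI)
  fix t assume "t \<in> split_iso ` VV"
  then obtain x where x: "t = split_iso x" "x \<in> VV" by blast
  have "VV \<subseteq> {x. split_iso x \<in> ts.span ?P}"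
    unfolding VV_span
  proof (intro fs.span_minimal fs.subspaceI subsetI CollectI)
    have "split_iso (fock_scale 0 0) = tensor_scale 0 (split_iso 0)" by (rule split_iso_scale)
    then show "split_iso 0 \<in> ts.span ?P" by (simp add: ts.span_zero)
    show "split_iso (x + y) \<in> ts.span ?P" if "x \<in> {x. split_iso x \<in> ts.span ?P}" "y \<in> {x. split_iso x \<in> ts.span ?P}" for x y
      using that by (simp add: split_iso_add ts.span_add)
    show "split_iso (fock_scale c x) \<in> ts.span ?P" if "x \<in> {x. split_iso x \<in> ts.span ?P}" for c x
      using that by (simp add: split_iso_scale ts.span_scale)
    fix v assume "v \<in> Bm ` Vkeys"
    then obtain M where M: "v = Bm M" "M \<in> Vkeys" by blast
    then have "up M \<in> states_on {1}" "wp M \<in> WW" using up_H1 wp_WW by (auto simp: Vkeys_def)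
    then show "split_iso v \<in> ts.span ?P" unfolding M(1) Bm_up_wp
      by (intro ts.span_base CollectI exI[of _ "up M"] exI[of _ "wp M"]) (simp add: split_iso_pure)
  qed
  then show "t \<in> ts.span ?P" using x by blast
next
  have "ts.subspace (split_iso ` VV)"
  proof (rule ts.subspaceI)
    have "split_iso (fock_scale 0 0) = tensor_scale 0 (split_iso 0)" by (rule split_iso_scale)
    then show "0 \<in> split_iso ` VV" using fs.subspace_0[OF subspace_VV] by (intro image_eqI[of _ _ 0]) simp_all
    show "x + y \<in> split_iso ` VV" if "x \<in> split_iso ` VV" "y \<in> split_iso ` VV" for x y
      using that fs.subspace_add[OF subspace_VV] by (auto simp flip: split_iso_add)
    show "tensor_scale c x \<in> split_iso ` VV" if "x \<in> split_iso ` VV" for c x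
      using that fs.subspace_scale[OF subspace_VV] by (auto simp flip: split_iso_scale)
  qed
  moreover have "?P \<subseteq> split_iso ` VV"
  proof
    fix t assume "t \<in> ?P"
    then obtain u w where t: "t = pure_tensor (heisenberg 1) (sub_voa WW omegaW) u w" and uw: "u \<in> states_on {1}" "w \<in> WW" by blast
    show "t \<in> split_iso ` VV" unfolding t split_iso_pure[OF uw, symmetric] by (rule imageI) (rule Phi_VV[OF uw])
  qed
  ultimately show "t \<in> split_iso ` VV" if "t \<in> ts.span ?P" for t using that ts.span_minimal by blast
qed

text \<open>The inner form of \<open>tensor_nprod\<close>, with the components of the left argument
  frozen.\<close>

definition Dn :: "int \<Rightarrow> (fock \<Rightarrow> fock \<Rightarrow> complex) \<Rightarrow> fock \<Rightarrow> fock \<Rightarrow> fock \<Rightarrow> fock \<Rightarrow> complex" where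
  "Dn n B u w = (\<lambda>u' w'. Sum_any (\<lambda>p. B (Y u p u') (Y w (n - 1 - p) w')))"

lemma Dn_finite:
  assumes "bil B" "u \<in> states_on {1}" "u' \<in> states_on {1}" "w \<in> WW" "w' \<in> WW"
  shows "finite {p. B (Y u p u') (Y w (n - 1 - p) w') \<noteq> 0}"
proof -
  obtain P :: "int set" where P: "finite P" "\<And>p. p \<notin> P \<Longrightarrow> Y u p u' = 0 \<or> Y w (n - 1 - p) w' = 0"
    using Y_tensor[OF assms(2-5), of n] by blast
  have "p \<in> P" if "B (Y u p u') (Y w (n - 1 - p) w') \<noteq> 0" for p
    using P(2)[of p] that bil_zero(1)[OF assms(1) WW_closed[OF assms(4,5)]] bil_zero(2)[OF assms(1) Y_states_on[OF assms(2,3)]] by metis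
  then show ?thesis by (intro finite_subset[OF _ P(1)]) blast
qed

lemma Dn_linear:
  assumes B: "bil B" and u: "u \<in> states_on {1}" "u' \<in> states_on {1}" and w: "w \<in> WW" "w' \<in> WW"
  shows "v \<in> states_on {1} \<Longrightarrow> Dn n B (u + v) w u' w' = Dn n B u w u' w' + Dn n B v w u' w'"
    "z \<in> WW \<Longrightarrow> Dn n B u (w + z) u' w' = Dn n B u w u' w' + Dn n B u z u' w'"
    "v \<in> states_on {1} \<Longrightarrow> Dn n B u w (u' + v) w' = Dn n B u w u' w' + Dn n B u w v w'"
    "z \<in> WW \<Longrightarrow> Dn n B u w u' (w' + z) = Dn n B u w u' w' + Dn n B u w u' z"
    "Dn n B (fock_scale c u) w u' w' = c * Dn n B u w u' w'"
    "Dn n B u (fock_scale c w) u' w' = c * Dn n B u w u' w'"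
    "Dn n B u w (fock_scale c u') w' = c * Dn n B u w u' w'"
    "Dn n B u w u' (fock_scale c w') = c * Dn n B u w u' w'"
  using u w
  by (simp_all add: Dn_def flin_add[OF flin_Y] flin_add[OF flin_Y_left] flin_scale[OF flin_Y] flin_scale[OF flin_Y_left]
      bilD[OF B] Y_states_on WW_closed Sum_any.distrib Sum_any_right_distrib Dn_finite[OF B])

lemma Dn_bil: "bil B \<Longrightarrow> u \<in> states_on {1} \<Longrightarrow> w \<in> WW \<Longrightarrow> bil (Dn n B u w)"
  by (rule bilI) (simp_all add: Dn_linear)

lemma L_cong: "x \<in> VV \<Longrightarrow> (\<And>u w. u \<in> states_on {1} \<Longrightarrow> w \<in> WW \<Longrightarrow> g u w = h u w) \<Longrightarrow> L g x = L h x"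
  unfolding L_def using VV_letters[of x] up_H1 wp_WW
  by (intro sum.cong arg_cong2[of _ _ _ _ "(*)"] refl) (auto simp: Vkeys_def subset_eq)

lemma L_add_left: "L (\<lambda>u w. g u w + h u w) x = L g x + L h x"
  by (simp add: L_def distrib_left sum.distrib)

lemma L_scale_left: "L (\<lambda>u w. c * g u w) x = c * L g x"
  by (simp add: L_def sum_distrib_left mult_ac)

lemma L_Dn_bil:
  assumes B: "bil B" and b: "b \<in> VV"
  shows "bil (\<lambda>u w. L (Dn n B u w) b)"
proof (rule bilI)
  fix u v w z c assume u: "u \<in> states_on {1}" "v \<in> states_on {1}" and w: "w \<in> WW" "z \<in> WW"
  show "L (Dn n B (u + v) w) b = L (Dn n B u w) b + L (Dn n B v w) b"
    unfolding L_add_left[symmetric] by (rule L_cong[OF b]) (rule Dn_linear(1)[OF B u(1) _ w(1) _ u(2)])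
  show "L (Dn n B u (w + z)) b = L (Dn n B u w) b + L (Dn n B u z) b"
    unfolding L_add_left[symmetric] by (rule L_cong[OF b]) (rule Dn_linear(2)[OF B u(1) _ w(1) _ w(2)])
  show "L (Dn n B (fock_scale c u) w) b = c * L (Dn n B u w) b"
    unfolding L_scale_left[symmetric] by (rule L_cong[OF b]) (rule Dn_linear(5)[OF B u(1) _ w(1)])
  show "L (Dn n B u (fock_scale c w)) b = c * L (Dn n B u w) b"
    unfolding L_scale_left[symmetric] by (rule L_cong[OF b]) (rule Dn_linear(6)[OF B u(1) _ w(1)])
qed

text \<open>On eigenmonomials this is \<open>Y_tensor\<close> evaluated by \<open>B\<close>; the
  rest is linearity in \<open>a\<close> and in \<open>b\<close>.\<close>

lemma L_Y:
  assumes B: "bil B" and a: "a \<in> VV" and b: "b \<in> VV"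
  shows "L B (Y a n b) = L (\<lambda>u w. L (Dn n B u w) b) a"
proof -
  have base: "L B (Y (Bm M) n (Bm N)) = L (\<lambda>u w. L (Dn n B u w) (Bm N)) (Bm M)" if M: "M \<in> Vkeys" and N: "N \<in> Vkeys" for M N
  proof -
    have l: "M \<in> letters" "N \<in> letters" using M N by (auto simp: Vkeys_def)
    note s = up_H1[OF l(1)] up_H1[OF l(2)] wp_WW[OF M] wp_WW[OF N]
    obtain P where P: "finite P" "\<And>p. p \<notin> P \<Longrightarrow> Y (up M) p (up N) = 0 \<or> Y (wp M) (n - 1 - p) (wp N) = 0"
      "Y (Phi (up M) * wp M) n (Phi (up N) * wp N) = (\<Sum>p\<in>P. Phi (Y (up M) p (up N)) * Y (wp M) (n - 1 - p) (wp N))"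
      using Y_tensor[OF s, of n] by blast
    have "L B (Y (Bm M) n (Bm N)) = (\<Sum>p\<in>P. B (Y (up M) p (up N)) (Y (wp M) (n - 1 - p) (wp N)))"
      unfolding Bm_up_wp P(3) L_sum
      by (intro sum.cong refl L_Phi[OF B] Y_states_on s WW_closed)
    also have "\<dots> = Dn n B (up M) (wp M) (up N) (wp N)"
    proof -
      have "{p. B (Y (up M) p (up N)) (Y (wp M) (n - 1 - p) (wp N)) \<noteq> 0} \<subseteq> P"
      proof
        fix p assume p: "p \<in> {p. B (Y (up M) p (up N)) (Y (wp M) (n - 1 - p) (wp N)) \<noteq> 0}"
        show "p \<in> P"
        proof (rule ccontr)
          assume "p \<notin> P"
          from P(2)[OF this] show False
          proof
            assume z: "Y (up M) p (up N) = 0"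
            show False using p bil_zero(1)[OF B WW_closed[OF s(3,4)], of "n - 1 - p"] by (simp add: z)
          next
            assume z: "Y (wp M) (n - 1 - p) (wp N) = 0"
            show False using p bil_zero(2)[OF B Y_states_on[OF s(1,2)], of p] by (simp add: z)
          qed
        qed
      qed
      then show ?thesis unfolding Dn_def by (rule Sum_any.expand_superset[OF P(1), symmetric])
    qed
    also have "\<dots> = L (\<lambda>u w. L (Dn n B u w) (Bm N)) (Bm M)" by (simp add: L_Bm l)
    finally show ?thesis .
  qed
  have 1: "L B (Y (Bm M) n b) = L (\<lambda>u w. L (Dn n B u w) b) (Bm M)" if M: "M \<in> Vkeys" for M
  proof (rule span_functional_eq[of b "Bm ` Vkeys" "\<lambda>b. L B (Y (Bm M) n b)" "\<lambda>b. L (\<lambda>u w. L (Dn n B u w) b) (Bm M)"])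
    show "b \<in> fs.span (Bm ` Vkeys)" using b by (simp add: VV_span)
    show "L B (Y (Bm M) n x) = L (\<lambda>u w. L (Dn n B u w) x) (Bm M)" if "x \<in> Bm ` Vkeys" for x using base[OF M] that by blast
  qed (simp_all add: flin_add[OF flin_Y] flin_scale[OF flin_Y] L_add L_scale L_add_left L_scale_left)
  show ?thesis
  proof (rule span_functional_eq[of a "Bm ` Vkeys" "\<lambda>a. L B (Y a n b)" "L (\<lambda>u w. L (Dn n B u w) b)"])
    show "a \<in> fs.span (Bm ` Vkeys)" using a by (simp add: VV_span)
    show "L B (Y x n b) = L (\<lambda>u w. L (Dn n B u w) b) x" if "x \<in> Bm ` Vkeys" for x using 1 that by blast
  qed (simp_all add: flin_add[OF flin_Y_left] flin_scale[OF flin_Y_left] L_add L_scale)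
qed

lemma split_iso_Y:
  assumes a: "a \<in> VV" and b: "b \<in> VV"
  shows "split_iso (Y a n b) = tensor_nprod (heisenberg 1) (sub_voa WW omegaW) (split_iso a) n (split_iso b)"
proof
  fix B
  show "split_iso (Y a n b) B = tensor_nprod (heisenberg 1) (sub_voa WW omegaW) (split_iso a) n (split_iso b) B"
  proof (cases "bil B")
    case True
    \<comment> \<open>\<open>C\<close> is the function that \<open>tensor_nprod\<close> feeds to the
      left tensor. It contains the guard of \<open>split_iso\<close> and is compared with the
      unguarded \<open>C'\<close> on states only, which suffices both for bilinearity and for
      \<open>L\<close>.\<close>
    define C where "C = (\<lambda>u w. split_iso b (Dn n B u w))"
    define C' where "C' = (\<lambda>u w. L (Dn n B u w) b)"
    have C: "C u w = C' u w" if "u \<in> states_on {1}" "w \<in> WW" for u w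
      using Dn_bil[OF True that, of n] by (simp add: split_iso_def C_def C'_def)
    have "bil C'" unfolding C'_def by (rule L_Dn_bil[OF True b])
    then have "bil C"
      using C fs.subspace_add[OF subspace_states_on] fs.subspace_scale[OF subspace_states_on] fs.subspace_add[OF subspace_WW] fs.subspace_scale[OF subspace_WW]
      by (intro bilI) (simp_all add: bilD)
    then have "split_iso a C = L C a" by (simp add: split_iso_def)
    also have "\<dots> = L C' a" by (rule L_cong[OF a C])
    also have "\<dots> = L B (Y a n b)" unfolding C'_def by (rule L_Y[OF True a b, symmetric])
    finally have "split_iso (Y a n b) B = split_iso a C" using True by (simp add: split_iso_def)
    moreover have "tensor_nprod (heisenberg 1) (sub_voa WW omegaW) (split_iso a) n (split_iso b) B = split_iso a C"
      unfolding tensor_nprod_def C_def Dn_def using True by simp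
    ultimately show ?thesis by simp
  next
    case False
    then show ?thesis by (simp add: split_iso_def tensor_nprod_def)
  qed
qed

lemma split_iso_conf:
  "split_iso omega3 = pure_tensor (heisenberg 1) (sub_voa WW omegaW) (conf (heisenberg 1)) 1 + pure_tensor (heisenberg 1) (sub_voa WW omegaW) 1 omegaW"
proof -
  have c: "conf (heisenberg 1) = fock_scale (1 / 2) (alpha 1 (-1) (alpha 1 (-1) 1))" by (simp add: heisenberg_def)
  have a1: "alpha 1 (-1) 1 \<in> states_on {1}" by (rule alpha_states_on[OF one_states_on]) simp
  have a2: "alpha 1 (-1) (alpha 1 (-1) 1) \<in> states_on {1}" by (rule alpha_states_on[OF a1]) simp
  have cH: "conf (heisenberg 1) \<in> states_on {1}" unfolding c by (rule fs.subspace_scale[OF subspace_states_on a2])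
  have "qd (cf 0) (cf 0) = Phi (alpha 1 (-1) (alpha 1 (-1) 1)) * 1"
    unfolding qd_def using Phi_alpha[OF one_states_on one_WW, of "-1"] Phi_alpha[OF a1 one_WW, of "-1"] by simp
  then have "omega3 = Phi (conf (heisenberg 1)) * 1 + Phi 1 * omegaW"
    unfolding omega3_decomp c Phi_tensor by simp
  then show ?thesis
    by (simp only: split_iso_add split_iso_pure[OF cH one_WW] split_iso_pure[OF one_states_on omegaW_WW])
qed

lemma heisenberg3_Z3_splits: "voa_isomorphic heisenberg3_Z3 (tensor_voa (heisenberg 1) (sub_voa WW omegaW))"
  unfolding voa_isomorphic_def voa_iso_def heisenberg3_Z3_eq
proof (intro exI[of _ split_iso] conjI)
  show "bij_betw split_iso (states (sub_voa VV omega3)) (states (tensor_voa (heisenberg 1) (sub_voa WW omegaW)))"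
    unfolding bij_betw_def tensor_voa_def voa.simps states_H1 sub_voa_simps using split_iso_inj split_iso_image by blast
  show "linear_on_states (sub_voa VV omega3) (tensor_voa (heisenberg 1) (sub_voa WW omegaW)) split_iso"
    by (simp add: linear_on_states_def tensor_voa_def split_iso_add split_iso_scale)
  show "\<forall>a\<in>states (sub_voa VV omega3). \<forall>n. \<forall>b\<in>states (sub_voa VV omega3).
      split_iso (nprod (sub_voa VV omega3) a n b) = nprod (tensor_voa (heisenberg 1) (sub_voa WW omegaW)) (split_iso a) n (split_iso b)"
    by (simp add: tensor_voa_def split_iso_Y)
  have "split_iso 1 = pure_tensor (heisenberg 1) (sub_voa WW omegaW) 1 1"
    using split_iso_pure[OF one_states_on one_WW] by simp
  then show "split_iso (vac (sub_voa VV omega3)) = vac (tensor_voa (heisenberg 1) (sub_voa WW omegaW))"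
    by (simp add: tensor_voa_def)
  show "split_iso (conf (sub_voa VV omega3)) = conf (tensor_voa (heisenberg 1) (sub_voa WW omegaW))"
    by (simp add: tensor_voa_def split_iso_conf)
qed

theorem theorem5p1:
  shows "(simple_voa heisenberg3_Z3 \<and>
          (\<exists>S. minimally_strongly_generates heisenberg3_Z3 S \<and>
               has_weights heisenberg3_Z3 S {#1, 2, 3, 3, 3, 4, 5, 5, 5#})) \<and>
         (\<exists>W :: fock voa.
            vertex_operator_algebra W \<and>
            of_type W {#2, 3, 3, 3, 4, 5, 5, 5#} \<and>
            voa_isomorphic heisenberg3_Z3 (tensor_voa (heisenberg 1) W)) \<and>
         (\<nexists>S. freely_generates heisenberg3_Z3 S)"
proof (intro conjI)
  show "simple_voa heisenberg3_Z3" by (rule VV_simple)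
  show "\<exists>S. minimally_strongly_generates heisenberg3_Z3 S \<and> has_weights heisenberg3_Z3 S {#1, 2, 3, 3, 3, 4, 5, 5, 5#}"
    using SV_minimal SV_weights by blast
  have "of_type (sub_voa WW omegaW) {#2, 3, 3, 3, 4, 5, 5, 5#}"
    unfolding of_type_def using SW_strong SW_weights by blast
  then show "\<exists>W :: fock voa. vertex_operator_algebra W \<and> of_type W {#2, 3, 3, 3, 4, 5, 5, 5#} \<and>
      voa_isomorphic heisenberg3_Z3 (tensor_voa (heisenberg 1) W)"
    using W.voa heisenberg3_Z3_splits by blast
  show "\<nexists>S. freely_generates heisenberg3_Z3 S" using not_freely_generated by blast
qed

end
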